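(* Let $\Omega\subset\mathbb{C}^{n}$ be a bounded symmetric domain with origin and Bergman-Silov boundary $b$, and let $p\in[1,\infty]$ be a given constant. Let $f=h+\overline{g}$, where $h$ and $g$ are holomorphic functions in $\Omega$. Put $$C_{1}(p)=\sqrt{1-\left|\cos\frac{\pi}{p}\right|},\qquad C_{2}(p)=\sqrt{2}\max\left\{\sin\frac{\pi}{2p},\ \cos\frac{\pi}{2p}\right\}.$$ Then the following statements hold. ($\mathscr{B}_1$) If $p\in(1,\infty)$, then $f=h+\overline{g}\in\mathscr{PH}^{p}(\Omega)$ if and only if $h,g\in\mathscr{PH}^{p}(\Omega)$. Moreover: (I) If $f=h+\overline{g}\in\mathscr{PH}^{p}(\Omega)$ and $\mathrm{Re}(g(0)h(0))\geq 0$, then $$\lim_{r\rightarrow1^{-}}\left(\int_{b}\big(|h(r\zeta)|^{2}+|g(r\zeta)|^{2}\big)^{\frac{p}{2}}d\sigma(\zeta)\right)^{\frac{1}{p}}\leq\frac{1}{C_{1}(p)}\|f\|_{p}.$$ (II) If $f=h+\overline{g}\in\mathscr{PH}^{p}(\Omega)$ and $\mathrm{Re}(g(0)h(0))\leq 0$, then $$\|f\|_p\leq C_{2}(p)\lim_{r\rightarrow1^{-}}\left(\int_{b}\big(|h(r\zeta)|^{2}+|g(r\zeta)|^{2}\big)^{\frac{p}{2}}d\sigma(\zeta)\right)^{\frac{1}{p}}.$$ ($\mathscr{B}_2$) If $p=1$, then $f=h+\overline{g}\in\mathscr{PH}^{1}(\Omega)$ implies that $h,g\in\mathscr{PH}^{q}(\Omega)$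 for all $q\in(0,1)$. Furthermore, if $f=h+\overline{g}\in\mathscr{PH}^{1}(\Omega)$, then $$M_{1}(r,h)=O\left(\log\frac{1}{1-r}\right)\quad\text{and}\quad M_{1}(r,g)=O\left(\log\frac{1}{1-r}\right)\qquad\text{as } r\rightarrow1^{-}.$$ In particular, if $\Omega$ is the unit polydisk, then these two estimates are sharp, in the sense that the order $\log\frac{1}{1-r}$ cannot be replaced by $o\left(\log\frac{1}{1-r}\right)$ for all $f=h+\overline g\in\mathscr{PH}^1(\Omega)$. ($\mathscr{B}_3$) If $p=\infty$, then there are two unbounded holomorphic functions $h$ and $g$ in $\Omega$ such that $f=h+\overline{g}\in\mathscr{PH}^{\infty}(\Omega)$.
   Context: A twice continuously differentiable complex-valued function $f$ on an open subset of $\mathbb{C}^n$ is pluriharmonic if $\partial^2 f/\partial z_j\partial\overline{z}_k=0$ for all $j,k\in\{1,\ldots,n\}$. $\Omega\subset\mathbb{C}^n$ denotes a bounded symmetric domain containing the origin, in its standard realization, so that $\Omega$ is circular and star-shaped with respect to $0$; $b$ denotes its Bergman-Silov (Shilov) boundary, which is circular. Let $\Gamma$ be the group of holomorphic automorphisms of $\Omega$ and $\Gamma_0$ the isotropy group of $0$ in $\Gamma$. The group $\Gamma_0$ is transitive on $b$, and $\sigma$ denotes the unique $\Gamma_0$-invariant measure on $b$ normalized by $\sigma(b)=1$. For $r\in[0,1)$ and $p\in(0,\infty)$, $$M_{p}(r,f)=\left(\int_{b}|f(r\zeta)|^{p}d\sigma(\zeta)\right)^{1/p},\qquad M_{\infty}(r,f)=\sup_{\zeta\in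 b}|f(r\zeta)|,$$ and $\|f\|_p=\sup_{r\in[0,1)}M_p(r,f)$ for $p\in(0,\infty]$. The pluriharmonic Hardy space $\mathscr{PH}^{p}(\Omega)$ consists of all pluriharmonic functions $f:\Omega\to\mathbb{C}$ with $\|f\|_p<\infty$. *)

theory Defs
  imports "HOL-Analysis.Analysis" "HOL-Library.Landau_Symbols"
begin

section \<open>Holomorphic and pluriharmonic functions on \<open>\<complex>\<^sup>n\<close>\<close>

text \<open>Holomorphy on an open set: a complex-linear Frechet derivative at every point.\<close>

definition cn_holomorphic_on :: "(complex ^ 'n::finite \<Rightarrow> complex) \<Rightarrow> (complex ^ 'n) set \<Rightarrow> bool" where
  "cn_holomorphic_on f S \<longleftrightarrow>
     (\<forall>z\<in>S. \<exists>f'. (f has_derivative f') (at z) \<and> (\<forall>c v. f' (c *s v) = c * f' v))"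

definition cn_holomorphic_map_on ::
    "(complex ^ 'n::finite \<Rightarrow> complex ^ 'm::finite) \<Rightarrow> (complex ^ 'n) set \<Rightarrow> bool" where
  "cn_holomorphic_map_on F S \<longleftrightarrow> (\<forall>i. cn_holomorphic_on (\<lambda>z. F z $ i) S)"

definition C2_on :: "('a::real_normed_vector \<Rightarrow> 'b::real_normed_vector) \<Rightarrow> 'a set \<Rightarrow> bool" where
  "C2_on f S \<longleftrightarrow>
     (\<exists>(f' :: 'a \<Rightarrow> 'a \<Rightarrow>\<^sub>L 'b) (f'' :: 'a \<Rightarrow> 'a \<Rightarrow>\<^sub>L ('a \<Rightarrow>\<^sub>L 'b)).
        (\<forall>z\<in>S. (f has_derivative blinfun_apply (f' z)) (at z)) \<and>
        (\<forall>z\<in>S. (f' has_derivative blinfun_apply (f'' z)) (at z)) \<and>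
        continuous_on S f'')"

text \<open>The Wirtinger derivatives: with \<open>z\<^sub>j = x + \<i> y\<close>, the real partial derivatives in \<open>x\<close> and
  \<open>y\<close> are the values of the real Frechet derivative at \<open>axis j 1\<close> and \<open>axis j \<i>\<close>.\<close>

definition wirtinger :: "'n::finite \<Rightarrow> (complex ^ 'n \<Rightarrow> complex) \<Rightarrow> complex ^ 'n \<Rightarrow> complex" where
  "wirtinger j f z =
     (frechet_derivative f (at z) (axis j 1) - \<i> * frechet_derivative f (at z) (axis j \<i>)) / 2"

definition wirtinger_bar :: "'n::finite \<Rightarrow> (complex ^ 'n \<Rightarrow> complex) \<Rightarrow> complex ^ 'n \<Rightarrow> complex" where
  "wirtinger_bar j f z =
     (frechet_derivative f (at z) (axis j 1) + \<i> * frechet_derivative f (at z) (axis j \<i>)) / 2"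

definition pluriharmonic_on :: "(complex ^ 'n::finite \<Rightarrow> complex) \<Rightarrow> (complex ^ 'n) set \<Rightarrow> bool" where
  "pluriharmonic_on f S \<longleftrightarrow>
     C2_on f S \<and> (\<forall>j k. \<forall>z\<in>S. wirtinger j (wirtinger_bar k f) z = 0)"


section \<open>Bounded symmetric domains\<close>

text \<open>Automorphisms are represented by total functions whose values off \<open>\<Omega>\<close> are irrelevant.\<close>

definition holomorphic_automorphisms ::
    "(complex ^ 'n::finite) set \<Rightarrow> (complex ^ 'n \<Rightarrow> complex ^ 'n) set" where
  "holomorphic_automorphisms \<Omega> =
     {\<phi>. bij_betw \<phi> \<Omega> \<Omega> \<and> cn_holomorphic_map_on \<phi> \<Omega> \<and>
         cn_holomorphic_map_on (inv_into \<Omega> \<phi>) \<Omega>}"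

definition isotropy_group ::
    "(complex ^ 'n::finite) set \<Rightarrow> complex ^ 'n \<Rightarrow> (complex ^ 'n \<Rightarrow> complex ^ 'n) set" where
  "isotropy_group \<Omega> a = {\<phi> \<in> holomorphic_automorphisms \<Omega>. \<phi> a = a}"

definition bounded_symmetric_domain :: "(complex ^ 'n::finite) set \<Rightarrow> bool" where
  "bounded_symmetric_domain \<Omega> \<longleftrightarrow>
     open \<Omega> \<and> connected \<Omega> \<and> \<Omega> \<noteq> {} \<and> bounded \<Omega> \<and>
     (\<forall>a\<in>\<Omega>. \<exists>s\<in>holomorphic_automorphisms \<Omega>.
        (\<forall>z\<in>\<Omega>. s (s z) = z) \<and> s a = a \<and> \<not> a islimpt {z\<in>\<Omega>. s z = z})"

text \<open>The standard realization enters through its two geometric properties. A bounded symmetric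
  domain that contains 0 and is circular is a linear image of the Harish-Chandra realization
  (H. Cartan), so these properties single out the standard realization up to a linear
  change of coordinates.\<close>

definition standard_realization :: "(complex ^ 'n::finite) set \<Rightarrow> bool" where
  "standard_realization \<Omega> \<longleftrightarrow>
     0 \<in> \<Omega> \<and>
     (\<forall>z\<in>\<Omega>. \<forall>\<theta>. cis \<theta> *s z \<in> \<Omega>) \<and>
     (\<forall>z\<in>\<Omega>. closed_segment 0 z \<subseteq> \<Omega>)"

definition unit_polydisk :: "(complex ^ 'n::finite) set" where
  "unit_polydisk = {z. \<forall>j. cmod (z $ j) < 1}"


section \<open>The Bergman-Silov boundary and its invariant measure\<close>

definition maximum_modulus_set :: "(complex ^ 'n::finite) set \<Rightarrow> (complex ^ 'n) set \<Rightarrow> bool" where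
  "maximum_modulus_set \<Omega> E \<longleftrightarrow>
     closed E \<and> E \<subseteq> closure \<Omega> \<and>
     (\<forall>f. continuous_on (closure \<Omega>) f \<and> cn_holomorphic_on f \<Omega> \<longrightarrow>
        (\<forall>z\<in>closure \<Omega>. \<exists>w\<in>E. cmod (f z) \<le> cmod (f w)))"

text \<open>The smallest closed subset of the closure on which every function continuous on the closure
  and holomorphic in \<open>\<Omega>\<close> attains its maximum modulus; by Silov's theorem the intersection below
  is itself such a set.\<close>

definition silov_boundary :: "(complex ^ 'n::finite) set \<Rightarrow> (complex ^ 'n) set" where
  "silov_boundary \<Omega> = \<Inter> {E. maximum_modulus_set \<Omega> E}"

text \<open>The normalized Borel measure on the Silov boundary that is invariant under the isotropy group
  of 0. An automorphism acts on the boundary through its continuous extension to the closure,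
  hence the restriction to representatives that are continuous there; every element of the
  isotropy group has one, because it is the restriction of a linear map (H. Cartan).\<close>

definition silov_invariant_measure ::
    "(complex ^ 'n::finite) set \<Rightarrow> (complex ^ 'n) measure \<Rightarrow> bool" where
  "silov_invariant_measure \<Omega> \<sigma> \<longleftrightarrow>
     sets \<sigma> = sets (restrict_space borel (silov_boundary \<Omega>)) \<and>
     emeasure \<sigma> (silov_boundary \<Omega>) = 1 \<and>
     (\<forall>\<gamma>\<in>isotropy_group \<Omega> 0. continuous_on (closure \<Omega>) \<gamma> \<longrightarrow>
        (\<forall>A\<in>sets \<sigma>. emeasure \<sigma> {\<zeta>\<in>silov_boundary \<Omega>. \<gamma> \<zeta> \<in> A} = emeasure \<sigma> A))"


section \<open>Pluriharmonic Hardy spaces\<close>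

text \<open>The means are real-valued. They are applied to functions continuous on \<open>\<Omega>\<close>, and for
  \<open>r < 1\<close> the set \<open>r b\<close> is a compact subset of \<open>\<Omega>\<close>, so the integral and the supremum
  are always finite.\<close>

definition hardy_mean :: "(complex ^ 'n::finite) set \<Rightarrow> (complex ^ 'n) measure \<Rightarrow> ereal \<Rightarrow> real \<Rightarrow>
    (complex ^ 'n \<Rightarrow> complex) \<Rightarrow> real" where
  "hardy_mean \<Omega> \<sigma> p r f =
     (if p = \<infinity> then SUP \<zeta>\<in>silov_boundary \<Omega>. cmod (f (r *\<^sub>R \<zeta>))
      else (LINT \<zeta>|\<sigma>. cmod (f (r *\<^sub>R \<zeta>)) powr real_of_ereal p) powr (1 / real_of_ereal p))"

definition hardy_norm :: "(complex ^ 'n::finite) set \<Rightarrow> (complex ^ 'n) measure \<Rightarrow> ereal \<Rightarrow>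
    (complex ^ 'n \<Rightarrow> complex) \<Rightarrow> ereal" where
  "hardy_norm \<Omega> \<sigma> p f = (SUP r\<in>{0..<1}. ereal (hardy_mean \<Omega> \<sigma> p r f))"

definition PH :: "(complex ^ 'n::finite) set \<Rightarrow> (complex ^ 'n) measure \<Rightarrow> ereal \<Rightarrow>
    (complex ^ 'n \<Rightarrow> complex) set" where
  "PH \<Omega> \<sigma> p = {f. pluriharmonic_on f \<Omega> \<and> hardy_norm \<Omega> \<sigma> p f < \<infinity>}"

definition pair_mean :: "(complex ^ 'n::finite) measure \<Rightarrow> real \<Rightarrow> real \<Rightarrow>
    (complex ^ 'n \<Rightarrow> complex) \<Rightarrow> (complex ^ 'n \<Rightarrow> complex) \<Rightarrow> real" where
  "pair_mean \<sigma> p r h g =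
     (LINT \<zeta>|\<sigma>. ((cmod (h (r *\<^sub>R \<zeta>)))\<^sup>2 + (cmod (g (r *\<^sub>R \<zeta>)))\<^sup>2) powr (p / 2)) powr (1 / p)"

definition C1 :: "real \<Rightarrow> real" where
  "C1 p = sqrt (1 - \<bar>cos (pi / p)\<bar>)"

definition C2 :: "real \<Rightarrow> real" where
  "C2 p = sqrt 2 * max (sin (pi / (2 * p))) (cos (pi / (2 * p)))"

end

theory Submission
  imports Defs "HOL-Complex_Analysis.Complex_Analysis"
begin

text \<open>
  On every disc \<open>{z \<zeta>}\<close> with \<open>\<zeta>\<close> in the Silov boundary the problem is one-dimensional:
  \<open>\<sigma>\<close> is invariant under rotations, so an integral over \<open>r b\<close> is an average of circle means.
  For this \<open>r \<zeta>\<close> has to lie in \<open>\<Omega>\<close>, which is obtained from the symmetries of \<open>\<Omega>\<close>: with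
  respect to the Caratheodory-type metric the radius up to which balls are relatively compact
  is the same at all points.

  For \<open>1 < p\<close> both norm inequalities come from a pointwise inequality between \<open>\<bar>z + cnj w\<bar>^p\<close>,
  \<open>(\<bar>z\<bar>^2 + \<bar>w\<bar>^2)^(p/2)\<close> and a function of \<open>z w\<close> that is subharmonic, homogeneous of degree
  \<open>p/2\<close> and nonnegative on a half-plane; the sub-mean value property at 0 disposes of the last
  term, and the sign of \<open>Re (g 0 * h 0)\<close> decides which of the two estimates is available.
  For \<open>p = 1\<close> Kolmogorov's theorem is proved in the same way, and the Cauchy integral
  formula on a slightly larger circle bounds the mean of \<open>h\<close> by that of \<open>f\<close> times the mean of the
  Cauchy kernel, which grows logarithmically. On the polydisk the Poisson kernel
  \<open>Re ((1 + z\<^sub>j) / (1 - z\<^sub>j))\<close> shows that this is sharp, and \<open>\<i> Ln (1 - z\<^sub>j / M)\<close>, whose real part is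
  bounded, is the example for \<open>p = \<infinity>\<close>.
\<close>

section \<open>The scalar Riesz inequalities\<close>

text \<open>The constants come from one angle. Since
  \<open>|z + cnj w|^2 = S + Re (2 * z * w)\<close> with \<open>S = |z|^2 + |w|^2\<close>,
  homogeneity leaves a ratio \<open>S / |2 * z * w| \<ge> 1\<close> and an angle. At ratio 1 the
  inequalities compare \<open>cos t powr p\<close> or \<open>sin t powr p\<close> with a constant
  plus a multiple of \<open>cos (p * t)\<close>. The two sides touch at
  \<open>t = pi / (2 * p)\<close>, where \<open>cos (p * t)\<close> vanishes, and
  \<open>sqrt 2\<close> times the smaller or the larger of sine and cosine at this angle is
  \<open>C1 p\<close> or \<open>C2 p\<close>; the two change places at \<open>p = 2\<close>. The
  equivalence for \<open>p > 1\<close> carries no sign condition at 0: subtracting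
  \<open>h 0\<close> from \<open>h\<close> and adding its conjugate to \<open>g\<close> keeps
  \<open>f\<close> and makes the product vanish at 0. That \<open>r \<zeta>\<close> lies in
  \<open>\<Omega>\<close> is not a formality: the closure of a bounded circular star-shaped domain
  may contain radial segments of boundary points. Excluding them takes a property that is uniform
  over the domain, and the symmetries provide it.\<close>

lemma cos_powr_cos_mult_mono:
  fixes p t :: real
  assumes p: "1 < p" and t: "0 < t" "t < pi / 2" "(p - 1) * t < pi"
  shows "((\<lambda>t. sin (p * t) * cos t powr (1 - p) / sin t) has_real_derivative
      (((p - 1) * sin t * cos ((p - 1) * t) - sin ((p - 1) * t) * cos t) * cos t powr (- p) / (sin t)\<^sup>2)) (at t)"
proof -
  have s: "sin t > 0" and c: "cos t > 0"
    using t by (auto intro!: sin_gt_zero cos_gt_zero)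
  have e1: "cos t powr (1 - p) = cos t * cos t powr (- p)"
    using c by (simp add: powr_diff powr_minus divide_simps)
  have e2: "cos t powr (1 - p - 1) = cos t powr (- p)"
    by simp
  have e3: "sin (p * t) = sin ((p - 1) * t) * cos t + cos ((p - 1) * t) * sin t"
    using sin_add[of "(p - 1) * t" t] by (simp add: algebra_simps)
  have e4: "cos (p * t) = cos ((p - 1) * t) * cos t - sin ((p - 1) * t) * sin t"
    using cos_add[of "(p - 1) * t" t] by (simp add: algebra_simps)
  have sq: "cos t * cos t = 1 - sin t * sin t"
    using sin_cos_squared_add[of t] by (simp add: power2_eq_square algebra_simps)
  define X where "X = cos t powr (- p)"
  define a where "a = cos ((p - 1) * t)"
  define b where "b = sin ((p - 1) * t)"
  have d1: "((\<lambda>t. sin (p * t)) has_real_derivative cos (p * t) * p) (at t)"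
    by (auto intro!: derivative_eq_intros)
  have d2: "((\<lambda>t. cos t powr (1 - p)) has_real_derivative (1 - p) * cos t powr (1 - p - 1) * (- sin t)) (at t)"
    using DERIV_fun_powr[OF DERIV_cos, of t "1 - p"] c by simp
  have "((\<lambda>t. sin (p * t) * cos t powr (1 - p) / sin t) has_real_derivative
     ((cos (p * t) * p * cos t powr (1 - p) + (1 - p) * cos t powr (1 - p - 1) * (- sin t) * sin (p * t)) * sin t
       - sin (p * t) * cos t powr (1 - p) * cos t) / (sin t * sin t)) (at t)"
    by (intro DERIV_divide DERIV_mult d1 d2 DERIV_sin) (use s in auto)
  moreover have "(cos (p * t) * p * cos t powr (1 - p) + (1 - p) * cos t powr (1 - p - 1) * (- sin t) * sin (p * t)) * sin t
       - sin (p * t) * cos t powr (1 - p) * cos t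
     = ((p - 1) * sin t * cos ((p - 1) * t) - sin ((p - 1) * t) * cos t) * cos t powr (- p)"
    unfolding e1 e2 e3 e4 X_def[symmetric] a_def[symmetric] b_def[symmetric]
    using sq by algebra
  ultimately show ?thesis by (simp add: power2_eq_square)
qed

text \<open>As for the cosine above, the function is, up to sign, the quotient of the derivatives of
  \<open>cos (p * t)\<close> and of the power, here \<open>sin t powr p\<close>; the sign of the
  first factor of its derivative decides whether it increases.\<close>

lemma sin_powr_sin_mult_mono:
  fixes p t :: real
  assumes p: "1 < p" and t: "0 < t" "t < pi / 2"
  shows "((\<lambda>t. sin (p * t) * sin t powr (1 - p) / cos t) has_real_derivative
      ((sin t * cos ((p - 1) * t) - (p - 1) * cos t * sin ((p - 1) * t)) * sin t powr (- p) / (cos t)\<^sup>2)) (at t)"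
proof -
  have s: "sin t > 0" and c: "cos t > 0"
    using t by (auto intro!: sin_gt_zero cos_gt_zero)
  have e1: "sin t powr (1 - p) = sin t * sin t powr (- p)"
    using s by (simp add: powr_diff powr_minus divide_simps)
  have e2: "sin t powr (1 - p - 1) = sin t powr (- p)"
    by simp
  have e3: "sin (p * t) = sin ((p - 1) * t) * cos t + cos ((p - 1) * t) * sin t"
    using sin_add[of "(p - 1) * t" t] by (simp add: algebra_simps)
  have e4: "cos (p * t) = cos ((p - 1) * t) * cos t - sin ((p - 1) * t) * sin t"
    using cos_add[of "(p - 1) * t" t] by (simp add: algebra_simps)
  have sq: "cos t * cos t = 1 - sin t * sin t"
    using sin_cos_squared_add[of t] by (simp add: power2_eq_square algebra_simps)
  define X where "X = sin t powr (- p)"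
  define a where "a = cos ((p - 1) * t)"
  define b where "b = sin ((p - 1) * t)"
  have d1: "((\<lambda>t. sin (p * t)) has_real_derivative cos (p * t) * p) (at t)"
    by (auto intro!: derivative_eq_intros)
  have d2: "((\<lambda>t. sin t powr (1 - p)) has_real_derivative (1 - p) * sin t powr (1 - p - 1) * cos t) (at t)"
    using DERIV_fun_powr[OF DERIV_sin, of t "1 - p"] s by simp
  have "((\<lambda>t. sin (p * t) * sin t powr (1 - p) / cos t) has_real_derivative
     ((cos (p * t) * p * sin t powr (1 - p) + (1 - p) * sin t powr (1 - p - 1) * cos t * sin (p * t)) * cos t
       - sin (p * t) * sin t powr (1 - p) * (- sin t)) / (cos t * cos t)) (at t)"
    by (intro DERIV_divide DERIV_mult d1 d2 DERIV_cos) (use c in auto)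
  moreover have "(cos (p * t) * p * sin t powr (1 - p) + (1 - p) * sin t powr (1 - p - 1) * cos t * sin (p * t)) * cos t
       - sin (p * t) * sin t powr (1 - p) * (- sin t)
     = (sin t * cos ((p - 1) * t) - (p - 1) * cos t * sin ((p - 1) * t)) * sin t powr (- p)"
    unfolding e1 e2 e3 e4 X_def[symmetric] a_def[symmetric] b_def[symmetric]
    using sq by algebra
  ultimately show ?thesis by (simp add: power2_eq_square)
qed

section \<open>Powers of sine and cosine against comparison functions that touch them\<close>

lemma min_at_turning_point:
  fixes f f' :: "real \<Rightarrow> real"
  assumes cont: "continuous_on {a..b} f"
    and der: "\<And>t. a < t \<Longrightarrow> t < b \<Longrightarrow> (f has_real_derivative f' t) (at t)"
    and neg: "\<And>t. a < t \<Longrightarrow> t < m \<Longrightarrow> t < b \<Longrightarrow> f' t \<le> 0"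
    and pos: "\<And>t. m < t \<Longrightarrow> t < b \<Longrightarrow> a < t \<Longrightarrow> f' t \<ge> 0"
    and m: "a \<le> m" "m \<le> b" and t: "a \<le> t" "t \<le> b"
  shows "f m \<le> f t"
proof (cases "t \<le> m")
  case True
  show ?thesis
  proof (rule DERIV_nonpos_imp_decreasing_open[OF True])
    show "\<exists>y. (f has_real_derivative y) (at x) \<and> y \<le> 0" if "t < x" "x < m" for x
      using der[of x] neg[of x] that t m by auto
  qed (use t m in \<open>auto intro: continuous_on_subset[OF cont]\<close>)
next
  case False
  then have "m \<le> t" by simp
  then show ?thesis
  proof (rule DERIV_nonneg_imp_increasing_open)
    show "\<exists>y. (f has_real_derivative y) (at x) \<and> y \<ge> 0" if "m < x" "x < t" for x
      using der[of x] pos[of x] that t m by auto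
  qed (use t m in \<open>auto intro: continuous_on_subset[OF cont]\<close>)
qed

text \<open>The expression is \<open>(p - 1) * tan t - tan ((p - 1) * t)\<close> times the two
  cosines. It vanishes at 0, and in its derivative the products of two cosines cancel, leaving
  \<open>(1 - (p - 1)^2) * sin t * sin ((p - 1) * t)\<close>; so the position of \<open>p\<close>
  relative to 2 decides.\<close>

lemma tan_sub_sign:
  fixes p t :: real
  assumes p: "1 < p" and t: "0 \<le> t" "t \<le> pi" "(p - 1) * t \<le> pi"
  shows "p \<le> 2 \<Longrightarrow> 0 \<le> (p - 1) * sin t * cos ((p - 1) * t) - sin ((p - 1) * t) * cos t"
    and "2 \<le> p \<Longrightarrow> (p - 1) * sin t * cos ((p - 1) * t) - sin ((p - 1) * t) * cos t \<le> 0"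
proof -
  define N where "N = (\<lambda>t. (p - 1) * sin t * cos ((p - 1) * t) - sin ((p - 1) * t) * cos t)"
  have d: "(N has_real_derivative (1 - (p - 1)\<^sup>2) * (sin x * sin ((p - 1) * x))) (at x)" for x
    unfolding N_def by (auto intro!: derivative_eq_intros simp: algebra_simps power2_eq_square)
  have s: "0 \<le> sin x * sin ((p - 1) * x)" if "0 \<le> x" "x \<le> t" for x
  proof -
    have "(p - 1) * x \<le> (p - 1) * t" using p that by simp
    then have "(p - 1) * x \<le> pi" using t by linarith
    then show ?thesis using p that t by (intro mult_nonneg_nonneg sin_ge_zero) auto
  qed
  have N0: "N 0 = 0" by (simp add: N_def)
  show "0 \<le> (p - 1) * sin t * cos ((p - 1) * t) - sin ((p - 1) * t) * cos t" if "p \<le> 2"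
  proof -
    have "(p - 1)\<^sup>2 \<le> 1" using p that by (simp add: power_le_one)
    then have "\<exists>y. (N has_real_derivative y) (at x) \<and> 0 \<le> y" if "0 \<le> x" "x \<le> t" for x
      using d[of x] mult_nonneg_nonneg[OF _ s[OF that], of "1 - (p - 1)\<^sup>2"] by auto
    then have "N 0 \<le> N t"
      by (intro DERIV_nonneg_imp_nondecreasing[OF t(1)])
    then show ?thesis using N0 by (simp add: N_def)
  qed
  show "(p - 1) * sin t * cos ((p - 1) * t) - sin ((p - 1) * t) * cos t \<le> 0" if "2 \<le> p"
  proof -
    have "1 \<le> (p - 1)\<^sup>2" using p that by (simp add: one_le_power)
    then have "\<exists>y. (N has_real_derivative y) (at x) \<and> y \<le> 0" if "0 \<le> x" "x \<le> t" for x
      using d[of x] mult_nonpos_nonneg[OF _ s[OF that], of "1 - (p - 1)\<^sup>2"] by auto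
    then have "N t \<le> N 0"
      by (intro DERIV_nonpos_imp_nonincreasing[OF t(1)])
    then show ?thesis using N0 by (simp add: N_def)
  qed
qed

text \<open>The right side is the combination of 1 and \<open>cos (p * t)\<close> with the value and
  the derivative of \<open>cos t powr p\<close> at \<open>\<beta>\<close>, where
  \<open>p * \<beta> = pi / 2\<close>. The difference turns only at \<open>\<beta>\<close>, because
  the quotient of the two derivatives is monotone: increasing for \<open>p \<le> 2\<close>,
  decreasing for \<open>p \<ge> 2\<close>.\<close>

lemma cos_powr_bounds:
  fixes p t :: real
  defines "\<beta> \<equiv> pi / (2 * p)"
  assumes p: "1 < p" and t: "0 \<le> t" "t \<le> pi / 2" "t \<le> pi / p"
  shows "p \<le> 2 \<Longrightarrow> cos \<beta> powr p * (1 + tan \<beta> * cos (p * t)) \<le> cos t powr p"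
    and "2 \<le> p \<Longrightarrow> cos t powr p \<le> cos \<beta> powr p * (1 + tan \<beta> * cos (p * t))"
proof -
  define c where "c = min (pi / 2) (pi / p)"
  have \<beta>: "0 < \<beta>" "\<beta> < c" "p * \<beta> = pi / 2"
    using p by (auto simp: \<beta>_def c_def field_simps)
  have cpos: "sin x > 0" "cos x > 0" "(p - 1) * x < pi" if "0 < x" "x < c" for x
  proof -
    show "sin x > 0" "cos x > 0" using that by (auto simp: c_def intro!: sin_gt_zero cos_gt_zero)
    have "p * x < pi" using that p by (simp add: c_def field_simps)
    then show "(p - 1) * x < pi" using that p by (simp add: algebra_simps)
  qed
  \<comment> \<open>\<open>G\<close> is the quotient of the derivatives of
    \<open>cos (p * t)\<close> and \<open>cos t powr p\<close>; the derivative
    \<open>\<psi>'\<close> of the difference is a nonnegative factor times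
    \<open>G x / G \<beta> - 1\<close>.\<close>
  define G where "G = (\<lambda>t. sin (p * t) * cos t powr (1 - p) / sin t)"
  define N where "N = (\<lambda>t. (p - 1) * sin t * cos ((p - 1) * t) - sin ((p - 1) * t) * cos t)"
  have dG: "(G has_real_derivative N x * cos x powr (- p) / (sin x)\<^sup>2) (at x)" if "0 < x" "x < c" for x
    unfolding G_def N_def using cos_powr_cos_mult_mono[OF p, of x] that cpos[of x] by (simp add: c_def)
  have sin1: "sin (p * \<beta>) = 1" by (simp add: \<beta>(3))
  have G\<beta>: "G \<beta> = 1 / (cos \<beta> powr p * tan \<beta>)"
    using cpos[OF \<beta>(1,2)] unfolding G_def sin1 by (simp add: tan_def powr_diff field_simps)
  have G\<beta>_pos: "cos \<beta> powr p * tan \<beta> > 0"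
    using cpos[OF \<beta>(1,2)] by (simp add: tan_def)
  define \<psi> where "\<psi> = (\<lambda>t. cos t powr p - cos \<beta> powr p * (1 + tan \<beta> * cos (p * t)))"
  define \<psi>' where "\<psi>' = (\<lambda>t. p * (cos t powr (p - 1) * sin t) * (cos \<beta> powr p * tan \<beta> * G t - 1))"
  have d\<psi>: "(\<psi> has_real_derivative \<psi>' x) (at x)" if "0 < x" "x < c" for x
  proof -
    have "((\<lambda>t. cos t powr p) has_real_derivative p * cos x powr (p - 1) * (- sin x)) (at x)"
      using DERIV_fun_powr[OF DERIV_cos, of x p] cpos[OF that] by simp
    then have 1: "(\<psi> has_real_derivative p * cos x powr (p - 1) * (- sin x) + cos \<beta> powr p * tan \<beta> * (sin (p * x) * p)) (at x)"
      unfolding \<psi>_def using cpos[OF that] by (auto intro!: derivative_eq_intros simp: algebra_simps)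
    have "cos x powr (p - 1) * cos x powr (1 - p) = 1"
      using cpos[OF that] by (simp flip: powr_add)
    then have "cos x powr (p - 1) * sin x * G x = sin (p * x)"
      using cpos[OF that] unfolding G_def by (simp add: field_simps)
    then have "\<psi>' x = p * cos x powr (p - 1) * (- sin x) + cos \<beta> powr p * tan \<beta> * (sin (p * x) * p)"
      unfolding \<psi>'_def by (simp add: algebra_simps flip: \<open>_ = sin (p * x)\<close>)
    with 1 show ?thesis by simp
  qed
  have cont: "continuous_on {0..c} \<psi>"
    unfolding \<psi>_def using p
    by (intro continuous_intros continuous_on_powr') (auto simp: c_def intro!: cos_ge_zero)
  have tc: "0 \<le> t" "t \<le> c" using t by (auto simp: c_def)
  have z: "\<psi> \<beta> = 0" by (simp add: \<psi>_def \<beta>(3))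
  have fac: "0 \<le> p * (cos x powr (p - 1) * sin x)" if "0 < x" "x < c" for x
    using cpos[OF that] p by simp
  have Gle: "cos \<beta> powr p * tan \<beta> * G x \<le> 1" if "G x \<le> G \<beta>" for x
    using that G\<beta>_pos unfolding G\<beta> by (simp add: field_simps)
  have Gge: "1 \<le> cos \<beta> powr p * tan \<beta> * G x" if "G \<beta> \<le> G x" for x
    using that G\<beta>_pos unfolding G\<beta> by (simp add: field_simps)
  show "cos \<beta> powr p * (1 + tan \<beta> * cos (p * t)) \<le> cos t powr p" if "p \<le> 2"
  proof -
    have mono: "G x \<le> G y" if "0 < x" "x \<le> y" "y < c" for x y
    proof (rule DERIV_nonneg_imp_nondecreasing[OF that(2)])
      fix u assume "x \<le> u" "u \<le> y"
      then have u: "0 < u" "u < c" using that by auto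
      then have "0 \<le> N u" unfolding N_def using tan_sub_sign(1)[OF p, of u] cpos[OF u] \<open>p \<le> 2\<close> pi_gt_zero
        by (auto simp: c_def)
      then show "\<exists>y. (G has_real_derivative y) (at u) \<and> 0 \<le> y" using dG[OF u] by fastforce
    qed
    have "\<psi> \<beta> \<le> \<psi> t"
    proof (rule min_at_turning_point[OF cont d\<psi>])
      show "\<psi>' x \<le> 0" if "0 < x" "x < \<beta>" "x < c" for x
        unfolding \<psi>'_def using mult_nonneg_nonpos[OF fac[of x]] Gle mono that \<beta> by auto
      show "\<psi>' x \<ge> 0" if "\<beta> < x" "x < c" "0 < x" for x
        unfolding \<psi>'_def using mult_nonneg_nonneg[OF fac[of x]] Gge mono that \<beta> by auto
    qed (use \<beta> tc in auto)
    then show ?thesis by (simp add: z) (simp add: \<psi>_def)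
  qed
  show "cos t powr p \<le> cos \<beta> powr p * (1 + tan \<beta> * cos (p * t))" if "2 \<le> p"
  proof -
    have mono: "G y \<le> G x" if "0 < x" "x \<le> y" "y < c" for x y
    proof (rule DERIV_nonpos_imp_nonincreasing[OF that(2)])
      fix u assume "x \<le> u" "u \<le> y"
      then have u: "0 < u" "u < c" using that by auto
      then have "N u \<le> 0" unfolding N_def using tan_sub_sign(2)[OF p, of u] cpos[OF u] \<open>2 \<le> p\<close> pi_gt_zero
        by (auto simp: c_def)
      then have "N u * cos u powr (- p) / (sin u)\<^sup>2 \<le> 0"
        by (simp add: divide_nonpos_nonneg mult_nonpos_nonneg)
      then show "\<exists>y. (G has_real_derivative y) (at u) \<and> y \<le> 0" using dG[OF u] by blast
    qed
    have "- \<psi> \<beta> \<le> - \<psi> t"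
    proof (rule min_at_turning_point[where f = "\<lambda>t. - \<psi> t"])
      show "continuous_on {0..c} (\<lambda>t. - \<psi> t)" using cont by (intro continuous_intros)
      show "((\<lambda>t. - \<psi> t) has_real_derivative - \<psi>' x) (at x)" if "0 < x" "x < c" for x
        using d\<psi>[OF that] by (rule DERIV_minus)
      show "- \<psi>' x \<le> 0" if "0 < x" "x < \<beta>" "x < c" for x
        unfolding \<psi>'_def using mult_nonneg_nonneg[OF fac[of x]] Gge mono[of x \<beta>] that \<beta> by auto
      show "- \<psi>' x \<ge> 0" if "\<beta> < x" "x < c" "0 < x" for x
        unfolding \<psi>'_def using mult_nonneg_nonpos[OF fac[of x]] Gle mono[of \<beta> x] that \<beta> by auto
    qed (use \<beta> tc in auto)
    then show ?thesis by (simp add: z) (simp add: \<psi>_def)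
  qed
qed

text \<open>The same tangency at \<open>\<beta>\<close>, for the sine. Now the derivative of the
  difference is a nonnegative factor times \<open>1 - G x / G \<beta>\<close>, so the same
  monotonicity of the quotient yields the inequalities in the opposite direction.\<close>

lemma sin_powr_bounds:
  fixes p t :: real
  defines "\<beta> \<equiv> pi / (2 * p)"
  assumes p: "1 < p" and t: "0 \<le> t" "t \<le> pi / 2" "t \<le> pi / p"
  shows "p \<le> 2 \<Longrightarrow> sin t powr p \<le> sin \<beta> powr p * (1 - cot \<beta> * cos (p * t))"
    and "2 \<le> p \<Longrightarrow> sin \<beta> powr p * (1 - cot \<beta> * cos (p * t)) \<le> sin t powr p"
proof -
  define c where "c = min (pi / 2) (pi / p)"
  have \<beta>: "0 < \<beta>" "\<beta> < c" "p * \<beta> = pi / 2"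
    using p by (auto simp: \<beta>_def c_def field_simps)
  have cpos: "sin x > 0" "cos x > 0" "p * x < pi" if "0 < x" "x < c" for x
  proof -
    show "sin x > 0" "cos x > 0" using that by (auto simp: c_def intro!: sin_gt_zero cos_gt_zero)
    show "p * x < pi" using that p by (simp add: c_def field_simps)
  qed
  define G where "G = (\<lambda>t. sin (p * t) * sin t powr (1 - p) / cos t)"
  define N where "N = (\<lambda>t. sin t * cos ((p - 1) * t) - (p - 1) * cos t * sin ((p - 1) * t))"
  have dG: "(G has_real_derivative N x * sin x powr (- p) / (cos x)\<^sup>2) (at x)" if "0 < x" "x < c" for x
    unfolding G_def N_def using sin_powr_sin_mult_mono[OF p, of x] that by (simp add: c_def)
  have sin1: "sin (p * \<beta>) = 1" by (simp add: \<beta>(3))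
  have G\<beta>: "G \<beta> = 1 / (sin \<beta> powr p * cot \<beta>)"
    using cpos[OF \<beta>(1,2)] unfolding G_def sin1 by (simp add: cot_def powr_diff field_simps)
  have G\<beta>_pos: "sin \<beta> powr p * cot \<beta> > 0"
    using cpos[OF \<beta>(1,2)] by (simp add: cot_def)
  define \<psi> where "\<psi> = (\<lambda>t. sin t powr p - sin \<beta> powr p * (1 - cot \<beta> * cos (p * t)))"
  define \<psi>' where "\<psi>' = (\<lambda>t. p * (sin t powr (p - 1) * cos t) * (1 - sin \<beta> powr p * cot \<beta> * G t))"
  have d\<psi>: "(\<psi> has_real_derivative \<psi>' x) (at x)" if "0 < x" "x < c" for x
  proof -
    have "((\<lambda>t. sin t powr p) has_real_derivative p * sin x powr (p - 1) * cos x) (at x)"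
      using DERIV_fun_powr[OF DERIV_sin, of x p] cpos[OF that] by simp
    then have 1: "(\<psi> has_real_derivative p * sin x powr (p - 1) * cos x - sin \<beta> powr p * cot \<beta> * (sin (p * x) * p)) (at x)"
      unfolding \<psi>_def using cpos[OF that] by (auto intro!: derivative_eq_intros simp: algebra_simps)
    have "sin x powr (p - 1) * sin x powr (1 - p) = 1"
      using cpos[OF that] by (simp flip: powr_add)
    then have "sin x powr (p - 1) * cos x * G x = sin (p * x)"
      using cpos[OF that] unfolding G_def by (simp add: field_simps)
    then have "\<psi>' x = p * sin x powr (p - 1) * cos x - sin \<beta> powr p * cot \<beta> * (sin (p * x) * p)"
      unfolding \<psi>'_def by (simp add: algebra_simps flip: \<open>_ = sin (p * x)\<close>)
    with 1 show ?thesis by simp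
  qed
  have cont: "continuous_on {0..c} \<psi>"
    unfolding \<psi>_def using p
    by (intro continuous_intros continuous_on_powr') (auto simp: c_def intro!: sin_ge_zero)
  have tc: "0 \<le> t" "t \<le> c" using t by (auto simp: c_def)
  have z: "\<psi> \<beta> = 0" by (simp add: \<psi>_def \<beta>(3))
  have fac: "0 \<le> p * (sin x powr (p - 1) * cos x)" if "0 < x" "x < c" for x
    using cpos[OF that] p by simp
  have Gle: "sin \<beta> powr p * cot \<beta> * G x \<le> 1" if "G x \<le> G \<beta>" for x
    using that G\<beta>_pos unfolding G\<beta> by (simp add: field_simps)
  have Gge: "1 \<le> sin \<beta> powr p * cot \<beta> * G x" if "G \<beta> \<le> G x" for x
    using that G\<beta>_pos unfolding G\<beta> by (simp add: field_simps)
  \<comment> \<open>Consequently \<open>N u = sin ((2 - p) * u) + (2 - p) * cos u * sin ((p - 1) *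
    u)\<close>, and both terms have the sign of \<open>2 - p\<close>.\<close>
  have sum: "sin u * cos ((p - 1) * u) - cos u * sin ((p - 1) * u) = sin ((2 - p) * u)" for u
    using sin_diff[of u "(p - 1) * u"] by (simp add: algebra_simps)
  have sc: "0 \<le> cos u * sin ((p - 1) * u)" "(p - 1) * u \<le> p * u" if u: "0 < u" "u < c" for u
    using cpos[OF u] p u by (auto intro!: mult_nonneg_nonneg sin_ge_zero simp: algebra_simps)
  show "sin t powr p \<le> sin \<beta> powr p * (1 - cot \<beta> * cos (p * t))" if "p \<le> 2"
  proof -
    have mono: "G x \<le> G y" if "0 < x" "x \<le> y" "y < c" for x y
    proof (rule DERIV_nonneg_imp_nondecreasing[OF that(2)])
      fix u assume "x \<le> u" "u \<le> y"
      then have u: "0 < u" "u < c" using that by auto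
      have "(2 - p) * u \<le> 1 * u" using u p by (intro mult_right_mono) auto
      moreover have "u < pi / 2" using u by (simp add: c_def)
      ultimately have "(2 - p) * u \<le> pi" using pi_gt_zero by linarith
      then have "0 \<le> sin ((2 - p) * u)"
        using u \<open>p \<le> 2\<close> by (intro sin_ge_zero) auto
      moreover have "(p - 1) * (cos u * sin ((p - 1) * u)) \<le> 1 * (cos u * sin ((p - 1) * u))"
        using sc[OF u] \<open>p \<le> 2\<close> by (intro mult_right_mono) auto
      ultimately have "0 \<le> N u" unfolding N_def using sum[of u] by (simp add: algebra_simps)
      then show "\<exists>y. (G has_real_derivative y) (at u) \<and> 0 \<le> y" using dG[OF u] by fastforce
    qed
    have "- \<psi> \<beta> \<le> - \<psi> t"
    proof (rule min_at_turning_point[where f = "\<lambda>t. - \<psi> t"])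
      show "continuous_on {0..c} (\<lambda>t. - \<psi> t)" using cont by (intro continuous_intros)
      show "((\<lambda>t. - \<psi> t) has_real_derivative - \<psi>' x) (at x)" if "0 < x" "x < c" for x
        using d\<psi>[OF that] by (rule DERIV_minus)
      show "- \<psi>' x \<le> 0" if "0 < x" "x < \<beta>" "x < c" for x
        unfolding \<psi>'_def using mult_nonneg_nonneg[OF fac[of x]] Gle mono[of x \<beta>] that \<beta> by auto
      show "- \<psi>' x \<ge> 0" if "\<beta> < x" "x < c" "0 < x" for x
        unfolding \<psi>'_def using mult_nonneg_nonpos[OF fac[of x]] Gge mono[of \<beta> x] that \<beta> by auto
    qed (use \<beta> tc in auto)
    then show ?thesis by (simp add: z) (simp add: \<psi>_def)
  qed
  show "sin \<beta> powr p * (1 - cot \<beta> * cos (p * t)) \<le> sin t powr p" if "2 \<le> p"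
  proof -
    have mono: "G y \<le> G x" if "0 < x" "x \<le> y" "y < c" for x y
    proof (rule DERIV_nonpos_imp_nonincreasing[OF that(2)])
      fix u assume "x \<le> u" "u \<le> y"
      then have u: "0 < u" "u < c" using that by auto
      have "(p - 2) * u \<le> p * u" using u p by (intro mult_right_mono) auto
      then have "0 \<le> sin ((p - 2) * u)"
        using u \<open>2 \<le> p\<close> cpos(3)[OF u] by (intro sin_ge_zero) (simp, linarith)
      moreover have "sin ((2 - p) * u) = - sin ((p - 2) * u)"
        using sin_minus[of "(p - 2) * u"] by (simp add: algebra_simps)
      moreover have "1 * (cos u * sin ((p - 1) * u)) \<le> (p - 1) * (cos u * sin ((p - 1) * u))"
        using sc[OF u] \<open>2 \<le> p\<close> by (intro mult_right_mono) auto
      ultimately have "N u \<le> 0" unfolding N_def using sum[of u] by (simp add: algebra_simps)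
      then have "N u * sin u powr (- p) / (cos u)\<^sup>2 \<le> 0"
        by (simp add: divide_nonpos_nonneg mult_nonpos_nonneg)
      then show "\<exists>y. (G has_real_derivative y) (at u) \<and> y \<le> 0" using dG[OF u] by blast
    qed
    have "\<psi> \<beta> \<le> \<psi> t"
    proof (rule min_at_turning_point[OF cont d\<psi>])
      show "\<psi>' x \<le> 0" if "0 < x" "x < \<beta>" "x < c" for x
        unfolding \<psi>'_def using mult_nonneg_nonpos[OF fac[of x]] Gge mono that \<beta> by auto
      show "\<psi>' x \<ge> 0" if "\<beta> < x" "x < c" "0 < x" for x
        unfolding \<psi>'_def using mult_nonneg_nonneg[OF fac[of x]] Gle mono that \<beta> by auto
    qed (use \<beta> tc in auto)
    then show ?thesis by (simp add: z) (simp add: \<psi>_def)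
  qed
qed

text \<open>Passes from \<open>S = 1\<close>, the case of two numbers of equal modulus, to larger
  \<open>S\<close>: the hypothesis compares the derivatives of the two powers, the common factor
  \<open>q\<close> being removed.\<close>

lemma powr_add_diff_mono:
  fixes q c m S :: real
  assumes q: "0 < q" and c: "-1 \<le> c" and S: "1 \<le> S"
    and le: "\<And>x. 1 < x \<Longrightarrow> m * x powr (q - 1) \<le> (x + c) powr (q - 1)"
  shows "(1 + c) powr q - m \<le> (S + c) powr q - m * S powr q"
proof -
  define D where "D = (\<lambda>x. (x + c) powr q - m * x powr q)"
  have "D 1 \<le> D S"
  proof (rule DERIV_nonneg_imp_increasing_open[OF S])
    fix x :: real assume x: "1 < x" "x < S"
    have "(D has_real_derivative q * ((x + c) powr (q - 1) - m * x powr (q - 1))) (at x)"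
      unfolding D_def using x c by (auto intro!: derivative_eq_intros simp: algebra_simps)
    then show "\<exists>y. (D has_real_derivative y) (at x) \<and> 0 \<le> y"
      using le[OF x(1)] q by (intro exI conjI) auto
  next
    show "continuous_on {1..S} D"
      unfolding D_def using c q by (intro continuous_intros continuous_on_powr') auto
  qed
  then show ?thesis by (simp add: D_def)
qed

lemma powr_add_diff_antimono:
  fixes q c m S :: real
  assumes q: "0 < q" and c: "-1 \<le> c" and S: "1 \<le> S"
    and le: "\<And>x. 1 < x \<Longrightarrow> (x + c) powr (q - 1) \<le> m * x powr (q - 1)"
  shows "(S + c) powr q - m * S powr q \<le> (1 + c) powr q - m"
proof -
  define D where "D = (\<lambda>x. (x + c) powr q - m * x powr q)"
  have "D S \<le> D 1"
  proof (rule DERIV_nonpos_imp_decreasing_open[OF S])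
    fix x :: real assume x: "1 < x" "x < S"
    have "(D has_real_derivative q * ((x + c) powr (q - 1) - m * x powr (q - 1))) (at x)"
      unfolding D_def using x c by (auto intro!: derivative_eq_intros simp: algebra_simps)
    then show "\<exists>y. (D has_real_derivative y) (at x) \<and> y \<le> 0"
      using le[OF x(1)] q by (intro exI conjI) (auto simp: mult_nonneg_nonpos)
  next
    show "continuous_on {1..S} D"
      unfolding D_def using c q by (intro continuous_intros continuous_on_powr') auto
  qed
  then show ?thesis by (simp add: D_def)
qed

section \<open>Half angles and the four scalar inequalities\<close>

lemma powr_half_angle:
  fixes p t :: real
  shows "0 \<le> cos t \<Longrightarrow> (1 + cos (2 * t)) powr (p / 2) = 2 powr (p / 2) * cos t powr p"
    and "0 \<le> sin t \<Longrightarrow> (1 - cos (2 * t)) powr (p / 2) = 2 powr (p / 2) * sin t powr p"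
proof -
  have sq: "(x\<^sup>2) powr (p / 2) = x powr p" if "0 \<le> x" for x :: real
    using that by (cases "x = 0") (auto simp: powr_powr simp flip: powr_numeral)
  show "(1 + cos (2 * t)) powr (p / 2) = 2 powr (p / 2) * cos t powr p" if "0 \<le> cos t"
    using sq[OF that] by (simp add: cos_double_cos powr_mult)
  show "(1 - cos (2 * t)) powr (p / 2) = 2 powr (p / 2) * sin t powr p" if "0 \<le> sin t"
    using sq[OF that] by (simp add: cos_double_sin powr_mult)
qed

lemma sin_ge_chord:
  fixes x :: real
  assumes "0 \<le> x" "x \<le> 1"
  shows "x \<le> sin (x * (pi / 2))"
proof -
  have "concave_on {0..pi} sin"
  proof (rule f''_le0_imp_concave)
    show "(sin has_real_derivative cos x) (at x)" "(cos has_real_derivative - sin x) (at x)" for x :: real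
      by (auto intro!: derivative_eq_intros)
  qed (auto intro: sin_ge_zero)
  from concave_onD[OF this, of x 0 "pi / 2"] show ?thesis
    using assms by simp
qed

lemma cos_ge_chord:
  fixes x :: real
  assumes "0 \<le> x" "x \<le> 1"
  shows "1 - x \<le> cos (x * (pi / 2))"
proof -
  have "(1 - x) * (pi / 2) = pi / 2 - x * (pi / 2)" by (simp add: left_diff_distrib)
  moreover have "1 - x \<le> sin ((1 - x) * (pi / 2))" using sin_ge_chord[of "1 - x"] assms by simp
  moreover have "cos (x * (pi / 2)) = sin (pi / 2 - x * (pi / 2))" by (simp add: cos_sin_eq)
  ultimately show ?thesis by (simp only:)
qed

lemma half_angle_facts:
  fixes p :: real
  assumes p: "1 < p"
  shows "0 < sin (pi / (2 * p))" "0 < cos (pi / (2 * p))" "0 < tan (pi / (2 * p))" "0 < cot (pi / (2 * p))"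
    and "p \<le> 2 \<Longrightarrow> 1 \<le> tan (pi / (2 * p))" "2 \<le> p \<Longrightarrow> tan (pi / (2 * p)) \<le> 1"
    and "p \<le> 2 \<Longrightarrow> cos (pi / p) \<le> 0" "2 \<le> p \<Longrightarrow> 0 \<le> cos (pi / p)"
    and "(1 + cos (pi / p)) powr (p / 2) = 2 powr (p / 2) * cos (pi / (2 * p)) powr p"
    and "(1 - cos (pi / p)) powr (p / 2) = 2 powr (p / 2) * sin (pi / (2 * p)) powr p"
proof -
  have b: "0 < pi / (2 * p)" "pi / (2 * p) < pi / 2"
    using p by (auto simp: field_simps)
  show sc: "0 < sin (pi / (2 * p))" "0 < cos (pi / (2 * p))"
    using b by (auto intro!: sin_gt_zero cos_gt_zero)
  then show "0 < tan (pi / (2 * p))" "0 < cot (pi / (2 * p))" by (auto simp: tan_def cot_def)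
  show "1 \<le> tan (pi / (2 * p))" if "p \<le> 2"
    using tan_mono_le[of "pi / 4" "pi / (2 * p)"] b p that by (auto simp: tan_45 field_simps)
  show "tan (pi / (2 * p)) \<le> 1" if "2 \<le> p"
    using tan_mono_le[of "pi / (2 * p)" "pi / 4"] b(1) that divide_left_mono[of 4 "2 * p" pi] by (simp add: tan_45)
  show "cos (pi / p) \<le> 0" if "p \<le> 2"
    using cos_monotone_0_pi_le[of "pi / 2" "pi / p"] p that by (auto simp: field_simps)
  show "0 \<le> cos (pi / p)" if "2 \<le> p"
    using p that by (intro cos_ge_zero) (auto simp: field_simps intro: order_trans[of _ 0])
  show "(1 + cos (pi / p)) powr (p / 2) = 2 powr (p / 2) * cos (pi / (2 * p)) powr p"
    "(1 - cos (pi / p)) powr (p / 2) = 2 powr (p / 2) * sin (pi / (2 * p)) powr p"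
    using powr_half_angle[of "pi / (2 * p)" p] sc by auto
qed

text \<open>At \<open>S = 1\<close> this is the bound for \<open>cos (\<tau> / 2) powr p\<close>.
  For larger \<open>S\<close> the derivatives are compared, with the nonpositive exponent
  \<open>p / 2 - 1\<close>: where \<open>cos \<tau> \<le> 0\<close> it suffices that
  \<open>m \<le> 1\<close>, elsewhere \<open>x + cos \<tau> \<le> 2 * x\<close> reduces it to
  \<open>m \<le> 2 powr (p / 2 - 1)\<close>.\<close>

lemma riesz_scalar_lower_le_2:
  fixes p \<tau> S :: real
  assumes p: "1 < p" "p \<le> 2" and \<tau>: "0 \<le> \<tau>" "\<tau> \<le> pi" and S: "1 \<le> S"
  shows "(1 + cos (pi / p)) powr (p / 2) * (S powr (p / 2) + tan (pi / (2 * p)) * cos (p / 2 * \<tau>))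
           \<le> (S + cos \<tau>) powr (p / 2)"
proof -
  define m where "m = (1 + cos (pi / p)) powr (p / 2)"
  define b where "b = pi / (2 * p)"
  note h = half_angle_facts[OF p(1), folded b_def] 
  have m: "m = 2 powr (p / 2) * cos b powr p" "0 \<le> m" by (simp_all add: m_def h)
  have "cos b powr p * (1 + tan b * cos (p * (\<tau> / 2))) \<le> cos (\<tau> / 2) powr p"
    unfolding b_def using p \<tau> mult_mono[of p 2 \<tau> pi] by (intro cos_powr_bounds) (auto simp: field_simps)
  then have "m * (1 + tan b * cos (p / 2 * \<tau>)) \<le> 2 powr (p / 2) * cos (\<tau> / 2) powr p"
    unfolding m by (simp add: mult.assoc)
  also have "\<dots> = (1 + cos \<tau>) powr (p / 2)"
    using powr_half_angle(1)[of "\<tau> / 2" p] \<tau> by (simp add: cos_ge_zero)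
  finally have 1: "m * (1 + tan b * cos (p / 2 * \<tau>)) \<le> (1 + cos \<tau>) powr (p / 2)" .
  \<comment> \<open>The cosine bound at \<open>t = 0\<close> reads
    \<open>cos b powr p * (1 + tan b) \<le> 1\<close>, and \<open>tan b \<ge> 1\<close> since
    \<open>p \<le> 2\<close>.\<close>
  have mh: "m \<le> 2 powr (p / 2 - 1)"
  proof -
    have "cos b powr p * (1 + tan b * cos (p * 0)) \<le> cos 0 powr p"
      unfolding b_def using p by (intro cos_powr_bounds) auto
    then have "cos b powr p * (1 + tan b) \<le> 1" by simp
    moreover have "cos b powr p * 2 \<le> cos b powr p * (1 + tan b)" using h p by (intro mult_left_mono) auto
    ultimately have "cos b powr p * 2 \<le> 1" by linarith
    then have "2 powr (p / 2) * cos b powr p \<le> 2 powr (p / 2) * (1 / 2)" by (intro mult_left_mono) auto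
    also have "\<dots> = 2 powr (p / 2 - 1)" by (simp add: powr_diff)
    finally show ?thesis unfolding m .
  qed
  have "(1 + cos \<tau>) powr (p / 2) - m \<le> (S + cos \<tau>) powr (p / 2) - m * S powr (p / 2)"
  proof (rule powr_add_diff_mono)
    fix x :: real assume x: "1 < x"
    have xc: "0 < x + cos \<tau>" using x cos_ge_minus_one[of \<tau>] by linarith
    show "m * x powr (p / 2 - 1) \<le> (x + cos \<tau>) powr (p / 2 - 1)"
    proof (cases "cos \<tau> \<le> 0")
      case True
      have "m \<le> 1" unfolding m_def using h(7)[OF p(2)] p cos_ge_minus_one[of "pi / p"] by (intro powr_le1) linarith+
      then have "m * x powr (p / 2 - 1) \<le> 1 * x powr (p / 2 - 1)" by (intro mult_right_mono) auto
      also have "\<dots> \<le> (x + cos \<tau>) powr (p / 2 - 1)" using True xc p by (simp add: powr_mono2')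
      finally show ?thesis .
    next
      case False
      have "m * x powr (p / 2 - 1) \<le> 2 powr (p / 2 - 1) * x powr (p / 2 - 1)" using mh by (intro mult_right_mono) auto
      also have "\<dots> = (2 * x) powr (p / 2 - 1)" using x by (simp add: powr_mult)
      also have "\<dots> \<le> (x + cos \<tau>) powr (p / 2 - 1)"
        using xc x p cos_le_one[of \<tau>] by (intro powr_mono2') linarith+
      finally show ?thesis .
    qed
  qed (use p S in auto)
  with 1 show ?thesis unfolding m_def[symmetric] b_def[symmetric] by (simp add: algebra_simps)
qed

text \<open>For \<open>cos \<tau> > 0\<close> a comparison of derivatives may fail: with the
  nonpositive exponent \<open>q - 1\<close> the power of \<open>x - cos \<tau>\<close> can be large
  near \<open>x = 1\<close>. Concavity of the power \<open>q\<close> takes its place.\<close>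

lemma riesz_scalar_upper_le_2:
  fixes p \<tau> S :: real
  assumes p: "1 < p" "p \<le> 2" and \<tau>: "0 \<le> \<tau>" "\<tau> \<le> pi" and S: "1 \<le> S"
  shows "(S - cos \<tau>) powr (p / 2)
           \<le> (1 - cos (pi / p)) powr (p / 2) * (S powr (p / 2) - cot (pi / (2 * p)) * cos (p / 2 * \<tau>))"
proof -
  define C where "C = (1 - cos (pi / p)) powr (p / 2)"
  define b where "b = pi / (2 * p)"
  define q where "q = p / 2"
  define b' where "b' = C * cot b"
  note h = half_angle_facts[OF p(1), folded b_def] 
  have q: "0 < q" "q \<le> 1" "1/2 < q" using p by (auto simp: q_def)
  have C: "C = 2 powr q * sin b powr p" by (simp_all add: C_def h q_def)
  have C1: "1 \<le> C" unfolding C_def using h p by (intro ge_one_powr_ge_zero) auto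
  have key: "(1 - cos t) powr q \<le> C - b' * cos (q * t)" if t: "0 \<le> t" "t \<le> pi" for t
  proof -
    have "sin (t / 2) powr p \<le> sin b powr p * (1 - cot b * cos (p * (t / 2)))"
      unfolding b_def using p t mult_mono[of p 2 t pi] by (intro sin_powr_bounds) (auto simp: field_simps)
    then have "2 powr q * sin (t / 2) powr p \<le> C * (1 - cot b * cos (q * t))"
      unfolding C by (simp add: mult.assoc q_def)
    moreover have "2 powr q * sin (t / 2) powr p = (1 - cos t) powr q"
      unfolding q_def using powr_half_angle(2)[of "t / 2" p] t by (simp add: sin_ge_zero)
    ultimately show ?thesis by (simp add: b'_def algebra_simps)
  qed
  have b'0: "0 \<le> b'" unfolding b'_def using C1 h by auto
  \<comment> \<open>\<open>b'\<close> equals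
    \<open>(2 * (sin b)^2) powr (q - 1) * sin (2 * b)\<close>, where the base is
    \<open>1 - cos (pi / p) \<ge> 1\<close> and the exponent is nonpositive.\<close>
  have b'1: "b' \<le> 1"
  proof -
    have "sin (2 * b) \<le> 1" by simp
    have "b' = 2 powr q * sin b powr p * (cos b / sin b)" by (simp add: b'_def C cot_def)
    also have "sin b powr p = (sin b)\<^sup>2 powr q" using h p by (simp add: q_def powr_powr flip: powr_numeral)
    also have "2 powr q * (sin b)\<^sup>2 powr q = (2 * (sin b)\<^sup>2) powr q" by (simp add: powr_mult)
    also have "\<dots> = (2 * (sin b)\<^sup>2) powr (q - 1) * (2 * (sin b)\<^sup>2)" using h by (simp add: powr_diff)
    also have "(2 * (sin b)\<^sup>2) powr (q - 1) * (2 * (sin b)\<^sup>2) * (cos b / sin b) = (2 * (sin b)\<^sup>2) powr (q - 1) * sin (2 * b)"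
      using h by (simp add: sin_double power2_eq_square)
    also have "\<dots> \<le> 1 * 1"
    proof (intro mult_mono)
      have "1 \<le> 2 * (sin b)\<^sup>2" using h p cos_double_sin[of b] by (simp add: b_def)
      then show "(2 * (sin b)\<^sup>2) powr (q - 1) \<le> 1" using q powr_mono2'[of "q - 1" 1 "2 * (sin b)\<^sup>2"] by auto
    qed (use h \<open>sin (2 * b) \<le> 1\<close> in \<open>auto simp: sin_double\<close>)
    finally show ?thesis by simp
  qed
  have "(S - cos \<tau>) powr q \<le> C * S powr q - b' * cos (q * \<tau>)"
  proof (cases "cos \<tau> \<le> 0")
    case True
    have "(S + - cos \<tau>) powr q - C * S powr q \<le> (1 + - cos \<tau>) powr q - C"
    proof (rule powr_add_diff_antimono)
      fix x :: real assume x: "1 < x"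
      have "(x + - cos \<tau>) powr (q - 1) \<le> x powr (q - 1)" using True x q by (intro powr_mono2') auto
      also have "\<dots> \<le> C * x powr (q - 1)" using C1 mult_right_mono[of 1 C "x powr (q - 1)"] by simp
      finally show "(x + - cos \<tau>) powr (q - 1) \<le> C * x powr (q - 1)" .
    qed (use q S in auto)
    with key[OF \<tau>] show ?thesis by simp
  next
    case False
    then have c: "0 < cos \<tau>" "cos \<tau> \<le> 1" by auto
    have \<tau>2: "\<tau> < pi / 2" using False \<tau> cos_monotone_0_pi_le[of "pi / 2" \<tau>] by (cases "\<tau> < pi / 2") auto
    \<comment> \<open>Division by \<open>S powr q\<close> turns the claim into \<open>(1 - k * cos
      \<tau>) powr q + b' * cos (q * \<tau>) * k powr q \<le> C\<close> for
      \<open>0 < k \<le> 1\<close>. Replacing the two concave powers by tangent lines, at 1 in both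
      cases, leaves an expression affine in \<open>k\<close>; so \<open>i\<close>, the case
      \<open>k = 0\<close>, and \<open>ii\<close>, the case \<open>k = 1\<close>, suffice.\<close>
    define k where "k = 1 / S"
    have k: "0 < k" "k \<le> 1" "k * S = 1" using S by (auto simp: k_def)
    have cq: "cos (q * (pi / 2)) \<ge> 1 - q" using cos_ge_chord[of q] q by simp
    have qt: "q * \<tau> \<le> \<tau>" "0 \<le> q * \<tau>" using q \<tau> mult_right_mono[of q 1 \<tau>] by auto
    have ct: "0 \<le> cos (q * \<tau>)" "cos (q * \<tau>) \<le> 1" using qt \<tau>2 by (auto intro!: cos_ge_zero)
    have e: "1 + b' * cos (q * (pi / 2)) \<le> C" using key[of "pi / 2"] by simp
    have i: "1 + b' * (1 - q) * cos (q * \<tau>) \<le> C"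
    proof -
      have "b' * (1 - q) * cos (q * \<tau>) \<le> b' * (1 - q) * 1" using ct b'0 q by (intro mult_left_mono) auto
      also have "\<dots> \<le> b' * cos (q * (pi / 2))" using cq b'0 by (simp add: mult_left_mono)
      finally show ?thesis using e by linarith
    qed
    \<comment> \<open>The left side increases with the angle up to \<open>pi / 2\<close>, by
      \<open>b' \<le> 1\<close> and \<open>sin (q * x) \<le> sin x\<close>, and its value there is
      bounded by \<open>e\<close>.\<close>
    have ii: "1 - q * cos \<tau> + b' * cos (q * \<tau>) \<le> C"
    proof -
      have "1 - q * cos \<tau> + b' * cos (q * \<tau>) \<le> 1 - q * cos (pi / 2) + b' * cos (q * (pi / 2))"
      proof (rule DERIV_nonneg_imp_nondecreasing[of \<tau> "pi / 2"])
        fix x assume x: "\<tau> \<le> x" "x \<le> pi / 2"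
        have d: "((\<lambda>x. 1 - q * cos x + b' * cos (q * x)) has_real_derivative q * (sin x - b' * sin (q * x))) (at x)"
          by (auto intro!: derivative_eq_intros simp: algebra_simps)
        have qx: "q * x \<le> x" "0 \<le> q * x" using q \<tau> x mult_right_mono[of q 1 x] by auto
        then have "sin (q * x) \<le> sin x" "0 \<le> sin (q * x)"
          using x \<tau> by (auto intro!: sin_monotone_2pi_le sin_ge_zero)
        then have "b' * sin (q * x) \<le> 1 * sin x" using b'0 b'1 by (intro mult_mono) auto
        then show "\<exists>y. ((\<lambda>x. 1 - q * cos x + b' * cos (q * x)) has_real_derivative y) (at x) \<and> 0 \<le> y"
          using d q by (intro exI conjI) auto
      qed (use \<tau>2 in auto)
      then show ?thesis using e by simp
    qed
    have Sq: "S powr q > 0" using S by simp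
    have A: "(S - cos \<tau>) powr q \<le> S powr q * (1 - q * k * cos \<tau>)"
    proof -
      have kc: "k * cos \<tau> \<le> 1 * 1" using k c by (intro mult_mono) auto
      have "(1 - k * cos \<tau>) powr q \<le> 1 - q * k * cos \<tau>"
      proof (cases "k * cos \<tau> = 1")
        case True then show ?thesis using q by (simp add: mult.assoc)
      next
        case False
        then show ?thesis using Youngs_inequality_0[of q "1 - q" "1 - k * cos \<tau>" 1] q kc by (simp add: algebra_simps)
      qed
      moreover have "S - cos \<tau> = S * (1 - k * cos \<tau>)" using k by (simp add: algebra_simps)
      then have "(S - cos \<tau>) powr q = S powr q * (1 - k * cos \<tau>) powr q" using S kc by (simp add: powr_mult)
      ultimately show ?thesis using Sq by simp
    qed
    have B: "1 \<le> S powr q * (q * k + (1 - q))"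
    proof -
      have "1 = S powr q * k powr q" using k S by (simp add: mult.commute flip: powr_mult)
      also have "k powr q \<le> q * k + (1 - q)"
        using Youngs_inequality_0[of q "1 - q" k 1] q k by simp
      finally show ?thesis using Sq by simp
    qed
    have "(S - cos \<tau>) powr q + b' * cos (q * \<tau>) * 1
        \<le> S powr q * (1 - q * k * cos \<tau>) + b' * cos (q * \<tau>) * (S powr q * (q * k + (1 - q)))"
      using A B b'0 ct by (intro add_mono mult_left_mono) auto
    also have "\<dots> = S powr q * ((1 - k) * (1 + b' * (1 - q) * cos (q * \<tau>)) + k * (1 - q * cos \<tau> + b' * cos (q * \<tau>)))"
      by (simp add: algebra_simps)
    also have "\<dots> \<le> S powr q * ((1 - k) * C + k * C)"
      using i ii k Sq by (intro mult_left_mono add_mono) auto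
    finally show ?thesis by (simp add: algebra_simps)
  qed
  then show ?thesis unfolding C_def[symmetric] b_def[symmetric] unfolding q_def[symmetric] by (simp add: b'_def algebra_simps)
qed

text \<open>For \<open>S = 1\<close> and an angle beyond \<open>2 * pi / p\<close>, the cut-off
  freezes the right side while the left side goes on decreasing. The passage to \<open>S > 1\<close>
  rests on \<open>2 powr (q - 1) \<le> C\<close>, which is the cosine bound at \<open>t = 0\<close>
  together with \<open>tan b \<le> 1\<close>.\<close>

lemma riesz_scalar_upper_ge_2:
  fixes p \<delta> S :: real
  assumes p: "2 \<le> p" and \<delta>: "0 \<le> \<delta>" "\<delta> \<le> pi" and S: "1 \<le> S"
  shows "(S + cos \<delta>) powr (p / 2)
     \<le> (1 + cos (pi / p)) powr (p / 2) * (S powr (p / 2) + tan (pi / (2 * p)) * cos (min (p / 2 * \<delta>) pi))"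
proof -
  define C where "C = (1 + cos (pi / p)) powr (p / 2)"
  define b where "b = pi / (2 * p)"
  define q where "q = p / 2"
  have p1: "1 < p" using p by simp
  note h = half_angle_facts[OF p1, folded b_def]
  have q: "1 \<le> q" using p by (simp add: q_def)
  have C: "C = 2 powr q * cos b powr p" by (simp_all add: C_def h q_def)
  have C2: "2 powr (q - 1) \<le> C"
  proof -
    have "cos 0 powr p \<le> cos b powr p * (1 + tan b * cos (p * 0))"
      unfolding b_def using p p1 by (intro cos_powr_bounds) auto
    also have "\<dots> \<le> cos b powr p * 2" using h p by (intro mult_left_mono) auto
    finally show ?thesis unfolding C by (simp add: powr_diff field_simps)
  qed
  have key: "(1 + cos \<delta>) powr q \<le> C * (1 + tan b * cos (min (q * \<delta>) pi))"
  proof (cases "\<delta> \<le> 2 * pi / p")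
    case True
    have m: "min (q * \<delta>) pi = p * (\<delta> / 2)" using True p by (simp add: q_def field_simps min_def)
    have "cos (\<delta> / 2) powr p \<le> cos b powr p * (1 + tan b * cos (p * (\<delta> / 2)))"
      unfolding b_def using p \<delta> True by (intro cos_powr_bounds) (auto simp: field_simps)
    then have "2 powr q * cos (\<delta> / 2) powr p \<le> C * (1 + tan b * cos (p * (\<delta> / 2)))"
      unfolding C by (simp add: mult.assoc)
    then show ?thesis
      using powr_half_angle(1)[of "\<delta> / 2" p] \<delta> unfolding m by (simp add: q_def cos_ge_zero)
  next
    case False
    have m: "min (q * \<delta>) pi = p * (pi / p)" using False p by (simp add: q_def field_simps min_def)
    have "cos (\<delta> / 2) powr p \<le> cos (pi / p) powr p"
      using False \<delta> p by (intro powr_mono2 cos_ge_zero cos_monotone_0_pi_le) (auto simp: field_simps)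
    also have "\<dots> \<le> cos b powr p * (1 + tan b * cos (p * (pi / p)))"
      unfolding b_def using p by (intro cos_powr_bounds) (auto simp: field_simps)
    finally have "2 powr q * cos (\<delta> / 2) powr p \<le> C * (1 + tan b * cos (p * (pi / p)))"
      unfolding C by (simp add: mult.assoc)
    then show ?thesis
      using powr_half_angle(1)[of "\<delta> / 2" p] \<delta> unfolding m by (simp add: q_def cos_ge_zero)
  qed
  have "(S + cos \<delta>) powr q - C * S powr q \<le> (1 + cos \<delta>) powr q - C"
  proof (rule powr_add_diff_antimono)
    fix x :: real assume x: "1 < x"
    have "0 < x + cos \<delta>" using x cos_ge_minus_one[of \<delta>] by linarith
    then have "(x + cos \<delta>) powr (q - 1) \<le> (2 * x) powr (q - 1)"
      using x q cos_le_one[of \<delta>] by (intro powr_mono2) linarith+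
    also have "\<dots> = 2 powr (q - 1) * x powr (q - 1)" using x by (simp add: powr_mult)
    also have "\<dots> \<le> C * x powr (q - 1)" using C2 by (intro mult_right_mono) auto
    finally show "(x + cos \<delta>) powr (q - 1) \<le> C * x powr (q - 1)" .
  qed (use q S in auto)
  with key show ?thesis unfolding C_def[symmetric] b_def[symmetric] unfolding q_def[symmetric] by (simp add: algebra_simps)
qed

text \<open>Comparing derivatives asks for
  \<open>m * x powr (q - 1) \<le> (x - cos \<delta>) powr (q - 1)\<close> for all
  \<open>x > 1\<close>, which is available as long as \<open>cos \<delta> \<le> 1 - \<eta>\<close>.
  For smaller angles convexity of the power \<open>q\<close> is used, with the same
  \<open>\<eta>\<close> as a weight.\<close>

lemma riesz_scalar_lower_gt_2:
  fixes p \<delta> S :: real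
  assumes p: "2 < p" and \<delta>: "0 \<le> \<delta>" "\<delta> \<le> pi" and S: "1 \<le> S"
  shows "(1 - cos (pi / p)) powr (p / 2) * (S powr (p / 2) - cot (pi / (2 * p)) * cos (min (p / 2 * \<delta>) pi))
     \<le> (S - cos \<delta>) powr (p / 2)"
proof -
  define m where "m = (1 - cos (pi / p)) powr (p / 2)"
  define b where "b = pi / (2 * p)"
  define q where "q = p / 2"
  have p1: "1 < p" using p by simp
  note h = half_angle_facts[OF p1, folded b_def]
  have q: "1 < q" using p by (simp add: q_def)
  have m: "m = 2 powr q * sin b powr p" by (simp_all add: m_def h q_def)
  have pp: "0 < pi / p" "pi / p < pi / 2" using p by (auto simp: field_simps)
  define d where "d = 1 - cos (pi / p)"
  have d: "0 < d" "d < 1"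
    using cos_monotone_0_pi[of 0 "pi / p"] cos_gt_zero[OF pp] pp by (auto simp: d_def)
  have md: "m = d powr q" by (simp add: m_def d_def q_def)
  \<comment> \<open>The solution of \<open>\<eta> powr (q - 1) = m\<close>: the comparison of
    derivatives then amounts to \<open>\<eta> * x \<le> x - cos \<delta>\<close>.\<close>
  define \<eta> where "\<eta> = d powr (q / (q - 1))"
  have \<eta>: "0 < \<eta>" "\<eta> < 1" "\<eta> powr (q - 1) = m" "\<eta> \<le> d"
  proof -
    show "0 < \<eta>" "\<eta> powr (q - 1) = m" using d q by (auto simp: \<eta>_def md powr_powr)
    have "\<eta> \<le> d powr 1" unfolding \<eta>_def using d q by (intro powr_mono') auto
    then show "\<eta> \<le> d" "\<eta> < 1" using d by auto
  qed
  have key: "m * (1 - cot b * cos (min (q * t) pi)) \<le> (1 - cos t) powr q" if t: "0 \<le> t" "t \<le> pi" for t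
  proof (cases "t \<le> 2 * pi / p")
    case True
    have m': "min (q * t) pi = p * (t / 2)" using True p by (simp add: q_def field_simps min_def)
    have "sin b powr p * (1 - cot b * cos (p * (t / 2))) \<le> sin (t / 2) powr p"
      unfolding b_def using p t True by (intro sin_powr_bounds) (auto simp: field_simps)
    then have "m * (1 - cot b * cos (p * (t / 2))) \<le> 2 powr q * sin (t / 2) powr p"
      unfolding m by (simp add: mult.assoc)
    then show ?thesis
      using powr_half_angle(2)[of "t / 2" p] t unfolding m' by (simp add: q_def sin_ge_zero)
  next
    case False
    have m': "min (q * t) pi = p * (pi / p)" using False p by (simp add: q_def field_simps min_def)
    have "sin b powr p * (1 - cot b * cos (p * (pi / p))) \<le> sin (pi / p) powr p"
      unfolding b_def using p by (intro sin_powr_bounds) (auto simp: field_simps)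
    also have "sin (pi / p) \<le> sin (t / 2)"
      using False t p pp by (intro sin_monotone_2pi_le) (linarith, simp add: field_simps, simp)
    then have "sin (pi / p) powr p \<le> sin (t / 2) powr p"
      using p sin_ge_zero[of "pi / p"] pp by (intro powr_mono2) linarith+
    finally have "m * (1 - cot b * cos (p * (pi / p))) \<le> 2 powr q * sin (t / 2) powr p"
      unfolding m by (simp add: mult.assoc)
    then show ?thesis
      using powr_half_angle(2)[of "t / 2" p] t unfolding m' by (simp add: q_def sin_ge_zero)
  qed
  have "m * (S powr q - cot b * cos (min (q * \<delta>) pi)) \<le> (S - cos \<delta>) powr q"
  proof (cases "cos \<delta> \<le> 1 - \<eta>")
    case True
    have "(1 + - cos \<delta>) powr q - m \<le> (S + - cos \<delta>) powr q - m * S powr q"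
    proof (rule powr_add_diff_mono)
      fix x :: real assume x: "1 < x"
      have "x * \<eta> \<le> x + - cos \<delta>"
      proof -
        have "1 * (1 - \<eta>) \<le> x * (1 - \<eta>)" using x \<eta> by (intro mult_right_mono) auto
        with True show ?thesis by (simp add: algebra_simps)
      qed
      then have "(x * \<eta>) powr (q - 1) \<le> (x + - cos \<delta>) powr (q - 1)"
        using x \<eta> q by (intro powr_mono2) auto
      then show "m * x powr (q - 1) \<le> (x + - cos \<delta>) powr (q - 1)"
        using x \<eta> by (simp add: powr_mult mult.commute)
    qed (use q S in auto)
    with key[OF \<delta>] show ?thesis by (simp add: algebra_simps)
  next
    case False
    \<comment> \<open>The convexity estimate \<open>conv\<close> below reduces the claim to
      \<open>K \<delta> \<ge> 0\<close>. At the threshold angle \<open>\<delta>1\<close> the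
      inequality for \<open>S = 1\<close> gives \<open>K \<delta>1 \<ge> 0\<close>, and
      \<open>K\<close> does not increase from \<open>\<delta>\<close> to
      \<open>\<delta>1\<close>.\<close>
    define K where "K = (\<lambda>t. cot b * cos (q * t) - cos t powr q * (1 - \<eta>) powr (1 - q))"
    define \<delta>1 where "\<delta>1 = arccos (1 - \<eta>)"
    have cos1: "cos \<delta>1 = 1 - \<eta>" using \<eta> by (simp add: \<delta>1_def)
    have cospos: "0 < cos \<delta>" "0 < cos \<delta>1" using False \<eta> by (auto simp: cos1)
    have d01: "0 \<le> \<delta>1" "\<delta>1 \<le> pi" using \<eta> by (auto simp: \<delta>1_def intro: arccos_lbound arccos_ubound)
    have d12: "\<delta> \<le> \<delta>1" using False \<delta> d01 cos_mono_le_eq[of \<delta> \<delta>1] cos1 by auto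
    have d1a: "\<delta>1 \<le> pi / p"
      using arccos_le_arccos[of "cos (pi / p)" "1 - \<eta>"] arccos_cos[of "pi / p"] pp \<eta> by (simp add: \<delta>1_def d_def)
    have qd: "q * t \<le> pi / 2" "0 \<le> q * t" "t \<le> q * t" if "0 \<le> t" "t \<le> \<delta>1" for t
    proof -
      have "q * t \<le> q * (pi / p)" using that d1a q by (intro mult_left_mono) auto
      then show "q * t \<le> pi / 2" using p by (simp add: q_def)
      show "0 \<le> q * t" "t \<le> q * t" using that q mult_right_mono[of 1 q t] by auto
    qed
    \<comment> \<open>Since \<open>q * b = pi / 4\<close>, this is
      \<open>q * tan b \<le> tan (q * b) = 1\<close>, which is \<open>tan_sub_sign\<close> for the
      exponent \<open>q + 1\<close>.\<close>
    have cotq: "q \<le> cot b"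
    proof -
      have qb: "q * b = pi / 4" using p by (simp add: q_def b_def)
      have "0 < b" "b \<le> pi / 2" using p by (auto simp: b_def field_simps)
      with qb have "q * sin b * cos (q * b) - sin (q * b) * cos b \<le> 0"
        using tan_sub_sign(2)[of "q + 1" b] q by simp
      then have "q * sin b * cos (pi / 4) - sin (pi / 4) * cos b \<le> 0" unfolding qb .
      then have "(q * sin b - cos b) * (sqrt 2 / 2) \<le> 0" by (simp add: cos_45 sin_45 algebra_simps)
      then have "q * sin b \<le> cos b" by (simp add: mult_le_0_iff)
      then show ?thesis using h by (simp add: cot_def field_simps)
    qed
    \<comment> \<open>It suffices that \<open>1 - \<eta>\<close> is at least
      \<open>y = (1 / q) powr (1 / (q - 1))\<close>, whose power \<open>1 - q\<close> is
      \<open>q\<close>. From \<open>q \<le> cot b\<close> follows \<open>d \<le> 1 / q\<close>,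
      hence \<open>\<eta> \<le> y / q\<close>; and \<open>y + y / q \<le> 1\<close> because
      \<open>(1 + 1 / q) powr (q - 1) \<le> q\<close>.\<close>
    have \<eta>q: "(1 - \<eta>) powr (1 - q) \<le> q"
    proof -
      have e1: "(1 + 1 / q) powr (q - 1) \<le> q"
      proof -
        have "(q - 1) * ln (1 + 1 / q) \<le> (q - 1) * (1 / q)" using q by (intro mult_left_mono ln_add_one_self_le_self) auto
        also have "\<dots> = - (1 / q - 1)" using q by (simp add: field_simps)
        also have "\<dots> \<le> - ln (1 / q)" using q ln_le_minus_one[of "1 / q"] by simp
        also have "\<dots> = ln q" using q by (simp add: ln_div)
        finally show ?thesis using q by (simp add: powr_def flip: ln_ge_iff)
      qed
      have db: "d \<le> 1 / q"
      proof -
        have "d = 2 * (sin b)\<^sup>2" using cos_double_sin[of b] by (simp add: d_def b_def)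
        also have "\<dots> = sin (2 * b) * tan b" using h by (simp add: sin_double tan_def power2_eq_square)
        also have "\<dots> \<le> 1 * tan b" using h by (intro mult_right_mono) auto
        also have "\<dots> \<le> 1 / q" using cotq q h by (simp add: cot_def tan_def field_simps)
        finally show ?thesis .
      qed
      have "\<eta> \<le> (1 / q) powr (q / (q - 1))" unfolding \<eta>_def using db d q by (intro powr_mono2) auto
      also have "\<dots> = (1 / q) powr (1 / (q - 1)) * (1 / q)"
      proof -
        have "q / (q - 1) = 1 / (q - 1) + 1" using q by (simp add: field_simps)
        then show ?thesis using q by (simp add: powr_add)
      qed
      finally have 2: "\<eta> \<le> (1 / q) powr (1 / (q - 1)) * (1 / q)" .
      have 3: "(1 / q) powr (1 / (q - 1)) * (1 + 1 / q) \<le> 1"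
      proof -
        have "(1 + 1 / q) = ((1 + 1 / q) powr (q - 1)) powr (1 / (q - 1))" using q by (simp add: powr_powr add_pos_pos)
        also have "\<dots> \<le> q powr (1 / (q - 1))" using e1 q by (intro powr_mono2) auto
        finally have "(1 / q) powr (1 / (q - 1)) * (1 + 1 / q) \<le> (1 / q) powr (1 / (q - 1)) * q powr (1 / (q - 1))"
          by (intro mult_left_mono) auto
        also have "\<dots> = 1" using q by (simp flip: powr_mult)
        finally show ?thesis .
      qed
      have "(1 / q) powr (1 / (q - 1)) \<le> 1 - \<eta>" using 2 3 by (simp add: algebra_simps)
      then have "(1 - \<eta>) powr (1 - q) \<le> ((1 / q) powr (1 / (q - 1))) powr (1 - q)"
        using q by (intro powr_mono2') auto
      also have "1 / (q - 1) * (1 - q) = -1" using q by (simp add: field_simps)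
      then have "((1 / q) powr (1 / (q - 1))) powr (1 - q) = q" using q by (simp only: powr_powr) (simp add: powr_minus)
      finally show ?thesis .
    qed
    have Kmono: "K \<delta>1 \<le> K \<delta>"
    proof (rule DERIV_nonpos_imp_nonincreasing[OF d12])
      fix x assume x: "\<delta> \<le> x" "x \<le> \<delta>1"
      have x0: "0 \<le> x" using x \<delta> by simp
      note qx = qd[OF x0 x(2)]
      have cx: "0 < cos x" using cos_monotone_0_pi_le[OF x0 x(2) d01(2)] cospos by linarith
      have sx: "0 \<le> sin x" "sin x \<le> sin (q * x)" using qx x0 by (auto intro!: sin_ge_zero sin_monotone_2pi_le)
      have "((\<lambda>t. cos t powr q) has_real_derivative q * cos x powr (q - 1) * (- sin x)) (at x)"
        using DERIV_fun_powr[OF DERIV_cos, of x q] cx by simp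
      then have "(K has_real_derivative cot b * (- sin (q * x) * q) - q * cos x powr (q - 1) * (- sin x) * (1 - \<eta>) powr (1 - q)) (at x)"
        unfolding K_def using cx by (auto intro!: derivative_eq_intros)
      moreover have "cos x powr (q - 1) * sin x * (1 - \<eta>) powr (1 - q) \<le> 1 * sin (q * x) * cot b"
        using sx \<eta>q cotq q cx h by (intro mult_mono powr_le1) auto
      then have "cot b * (- sin (q * x) * q) - q * cos x powr (q - 1) * (- sin x) * (1 - \<eta>) powr (1 - q) \<le> 0"
        using mult_left_mono[of _ _ q] q by (simp add: algebra_simps)
      ultimately show "\<exists>y. (K has_real_derivative y) (at x) \<and> y \<le> 0" by blast
    qed
    have "K \<delta>1 \<ge> 0"
    proof -
      have "min (q * \<delta>1) pi = q * \<delta>1" using qd[of \<delta>1] d01 by (auto simp: min_def)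
      then have "m * (1 - cot b * cos (q * \<delta>1)) \<le> \<eta> powr q" using key[OF d01] by (simp add: cos1)
      also have "\<eta> powr q = m * \<eta>" using \<eta> by (simp add: powr_diff field_simps)
      finally have "1 - cot b * cos (q * \<delta>1) \<le> \<eta>" using md d by simp
      then have "1 - \<eta> \<le> cot b * cos (q * \<delta>1)" by simp
      moreover have "cos \<delta>1 powr q * (1 - \<eta>) powr (1 - q) = 1 - \<eta>" using \<eta> by (simp add: cos1 flip: powr_add)
      ultimately show ?thesis by (simp add: K_def)
    qed
    with Kmono have K0: "0 \<le> K \<delta>" by simp
    \<comment> \<open>\<open>S\<close> is the mean, with weights \<open>1 - \<eta>\<close> and
      \<open>\<eta>\<close>, of \<open>cos \<delta> / (1 - \<eta>)\<close> and
      \<open>(S - cos \<delta>) / \<eta>\<close>; as \<open>\<eta> powr (1 - q) = 1 / m\<close>,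
      convexity gives the claim after multiplication by \<open>m\<close>. The case
      \<open>S = cos \<delta>\<close> is separate because there the second point is 0.\<close>
    have conv: "m * S powr q - m * (cos \<delta> powr q * (1 - \<eta>) powr (1 - q)) \<le> (S - cos \<delta>) powr q"
    proof (cases "S = cos \<delta>")
      case True
      then have "S = 1" using S cos_le_one[of \<delta>] by linarith
      have "1 \<le> (1 - \<eta>) powr (1 - q)" using \<eta> q powr_mono2'[of "1 - q" "1 - \<eta>" 1] by simp
      then show ?thesis using True \<open>S = 1\<close> md by (simp add: mult_le_cancel_left1)
    next
      case False
      then have Sc: "0 < S - cos \<delta>" using S cos_le_one[of \<delta>] by linarith
      have "((1 - \<eta>) *\<^sub>R (cos \<delta> / (1 - \<eta>)) + \<eta> *\<^sub>R ((S - cos \<delta>) / \<eta>)) powr q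
         \<le> (1 - \<eta>) * (cos \<delta> / (1 - \<eta>)) powr q + \<eta> * ((S - cos \<delta>) / \<eta>) powr q"
        using convex_onD[OF powr_convex[of q], of \<eta> "cos \<delta> / (1 - \<eta>)" "(S - cos \<delta>) / \<eta>"] \<eta> q cospos Sc by simp
      also have "(1 - \<eta>) *\<^sub>R (cos \<delta> / (1 - \<eta>)) + \<eta> *\<^sub>R ((S - cos \<delta>) / \<eta>) = S" using \<eta> by simp
      also have "(1 - \<eta>) * (cos \<delta> / (1 - \<eta>)) powr q = cos \<delta> powr q * (1 - \<eta>) powr (1 - q)"
        using \<eta> cospos by (simp add: powr_divide powr_diff)
      also have "\<eta> * ((S - cos \<delta>) / \<eta>) powr q = (S - cos \<delta>) powr q / m"
        unfolding \<eta>(3)[symmetric] using \<eta>(1,2) Sc by (simp add: powr_divide powr_diff)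
      finally have "S powr q \<le> cos \<delta> powr q * (1 - \<eta>) powr (1 - q) + (S - cos \<delta>) powr q / m" .
      then show ?thesis using md d by (simp add: field_simps)
    qed
    have "min (q * \<delta>) pi = q * \<delta>" using qd[OF \<delta>(1) d12] by (auto simp: min_def)
    moreover have "0 \<le> m * K \<delta>" using K0 md by simp
    ultimately show ?thesis using conv by (simp add: K_def algebra_simps)
  qed
  then show ?thesis unfolding m_def[symmetric] b_def[symmetric] unfolding q_def[symmetric] .
qed

text \<open>Essentially \<open>Re (z^(p/2))\<close> for \<open>p \<le> 2\<close> and \<open>- Re ((- z)^(p/2))\<close> for \<open>p > 2\<close>; in the second
  case the argument is cut off at \<open>pi\<close>, which keeps the function subharmonic and makes the
  pointwise inequalities hold in the whole plane.\<close>

definition riesz_fn :: "real \<Rightarrow> complex \<Rightarrow> real" where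
  "riesz_fn p z =
     (if p \<le> 2 then cmod z powr (p / 2) * cos (p / 2 * arccos (Re z / cmod z))
      else - (cmod z powr (p / 2) * cos (min (p / 2 * arccos (- Re z / cmod z)) pi)))"

section \<open>The inequalities for complex numbers\<close>

lemma riesz_fn_0 [simp]: "riesz_fn p 0 = 0"
  by (simp add: riesz_fn_def)

lemma Re_div_cmod_bounds: "- 1 \<le> Re z / cmod z" "Re z / cmod z \<le> 1"
  using abs_Re_le_cmod[of z] by (cases "z = 0"; auto simp: field_simps)+

text \<open>For \<open>p \<le> 2\<close> the angle of \<open>z\<close> is at most a right angle and
  multiplication by \<open>p / 2\<close> keeps it so. For \<open>p > 2\<close> the angle of
  \<open>- z\<close> is at least a right angle, multiplication enlarges it, and the cut-off prevents
  the cosine from becoming positive again.\<close>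

lemma riesz_fn_nonneg:
  assumes p: "1 < p" and z: "0 \<le> Re z"
  shows "0 \<le> riesz_fn p z"
proof (cases "p \<le> 2")
  case True
  have "arccos (Re z / cmod z) \<le> pi / 2" using z Re_div_cmod_bounds[of z] by (intro arccos_le_pi2) auto
  moreover have "0 \<le> arccos (Re z / cmod z)" using Re_div_cmod_bounds[of z] by (intro arccos_lbound) auto
  ultimately have "0 \<le> p / 2 * arccos (Re z / cmod z)" "p / 2 * arccos (Re z / cmod z) \<le> pi / 2"
    using True p mult_mono[of "p / 2" 1 "arccos (Re z / cmod z)" "pi / 2"] by auto
  then have "0 \<le> cos (p / 2 * arccos (Re z / cmod z))" by (intro cos_ge_zero) auto
  then show ?thesis using True by (simp add: riesz_fn_def)
next
  case False
  let ?\<delta> = "arccos (- Re z / cmod z)"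
  have "pi / 2 \<le> ?\<delta>" using arccos_le_arccos[of "- Re z / cmod z" 0] z Re_div_cmod_bounds[of "- z"] by (auto simp: arccos_0 divide_nonpos_nonneg)
  moreover have "1 * ?\<delta> \<le> p / 2 * ?\<delta>" using False Re_div_cmod_bounds[of "- z"] by (intro mult_right_mono arccos_lbound) auto
  ultimately have "pi / 2 \<le> p / 2 * ?\<delta>" by linarith
  then have "cos (min (p / 2 * ?\<delta>) pi) \<le> cos (pi / 2)"
    by (intro cos_monotone_0_pi_le) simp_all
  then show ?thesis using False by (simp add: riesz_fn_def mult_nonneg_nonpos)
qed

lemma powr_scaled:
  fixes S k :: real
  assumes "0 < k" "k \<le> S" "- 1 \<le> c"
  shows "S powr q = k powr q * (S / k) powr q" "(S + k * c) powr q = k powr q * (S / k + c) powr q"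
proof -
  show "S powr q = k powr q * (S / k) powr q" using assms by (simp flip: powr_mult)
  have "0 \<le> S / k + c" using assms mult_left_mono[of "- 1" c k] by (simp add: field_simps)
  then show "(S + k * c) powr q = k powr q * (S / k + c) powr q" using assms by (simp add: ring_distribs flip: powr_mult)
qed

text \<open>Both sides are homogeneous of degree \<open>p / 2\<close> in \<open>z\<close> and
  \<open>S\<close> together, so division by \<open>cmod z\<close> leads to the scalar inequalities
  for the ratio \<open>S / cmod z\<close> and the angle of \<open>z\<close>, or of
  \<open>- z\<close> when \<open>p > 2\<close>. Only the sign of \<open>\<kappa>\<close> is passed
  on: it multiplies a term that is dropped after integration.\<close>

lemma riesz_fn_lower:
  assumes p: "1 < p"
  obtains \<kappa> where "0 \<le> \<kappa>" "\<And>z S. cmod z \<le> S \<Longrightarrow> 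
    (1 - \<bar>cos (pi / p)\<bar>) powr (p / 2) * (S powr (p / 2) + \<kappa> * riesz_fn p z) \<le> (S + Re z) powr (p / 2)"
proof
  define \<kappa> where "\<kappa> = (if p \<le> 2 then tan (pi / (2 * p)) else cot (pi / (2 * p)))"
  note h = half_angle_facts[OF p]
  show "0 \<le> \<kappa>" using h by (auto simp: \<kappa>_def)
  fix z S assume z: "cmod z \<le> S"
  show "(1 - \<bar>cos (pi / p)\<bar>) powr (p / 2) * (S powr (p / 2) + \<kappa> * riesz_fn p z) \<le> (S + Re z) powr (p / 2)"
  proof (cases "z = 0")
    case True
    have "(1 - \<bar>cos (pi / p)\<bar>) powr (p / 2) \<le> 1" using p by (intro powr_le1) auto
    then show ?thesis using True mult_right_mono[of "(1 - \<bar>cos (pi / p)\<bar>) powr (p / 2)" 1 "S powr (p / 2)"] by simp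
  next
    case False
    define k where "k = cmod z"
    have k: "0 < k" "k \<le> S" using False z by (auto simp: k_def)
    have Sk: "1 \<le> S / k" using k by simp
    note b = Re_div_cmod_bounds[of z] Re_div_cmod_bounds[of "- z"]
    show ?thesis
    proof (cases "p \<le> 2")
      case True
      define \<tau> where "\<tau> = arccos (Re z / k)"
      have \<tau>: "0 \<le> \<tau>" "\<tau> \<le> pi" "cos \<tau> = Re z / k" using b by (auto simp: \<tau>_def k_def arccos_lbound arccos_ubound)
      have Rz: "S + Re z = S + k * cos \<tau>" using \<tau> k by simp
      have "(1 - \<bar>cos (pi / p)\<bar>) powr (p / 2) * (S powr (p / 2) + \<kappa> * riesz_fn p z)
        = k powr (p / 2) * ((1 + cos (pi / p)) powr (p / 2) * ((S / k) powr (p / 2) + tan (pi / (2 * p)) * cos (p / 2 * \<tau>)))"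
        using h(7) True powr_scaled(1)[OF k, of 0 "p / 2"] by (simp add: riesz_fn_def \<kappa>_def k_def[symmetric] \<tau>_def algebra_simps)
      also have "\<dots> \<le> k powr (p / 2) * (S / k + cos \<tau>) powr (p / 2)"
        using riesz_scalar_lower_le_2[OF p True \<tau>(1,2) Sk] by (intro mult_left_mono) auto
      also have "\<dots> = (S + Re z) powr (p / 2)" unfolding Rz using powr_scaled(2)[OF k, of "cos \<tau>" "p / 2"] by simp
      finally show ?thesis .
    next
      case False
      define \<delta> where "\<delta> = arccos (- Re z / k)"
      have \<delta>: "0 \<le> \<delta>" "\<delta> \<le> pi" "cos \<delta> = - Re z / k" using b by (auto simp: \<delta>_def k_def arccos_lbound arccos_ubound)
      have Rz: "S + Re z = S + k * (- cos \<delta>)" using \<delta> k by simp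
      have "(1 - \<bar>cos (pi / p)\<bar>) powr (p / 2) * (S powr (p / 2) + \<kappa> * riesz_fn p z)
        = k powr (p / 2) * ((1 - cos (pi / p)) powr (p / 2) * ((S / k) powr (p / 2) - cot (pi / (2 * p)) * cos (min (p / 2 * \<delta>) pi)))"
        using h(8) False powr_scaled(1)[OF k, of 0 "p / 2"] by (simp add: riesz_fn_def \<kappa>_def k_def[symmetric] \<delta>_def algebra_simps)
      also have "\<dots> \<le> k powr (p / 2) * (S / k - cos \<delta>) powr (p / 2)"
        using riesz_scalar_lower_gt_2[OF _ \<delta>(1,2) Sk, of p] False by (intro mult_left_mono) auto
      also have "\<dots> = (S + Re z) powr (p / 2)" unfolding Rz using powr_scaled(2)[OF k, of "- cos \<delta>" "p / 2"] by simp
      finally show ?thesis .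
    qed
  qed
qed

text \<open>Compared with the lower bound, tangent and cotangent change places in
  \<open>\<kappa>\<close>, just as the sine and cosine inequalities change direction at
  \<open>p = 2\<close>.\<close>

lemma riesz_fn_upper:
  assumes p: "1 < p"
  obtains \<kappa> where "0 \<le> \<kappa>" "\<And>z S. cmod z \<le> S \<Longrightarrow> 
    (S - Re z) powr (p / 2) \<le> (1 + \<bar>cos (pi / p)\<bar>) powr (p / 2) * (S powr (p / 2) - \<kappa> * riesz_fn p z)"
proof
  define \<kappa> where "\<kappa> = (if p \<le> 2 then cot (pi / (2 * p)) else tan (pi / (2 * p)))"
  note h = half_angle_facts[OF p]
  show "0 \<le> \<kappa>" using h by (auto simp: \<kappa>_def)
  fix z S assume z: "cmod z \<le> S"
  show "(S - Re z) powr (p / 2) \<le> (1 + \<bar>cos (pi / p)\<bar>) powr (p / 2) * (S powr (p / 2) - \<kappa> * riesz_fn p z)"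
  proof (cases "z = 0")
    case True
    have "1 \<le> (1 + \<bar>cos (pi / p)\<bar>) powr (p / 2)" using p by (intro ge_one_powr_ge_zero) auto
    then show ?thesis using True mult_right_mono[of 1 "(1 + \<bar>cos (pi / p)\<bar>) powr (p / 2)" "S powr (p / 2)"] by simp
  next
    case False
    define k where "k = cmod z"
    have k: "0 < k" "k \<le> S" using False z by (auto simp: k_def)
    have Sk: "1 \<le> S / k" using k by simp
    note b = Re_div_cmod_bounds[of z] Re_div_cmod_bounds[of "- z"]
    show ?thesis
    proof (cases "p \<le> 2")
      case True
      define \<tau> where "\<tau> = arccos (Re z / k)"
      have \<tau>: "0 \<le> \<tau>" "\<tau> \<le> pi" "cos \<tau> = Re z / k" using b by (auto simp: \<tau>_def k_def arccos_lbound arccos_ubound)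
      have Rz: "S - Re z = S + k * (- cos \<tau>)" using \<tau> k by simp
      have "(S - Re z) powr (p / 2) = k powr (p / 2) * (S / k - cos \<tau>) powr (p / 2)"
        unfolding Rz using powr_scaled(2)[OF k, of "- cos \<tau>" "p / 2"] by simp
      also have "\<dots> \<le> k powr (p / 2) * ((1 - cos (pi / p)) powr (p / 2) * ((S / k) powr (p / 2) - cot (pi / (2 * p)) * cos (p / 2 * \<tau>)))"
        using riesz_scalar_upper_le_2[OF p True \<tau>(1,2) Sk] by (intro mult_left_mono) auto
      also have "\<dots> = (1 + \<bar>cos (pi / p)\<bar>) powr (p / 2) * (S powr (p / 2) - \<kappa> * riesz_fn p z)"
        using h(7) True powr_scaled(1)[OF k, of 0 "p / 2"] by (simp add: riesz_fn_def \<kappa>_def k_def[symmetric] \<tau>_def algebra_simps)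
      finally show ?thesis .
    next
      case False
      define \<delta> where "\<delta> = arccos (- Re z / k)"
      have \<delta>: "0 \<le> \<delta>" "\<delta> \<le> pi" "cos \<delta> = - Re z / k" using b by (auto simp: \<delta>_def k_def arccos_lbound arccos_ubound)
      have Rz: "S - Re z = S + k * cos \<delta>" using \<delta> k by simp
      have "(S - Re z) powr (p / 2) = k powr (p / 2) * (S / k + cos \<delta>) powr (p / 2)"
        unfolding Rz using powr_scaled(2)[OF k, of "cos \<delta>" "p / 2"] by simp
      also have "\<dots> \<le> k powr (p / 2) * ((1 + cos (pi / p)) powr (p / 2) * ((S / k) powr (p / 2) + tan (pi / (2 * p)) * cos (min (p / 2 * \<delta>) pi)))"
        using riesz_scalar_upper_ge_2[OF _ \<delta>(1,2) Sk, of p] False by (intro mult_left_mono) auto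
      also have "\<dots> = (1 + \<bar>cos (pi / p)\<bar>) powr (p / 2) * (S powr (p / 2) - \<kappa> * riesz_fn p z)"
        using h(8) False powr_scaled(1)[OF k, of 0 "p / 2"] by (simp add: riesz_fn_def \<kappa>_def k_def[symmetric] \<delta>_def algebra_simps)
      finally show ?thesis .
    qed
  qed
qed

lemma cmod_add_cnj_powr:
  "(cmod (z + cnj w)) powr p = ((cmod z)\<^sup>2 + (cmod w)\<^sup>2 + Re (2 * z * w)) powr (p / 2)"
proof -
  have "(cmod (z + cnj w))\<^sup>2 = (cmod z)\<^sup>2 + (cmod w)\<^sup>2 + Re (2 * z * w)"
    by (simp only: cmod_power2) (simp add: power2_eq_square algebra_simps)
  moreover have "(cmod (z + cnj w)) powr p = ((cmod (z + cnj w))\<^sup>2) powr (p / 2)"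
    by (cases "z + cnj w = 0") (auto simp: powr_powr simp flip: powr_numeral)
  ultimately show ?thesis by simp
qed

lemma cmod_two_mult_le: "cmod (2 * z * w) \<le> (cmod z)\<^sup>2 + (cmod w)\<^sup>2"
  using sum_squares_bound[of "cmod z" "cmod w"] by (simp add: norm_mult)

lemma riesz_pointwise_lower:
  assumes p: "1 < p"
  obtains \<kappa> where "0 \<le> \<kappa>" "\<And>z w. (1 - \<bar>cos (pi / p)\<bar>) powr (p / 2) *
      (((cmod z)\<^sup>2 + (cmod w)\<^sup>2) powr (p / 2) + \<kappa> * riesz_fn p (2 * z * w)) \<le> cmod (z + cnj w) powr p"
  using riesz_fn_lower[OF p] cmod_two_mult_le unfolding cmod_add_cnj_powr by metis

text \<open>The subharmonic term is taken at \<open>- (2 * z * w)\<close> and subtracted; this is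
  why the upper norm estimate asks for the opposite sign of \<open>Re (g 0 * h 0)\<close>.\<close>

lemma riesz_pointwise_upper:
  assumes p: "1 < p"
  obtains \<kappa> where "0 \<le> \<kappa>" "\<And>z w. cmod (z + cnj w) powr p \<le> (1 + \<bar>cos (pi / p)\<bar>) powr (p / 2) *
      (((cmod z)\<^sup>2 + (cmod w)\<^sup>2) powr (p / 2) - \<kappa> * riesz_fn p (- (2 * z * w)))"
proof -
  obtain \<kappa> where \<kappa>: "0 \<le> \<kappa>" "\<And>z S. cmod z \<le> S \<Longrightarrow> 
    (S - Re z) powr (p / 2) \<le> (1 + \<bar>cos (pi / p)\<bar>) powr (p / 2) * (S powr (p / 2) - \<kappa> * riesz_fn p z)"
    using riesz_fn_upper[OF p] by metis
  show ?thesis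
  proof (rule that[OF \<kappa>(1)])
    fix z w
    have "cmod (- (2 * z * w)) \<le> (cmod z)\<^sup>2 + (cmod w)\<^sup>2"
      using cmod_two_mult_le[of z w] by (simp only: norm_minus_cancel)
    from \<kappa>(2)[OF this] show "cmod (z + cnj w) powr p \<le> (1 + \<bar>cos (pi / p)\<bar>) powr (p / 2) *
      (((cmod z)\<^sup>2 + (cmod w)\<^sup>2) powr (p / 2) - \<kappa> * riesz_fn p (- (2 * z * w)))"
      unfolding cmod_add_cnj_powr by (simp only: uminus_complex.sel diff_minus_eq_add)
  qed
qed

section \<open>Subharmonic functions on the disc\<close>

text \<open>A local form of subharmonicity: a harmonic function touching \<open>u\<close> from below
  at \<open>z\<close> forces the sub-mean value inequality on small circles about \<open>z\<close>.
  Such supports can be written down explicitly, and they pull back along holomorphic maps.\<close>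

definition supported :: "(complex \<Rightarrow> real) \<Rightarrow> complex \<Rightarrow> bool" where
  "supported u z \<longleftrightarrow> (\<exists>e>0. \<exists>V. V holomorphic_on ball z e \<and> Re (V z) = u z \<and> (\<forall>w\<in>ball z e. Re (V w) \<le> u w))"

lemma supported_compose:
  assumes \<Phi>: "supported \<Phi> (F z)" and F: "F holomorphic_on S" and S: "open S" "z \<in> S"
  shows "supported (\<lambda>w. \<Phi> (F w)) z"
proof -
  obtain e V where e: "e > 0" and V: "V holomorphic_on ball (F z) e" "Re (V (F z)) = \<Phi> (F z)"
      "\<And>w. w \<in> ball (F z) e \<Longrightarrow> Re (V w) \<le> \<Phi> w"
    using \<Phi> unfolding supported_def by auto
  have "open (S \<inter> F -` ball (F z) e)"
    using F S by (intro continuous_open_preimage holomorphic_on_imp_continuous_on) auto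
  moreover have "z \<in> S \<inter> F -` ball (F z) e" using e S by auto
  ultimately obtain d where d: "d > 0" "ball z d \<subseteq> S \<inter> F -` ball (F z) e"
    by (meson open_contains_ball)
  have "V \<circ> F holomorphic_on ball z d"
    by (rule holomorphic_on_compose_gen[OF holomorphic_on_subset[OF F] V(1)]) (use d in auto)
  then show ?thesis
    unfolding supported_def using d V by (intro exI[of _ d] conjI exI[of _ "V \<circ> F"]) (auto simp: o_def)
qed

text \<open>A positive maximum of \<open>u - Re Q\<close> is kept off the zeros of \<open>G\<close>
  by the penalty \<open>\<epsilon> * ln (|G| / M)\<close>, which is nonpositive and tends to minus
  infinity there. At a maximum of the penalized function the support allows the maximum modulus
  principle to be applied to \<open>exp H\<close>, so that the function is constant nearby; for a
  maximum point farthest from 0 this is absurd.\<close>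

lemma disc_max_principle:
  fixes u :: "complex \<Rightarrow> real" and G Q :: "complex \<Rightarrow> complex"
  assumes s: "0 < s" and u: "continuous_on (cball 0 s) u"
    and G: "continuous_on (cball 0 s) G" "G holomorphic_on ball 0 s" "\<exists>z\<in>ball 0 s. G z \<noteq> 0"
    and sup: "\<And>z. z \<in> ball 0 s \<Longrightarrow> G z \<noteq> 0 \<Longrightarrow> supported u z"
    and Q: "continuous_on (cball 0 s) Q" "Q holomorphic_on ball 0 s"
    and le: "\<And>z. z \<in> sphere 0 s \<Longrightarrow> u z \<le> Re (Q z)"
    and z: "z \<in> cball 0 s"
  shows "u z \<le> Re (Q z)"
proof (rule ccontr)
  assume neg: "\<not> ?thesis"
  define w0 where "w0 = (\<lambda>z. u z - Re (Q z))"
  have w0: "continuous_on (cball 0 s) w0" unfolding w0_def using u Q by (intro continuous_intros)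
  have zin: "z \<in> ball 0 s" using z neg le[of z] by force
  define P where "P = {x \<in> ball 0 s. 0 < w0 x}"
  have "open P"
  proof -
    have "open (ball 0 s \<inter> w0 -` {0<..})"
      using w0 by (intro continuous_open_preimage continuous_on_subset[OF w0]) auto
    then show ?thesis by (simp add: P_def vimage_def Int_def)
  qed
  have zP: "z \<in> P" using zin neg by (auto simp: P_def w0_def)
  obtain z1 where z1: "z1 \<in> P" "G z1 \<noteq> 0"
  proof (rule ccontr)
    assume "\<not> thesis"
    then have "\<And>x. x \<in> P \<Longrightarrow> G x = 0" using that by blast
    have "G x = 0" if "x \<in> ball 0 s" for x
    proof (rule analytic_continuation_open[of P "ball 0 s" G "\<lambda>_. 0"])
      show "P \<noteq> {}" "P \<subseteq> ball 0 s" using zP by (auto simp: P_def)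
    qed (use \<open>open P\<close> G(2) that \<open>\<And>x. x \<in> P \<Longrightarrow> G x = 0\<close> in auto)
    with G(3) show False by blast
  qed
  define \<kappa> where "\<kappa> = w0 z1"
  have \<kappa>: "\<kappa> > 0" using z1 by (auto simp: \<kappa>_def P_def)
  obtain M where M: "M > 0" "\<And>x. x \<in> cball 0 s \<Longrightarrow> cmod (G x) \<le> M"
    using compact_imp_bounded[OF compact_continuous_image[OF G(1) compact_cball]]
    by (auto simp: bounded_pos)
  obtain B where B0: "B > 0" "\<forall>y\<in>w0 ` cball 0 s. norm y \<le> B"
    using compact_imp_bounded[OF compact_continuous_image[OF w0 compact_cball]]
    unfolding bounded_pos by blast
  have B: "B > 0" "\<And>x. x \<in> cball 0 s \<Longrightarrow> w0 x \<le> B"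
    using B0 by (auto simp: abs_le_iff)
  define c1 where "c1 = ln (cmod (G z1) / M)"
  have c1: "c1 \<le> 0" unfolding c1_def using z1 M(1) M(2)[of z1] by (auto simp: P_def ln_le_zero_iff)
  \<comment> \<open>Small enough for the penalty at \<open>z1\<close> to cost at most half of the
    positive value \<open>\<kappa>\<close>; the summand 1 keeps the denominator positive when
    \<open>c1 = 0\<close>.\<close>
  define \<epsilon> where "\<epsilon> = \<kappa> / (2 * (1 - c1))"
  have \<epsilon>: "\<epsilon> > 0" using \<kappa> c1 by (simp add: \<epsilon>_def)
  define w where "w = (\<lambda>x. w0 x + \<epsilon> * ln (cmod (G x) / M))"
  have wz1: "w z1 \<ge> \<kappa> / 2"
  proof -
    have "\<epsilon> * (1 - c1) = \<kappa> / 2" using c1 unfolding \<epsilon>_def by (simp add: divide_simps)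
    then have "\<epsilon> * c1 \<ge> - \<kappa> / 2" using \<epsilon> by (simp add: algebra_simps)
    then show ?thesis by (simp add: w_def \<kappa>_def c1_def)
  qed
  \<comment> \<open>Where \<open>|G| \<le> \<eta>\<close> the penalty is at most
    \<open>- (B + 1)\<close> and outweighs \<open>w0 \<le> B\<close>. The search for the maximum is
    thus confined to the compact set \<open>K\<close>, on which \<open>ln |G|\<close> is
    continuous.\<close>
  define \<eta> where "\<eta> = M * exp (- (B + 1) / \<epsilon>)"
  have \<eta>: "\<eta> > 0" using M by (simp add: \<eta>_def)
  have small: "w x \<le> - 1" if "x \<in> cball 0 s" "cmod (G x) \<le> \<eta>" "G x \<noteq> 0" for x
  proof -
    have "ln (cmod (G x) / M) \<le> ln (exp (- (B + 1) / \<epsilon>))"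
      using that M by (subst ln_le_cancel_iff) (auto simp: \<eta>_def field_simps)
    then have "\<epsilon> * ln (cmod (G x) / M) \<le> \<epsilon> * (- (B + 1) / \<epsilon>)" using \<epsilon> by (intro mult_left_mono) auto
    then show ?thesis using B(2)[OF that(1)] \<epsilon> by (simp add: w_def)
  qed
  define K where "K = {x \<in> cball 0 s. \<eta> \<le> cmod (G x)}"
  have K: "compact K" "K \<subseteq> cball 0 s" "\<And>x. x \<in> K \<Longrightarrow> G x \<noteq> 0"
  proof -
    have "closed (cball 0 s \<inter> (\<lambda>x. cmod (G x)) -` {\<eta>..})"
      using G by (intro continuous_closed_preimage continuous_intros) auto
    then have "compact (cball 0 s \<inter> (cball 0 s \<inter> (\<lambda>x. cmod (G x)) -` {\<eta>..}))"
      by (intro compact_Int_closed) auto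
    also have "cball 0 s \<inter> (cball 0 s \<inter> (\<lambda>x. cmod (G x)) -` {\<eta>..}) = K" by (auto simp: K_def)
    finally show "compact K" .
  qed (use \<eta> in \<open>auto simp: K_def\<close>)
  have z1K: "z1 \<in> K"
    using small[of z1] wz1 \<kappa> z1 by (force simp: K_def P_def)
  have wK: "continuous_on K w"
    unfolding w_def using K M by (intro continuous_intros continuous_on_subset[OF w0] continuous_on_subset[OF G(1)]) auto
  obtain zm where zm: "zm \<in> K" "\<And>x. x \<in> K \<Longrightarrow> w x \<le> w zm"
    using continuous_attains_sup[OF K(1) _ wK] z1K by blast
  \<comment> \<open>Among the maximum points one of largest modulus is chosen, so that a maximum on
    a whole neighbourhood of it yields a contradiction.\<close>
  define A where "A = {x \<in> K. w x = w zm}"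
  have "compact A"
  proof -
    have "closed (K \<inter> w -` {w zm})" using wK K by (intro continuous_closed_preimage compact_imp_closed) auto
    then have "compact (K \<inter> (K \<inter> w -` {w zm}))" using K by (intro compact_Int_closed) auto
    also have "K \<inter> (K \<inter> w -` {w zm}) = A" by (auto simp: A_def)
    finally show ?thesis .
  qed
  moreover have "A \<noteq> {}" using zm by (auto simp: A_def)
  ultimately obtain z0 where z0: "z0 \<in> A" "\<And>x. x \<in> A \<Longrightarrow> norm x \<le> norm z0"
    using continuous_attains_sup[of A norm] by (auto intro: continuous_intros)
  have wz0: "w z0 = w zm" "z0 \<in> K" using z0 by (auto simp: A_def)
  have pos: "w z0 > 0" using zm(2)[OF z1K] wz0 wz1 \<kappa> by simp
  have Gz0: "\<eta> < cmod (G z0)" "G z0 \<noteq> 0" using small[of z0] pos wz0(2) \<eta> by (force simp: K_def)+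
  have "z0 \<notin> sphere 0 s"
  proof
    assume "z0 \<in> sphere 0 s"
    then have "w0 z0 \<le> 0" using le by (simp add: w0_def)
    moreover have "ln (cmod (G z0) / M) \<le> 0" using Gz0 M(1) M(2)[of z0] wz0(2) by (auto simp: K_def ln_le_zero_iff)
    then have "\<epsilon> * ln (cmod (G z0) / M) \<le> 0" using \<epsilon> by (simp add: mult_nonneg_nonpos)
    ultimately show False using pos by (simp add: w_def)
  qed
  then have z0b: "z0 \<in> ball 0 s" using wz0(2) K(2) by force
  obtain e V where e: "e > 0" and V: "V holomorphic_on ball z0 e" "Re (V z0) = u z0"
      "\<And>x. x \<in> ball z0 e \<Longrightarrow> Re (V x) \<le> u x"
    using sup[OF z0b Gz0(2)] unfolding supported_def by auto
  have contG: "continuous_on (ball 0 s) G" by (rule continuous_on_subset[OF G(1)]) auto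
  have "open (ball 0 s \<inter> G -` ({x. \<eta> < cmod x} \<inter> ball (G z0) (cmod (G z0))))"
    by (intro continuous_open_preimage[OF contG] open_Int open_Collect_less continuous_intros) auto
  moreover have "z0 \<in> ball 0 s \<inter> G -` ({x. \<eta> < cmod x} \<inter> ball (G z0) (cmod (G z0)))"
    using z0b Gz0 by auto
  ultimately obtain d where d: "d > 0" "ball z0 d \<subseteq> ball 0 s \<inter> G -` ({x. \<eta> < cmod x} \<inter> ball (G z0) (cmod (G z0)))"
    by (meson open_contains_ball)
  define r where "r = min d e"
  have r: "r > 0" "ball z0 r \<subseteq> ball z0 d" "ball z0 r \<subseteq> ball z0 e" using d e by (auto simp: r_def)
  have near: "x \<in> ball 0 s" "\<eta> < cmod (G x)" "cmod (G z0 - G x) < cmod (G z0)" if "x \<in> ball z0 r" for x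
  proof -
    have "x \<in> ball 0 s \<inter> G -` ({x. \<eta> < cmod x} \<inter> ball (G z0) (cmod (G z0)))" using that r(2) d(2) by blast
    then show "x \<in> ball 0 s" "\<eta> < cmod (G x)" "cmod (G z0 - G x) < cmod (G z0)" by (auto simp: dist_norm)
  qed
  have quot: "G x / G z0 \<notin> \<real>\<^sub>\<le>\<^sub>0" if "x \<in> ball z0 r" for x
  proof -
    have "cmod (1 - G x / G z0) = cmod (G z0 - G x) / cmod (G z0)"
      using Gz0 by (simp add: field_simps flip: norm_divide)
    also have "\<dots> < 1" using near(3)[OF that] Gz0 by simp
    finally have "0 < Re (G x / G z0)" using abs_Re_le_cmod[of "1 - G x / G z0"] by simp
    then show ?thesis by (auto simp: complex_nonpos_Reals_iff)
  qed
  \<comment> \<open>Holomorphic near \<open>z0\<close> with \<open>Re H \<le> w - c\<close> and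
    equality at \<open>z0\<close>. Dividing by \<open>G z0\<close> keeps the argument of the
    logarithm in the right half-plane, where the principal branch is holomorphic.\<close>
  define H where "H = (\<lambda>x. V x - Q x + of_real \<epsilon> * Ln (G x / G z0))"
  have H: "H holomorphic_on ball z0 r"
    unfolding H_def using quot near(1) Gz0(2)
    by (intro holomorphic_intros holomorphic_on_subset[OF V(1)] holomorphic_on_subset[OF Q(2)] holomorphic_on_subset[OF G(2)])
       (use r in auto)
  define c where "c = \<epsilon> * ln (cmod (G z0) / M)"
  have ReH: "Re (H x) \<le> w x - c" if "x \<in> ball z0 r" for x
  proof -
    have Gx: "G x \<noteq> 0" using near(2)[OF that] \<eta> by auto
    have "Re (H x) = Re (V x) - Re (Q x) + \<epsilon> * ln (cmod (G x) / cmod (G z0))"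
      using Gx Gz0 by (simp add: H_def norm_divide)
    also have "\<epsilon> * ln (cmod (G x) / cmod (G z0)) = \<epsilon> * ln (cmod (G x) / M) - c"
      using Gx Gz0 M(1) by (simp add: c_def ln_div algebra_simps)
    finally show ?thesis using V(3)[of x] that r by (auto simp: w_def w0_def)
  qed
  have ReH0: "Re (H z0) = w z0 - c" using V(2) Gz0 by (simp add: H_def w_def w0_def c_def)
  have xK: "x \<in> K" if "x \<in> ball z0 r" for x using near[OF that] by (auto simp: K_def)
  have const: "w x = w zm" if x: "x \<in> ball z0 r" for x
  proof -
    have "(exp \<circ> H) constant_on ball z0 r"
    proof (rule maximum_modulus_principle)
      show "(exp \<circ> H) holomorphic_on ball z0 r" unfolding o_def using H by (intro holomorphic_intros)
      show "cmod ((exp \<circ> H) y) \<le> cmod ((exp \<circ> H) z0)" if "y \<in> ball z0 r" for y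
        using ReH[OF that] zm(2)[OF xK[OF that]] ReH0 wz0 by simp
    qed (use r in auto)
    then obtain k where "\<And>y. y \<in> ball z0 r \<Longrightarrow> exp (H y) = k" by (auto simp: constant_on_def)
    then have "exp (H x) = exp (H z0)" using x r by (metis centre_in_ball)
    then have "Re (H x) = Re (H z0)" by (metis exp_inj_iff norm_exp_eq_Re)
    then show ?thesis using ReH[OF x] ReH0 zm(2)[OF xK[OF x]] wz0 by simp
  qed
  define v where "v = (if z0 = 0 then 1 else sgn z0)"
  have v: "norm v = 1" "norm (z0 + of_real (r / 2) * v) = norm z0 + r / 2"
  proof -
    show "norm v = 1" by (auto simp: v_def norm_sgn)
    show "norm (z0 + of_real (r / 2) * v) = norm z0 + r / 2"
    proof (cases "z0 = 0")
      case False
      then have eq: "z0 + of_real (r / 2) * v = of_real (norm z0 + r / 2) * v"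
        by (simp add: v_def sgn_eq algebra_simps)
      show ?thesis using \<open>norm v = 1\<close> r unfolding eq norm_mult norm_of_real by simp
    qed (use r in \<open>simp add: v_def\<close>)
  qed
  have "z0 + of_real (r / 2) * v \<in> ball z0 r" using v(1) r by (simp add: dist_norm norm_mult)
  then have "z0 + of_real (r / 2) * v \<in> A" using const xK by (simp add: A_def)
  then show False using z0(2) v(2) r by fastforce
qed

text \<open>Stone-Weierstrass needs real parts of polynomials to be closed under products. On the
  circle they are: \<open>2 * Re x * Re y = Re (x * y + x * cnj y)\<close>, and
  \<open>z ^ j * cnj (z ^ k) = s ^ (2 * k) * z ^ (j - k)\<close> for \<open>k \<le> j\<close>. The
  lemma supplies harmonic functions with almost prescribed boundary values, in place of a Poisson
  integral.\<close>

lemma Re_poly_dense_on_circle: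
  fixes f :: "complex \<Rightarrow> real"
  assumes s: "0 < s" and f: "continuous_on (sphere 0 s) f" and e: "0 < e"
  shows "\<exists>Q :: complex poly. \<forall>z\<in>sphere 0 s. \<bar>f z - Re (poly Q z)\<bar> < e"
proof -
  define T where "T = {g. \<exists>Q :: complex poly. \<forall>z\<in>sphere 0 s. g z = Re (poly Q z)}"
  have Tadd: "(\<lambda>z. g z + h z) \<in> T" if gh: "g \<in> T" "h \<in> T" for g h
  proof -
    obtain P Q where "\<forall>z\<in>sphere 0 s. g z = Re (poly P z)" "\<forall>z\<in>sphere 0 s. h z = Re (poly Q z)"
      using gh unfolding T_def by blast
    then show ?thesis unfolding T_def by (auto intro!: exI[of _ "P + Q"])
  qed
  have Tsum: "(\<lambda>z. \<Sum>i\<in>I. g i z) \<in> T" if "finite I" "\<And>i. i \<in> I \<Longrightarrow> g i \<in> T" for g and I :: "nat set"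
    using that
  proof (induction I rule: finite_induct)
    case empty
    show ?case unfolding T_def by (auto intro!: exI[of _ 0])
  next
    case (insert i I)
    then show ?case using Tadd[of "g i" "\<lambda>z. \<Sum>i\<in>I. g i z"] by simp
  qed
  have Tmono: "(\<lambda>z. Re (a * z ^ j) * Re (b * z ^ k)) \<in> T" if jk: "k \<le> j" for a b j k
  proof -
    define Q where "Q = monom (a * b / 2) (j + k) + monom (a * cnj b * of_real (s ^ (2 * k)) / 2) (j - k)"
    have "Re (a * z ^ j) * Re (b * z ^ k) = Re (poly Q z)" if z: "z \<in> sphere 0 s" for z
    proof -
      have zz: "z * cnj z = of_real (s\<^sup>2)" using z by (simp flip: complex_norm_square)
      have "z ^ j * cnj (z ^ k) = z ^ (j - k) * (z * cnj z) ^ k"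
        using jk by (simp add: power_mult_distrib flip: mult.assoc power_add)
      also have "\<dots> = of_real (s ^ (2 * k)) * z ^ (j - k)" by (simp add: zz power_mult)
      finally have *: "z ^ j * cnj (z ^ k) = of_real (s ^ (2 * k)) * z ^ (j - k)" .
      have "Re x * Re y = Re (x * y / 2 + x * cnj y / 2)" for x y by (simp add: field_simps)
      then have "Re (a * z ^ j) * Re (b * z ^ k) = Re ((a * z ^ j) * (b * z ^ k) / 2 + (a * z ^ j) * cnj (b * z ^ k) / 2)" .
      also have "(a * z ^ j) * cnj (b * z ^ k) = a * cnj b * (z ^ j * cnj (z ^ k))" by simp
      also have "(a * z ^ j) * (b * z ^ k) / 2 + a * cnj b * (z ^ j * cnj (z ^ k)) / 2 = poly Q z"
        unfolding * by (simp add: Q_def poly_monom power_add algebra_simps)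
      finally show ?thesis .
    qed
    then show ?thesis unfolding T_def by auto
  qed
  have Tmono': "(\<lambda>z. Re (a * z ^ j) * Re (b * z ^ k)) \<in> T" for a b j k
    using Tmono[of k j a b] Tmono[of j k b a] by (cases "k \<le> j") (auto simp: mult.commute)
  have Tmult: "(\<lambda>z. g z * h z) \<in> T" if gh: "g \<in> T" "h \<in> T" for g h
  proof -
    obtain P Q where PQ: "\<forall>z\<in>sphere 0 s. g z = Re (poly P z)" "\<forall>z\<in>sphere 0 s. h z = Re (poly Q z)"
      using gh unfolding T_def by blast
    have "(\<lambda>z. \<Sum>i\<le>degree P. \<Sum>j\<le>degree Q. Re (coeff P i * z ^ i) * Re (coeff Q j * z ^ j)) \<in> T"
      by (intro Tsum Tmono') auto
    moreover have "Re (poly P z) * Re (poly Q z)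
        = (\<Sum>i\<le>degree P. \<Sum>j\<le>degree Q. Re (coeff P i * z ^ i) * Re (coeff Q j * z ^ j))" for z
      by (simp add: poly_altdef sum_product)
    ultimately show ?thesis using PQ unfolding T_def by auto
  qed
  define R where "R = T \<inter> {g. continuous_on (sphere 0 s) g}"
  interpret function_ring_on R "sphere 0 s"
  proof
    show "(\<lambda>_. c) \<in> R" for c :: real
      unfolding R_def T_def by (auto intro!: exI[of _ "[:of_real c:]"])
    show "\<exists>g\<in>R. g x \<noteq> g y" if "x \<in> sphere 0 s" "y \<in> sphere 0 s" "x \<noteq> y" for x y
    proof -
      have "\<forall>z\<in>sphere 0 s. Re z = Re (poly [:0, 1:] z)" "\<forall>z\<in>sphere 0 s. Im z = Re (poly [:0, - \<i>:] z)"
        by simp_all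
      then have "Re \<in> T" "Im \<in> T" unfolding T_def by blast+
      moreover have "continuous_on (sphere 0 s) Re" "continuous_on (sphere 0 s) Im"
        by (intro continuous_intros)+
      ultimately have 1: "Re \<in> R" "Im \<in> R" unfolding R_def by simp_all
      show ?thesis using that(3) 1 by (metis complex_eqI)
    qed
  qed (auto simp: R_def intro!: Tadd Tmult continuous_intros)
  obtain g where "g \<in> R" "\<forall>x\<in>sphere 0 s. \<bar>f x - g x\<bar> < e"
    using Stone_Weierstrass_basic[OF f e] by blast
  moreover then obtain Q where "\<forall>z\<in>sphere 0 s. g z = Re (poly Q z)" unfolding R_def T_def by blast
  ultimately show ?thesis by (intro exI[of _ Q]) auto
qed

section \<open>Circle means and their growth with the radius\<close>

definition circle_mean :: "(complex \<Rightarrow> 'a::banach) \<Rightarrow> 'a" where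
  "circle_mean f = (1 / (2 * pi)) *\<^sub>R integral {0..2 * pi} (\<lambda>t. f (cis t))"

lemma integrable_on_cis:
  fixes f :: "complex \<Rightarrow> 'a::banach"
  assumes "continuous_on (sphere 0 1) f"
  shows "(\<lambda>t. f (cis t)) integrable_on {0..2 * pi}"
  by (intro integrable_continuous_real continuous_on_compose2[OF assms] continuous_intros) auto

lemma circle_mean_const [simp]: "circle_mean (\<lambda>_. c) = c"
  by (simp add: circle_mean_def)

lemma circle_mean_add:
  assumes "continuous_on (sphere 0 1) f" "continuous_on (sphere 0 1) g"
  shows "circle_mean (\<lambda>z. f z + g z) = circle_mean f + circle_mean g"
  unfolding circle_mean_def
  by (simp add: Henstock_Kurzweil_Integration.integral_add integrable_on_cis assms scaleR_add_right)

lemma circle_mean_mono: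
  fixes f g :: "complex \<Rightarrow> real"
  assumes "continuous_on (sphere 0 1) f" "continuous_on (sphere 0 1) g" "\<And>z. z \<in> sphere 0 1 \<Longrightarrow> f z \<le> g z"
  shows "circle_mean f \<le> circle_mean g"
  unfolding circle_mean_def using assms
  by (auto intro!: divide_right_mono integral_le integrable_on_cis)

lemma circle_mean_linear:
  assumes "continuous_on (sphere 0 1) f" "bounded_linear T"
  shows "circle_mean (\<lambda>z. T (f z)) = T (circle_mean f)"
  unfolding circle_mean_def
  using integral_linear[OF integrable_on_cis[OF assms(1)] assms(2)]
  by (simp add: o_def linear_cmul[OF bounded_linear.linear[OF assms(2)]])

text \<open>With respect to the normalized angle, \<open>z / (z - w)\<close> is the Cauchy
  kernel.\<close>

lemma circle_mean_Cauchy: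
  assumes F: "F holomorphic_on cball 0 1" and w: "cmod w < 1"
  shows "circle_mean (\<lambda>z. F z * (z / (z - w))) = F w"
proof -
  have "((\<lambda>u. F u / (u - w)) has_contour_integral (2 * of_real pi * \<i> * F w)) (circlepath 0 1)"
    using Cauchy_integral_circlepath_simple[OF F, of w] w by simp
  then have "((\<lambda>t. F (cis t) / (cis t - w) * \<i> * cis t) has_integral (2 * of_real pi * \<i> * F w)) {0..2 * pi}"
    unfolding circlepath_def by (subst (asm) has_contour_integral_part_circlepath_iff) auto
  then have "((\<lambda>t. (1 / \<i>) * (F (cis t) / (cis t - w) * \<i> * cis t)) has_integral (1 / \<i>) * (2 * of_real pi * \<i> * F w)) {0..2 * pi}"
    by (rule has_integral_mult_right)
  then have "((\<lambda>t. F (cis t) * (cis t / (cis t - w))) has_integral 2 * of_real pi * F w) {0..2 * pi}"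
    by (simp add: mult.commute mult.left_commute)
  then show ?thesis
    unfolding circle_mean_def by (simp add: integral_unique scaleR_conv_of_real)
qed

lemma circle_mean_value:
  assumes F: "F holomorphic_on cball 0 1"
  shows "circle_mean F = F 0"
proof -
  have "circle_mean (\<lambda>z. F z * (z / (z - 0))) = circle_mean F"
    unfolding circle_mean_def by simp
  with circle_mean_Cauchy[OF F, of 0] show ?thesis by simp
qed

text \<open>The exceptional zeros of \<open>G\<close> are there because \<open>riesz_fn p\<close> need not be supported at 0;
  the maximum principle disposes of them by adding a small multiple of \<open>ln \<bar>G\<bar>\<close>.\<close>

definition disc_subharmonic :: "(complex \<Rightarrow> real) \<Rightarrow> bool" where
  "disc_subharmonic v \<longleftrightarrow> continuous_on (ball 0 1) v \<and>
     (\<exists>G. G holomorphic_on ball 0 1 \<and> (\<exists>z\<in>ball 0 1. G z \<noteq> 0) \<and> (\<forall>z\<in>ball 0 1. G z \<noteq> 0 \<longrightarrow> supported v z))"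

lemma disc_subharmonicI:
  assumes "continuous_on (ball 0 1) v" "\<And>z. z \<in> ball 0 1 \<Longrightarrow> supported v z"
  shows "disc_subharmonic v"
  unfolding disc_subharmonic_def using assms by (intro conjI exI[of _ "\<lambda>_. 1"] bexI[of _ 0]) auto

text \<open>On the circle of radius \<open>s2\<close>, \<open>v\<close> is replaced by
  \<open>Re Q\<close> up to \<open>e / 2\<close>. By the maximum principle
  \<open>Re Q + e / 2\<close> majorizes \<open>v\<close> inside, and the mean of \<open>Re Q\<close>
  over every circle about 0 is its value at 0; both means of \<open>v\<close> are compared with this
  value.\<close>

lemma circle_mean_radius_mono:
  assumes v: "disc_subharmonic v" and s: "0 \<le> s1" "s1 \<le> s2" "s2 < 1"
  shows "circle_mean (\<lambda>z. v (of_real s1 * z)) \<le> circle_mean (\<lambda>z. v (of_real s2 * z))"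
proof (cases "s2 = 0")
  case False
  then have s2: "0 < s2" using s by simp
  obtain G where G: "G holomorphic_on ball 0 1" "\<exists>z\<in>ball 0 1. G z \<noteq> 0"
    and sup: "\<And>z. z \<in> ball 0 1 \<Longrightarrow> G z \<noteq> 0 \<Longrightarrow> supported v z"
    using v unfolding disc_subharmonic_def by blast
  have vc: "continuous_on (ball 0 1) v" using v by (simp add: disc_subharmonic_def)
  have G2: "\<exists>z\<in>ball 0 s2. G z \<noteq> 0"
  proof (rule ccontr)
    assume "\<not> ?thesis"
    then have "G x = 0" if "x \<in> ball 0 1" for x
      using analytic_continuation_open[of "ball 0 s2" "ball 0 1" G "\<lambda>_. 0" x] G s s2 that
        subset_ball[of s2 1 "0 :: complex"] by auto
    with G(2) show False by blast
  qed
  have sub: "cball 0 s2 \<subseteq> ball 0 (1::real)" "cball (0::complex) s2 \<subseteq> ball 0 1" using s by auto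
  have cont: "continuous_on (sphere 0 1) (\<lambda>z. v (of_real t * z))" if "0 \<le> t" "t \<le> s2" for t
    by (rule continuous_on_compose2[OF vc]) (use that s in \<open>auto intro!: continuous_intros simp: norm_mult\<close>)
  show ?thesis
  proof (rule field_le_epsilon)
    fix e :: real assume e: "0 < e"
    have "continuous_on (sphere 0 s2) v" by (rule continuous_on_subset[OF vc]) (use s in auto)
    then obtain Q where Q: "\<And>z. z \<in> sphere 0 s2 \<Longrightarrow> \<bar>v z - Re (poly Q z)\<bar> < e / 2"
      using Re_poly_dense_on_circle[OF s2, of v "e / 2"] half_gt_zero[OF e] by blast
    have le: "v z \<le> Re (poly Q z + of_real (e / 2))" if "z \<in> cball 0 s2" for z
    proof (rule disc_max_principle[OF s2 _ _ _ G2 _ _ _ _ that])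
      show "v z \<le> Re (poly Q z + of_real (e / 2))" if "z \<in> sphere 0 s2" for z using Q[OF that] unfolding plus_complex.sel Re_complex_of_real by arith
      show "G holomorphic_on ball 0 s2" by (rule holomorphic_on_subset[OF G(1)]) (use s in auto)
      show "continuous_on (cball 0 s2) G"
        by (rule continuous_on_subset[OF holomorphic_on_imp_continuous_on[OF G(1)] sub(2)])
      show "continuous_on (cball 0 s2) v" by (rule continuous_on_subset[OF vc sub(2)])
    qed (use sup s in \<open>auto intro!: continuous_intros holomorphic_intros\<close>)
    have mv: "circle_mean (\<lambda>z. Re (poly Q (of_real t * z))) = Re (poly Q 0)" for t :: real
    proof -
      have "circle_mean (\<lambda>z. poly Q (of_real t * z)) = poly Q 0"
        by (subst circle_mean_value) (auto intro!: holomorphic_intros)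
      then show ?thesis
        by (subst circle_mean_linear[OF _ bounded_linear_Re]) (auto intro!: continuous_intros)
    qed
    have "circle_mean (\<lambda>z. v (of_real s1 * z)) \<le> circle_mean (\<lambda>z. Re (poly Q (of_real s1 * z)) + e / 2)"
    proof (rule circle_mean_mono)
      fix z :: complex assume "z \<in> sphere 0 1"
      then show "v (of_real s1 * z) \<le> Re (poly Q (of_real s1 * z)) + e / 2"
        using le[of "of_real s1 * z"] s by (simp add: norm_mult)
    qed (use cont s in \<open>auto intro!: continuous_intros\<close>)
    also have "\<dots> = Re (poly Q 0) + e / 2"
      by (subst circle_mean_add) (auto intro!: continuous_intros simp: mv)
    also have "\<dots> = circle_mean (\<lambda>z. Re (poly Q (of_real s2 * z)) + e / 2)"
      by (subst circle_mean_add) (auto intro!: continuous_intros simp: mv)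
    also have "\<dots> \<le> circle_mean (\<lambda>z. v (of_real s2 * z) + e)"
    proof (rule circle_mean_mono)
      fix z :: complex assume "z \<in> sphere 0 1"
      then have "of_real s2 * z \<in> sphere 0 s2" using s by (simp add: norm_mult)
      from Q[OF this] show "Re (poly Q (of_real s2 * z)) + e / 2 \<le> v (of_real s2 * z) + e"
        by arith
    qed (use cont s in \<open>auto intro!: continuous_intros\<close>)
    also have "\<dots> = circle_mean (\<lambda>z. v (of_real s2 * z)) + e"
      by (subst circle_mean_add) (use cont s in \<open>auto intro!: continuous_intros\<close>)
    finally show "circle_mean (\<lambda>z. v (of_real s1 * z)) \<le> circle_mean (\<lambda>z. v (of_real s2 * z)) + e" .
  qed
qed (use s in simp)

section \<open>Supports for powers and for the Riesz function\<close>

lemma supportedI_powr: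
  fixes \<Phi> :: "complex \<Rightarrow> real"
  assumes z: "z \<noteq> 0" and r: "0 < r" "r \<le> cmod z"
    and eq: "\<Phi> z = cmod z powr q * Re c"
    and le: "\<And>w. w \<in> ball z r \<Longrightarrow> cmod w powr q * Re (c * cis (q * Arg (w / z))) \<le> \<Phi> w"
  shows "supported \<Phi> z"
proof -
  \<comment> \<open>The power \<open>q\<close> in the branch anchored at \<open>z\<close>: on a ball
    of radius at most \<open>cmod z\<close> the quotient \<open>w / z\<close> has positive real
    part, so no cut is met. The factor \<open>c\<close> carries the phase at
    \<open>z\<close>.\<close>
  define V where "V = (\<lambda>w. of_real (cmod z powr q) * c * exp (of_real q * Ln (w / z)))"
  have Re_pos: "0 < Re (w / z)" if "w \<in> ball z r" for w
  proof -
    have "cmod (1 - w / z) = cmod (z - w) / cmod z"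
      using z by (simp add: field_simps flip: norm_divide)
    also have "\<dots> < 1" using that r z by (simp add: dist_norm)
    finally show ?thesis using abs_Re_le_cmod[of "1 - w / z"] by simp
  qed
  have "V holomorphic_on ball z r"
    unfolding V_def using z
  proof (intro holomorphic_intros)
    show "w / z \<notin> \<real>\<^sub>\<le>\<^sub>0" if "w \<in> ball z r" for w
      using Re_pos[OF that] by (simp add: complex_nonpos_Reals_iff)
  qed
  moreover have "Re (V w) = cmod w powr q * Re (c * cis (q * Arg (w / z)))" if "w \<in> ball z r" for w
  proof -
    have w: "w \<noteq> 0" using Re_pos[OF that] by auto
    have "exp (of_real q * Ln (w / z)) = of_real ((cmod w / cmod z) powr q) * cis (q * Arg (w / z))"
      using w z by (simp add: exp_eq_polar powr_def norm_divide Arg_def)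
    then have "V w = of_real (cmod z powr q * (cmod w / cmod z) powr q) * (c * cis (q * Arg (w / z)))"
      by (simp add: V_def)
    also have "cmod z powr q * (cmod w / cmod z) powr q = cmod w powr q"
      using z by (simp flip: powr_mult)
    finally have "V w = of_real (cmod w powr q) * (c * cis (q * Arg (w / z)))" .
    moreover have "Re (of_real x * y) = x * Re y" for x y by simp
    ultimately show ?thesis by (simp only:)
  qed
  ultimately show ?thesis
    unfolding supported_def using r le z eq by (intro exI[of _ r] conjI exI[of _ V]) auto
qed

lemma Re_div_cmod_rotate:
  assumes z: "z \<noteq> 0" "w \<noteq> 0"
  shows "Re w / cmod w = cos (Arg z + Arg (w / z))"
proof -
  have "w = z * (w / z)" using z by simp
  also have "\<dots> = of_real (cmod z * cmod (w / z)) * cis (Arg z + Arg (w / z))"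
    using Arg_eq[of z] Arg_eq[of "w / z"] z by (simp add: cis_mult cis_conv_exp exp_add algebra_simps)
  also have "cmod z * cmod (w / z) = cmod w" using z by (simp add: norm_divide)
  finally have "Re w = Re (of_real (cmod w) * cis (Arg z + Arg (w / z)))" by simp
  then show ?thesis using z by simp
qed

lemma Arg_quotient_less:
  assumes "z \<noteq> 0" "w \<in> ball z (cmod z)"
  shows "\<bar>Arg (w / z)\<bar> < pi / 2"
proof -
  have "cmod (1 - w / z) = cmod (z - w) / cmod z"
    using assms by (simp add: field_simps flip: norm_divide)
  also have "\<dots> < 1" using assms by (simp add: dist_norm)
  finally have Re: "0 < Re (w / z)" using abs_Re_le_cmod[of "1 - w / z"] by simp
  then have nz: "w / z \<noteq> 0" by force
  show ?thesis
    unfolding Arg_eq_Im_Ln[OF nz] using Re Re_Ln_pos_lt[OF nz] by blast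
qed

lemma arccos_cos_wrap:
  assumes "pi \<le> \<theta>" "\<theta> \<le> 2 * pi"
  shows "arccos (cos \<theta>) = 2 * pi - \<theta>"
  using arccos_cos[of "2 * pi - \<theta>"] assms cos_2pi_minus[of \<theta>] by simp

text \<open>Continuing \<open>cos (q * \<theta>)\<close> past \<open>pi\<close> gives less than
  folding the angle back: the difference is
  \<open>2 * sin (q * pi) * sin (q * (\<theta> - pi))\<close>. So across the negative axis the real
  part of the power is the maximum of two branches. The range \<open>3 * pi / 2\<close> is
  \<open>pi\<close> for the angle of the centre plus the quarter turn that can be made inside the
  ball.\<close>

lemma cos_mult_le_arccos:
  fixes q \<theta> :: real
  assumes q: "0 < q" "q \<le> 1" and \<theta>: "\<bar>\<theta>\<bar> \<le> 3 * pi / 2"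
  shows "cos (q * \<theta>) \<le> cos (q * arccos (cos \<theta>))"
proof -
  have *: "cos (q * \<theta>) \<le> cos (q * arccos (cos \<theta>))" if \<theta>: "0 \<le> \<theta>" "\<theta> \<le> 3 * pi / 2" for \<theta>
  proof (cases "\<theta> \<le> pi")
    case True
    then show ?thesis using \<theta> by (simp add: arccos_cos)
  next
    case False
    have qp: "q * pi \<le> pi" "0 \<le> q * pi" using q by auto
    have "q * (\<theta> - pi) \<le> \<theta> - pi" using q False mult_right_mono[of q 1 "\<theta> - pi"] by simp
    then have "q * (\<theta> - pi) \<le> pi" using \<theta> pi_gt_zero by linarith
    then have "0 \<le> sin (q * (\<theta> - pi))" using q False by (intro sin_ge_zero) auto
    moreover have "0 \<le> sin (q * pi)" using qp by (intro sin_ge_zero) auto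
    moreover have "cos (q * (2 * pi - \<theta>)) - cos (q * \<theta>) = 2 * sin (q * pi) * sin (q * (\<theta> - pi))"
    proof -
      have "(q * (2 * pi - \<theta>) + q * \<theta>) / 2 = q * pi" "(q * \<theta> - q * (2 * pi - \<theta>)) / 2 = q * (\<theta> - pi)"
        by (simp_all add: field_simps)
      then show ?thesis by (simp only: cos_diff_cos)
    qed
    ultimately have "cos (q * \<theta>) \<le> cos (q * (2 * pi - \<theta>))" using mult_nonneg_nonneg[of "sin (q * pi)" "sin (q * (\<theta> - pi))"] by linarith
    then show ?thesis using arccos_cos_wrap[of \<theta>] False \<theta> by simp
  qed
  show ?thesis using *[of "\<bar>\<theta>\<bar>"] \<theta> by (cases "0 \<le> \<theta>") auto
qed

text \<open>For \<open>p \<le> 2\<close> the branch anchored at \<open>z\<close> is a support, even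
  across the negative axis. For \<open>p > 2\<close>, as long as the cut-off is not exceeded at
  \<open>z\<close>, the branch of \<open>z\<close> is a support because \<open>- cos\<close> never
  exceeds the cut-off value 1; beyond it the function is locally \<open>cmod w powr q\<close>, which
  dominates the real part of the anchored power.\<close>

lemma supported_riesz_fn:
  assumes p: "1 < p" and z: "z \<noteq> 0"
  shows "supported (riesz_fn p) z"
proof (cases "p \<le> 2")
  case True
  define q where "q = p / 2"
  have q: "0 < q" "q \<le> 1" using p True by (auto simp: q_def)
  have fn: "riesz_fn p w = cmod w powr q * cos (q * arccos (Re w / cmod w))" for w
    using True by (simp add: riesz_fn_def q_def)
  show ?thesis
  proof (rule supportedI_powr[where q = q and c = "cis (q * Arg z)", OF z _ order_refl])
    show "0 < cmod z" using z by simp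
    have "arccos (Re z / cmod z) = \<bar>Arg z\<bar>"
    proof -
      have "Arg (z / z) = 0" using z by simp
      then have "Re z / cmod z = cos (Arg z)" using Re_div_cmod_rotate[OF z z] by (simp only: add_0_right)
      moreover have "\<bar>Arg z\<bar> \<le> pi" using Arg_le_pi[of z] mpi_less_Arg[of z] by linarith
      ultimately show ?thesis by (simp only: arccos_cos_eq_abs)
    qed
    then show "riesz_fn p z = cmod z powr q * Re (cis (q * Arg z))"
      unfolding fn using cos_abs_real[of "q * Arg z"] q by (simp only: abs_mult abs_of_pos cis.sel)
    fix w assume w: "w \<in> ball z (cmod z)"
    have w0: "w \<noteq> 0" using w by auto
    have "cos (q * (Arg z + Arg (w / z))) \<le> cos (q * arccos (cos (Arg z + Arg (w / z))))"
    proof (rule cos_mult_le_arccos[OF q])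
      show "\<bar>Arg z + Arg (w / z)\<bar> \<le> 3 * pi / 2"
        using Arg_quotient_less[OF z w] Arg_le_pi[of z] mpi_less_Arg[of z] by linarith
    qed
    then have "cmod w powr q * cos (q * (Arg z + Arg (w / z))) \<le> riesz_fn p w"
      unfolding fn Re_div_cmod_rotate[OF z w0] by (rule mult_left_mono) (rule powr_ge_zero)
    then show "cmod w powr q * Re (cis (q * Arg z) * cis (q * Arg (w / z))) \<le> riesz_fn p w"
      by (simp only: cis_mult cis.sel distrib_left)
  qed
next
  case False
  define q where "q = p / 2"
  have q: "1 < q" using False by (auto simp: q_def)
  define \<delta> where "\<delta> = (\<lambda>w::complex. arccos (- Re w / cmod w))"
  have fn: "riesz_fn p w = cmod w powr q * (- cos (min (q * \<delta> w) pi))" for w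
    using False by (simp add: riesz_fn_def q_def \<delta>_def)
  have cos_\<delta>: "- Re w / cmod w = cos (Arg (- z) + Arg (w / z))" if "w \<noteq> 0" for w
    using Re_div_cmod_rotate[of "- z" "- w"] that z by simp
  have Argz: "- pi < Arg (- z)" "Arg (- z) \<le> pi" by (auto simp: mpi_less_Arg Arg_le_pi)
  have \<delta>_eq: "\<delta> w = \<bar>Arg (- z) + Arg (w / z)\<bar>" if "w \<noteq> 0" "\<bar>Arg (- z) + Arg (w / z)\<bar> \<le> pi" for w
    unfolding \<delta>_def cos_\<delta>[OF that(1)] using that(2) by (rule arccos_cos_eq_abs)
  have Arg1: "Arg (z / z) = 0" using z by simp
  have \<delta>z: "\<delta> z = \<bar>Arg (- z)\<bar>"
    using \<delta>_eq[OF z] Argz unfolding Arg1 by simp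
  have cont: "continuous_on (- {0}) \<delta>"
    unfolding \<delta>_def using Re_div_cmod_bounds[of "- w" for w] by (intro continuous_intros) auto
  show ?thesis
  proof (cases "q * \<bar>Arg (- z)\<bar> \<le> pi")
    case True
    \<comment> \<open>Since \<open>q > 1\<close>, the angle of \<open>- z\<close> is not
      \<open>pi\<close>; hence for \<open>w\<close> close to \<open>z\<close> the angles add without
      wrapping around.\<close>
    have Az: "\<bar>Arg (- z)\<bar> < pi"
    proof (cases "Arg (- z) = 0")
      case False
      then have "1 * \<bar>Arg (- z)\<bar> < q * \<bar>Arg (- z)\<bar>" using q by (intro mult_strict_right_mono) auto
      then show ?thesis using True by linarith
    qed (simp only: abs_zero pi_gt_zero)
    have "continuous (at z) (\<lambda>w. Arg (w / z))"
    proof -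
      have "isCont Arg (z / z)" using z by (intro continuous_at_Arg) (simp add: complex_nonpos_Reals_iff)
      moreover have "isCont (\<lambda>w. w / z) z" using z by (intro continuous_intros) auto
      ultimately show ?thesis by (rule isCont_o2[rotated])
    qed
    moreover have "0 < pi - \<bar>Arg (- z)\<bar>" using Az by linarith
    ultimately obtain r0 where r0: "r0 > 0" "\<And>w. dist w z < r0 \<Longrightarrow> dist (Arg (w / z)) (Arg (z / z)) < pi - \<bar>Arg (- z)\<bar>"
      unfolding continuous_at_eps_delta by metis
    then have r0: "r0 > 0" "\<And>w. dist w z < r0 \<Longrightarrow> \<bar>Arg (w / z)\<bar> < pi - \<bar>Arg (- z)\<bar>"
      unfolding Arg1 by (simp_all add: dist_real_def)
    define r where "r = min r0 (cmod z)"
    show ?thesis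
    proof (rule supportedI_powr[where r = r and q = q and c = "- cis (q * Arg (- z))", OF z])
      show "0 < r" "r \<le> cmod z" using r0 z by (auto simp: r_def)
      have "min (q * \<delta> z) pi = q * \<bar>Arg (- z)\<bar>" using True by (simp add: \<delta>z)
      then show "riesz_fn p z = cmod z powr q * Re (- cis (q * Arg (- z)))"
        unfolding fn using cos_abs_real[of "q * Arg (- z)"] q by (simp add: abs_mult)
      fix w assume w: "w \<in> ball z r"
      have w0: "w \<noteq> 0" using w by (auto simp: r_def)
      define \<theta> where "\<theta> = Arg (- z) + Arg (w / z)"
      have "dist w z < r0" using w by (simp add: r_def dist_commute)
      from r0(2)[OF this] have "\<bar>\<theta>\<bar> \<le> pi" unfolding \<theta>_def by linarith
      then have \<delta>w: "\<delta> w = \<bar>\<theta>\<bar>" using \<delta>_eq[OF w0] by (simp only: \<theta>_def)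
      have "- cos (q * \<theta>) \<le> - cos (min (q * \<delta> w) pi)"
      proof (cases "q * \<bar>\<theta>\<bar> \<le> pi")
        case True
        then have "min (q * \<delta> w) pi = q * \<bar>\<theta>\<bar>" unfolding \<delta>w by simp
        then show ?thesis using cos_abs_real[of "q * \<theta>"] q by (simp add: abs_mult)
      next
        case False
        then have "min (q * \<delta> w) pi = pi" unfolding \<delta>w by simp
        then show ?thesis by simp
      qed
      then have "cmod w powr q * - cos (q * \<theta>) \<le> riesz_fn p w"
        unfolding fn by (intro mult_left_mono) auto
      then show "cmod w powr q * Re (- cis (q * Arg (- z)) * cis (q * Arg (w / z))) \<le> riesz_fn p w"
        by (simp only: cis_mult mult_minus_left) (simp add: \<theta>_def algebra_simps)
    qed
  next
    case False
    have "open (- {0} \<inter> \<delta> -` {pi / q<..})" by (intro continuous_open_preimage[OF cont]) auto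
    moreover have "z \<in> - {0} \<inter> \<delta> -` {pi / q<..}" using False z q unfolding vimage_def by (simp add: \<delta>z pos_divide_less_eq mult.commute)
    ultimately obtain r0 where r0: "r0 > 0" "ball z r0 \<subseteq> - {0} \<inter> \<delta> -` {pi / q<..}"
      by (meson open_contains_ball)
    define r where "r = min r0 (cmod z)"
    have one: "riesz_fn p w = cmod w powr q" if "w \<in> ball z r0" for w
    proof -
      have "pi / q < \<delta> w" using that r0(2) by auto
      then have "pi < q * \<delta> w" using q by (simp add: field_simps)
      then have "min (q * \<delta> w) pi = pi" by simp
      then show ?thesis unfolding fn by simp
    qed
    show ?thesis
    proof (rule supportedI_powr[where r = r and q = q and c = 1, OF z])
      show "0 < r" "r \<le> cmod z" using r0 z by (auto simp: r_def)
      show "riesz_fn p z = cmod z powr q * Re 1" using one[of z] r0 by simp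
      fix w assume w: "w \<in> ball z r"
      then show "cmod w powr q * Re (1 * cis (q * Arg (w / z))) \<le> riesz_fn p w"
        using one[of w] by (auto simp: r_def mult_left_le)
    qed
  qed
qed

lemma continuous_riesz_fn:
  assumes p: "1 < p"
  shows "continuous_on UNIV (riesz_fn p)"
proof -
  have le: "\<bar>riesz_fn p w\<bar> \<le> cmod w powr (p / 2)" for w
    unfolding riesz_fn_def by (auto simp: abs_mult intro!: mult_left_le)
  have "isCont (riesz_fn p) z" for z
  proof (cases "z = 0")
    case True
    have "((\<lambda>w. cmod w powr (p / 2)) \<longlongrightarrow> cmod 0 powr (p / 2)) (at 0)"
      using p by (intro tendsto_powr' tendsto_intros) auto
    then have "((\<lambda>w. cmod w powr (p / 2)) \<longlongrightarrow> 0) (at 0)" by simp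
    then have "(riesz_fn p \<longlongrightarrow> 0) (at 0)"
      by (rule Lim_null_comparison[rotated]) (use le in auto)
    then show ?thesis using True by (simp add: isCont_def)
  next
    case False
    have "continuous_on (- {0}) (riesz_fn p)"
    proof (cases "p \<le> 2")
      case True
      then have "riesz_fn p = (\<lambda>z. cmod z powr (p / 2) * cos (p / 2 * arccos (Re z / cmod z)))"
        by (simp add: riesz_fn_def fun_eq_iff)
      then show ?thesis
        using Re_div_cmod_bounds p by (auto intro!: continuous_intros)
    next
      case False
      then have "riesz_fn p = (\<lambda>z. - (cmod z powr (p / 2) * cos (min (p / 2 * arccos (- Re z / cmod z)) pi)))"
        by (simp add: riesz_fn_def fun_eq_iff)
      then show ?thesis
        using Re_div_cmod_bounds[of "- w" for w] p by (auto intro!: continuous_intros)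
    qed
    then show ?thesis using False by (simp add: continuous_on_eq_continuous_at open_Compl)
  qed
  then show ?thesis by (simp add: continuous_at_imp_continuous_on)
qed

text \<open>\<open>F\<close> itself serves as the function whose zeros are exempt, unless it
  vanishes identically; then the composition is the constant 0.\<close>

lemma disc_subharmonic_riesz_fn:
  assumes p: "1 < p" and F: "F holomorphic_on ball 0 1"
  shows "disc_subharmonic (\<lambda>z. riesz_fn p (F z))"
proof (cases "\<exists>z\<in>ball 0 1. F z \<noteq> 0")
  case True
  show ?thesis
    unfolding disc_subharmonic_def
  proof (intro conjI exI[of _ F] ballI impI)
    show "supported (\<lambda>w. riesz_fn p (F w)) z" if "z \<in> ball 0 1" "F z \<noteq> 0" for z
      by (rule supported_compose[of "riesz_fn p" F z, OF supported_riesz_fn[OF p that(2)] F]) (use that in auto)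
  qed (use True F in \<open>auto intro!: continuous_on_compose2[OF continuous_riesz_fn[OF p]] holomorphic_on_imp_continuous_on\<close>)
next
  case False
  show ?thesis
  proof (rule disc_subharmonicI)
    show "continuous_on (ball 0 1) (\<lambda>z. riesz_fn p (F z))"
      using False by (subst continuous_on_cong[of _ "ball 0 1" _ "\<lambda>_. 0"]) auto
    show "supported (\<lambda>z. riesz_fn p (F z)) z" if z: "z \<in> ball 0 1" for z
    proof -
      obtain e where "e > 0" "ball z e \<subseteq> ball 0 1" using z by (meson open_ball open_contains_ball)
      then show ?thesis using False z unfolding supported_def
        by (intro exI[of _ e] conjI exI[of _ "\<lambda>_. 0"]) auto
    qed
  qed
qed

text \<open>This is a power of the norm of the vector \<open>(h, g)\<close>. \<open>L\<close> is the
  scalar product with the value at \<open>z\<close>, normalized by \<open>L z = 1\<close>, and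
  Cauchy-Schwarz gives \<open>N * |L w|^2 \<le> |h w|^2 + |g w|^2\<close>. So
  \<open>N powr (p / 2)\<close> times the power \<open>p\<close> of \<open>L\<close> is a support,
  for every \<open>p > 0\<close>; at a common zero of \<open>h\<close> and \<open>g\<close> the
  constant 0 is one.\<close>

lemma disc_subharmonic_pair:
  assumes p: "0 < p" and h: "h holomorphic_on ball 0 1" and g: "g holomorphic_on ball 0 1"
  shows "disc_subharmonic (\<lambda>z. ((cmod (h z))\<^sup>2 + (cmod (g z))\<^sup>2) powr (p / 2))"
proof (rule disc_subharmonicI)
  let ?u = "\<lambda>z. ((cmod (h z))\<^sup>2 + (cmod (g z))\<^sup>2) powr (p / 2)"
  note hc = holomorphic_on_imp_continuous_on[OF h] and gc = holomorphic_on_imp_continuous_on[OF g]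
  show "continuous_on (ball 0 1) ?u"
    using p by (intro continuous_on_powr' continuous_intros hc gc) auto
  fix z :: complex assume z: "z \<in> ball 0 1"
  define N where "N = (cmod (h z))\<^sup>2 + (cmod (g z))\<^sup>2"
  show "supported ?u z"
  proof (cases "N = 0")
    case True
    have "?u z = 0" using True by (simp add: N_def)
    then show ?thesis unfolding supported_def
      by (intro exI[of _ 1] conjI exI[of _ "\<lambda>_. 0"]) (auto simp: powr_ge_zero)
  next
    case False
    then have N: "0 < N" by (simp add: N_def sum_power2_gt_zero_iff add_nonneg_eq_0_iff less_le)
    define L where "L = (\<lambda>w. (cnj (h z) * h w + cnj (g z) * g w) / of_real N)"
    have L: "L holomorphic_on ball 0 1" unfolding L_def using h g N by (intro holomorphic_intros) auto
    have Lz: "L z = 1"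
    proof -
      have "of_real N = cnj (h z) * h z + cnj (g z) * g z"
        unfolding N_def of_real_add complex_norm_square by (simp only: mult.commute)
      from this[symmetric] show ?thesis using N unfolding L_def by simp
    qed
    have CS: "(cmod (L w))\<^sup>2 \<le> ((cmod (h w))\<^sup>2 + (cmod (g w))\<^sup>2) / N" for w
    proof -
      have "cmod (L w) * N \<le> cmod (h z) * cmod (h w) + cmod (g z) * cmod (g w)"
        using N norm_triangle_ineq[of "cnj (h z) * h w" "cnj (g z) * g w"] by (simp add: L_def norm_divide norm_mult)
      then have "(cmod (L w) * N)\<^sup>2 \<le> (cmod (h z) * cmod (h w) + cmod (g z) * cmod (g w))\<^sup>2"
        using N by (intro power_mono) auto
      also have "\<dots> \<le> N * ((cmod (h w))\<^sup>2 + (cmod (g w))\<^sup>2)"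
        using zero_le_power2[of "cmod (h z) * cmod (g w) - cmod (g z) * cmod (h w)"]
        unfolding N_def by (simp add: power2_eq_square algebra_simps)
      finally have "N * ((cmod (L w))\<^sup>2 * N) \<le> N * ((cmod (h w))\<^sup>2 + (cmod (g w))\<^sup>2)"
        by (simp add: power2_eq_square mult_ac)
      then show ?thesis using N by (simp only: mult_le_cancel_left_pos pos_le_divide_eq)
    qed
    have "open (ball 0 1 \<inter> L -` ball 1 1)"
      by (intro continuous_open_preimage holomorphic_on_imp_continuous_on L) auto
    moreover have "z \<in> ball 0 1 \<inter> L -` ball 1 1" using z Lz by auto
    ultimately obtain r where r: "r > 0" "ball z r \<subseteq> ball 0 1 \<inter> L -` ball 1 1"
      by (meson open_contains_ball)
    have ReL: "0 < Re (L w)" if "w \<in> ball z r" for w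
    proof -
      have "cmod (1 - L w) < 1" using that r by (auto simp: dist_norm)
      then show ?thesis using abs_Re_le_cmod[of "1 - L w"] by simp
    qed
    define V where "V = (\<lambda>w. of_real (N powr (p / 2)) * exp (of_real p * Ln (L w)))"
    have "V holomorphic_on ball z r"
      unfolding V_def using ReL r(2)
    proof (intro holomorphic_intros holomorphic_on_subset[OF L])
      show "L w \<notin> \<real>\<^sub>\<le>\<^sub>0" if "w \<in> ball z r" for w
        using ReL[OF that] by (simp add: complex_nonpos_Reals_iff)
    qed auto
    moreover have "Re (V z) = ?u z" using Lz by (simp add: V_def N_def)
    moreover have "Re (V w) \<le> ?u w" if "w \<in> ball z r" for w
    proof -
      have L0: "L w \<noteq> 0" using ReL[OF that] by auto
      have "Re (V w) \<le> cmod (V w)" by (rule complex_Re_le_cmod)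
      also have "\<dots> = N powr (p / 2) * cmod (L w) powr p"
        using L0 by (simp add: V_def norm_mult powr_def)
      also have "\<dots> = N powr (p / 2) * ((cmod (L w))\<^sup>2) powr (p / 2)"
        using L0 by (simp add: powr_powr flip: powr_numeral)
      also have "\<dots> \<le> N powr (p / 2) * (((cmod (h w))\<^sup>2 + (cmod (g w))\<^sup>2) / N) powr (p / 2)"
        using CS p by (intro mult_left_mono powr_mono2) auto
      also have "\<dots> = ?u w" using N by (simp flip: powr_mult)
      finally show ?thesis .
    qed
    ultimately show ?thesis unfolding supported_def using r by blast
  qed
qed

text \<open>Because of the shift by 2, \<open>w - (2 + w)^q\<close> has a real part that increases with \<open>Re w\<close> near
  the imaginary axis; hence the reflected function is locally a maximum of two harmonic ones.\<close>

definition kolmogorov_fn :: "real \<Rightarrow> complex \<Rightarrow> real" where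
  "kolmogorov_fn q z = \<bar>Re z\<bar> - Re (exp (of_real q * Ln (of_real (2 + \<bar>Re z\<bar>) + \<i> * of_real (Im z))))"

lemma cmod_exp_mult_Ln: "w \<noteq> 0 \<Longrightarrow> cmod (exp (of_real q * Ln w)) = cmod w powr q"
  by (simp add: powr_def)

text \<open>The argument of the shifted number is below \<open>pi / 2\<close> in modulus, so the
  real part of its power \<open>q < 1\<close> keeps at least the proportion
  \<open>cos (q * (pi / 2))\<close> of the modulus. After integration this bounds the mean of
  \<open>|F|^q\<close> by that of \<open>|Re F|\<close> and a value at 0.\<close>

lemma kolmogorov_fn_bound:
  assumes q: "0 < q" "q < 1"
  shows "cos (q * (pi / 2)) * cmod z powr q \<le> \<bar>Re z\<bar> - kolmogorov_fn q z"
proof -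
  define W where "W = of_real (2 + \<bar>Re z\<bar>) + \<i> * of_real (Im z)"
  have W: "Re W = 2 + \<bar>Re z\<bar>" "Im W = Im z" by (auto simp: W_def)
  have W0: "W \<noteq> 0" using W(1) by (auto simp: complex_eq_iff)
  have zW: "cmod z \<le> cmod W" 
  proof -
    have "(Re z)\<^sup>2 \<le> (2 + \<bar>Re z\<bar>)\<^sup>2" by (rule abs_le_square_iff[THEN iffD1]) auto
    then show ?thesis unfolding cmod_def W by (intro real_sqrt_le_mono) auto
  qed
  have im: "\<bar>Im (Ln W)\<bar> < pi / 2" using Re_Ln_pos_lt[OF W0] W(1) by simp
  have "q * \<bar>Im (Ln W)\<bar> \<le> q * (pi / 2)" using im q by (intro mult_left_mono) auto
  moreover have "q * (pi / 2) \<le> pi" using q mult_right_mono[of q 2 "pi / 2"] by simp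
  ultimately have c: "cos (q * (pi / 2)) \<le> cos (q * \<bar>Im (Ln W)\<bar>)"
    using q by (intro cos_monotone_0_pi_le) auto
  have "0 \<le> q * (pi / 2)" "q * (pi / 2) \<le> pi / 2" using q mult_right_mono[of q 1 "pi / 2"] by auto
  then have c0: "0 \<le> cos (q * (pi / 2))" by (intro cos_ge_zero) linarith+
  have "cos (q * \<bar>Im (Ln W)\<bar>) = cos (q * Im (Ln W))" using cos_abs_real[of "q * Im (Ln W)"] q by (simp only: abs_mult abs_of_pos)
  then have "Re (exp (of_real q * Ln W)) = cmod W powr q * cos (q * \<bar>Im (Ln W)\<bar>)"
    using W0 by (simp add: Re_exp powr_def)
  moreover have "cmod z powr q * cos (q * (pi / 2)) \<le> cmod W powr q * cos (q * \<bar>Im (Ln W)\<bar>)"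
    using zW c c0 q by (intro mult_mono powr_mono2) auto
  ultimately show ?thesis unfolding kolmogorov_fn_def W_def[symmetric] by (simp add: mult.commute)
qed

lemma continuous_kolmogorov_fn: "continuous_on UNIV (kolmogorov_fn q)"
  unfolding kolmogorov_fn_def
  by (intro continuous_intros) (auto simp: complex_nonpos_Reals_iff)

lemma supported_kolmogorov_fn:
  assumes q: "0 < q" "q < 1"
  shows "supported (kolmogorov_fn q) z"
proof -
  define k where "k = (\<lambda>w::complex. w - exp (of_real q * Ln (2 + w)))"
  have pos: "kolmogorov_fn q w = Re (k w)" if "0 \<le> Re w" for w
  proof -
    have "of_real (2 + \<bar>Re w\<bar>) + \<i> * of_real (Im w) = 2 + w" using that by (auto simp: complex_eq_iff)
    then show ?thesis using that unfolding kolmogorov_fn_def k_def by (simp only: minus_complex.sel abs_of_nonneg)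
  qed
  have sym: "kolmogorov_fn q (- w) = kolmogorov_fn q w" for w
  proof -
    define W where "W = of_real (2 + \<bar>Re w\<bar>) + \<i> * of_real (Im w)"
    have W: "W \<notin> \<real>\<^sub>\<le>\<^sub>0" by (auto simp: W_def complex_nonpos_Reals_iff)
    have "of_real (2 + \<bar>Re (- w)\<bar>) + \<i> * of_real (Im (- w)) = cnj W" by (simp add: W_def complex_eq_iff)
    moreover have "exp (of_real q * Ln (cnj W)) = cnj (exp (of_real q * Ln W))"
      unfolding cnj_Ln[OF W, symmetric] by (simp add: exp_cnj)
    ultimately show ?thesis unfolding kolmogorov_fn_def W_def[symmetric] by simp
  qed
  have hol: "k holomorphic_on {w. - 2 < Re w}"
    unfolding k_def by (intro holomorphic_intros) (auto simp: complex_nonpos_Reals_iff)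
  have hol': "(\<lambda>w. k (- w)) holomorphic_on {w. Re w < 2}"
  proof -
    have "(k \<circ> uminus) holomorphic_on {w. Re w < 2}"
      by (rule holomorphic_on_compose_gen[OF _ hol]) (auto intro!: holomorphic_intros)
    then show ?thesis by (simp add: o_def)
  qed
  have Re_near: "Re z - e < Re w" "Re w < Re z + e" if "w \<in> ball z e" for w e
    using that abs_Re_le_cmod[of "z - w"] by (auto simp: dist_norm)
  consider "0 < Re z" | "Re z < 0" | "Re z = 0" by linarith
  then show ?thesis
  proof cases
    case 1
    have "k holomorphic_on ball z (Re z)" by (rule holomorphic_on_subset[OF hol]) (use Re_near in force)
    moreover have "Re (k w) \<le> kolmogorov_fn q w" if "w \<in> ball z (Re z)" for w
      using pos[of w] Re_near(1)[OF that] by simp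
    ultimately show ?thesis unfolding supported_def using 1 pos[of z] by (intro exI[of _ "Re z"] conjI exI[of _ k]) auto
  next
    case 2
    have "(\<lambda>w. k (- w)) holomorphic_on ball z (- Re z)" by (rule holomorphic_on_subset[OF hol']) (use Re_near in force)
    moreover have "Re (k (- w)) \<le> kolmogorov_fn q w" if "w \<in> ball z (- Re z)" for w
      using pos[of "- w"] sym[of w] Re_near(2)[OF that] by simp
    ultimately show ?thesis unfolding supported_def using 2 pos[of "- z"] sym[of z]
      by (intro exI[of _ "- Re z"] conjI exI[of _ "\<lambda>w. k (- w)"]) auto
  next
    case 3
    define V where "V = (\<lambda>w. (k w + k (- w)) / 2)"
    have "V holomorphic_on ball z 1" unfolding V_def
      by (intro holomorphic_intros holomorphic_on_subset[OF hol] holomorphic_on_subset[OF hol']) (use Re_near 3 in force)+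
    moreover have "Re (V z) = kolmogorov_fn q z"
      using pos[of z] pos[of "- z"] sym[of z] 3 by (simp add: V_def)
    moreover have "Re (V w) \<le> kolmogorov_fn q w" if w: "w \<in> ball z 1" for w
    proof -
      \<comment> \<open>The points \<open>2 + v\<close> and \<open>cnj (2 - v)\<close> have real
        part at least 1, the same imaginary part and distance \<open>2 * Re v\<close>. On
        \<open>Re x \<ge> 1\<close> the power has derivative of modulus at most 1, so its real part
        grows by at most \<open>2 * Re v\<close>, which is what the linear term of \<open>k\<close>
        gains.\<close>
      have *: "Re (k (- v)) \<le> Re (k v)" if v: "0 \<le> Re v" "Re v < 1" for v
      proof -
        define E where "E = (\<lambda>w. exp (of_real q * Ln w))"
        have "cmod (E (2 + v) - E (cnj (2 - v))) \<le> 1 * cmod ((2 + v) - cnj (2 - v))"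
        proof (rule field_differentiable_bound)
          show "convex {w. 1 \<le> Re w}" by (simp add: convex_halfspace_Re_ge)
          fix x assume x: "x \<in> {w. 1 \<le> Re w}"
          then have x0: "x \<noteq> 0" "x \<notin> \<real>\<^sub>\<le>\<^sub>0" by (auto simp: complex_nonpos_Reals_iff)
          show "(E has_field_derivative E x * (of_real q * inverse x)) (at x within {w. 1 \<le> Re w})"
            unfolding E_def using x0 by (auto intro!: derivative_eq_intros simp: field_simps)
          have x1: "1 \<le> cmod x" using x complex_Re_le_cmod[of x] by simp
          have "cmod (E x) = cmod x powr q" unfolding E_def by (rule cmod_exp_mult_Ln[OF x0(1)])
          then have "cmod (E x * (of_real q * inverse x)) = q * (cmod x powr q / cmod x)"
            using q x0 by (simp add: norm_mult norm_inverse divide_inverse)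
          also have "cmod x powr q / cmod x = cmod x powr (q - 1)" using x0 by (simp add: powr_diff)
          also have "q * cmod x powr (q - 1) \<le> 1 * 1" using q x1 powr_mono2'[of "q - 1" 1 "cmod x"] by (intro mult_mono) auto
          finally show "cmod (E x * (of_real q * inverse x)) \<le> 1" by simp
        qed (use v in auto)
        moreover have "(2 + v) - cnj (2 - v) = of_real (2 * Re v)" by (simp add: complex_eq_iff)
        ultimately have "Re (E (2 + v)) - Re (E (cnj (2 - v))) \<le> 2 * Re v"
          using v abs_Re_le_cmod[of "E (2 + v) - E (cnj (2 - v))"] by (simp add: norm_mult)
        moreover have "E (cnj (2 - v)) = cnj (E (2 - v))"
        proof -
          have "2 - v \<notin> \<real>\<^sub>\<le>\<^sub>0" using v by (auto simp: complex_nonpos_Reals_iff)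
          from cnj_Ln[OF this] have "Ln (cnj (2 - v)) = cnj (Ln (2 - v))" by (rule HOL.sym)
          then show ?thesis unfolding E_def exp_cnj complex_cnj_mult by simp
        qed
        ultimately show ?thesis by (simp add: k_def E_def)
      qed
      show ?thesis
      proof (cases "0 \<le> Re w")
        case True
        then show ?thesis using *[of w] pos[of w] Re_near(2)[OF w] 3 by (simp add: V_def)
      next
        case False
        then show ?thesis using *[of "- w"] pos[of "- w"] sym[of w] Re_near(1)[OF w] 3 by (simp add: V_def)
      qed
    qed
    ultimately show ?thesis unfolding supported_def by (intro exI[of _ 1] conjI exI[of _ V]) auto
  qed
qed

lemma disc_subharmonic_kolmogorov_fn:
  assumes q: "0 < q" "q < 1" and F: "F holomorphic_on ball 0 1"
  shows "disc_subharmonic (\<lambda>z. kolmogorov_fn q (F z))"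
proof (rule disc_subharmonicI)
  show "continuous_on (ball 0 1) (\<lambda>z. kolmogorov_fn q (F z))"
    by (intro continuous_on_compose2[OF continuous_kolmogorov_fn] holomorphic_on_imp_continuous_on F) auto
  show "supported (\<lambda>z. kolmogorov_fn q (F z)) z" if "z \<in> ball 0 1" for z
    by (rule supported_compose[of "kolmogorov_fn q", OF supported_kolmogorov_fn[OF q] F]) (use that in auto)
qed

section \<open>Holomorphic functions of several variables\<close>

lemma norm_vector_smult: "norm (c *s v) = cmod c * norm (v :: complex ^ 'n::finite)"
  unfolding norm_vec_def by (simp add: norm_mult L2_set_right_distrib)

lemma scaleR_eq_smult: "r *\<^sub>R v = of_real r *s (v :: complex ^ 'n)"
  by (simp add: vec_eq_iff) (simp add: scaleR_conv_of_real)

lemma bounded_linear_smult_left: "bounded_linear (\<lambda>c. c *s (v :: complex ^ 'n::finite))"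
  by (rule bounded_linear_intro[of _ "norm v"])
     (auto simp: vec_eq_iff norm_vector_smult algebra_simps)

lemma has_derivative_vecI:
  fixes F :: "'a::real_normed_vector \<Rightarrow> complex ^ 'n::finite"
  assumes "\<And>i. ((\<lambda>z. F z $ i) has_derivative d i) net"
  shows "(F has_derivative (\<lambda>v. \<chi> i. d i v)) net"
proof -
  have "((\<lambda>z. \<Sum>i\<in>UNIV. (F z $ i) *s axis i 1) has_derivative (\<lambda>v. \<Sum>i\<in>UNIV. (d i v) *s axis i 1)) net"
    by (intro has_derivative_sum bounded_linear.has_derivative[OF bounded_linear_smult_left] assms)
  moreover have "(\<lambda>v. \<Sum>i\<in>UNIV. (d i v) *s axis i 1) = (\<lambda>v. \<chi> i. d i v)"
    using basis_expansion[of "\<chi> i. d i v" for v] by simp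
  ultimately show ?thesis by (simp add: basis_expansion)
qed

lemmas continuous_on_smult [continuous_intros] =
  bounded_linear.continuous_on[OF bounded_linear_smult_left]

lemma continuous_on_smult_right [continuous_intros]:
  fixes f :: "'a::topological_space \<Rightarrow> complex ^ 'n::finite"
  assumes "continuous_on S f"
  shows "continuous_on S (\<lambda>x. c *s f x)"
proof -
  have "bounded_linear (\<lambda>v :: complex ^ 'n. c *s v)"
    by (rule bounded_linear_intro[of _ "cmod c"])
       (auto simp: vec_eq_iff norm_vector_smult algebra_simps)
  from bounded_linear.continuous_on[OF this assms] show ?thesis .
qed

section \<open>Complex differentiability and slices by complex lines\<close>

lemma cn_holomorphic_onE:
  assumes "cn_holomorphic_on f S" "z \<in> S"
  shows "(f has_derivative frechet_derivative f (at z)) (at z)"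
    and "frechet_derivative f (at z) (c *s v) = c * frechet_derivative f (at z) v"
proof -
  obtain f' where f': "(f has_derivative f') (at z)" "\<forall>c v. f' (c *s v) = c * f' v"
    using assms unfolding cn_holomorphic_on_def by blast
  have eq: "frechet_derivative f (at z) = f'" by (rule frechet_derivative_at[OF f'(1), symmetric])
  show "(f has_derivative frechet_derivative f (at z)) (at z)"
    "frechet_derivative f (at z) (c *s v) = c * frechet_derivative f (at z) v" using f' unfolding eq by auto
qed

lemma cn_holomorphic_imp_continuous_on: "cn_holomorphic_on f S \<Longrightarrow> continuous_on S f"
  unfolding cn_holomorphic_on_def
  by (meson continuous_at_imp_continuous_on has_derivative_continuous)

lemma cn_holomorphic_const [simp, intro]: "cn_holomorphic_on (\<lambda>_. c) S"
  unfolding cn_holomorphic_on_def by (auto intro!: exI[of _ "\<lambda>_. 0"])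

lemma cn_holomorphic_component: "cn_holomorphic_on (\<lambda>z. z $ j) S"
  unfolding cn_holomorphic_on_def
  by (intro ballI exI[of _ "\<lambda>z. z $ j"])
     (auto intro!: bounded_linear.has_derivative[OF bounded_linear_vec_nth] has_derivative_ident)

lemma cn_holomorphic_add:
  assumes "cn_holomorphic_on f S" "cn_holomorphic_on g S"
  shows "cn_holomorphic_on (\<lambda>z. f z + g z) S"
  unfolding cn_holomorphic_on_def
proof
  fix z assume z: "z \<in> S"
  note f = cn_holomorphic_onE[OF assms(1) z] and g = cn_holomorphic_onE[OF assms(2) z]
  show "\<exists>f'. ((\<lambda>z. f z + g z) has_derivative f') (at z) \<and> (\<forall>c v. f' (c *s v) = c * f' v)"
    by (rule exI, rule conjI, rule has_derivative_add[OF f(1) g(1)]) (simp add: f(2) g(2) distrib_left)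
qed

lemma cn_holomorphic_mult:
  assumes "cn_holomorphic_on f S" "cn_holomorphic_on g S"
  shows "cn_holomorphic_on (\<lambda>z. f z * g z) S"
  unfolding cn_holomorphic_on_def
proof
  fix z assume z: "z \<in> S"
  note f = cn_holomorphic_onE[OF assms(1) z] and g = cn_holomorphic_onE[OF assms(2) z]
  show "\<exists>f'. ((\<lambda>z. f z * g z) has_derivative f') (at z) \<and> (\<forall>c v. f' (c *s v) = c * f' v)"
    by (rule exI, rule conjI, rule has_derivative_mult[OF f(1) g(1)]) (simp add: f(2) g(2) algebra_simps)
qed

lemma cn_holomorphic_compose:
  assumes f: "cn_holomorphic_on f S" and G: "G holomorphic_on T" "open T" "f ` S \<subseteq> T"
  shows "cn_holomorphic_on (\<lambda>z. G (f z)) S"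
  unfolding cn_holomorphic_on_def
proof
  fix z assume z: "z \<in> S"
  note f = cn_holomorphic_onE[OF f z]
  have "(G has_field_derivative deriv G (f z)) (at (f z))"
    using G z by (intro holomorphic_derivI) auto
  then have "(G has_derivative (*) (deriv G (f z))) (at (f z))" by (simp add: has_field_derivative_def)
  from has_derivative_compose[OF f(1) this]
  have "((\<lambda>z. G (f z)) has_derivative (\<lambda>v. deriv G (f z) * frechet_derivative f (at z) v)) (at z)" .
  then show "\<exists>f'. ((\<lambda>z. G (f z)) has_derivative f') (at z) \<and> (\<forall>c v. f' (c *s v) = c * f' v)"
    by (intro exI[of _ "\<lambda>v. deriv G (f z) * frechet_derivative f (at z) v"] conjI) (simp_all add: f(2))
qed

lemma cn_holomorphic_map_compose:
  assumes f: "cn_holomorphic_on f T" and F: "cn_holomorphic_map_on F S" "F ` S \<subseteq> T"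
  shows "cn_holomorphic_on (\<lambda>z. f (F z)) S"
  unfolding cn_holomorphic_on_def
proof
  fix z assume z: "z \<in> S"
  have c: "cn_holomorphic_on (\<lambda>z. F z $ i) S" for i using F by (simp add: cn_holomorphic_map_on_def)
  note F' = cn_holomorphic_onE[OF c z]
  define D where "D = (\<lambda>v. \<chi> i. frechet_derivative (\<lambda>z. F z $ i) (at z) v)"
  have D: "(F has_derivative D) (at z)"
    unfolding D_def by (intro has_derivative_vecI F'(1))
  have Dc: "D (c *s v) = c *s D v" for c v unfolding D_def by (simp add: vec_eq_iff F'(2))
  have Fz: "F z \<in> T" using F z by auto
  note f' = cn_holomorphic_onE[OF f Fz]
  from has_derivative_compose[OF D f'(1)]
  have "((\<lambda>z. f (F z)) has_derivative (\<lambda>v. frechet_derivative f (at (F z)) (D v))) (at z)" .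
  then show "\<exists>f'. ((\<lambda>z. f (F z)) has_derivative f') (at z) \<and> (\<forall>c v. f' (c *s v) = c * f' v)"
    by (intro exI[of _ "\<lambda>v. frechet_derivative f (at (F z)) (D v)"] conjI) (simp_all add: f'(2) Dc)
qed

lemma cn_holomorphic_slice_deriv:
  assumes f: "cn_holomorphic_on f S" and z: "a + w *s v \<in> S"
  shows "((\<lambda>w. f (a + w *s v)) has_field_derivative frechet_derivative f (at (a + w *s v)) v) (at w)"
proof -
  note f' = cn_holomorphic_onE[OF f z]
  have "((\<lambda>w. a + w *s v) has_derivative (\<lambda>c. c *s v)) (at w)"
    by (auto intro!: derivative_eq_intros bounded_linear.has_derivative[OF bounded_linear_smult_left])
  from has_derivative_compose[OF this f'(1)] show ?thesis
    by (simp add: has_field_derivative_def f'(2) mult.commute[of _ "frechet_derivative f (at (a + w *s v)) v"])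
qed

lemma cn_holomorphic_slice:
  assumes f: "cn_holomorphic_on f S" and T: "\<And>w. w \<in> T \<Longrightarrow> a + w *s v \<in> S"
  shows "(\<lambda>w. f (a + w *s v)) holomorphic_on T"
  unfolding holomorphic_on_def field_differentiable_def
  using cn_holomorphic_slice_deriv[OF f T] has_field_derivative_at_within by blast

text \<open>A radius for complex slices that serves all centres near \<open>z0\<close>; the added 1
  also covers \<open>v = 0\<close>.\<close>

lemma ball_add_smult:
  fixes v :: "complex ^ 'n::finite"
  assumes S: "cball z0 (2 * \<rho>) \<subseteq> S" and z: "z \<in> cball z0 \<rho>" and w: "cmod w \<le> \<rho> / (norm v + 1)"
  shows "z + w *s v \<in> S"
proof -
  have \<rho>: "0 \<le> \<rho>" using z by (auto intro: order_trans[OF zero_le_dist])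
  have "cmod w * norm v \<le> \<rho> / (norm v + 1) * norm v" using w by (intro mult_right_mono) auto
  also have "\<dots> = \<rho> * (norm v / (norm v + 1))" by simp
  also have "\<dots> \<le> \<rho> * 1" using \<rho> by (intro mult_left_mono) (auto simp: divide_le_eq_1 add_nonneg_pos)
  finally have "norm (w *s v) \<le> \<rho>" unfolding mult_1_right by (simp add: norm_vector_smult)
  then have "dist z0 (z + w *s v) \<le> \<rho> + \<rho>"
    using z dist_triangle[of z0 "z + w *s v" z] by (simp add: dist_norm)
  then show ?thesis using S by auto
qed

text \<open>Holomorphy only provides a derivative at each point. Its continuity follows from the
  Cauchy estimate for the difference of the parallel slices through \<open>x\<close> and
  \<open>z0\<close>, which is uniformly small because \<open>f\<close> is uniformly continuous on a
  compact ball.\<close>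

lemma continuous_on_cn_deriv:
  fixes f :: "complex ^ 'n::finite \<Rightarrow> complex"
  assumes S: "open S" and f: "cn_holomorphic_on f S"
  shows "continuous_on S (\<lambda>z. frechet_derivative f (at z) v)"
proof -
  have "isCont (\<lambda>z. frechet_derivative f (at z) v) z0" if z0: "z0 \<in> S" for z0
  proof -
    obtain \<rho>' where "0 < \<rho>'" "cball z0 \<rho>' \<subseteq> S" using S z0 open_contains_cball by blast
    then obtain \<rho> where \<rho>: "0 < \<rho>" "cball z0 (2 * \<rho>) \<subseteq> S" by (metis field_sum_of_halves half_gt_zero mult_2)
    define r where "r = \<rho> / (norm v + 1)"
    have r: "0 < r" using \<rho> by (simp add: r_def add_nonneg_pos)
    have inS: "z + w *s v \<in> S" if "z \<in> cball z0 \<rho>" "cmod w \<le> r" for z w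
      using ball_add_smult[OF \<rho>(2) that(1)] that(2) by (simp add: r_def)
    have uc: "uniformly_continuous_on (cball z0 (2 * \<rho>)) f"
      using continuous_on_subset[OF cn_holomorphic_imp_continuous_on[OF f] \<rho>(2)]
      by (intro compact_uniformly_continuous) auto
    show ?thesis
      unfolding continuous_at_eps_delta
    proof (intro allI impI)
      fix e :: real assume e: "0 < e"
      obtain d where d: "0 < d" "\<And>x y. x \<in> cball z0 (2 * \<rho>) \<Longrightarrow> y \<in> cball z0 (2 * \<rho>) \<Longrightarrow> dist y x < d \<Longrightarrow> dist (f y) (f x) < e * r / 2"
        using uc e r unfolding uniformly_continuous_on_def by (metis half_gt_zero mult_pos_pos)
      show "\<exists>d>0. \<forall>x. dist x z0 < d \<longrightarrow> dist (frechet_derivative f (at x) v) (frechet_derivative f (at z0) v) < e"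
      proof (intro exI[of _ "min d \<rho>"] conjI allI impI)
        fix x assume x: "dist x z0 < min d \<rho>"
        have xb: "x \<in> cball z0 \<rho>" "z0 \<in> cball z0 \<rho>" using x \<rho> by (auto simp: dist_commute)
        define E where "E = (\<lambda>w. f (x + w *s v) - f (z0 + w *s v))"
        have E: "E holomorphic_on cball 0 r"
          unfolding E_def using inS xb by (intro holomorphic_intros cn_holomorphic_slice[OF f]) auto
        have E': "(E has_field_derivative frechet_derivative f (at x) v - frechet_derivative f (at z0) v) (at 0)"
          unfolding E_def using inS[OF xb(1), of 0] inS[OF xb(2), of 0] r
            cn_holomorphic_slice_deriv[OF f, of x 0 v] cn_holomorphic_slice_deriv[OF f, of z0 0 v]
          by (intro derivative_intros) auto
        have "norm ((deriv ^^ 1) E 0) \<le> fact 1 * (e * r / 2) / r ^ 1"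
        proof (rule Cauchy_inequality)
          fix w assume w: "cmod (0 - w) = r"
          have "x + w *s v \<in> cball z0 (2 * \<rho>)" "z0 + w *s v \<in> cball z0 (2 * \<rho>)"
            using ball_add_smult[OF order_refl, of x z0 \<rho> w v] ball_add_smult[OF order_refl, of z0 z0 \<rho> w v] xb w
            by (auto simp: r_def)
          moreover have "dist (x + w *s v) (z0 + w *s v) < d" using x by (simp add: dist_norm)
          ultimately show "cmod (E w) \<le> e * r / 2"
            using d(2)[of "z0 + w *s v" "x + w *s v"] by (simp add: E_def dist_norm)
        qed (use E r in \<open>auto intro: holomorphic_on_imp_continuous_on holomorphic_on_subset\<close>)
        then have "norm (frechet_derivative f (at x) v - frechet_derivative f (at z0) v) \<le> e / 2"
          using r DERIV_imp_deriv[OF E'] by simp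
        then show "dist (frechet_derivative f (at x) v) (frechet_derivative f (at z0) v) < e"
          using e by (simp add: dist_norm)
      qed (use d \<rho> in auto)
    qed
  qed
  then show ?thesis by (simp add: continuous_at_imp_continuous_on)
qed




section \<open>Second derivatives and pluriharmonicity\<close>

lemma cn_holomorphic_C1:
  fixes f :: "complex ^ 'n::finite \<Rightarrow> complex"
  assumes S: "open S" and f: "cn_holomorphic_on f S"
  obtains F :: "complex ^ 'n \<Rightarrow> (complex ^ 'n) \<Rightarrow>\<^sub>L complex"
    where "\<And>z. z \<in> S \<Longrightarrow> (f has_derivative F z) (at z)" "\<And>z. z \<in> S \<Longrightarrow> blinfun_apply (F z) = frechet_derivative f (at z)"
      "continuous_on S F"
proof
  define F where "F = (\<lambda>z. Blinfun (frechet_derivative f (at z)))"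
  show eq: "blinfun_apply (F z) = frechet_derivative f (at z)" if "z \<in> S" for z
    unfolding F_def using cn_holomorphic_onE(1)[OF f that]
    by (intro bounded_linear_Blinfun_apply has_derivative_bounded_linear)
  show "(f has_derivative F z) (at z)" if "z \<in> S" for z
    unfolding eq[OF that] by (rule cn_holomorphic_onE(1)[OF f that])
  show "continuous_on S F"
    by (rule continuous_on_blinfun_componentwise)
       (use continuous_on_cn_deriv[OF S f] eq in \<open>simp cong: continuous_on_cong\<close>)
qed

text \<open>Cauchy's formula for the derivative of a slice. The gain is that \<open>z\<close> enters
  only through values of \<open>f\<close>, so that the formula can be differentiated under the
  integral sign.\<close>

lemma cn_deriv_integral:
  fixes f :: "complex ^ 'n::finite \<Rightarrow> complex"
  assumes f: "cn_holomorphic_on f S" and r: "0 < r" and inS: "\<And>w. cmod w \<le> r \<Longrightarrow> z + w *s v \<in> S"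
  shows "((\<lambda>t. f (z + (of_real r * cis t) *s v) * cis (- t)) has_integral (2 * of_real pi * of_real r * frechet_derivative f (at z) v)) {0..2 * pi}"
proof -
  define G where "G = (\<lambda>w. f (z + w *s v))"
  have G: "G holomorphic_on cball 0 r" unfolding G_def by (rule cn_holomorphic_slice[OF f]) (use inS in auto)
  have G': "deriv G 0 = frechet_derivative f (at z) v"
    using cn_holomorphic_slice_deriv[OF f, of z 0 v] inS[of 0] r by (simp add: G_def DERIV_imp_deriv)
  have "((\<lambda>u. G u / (u - 0) ^ Suc 1) has_contour_integral (2 * pi * \<i>) / fact 1 * (deriv ^^ 1) G 0) (circlepath 0 r)"
    using G r by (intro Cauchy_has_contour_integral_higher_derivative_circlepath)
      (auto intro: holomorphic_on_imp_continuous_on holomorphic_on_subset)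
  then have "((\<lambda>u. G u / (u * u)) has_contour_integral (2 * pi * \<i>) * frechet_derivative f (at z) v) (part_circlepath 0 r 0 (2 * pi))"
    by (simp add: G' circlepath_def power2_eq_square)
  then have "((\<lambda>t. G (of_real r * cis t) / ((of_real r * cis t) * (of_real r * cis t)) * of_real r * \<i> * cis t) has_integral (2 * pi * \<i>) * frechet_derivative f (at z) v) {0..2 * pi}"
    by (subst (asm) has_contour_integral_part_circlepath_iff) (auto simp: mult.assoc)
  from has_integral_mult_right[OF this, of "of_real r / \<i>"]
  have "((\<lambda>t. of_real r / \<i> * (G (of_real r * cis t) / ((of_real r * cis t) * (of_real r * cis t)) * of_real r * \<i> * cis t)) has_integral 2 * of_real pi * of_real r * frechet_derivative f (at z) v) {0..2 * pi}"
    by (simp add: mult_ac)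
  moreover have "of_real r / \<i> * (G (of_real r * cis t) / ((of_real r * cis t) * (of_real r * cis t)) * of_real r * \<i> * cis t)
      = f (z + (of_real r * cis t) *s v) * cis (- t)" for t
    using r by (simp add: G_def cis_inverse[symmetric] field_simps del: cis_inverse)
  ultimately show ?thesis by simp
qed

text \<open>The integral formula is differentiated by the Leibniz rule; the result is complex linear
  because the derivative of \<open>f\<close> is so at every point of the circle of
  integration.\<close>

lemma cn_holomorphic_deriv:
  fixes f :: "complex ^ 'n::finite \<Rightarrow> complex"
  assumes S: "open S" and f: "cn_holomorphic_on f S"
  shows "cn_holomorphic_on (\<lambda>z. frechet_derivative f (at z) v) S"
  unfolding cn_holomorphic_on_def
proof
  fix z0 assume z0: "z0 \<in> S"
  obtain F where F: "\<And>z. z \<in> S \<Longrightarrow> (f has_derivative blinfun_apply (F z)) (at z)"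
      "\<And>z. z \<in> S \<Longrightarrow> blinfun_apply (F z) = frechet_derivative f (at z)" "continuous_on S F"
    using cn_holomorphic_C1[OF S f] by metis
  obtain \<rho>' where "0 < \<rho>'" "cball z0 \<rho>' \<subseteq> S" using S z0 open_contains_cball by blast
  then obtain \<rho> where \<rho>: "0 < \<rho>" "cball z0 (2 * \<rho>) \<subseteq> S" by (metis field_sum_of_halves half_gt_zero mult_2)
  define r where "r = \<rho> / (norm v + 1)"
  have r: "0 < r" using \<rho> by (simp add: r_def add_nonneg_pos)
  have inS: "z + w *s v \<in> S" if "z \<in> ball z0 \<rho>" "cmod w \<le> r" for z w
    using ball_add_smult[OF \<rho>(2)] that by (auto simp: r_def)
  have inS': "z + (of_real r * cis t) *s v \<in> S" if "z \<in> ball z0 \<rho>" for z t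
    using inS[OF that] r by (simp add: norm_mult)
  define \<phi> where "\<phi> = (\<lambda>z t. f (z + (of_real r * cis t) *s v) * cis (- t))"
  define \<phi>' where "\<phi>' = (\<lambda>z t. blinfun_mult_left (cis (- t)) o\<^sub>L F (z + (of_real r * cis t) *s v))"
  have int: "(\<phi> z has_integral (2 * of_real pi * of_real r * frechet_derivative f (at z) v)) (cbox 0 (2 * pi))" if "z \<in> ball z0 \<rho>" for z
    unfolding \<phi>_def using cn_deriv_integral[OF f r, of z v] inS[OF that] by simp
  have contF: "continuous_on (ball z0 \<rho> \<times> cbox 0 (2 * pi)) (\<lambda>(z, t). \<phi>' z t)"
    unfolding \<phi>'_def case_prod_beta
  proof (intro bounded_bilinear.continuous_on[OF bounded_bilinear_blinfun_compose])
    show "continuous_on (ball z0 \<rho> \<times> cbox 0 (2 * pi)) (\<lambda>x. blinfun_mult_left (cis (- snd x)) :: complex \<Rightarrow>\<^sub>L complex)"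
      by (intro bounded_linear.continuous_on[OF bounded_linear_blinfun_mult_left] continuous_intros)
    show "continuous_on (ball z0 \<rho> \<times> cbox 0 (2 * pi)) (\<lambda>x. F (fst x + (of_real r * cis (snd x)) *s v))"
    proof (rule continuous_on_compose2[OF F(3)])
      show "(\<lambda>x. fst x + (of_real r * cis (snd x)) *s v) ` (ball z0 \<rho> \<times> cbox 0 (2 * pi)) \<subseteq> S"
        by (intro image_subsetI inS') (simp add: mem_Times_iff)
    qed (intro continuous_intros)
  qed
  have L: "((\<lambda>z. integral (cbox 0 (2 * pi)) (\<phi> z)) has_derivative integral (cbox 0 (2 * pi)) (\<phi>' z0)) (at z0 within ball z0 \<rho>)"
  proof (rule leibniz_rule)
    fix z t assume z: "z \<in> ball z0 \<rho>"
    have "((\<lambda>z. z + (of_real r * cis t) *s v) has_derivative (\<lambda>u. u)) (at z within ball z0 \<rho>)"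
      by (rule has_derivative_add_const[OF has_derivative_ident])
    from has_derivative_compose[OF this F(1)[OF inS'[OF z]]]
    have D: "((\<lambda>z. f (z + (of_real r * cis t) *s v)) has_derivative (\<lambda>u. F (z + (of_real r * cis t) *s v) u)) (at z within ball z0 \<rho>)" .
    have eq: "blinfun_apply (\<phi>' z t) = (\<lambda>u. F (z + (of_real r * cis t) *s v) u * cis (- t))"
      by (simp add: \<phi>'_def fun_eq_iff)
    show "((\<lambda>z. \<phi> z t) has_derivative blinfun_apply (\<phi>' z t)) (at z within ball z0 \<rho>)"
      unfolding eq unfolding \<phi>_def by (rule has_derivative_mult_left[OF D])
    show "\<phi> z integrable_on cbox 0 (2 * pi)" using int[OF z] by (rule has_integral_integrable)
  qed (use contF \<rho> in simp_all)
  define c where "c = 2 * of_real pi * (of_real r :: complex)"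
  have c: "c \<noteq> 0" using r by (simp add: c_def)
  define J where "J = integral (cbox 0 (2 * pi)) (\<phi>' z0)"
  have "z0 \<in> ball z0 \<rho>" using \<rho> by simp
  from L have "((\<lambda>z. integral (cbox 0 (2 * pi)) (\<phi> z)) has_derivative blinfun_apply J) (at z0)"
    unfolding J_def at_within_open[OF \<open>z0 \<in> ball z0 \<rho>\<close> open_ball] .
  from bounded_linear.has_derivative[OF bounded_linear_divide this]
  have "((\<lambda>z. integral (cbox 0 (2 * pi)) (\<phi> z) / c) has_derivative (\<lambda>u. J u / c)) (at z0)" .
  then have der: "((\<lambda>z. frechet_derivative f (at z) v) has_derivative (\<lambda>u. J u / c)) (at z0)"
  proof (rule has_derivative_transform_within_open)
    show "integral (cbox 0 (2 * pi)) (\<phi> z) / c = frechet_derivative f (at z) v" if "z \<in> ball z0 \<rho>" for z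
      using integral_unique[OF int[OF that]] c by (simp add: c_def)
  qed (use \<rho> in auto)
  have Jint: "\<phi>' z0 integrable_on cbox 0 (2 * pi)"
  proof (rule integrable_continuous)
    have "continuous_on (cbox 0 (2 * pi)) (\<lambda>t. (\<lambda>(z, t). \<phi>' z t) (z0, t))"
      by (rule continuous_on_compose2[OF contF]) (use \<rho> in \<open>auto intro!: continuous_intros\<close>)
    then show "continuous_on (cbox 0 (2 * pi)) (\<phi>' z0)" by simp
  qed
  have Japp: "J u = integral (cbox 0 (2 * pi)) (\<lambda>t. \<phi>' z0 t u)" for u
    unfolding J_def by (rule blinfun_apply_integral[OF Jint])
  have lin: "\<phi>' z0 t (d *s u) = d * \<phi>' z0 t u" for t d u
  proof -
    have w: "z0 + (of_real r * cis t) *s v \<in> S" by (rule inS') (simp add: \<rho>)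
    have "blinfun_apply (\<phi>' z0 t) = (\<lambda>u. frechet_derivative f (at (z0 + (of_real r * cis t) *s v)) u * cis (- t))"
      by (simp add: \<phi>'_def fun_eq_iff F(2)[OF w])
    then show ?thesis by (simp only: cn_holomorphic_onE(2)[OF f w] mult.assoc)
  qed
  have Jlin: "J (d *s u) = d * J u" for d u
  proof -
    have "integral (cbox 0 (2 * pi)) (\<lambda>t. d * \<phi>' z0 t u) = d * integral (cbox 0 (2 * pi)) (\<lambda>t. \<phi>' z0 t u)"
      by (rule integral_mult_right)
    then show ?thesis by (simp only: Japp lin)
  qed
  show "\<exists>f'. ((\<lambda>z. frechet_derivative f (at z) v) has_derivative f') (at z0) \<and> (\<forall>c v. f' (c *s v) = c * f' v)"
    by (intro exI[of _ "\<lambda>u. J u / c"] conjI der) (simp add: Jlin)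
qed

lemma cn_holomorphic_C2:
  fixes f :: "complex ^ 'n::finite \<Rightarrow> complex"
  assumes S: "open S" and f: "cn_holomorphic_on f S"
  obtains F :: "complex ^ 'n \<Rightarrow> (complex ^ 'n) \<Rightarrow>\<^sub>L complex" and F' :: "complex ^ 'n \<Rightarrow> (complex ^ 'n) \<Rightarrow>\<^sub>L ((complex ^ 'n) \<Rightarrow>\<^sub>L complex)"
    where "\<And>z. z \<in> S \<Longrightarrow> (f has_derivative F z) (at z)" "\<And>z. z \<in> S \<Longrightarrow> (F has_derivative F' z) (at z)"
      "continuous_on S F'"
proof -
  obtain F where F: "\<And>z. z \<in> S \<Longrightarrow> (f has_derivative blinfun_apply (F z)) (at z)"
      "\<And>z. z \<in> S \<Longrightarrow> blinfun_apply (F z) = frechet_derivative f (at z)" "continuous_on S F"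
    using cn_holomorphic_C1[OF S f] by metis
  have "\<exists>G. (\<forall>z\<in>S. ((\<lambda>z. frechet_derivative f (at z) i) has_derivative blinfun_apply (G z)) (at z)) \<and> continuous_on S G" for i
    using cn_holomorphic_C1[OF S cn_holomorphic_deriv[OF S f, of i]] by metis
  then obtain G where G: "\<And>i z. z \<in> S \<Longrightarrow> ((\<lambda>z. frechet_derivative f (at z) i) has_derivative blinfun_apply (G i z)) (at z)"
      "\<And>i. continuous_on S (G i)" by metis
  \<comment> \<open>\<open>K i c\<close> is the functional
    \<open>v \<mapsto> (v \<bullet> i) *\<^sub>R c\<close>. It recovers a real linear functional
    from its values on the real basis, so that the operator-valued derivative becomes a finite sum
    built from scalar-valued ones.\<close>
  define K :: "complex ^ 'n \<Rightarrow> complex \<Rightarrow>\<^sub>L ((complex ^ 'n) \<Rightarrow>\<^sub>L complex)" where "K = (\<lambda>i. Blinfun (\<lambda>c. blinfun_scaleR_left c o\<^sub>L blinfun_inner_left i))"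
  have K: "blinfun_apply (K i) = (\<lambda>c. blinfun_scaleR_left c o\<^sub>L blinfun_inner_left i)" for i
    unfolding K_def
    by (intro bounded_linear_Blinfun_apply bounded_linear_compose[OF bounded_bilinear.bounded_linear_left[OF bounded_bilinear_blinfun_compose]]
          bounded_linear_blinfun_scaleR_left)
  have rep: "T = (\<Sum>i\<in>Basis. K i (T i))" for T :: "(complex ^ 'n) \<Rightarrow>\<^sub>L complex"
  proof (rule blinfun_eqI)
    fix v :: "complex ^ 'n"
    have "T v = T (\<Sum>i\<in>Basis. (v \<bullet> i) *\<^sub>R i)" by (simp add: euclidean_representation)
    also have "\<dots> = (\<Sum>i\<in>Basis. (v \<bullet> i) *\<^sub>R T i)" by (simp add: blinfun.sum_right blinfun.scaleR_right)
    finally show "T v = (\<Sum>i\<in>Basis. K i (T i)) v" by (simp add: K blinfun.sum_left)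
  qed
  define F' where "F' = (\<lambda>z. \<Sum>i\<in>Basis. K i o\<^sub>L G i z)"
  show ?thesis
  proof (rule that[OF F(1)])
    fix z assume z: "z \<in> S"
    have "((\<lambda>z. \<Sum>i\<in>Basis. K i (frechet_derivative f (at z) i)) has_derivative (\<lambda>u. \<Sum>i\<in>Basis. K i (G i z u))) (at z)"
      by (intro has_derivative_sum bounded_linear.has_derivative[OF blinfun.bounded_linear_right] G(1)[OF z])
    moreover have "(\<lambda>u. \<Sum>i\<in>Basis. K i (G i z u)) = blinfun_apply (F' z)"
      by (simp add: F'_def blinfun.sum_left fun_eq_iff)
    ultimately have "((\<lambda>z. \<Sum>i\<in>Basis. K i (frechet_derivative f (at z) i)) has_derivative blinfun_apply (F' z)) (at z)" by simp
    then show "(F has_derivative blinfun_apply (F' z)) (at z)"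
      by (rule has_derivative_transform_within_open[OF _ S z]) (simp add: rep[symmetric] flip: F(2))
  next
    show "continuous_on S F'" unfolding F'_def by (intro continuous_intros G(2))
  qed
qed

lemma cn_holomorphic_deriv_slope:
  assumes "cn_holomorphic_on f S" "z \<in> S"
  shows "frechet_derivative f (at z) (axis k \<i>) = \<i> * frechet_derivative f (at z) (axis k 1)"
proof -
  have "axis k \<i> = \<i> *s axis k (1 :: complex)" by (simp add: vec_eq_iff axis_def)
  then show ?thesis using cn_holomorphic_onE(2)[OF assms] by simp
qed

text \<open>Once the second derivatives are exhibited, \<open>wirtinger_bar\<close> removes
  \<open>h\<close> and leaves the conjugate of a derivative of \<open>g\<close>; that derivative is
  again holomorphic, so \<open>wirtinger\<close> annihilates its conjugate.\<close>

lemma pluriharmonic_add_cnj: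
  fixes h g :: "complex ^ 'n::finite \<Rightarrow> complex"
  assumes S: "open S" and h: "cn_holomorphic_on h S" and g: "cn_holomorphic_on g S"
  shows "pluriharmonic_on (\<lambda>z. h z + cnj (g z)) S"
  unfolding pluriharmonic_on_def
proof (intro conjI allI ballI)
  let ?f = "\<lambda>z. h z + cnj (g z)"
  obtain H H' where H: "\<And>z. z \<in> S \<Longrightarrow> (h has_derivative blinfun_apply (H z)) (at z)"
      "\<And>z. z \<in> S \<Longrightarrow> (H has_derivative blinfun_apply (H' z)) (at z)" "continuous_on S H'"
    using cn_holomorphic_C2[OF S h] by metis
  obtain G G' where G: "\<And>z. z \<in> S \<Longrightarrow> (g has_derivative blinfun_apply (G z)) (at z)"
      "\<And>z. z \<in> S \<Longrightarrow> (G has_derivative blinfun_apply (G' z)) (at z)" "continuous_on S G'"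
    using cn_holomorphic_C2[OF S g] by metis
  define J :: "complex \<Rightarrow>\<^sub>L complex" where "J = Blinfun cnj"
  have J: "blinfun_apply J = cnj" unfolding J_def by (rule bounded_linear_Blinfun_apply) (rule bounded_linear_cnj)
  define JJ :: "((complex ^ 'n) \<Rightarrow>\<^sub>L complex) \<Rightarrow>\<^sub>L ((complex ^ 'n) \<Rightarrow>\<^sub>L complex)" where "JJ = Blinfun (\<lambda>T. J o\<^sub>L T)"
  have JJ: "blinfun_apply JJ = (\<lambda>T. J o\<^sub>L T)" unfolding JJ_def
    by (rule bounded_linear_Blinfun_apply) (rule bounded_bilinear.bounded_linear_right[OF bounded_bilinear_blinfun_compose])
  show "C2_on ?f S"
    unfolding C2_on_def
  proof (intro exI conjI ballI)
    show "(?f has_derivative blinfun_apply (H z + (J o\<^sub>L G z))) (at z)" if "z \<in> S" for z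
    proof -
      have "blinfun_apply (H z + (J o\<^sub>L G z)) = (\<lambda>u. H z u + cnj (G z u))"
        by (simp add: fun_eq_iff blinfun.add_left J)
      then show ?thesis
        using has_derivative_add[OF H(1)[OF that] bounded_linear.has_derivative[OF bounded_linear_cnj G(1)[OF that]]] by simp
    qed
    show "((\<lambda>z. H z + (J o\<^sub>L G z)) has_derivative blinfun_apply (H' z + (JJ o\<^sub>L G' z))) (at z)" if "z \<in> S" for z
    proof -
      have "blinfun_apply (H' z + (JJ o\<^sub>L G' z)) = (\<lambda>u. H' z u + JJ (G' z u))"
        by (simp add: fun_eq_iff blinfun.add_left)
      then show ?thesis
        using has_derivative_add[OF H(2)[OF that] bounded_linear.has_derivative[OF blinfun.bounded_linear_right[of JJ] G(2)[OF that]]]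
        by (simp add: JJ)
    qed
    show "continuous_on S (\<lambda>z. H' z + (JJ o\<^sub>L G' z))" by (intro continuous_intros H(3) G(3))
  qed
  fix j k z assume z: "z \<in> S"
  have bar: "wirtinger_bar k ?f w = cnj (frechet_derivative g (at w) (axis k 1))" if w: "w \<in> S" for w
  proof -
    have "(?f has_derivative (\<lambda>u. frechet_derivative h (at w) u + cnj (frechet_derivative g (at w) u))) (at w)"
      by (intro has_derivative_add bounded_linear.has_derivative[OF bounded_linear_cnj] cn_holomorphic_onE(1)[OF h w] cn_holomorphic_onE(1)[OF g w])
    from frechet_derivative_at[OF this, symmetric] show ?thesis
      unfolding wirtinger_bar_def
      using cn_holomorphic_deriv_slope[OF h w, of k] cn_holomorphic_deriv_slope[OF g w, of k] by (simp add: algebra_simps)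
  qed
  define d where "d = (\<lambda>w. frechet_derivative g (at w) (axis k 1))"
  have d: "cn_holomorphic_on d S" unfolding d_def by (rule cn_holomorphic_deriv[OF S g])
  have "((\<lambda>w. cnj (d w)) has_derivative (\<lambda>u. cnj (frechet_derivative d (at z) u))) (at z)"
    by (intro bounded_linear.has_derivative[OF bounded_linear_cnj] cn_holomorphic_onE(1)[OF d z])
  then have "(wirtinger_bar k ?f has_derivative (\<lambda>u. cnj (frechet_derivative d (at z) u))) (at z)"
    by (rule has_derivative_transform_within_open[OF _ S z]) (simp add: bar d_def)
  from frechet_derivative_at[OF this, symmetric]
  show "wirtinger j (wirtinger_bar k ?f) z = 0"
    unfolding wirtinger_def using cn_holomorphic_deriv_slope[OF d z, of j] by simp
qed

lemma pluriharmonic_cn_holomorphic: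
  "open S \<Longrightarrow> cn_holomorphic_on h S \<Longrightarrow> pluriharmonic_on h S"
  using pluriharmonic_add_cnj[of S h "\<lambda>_. 0"] by simp

section \<open>Radial segments to the boundary of a bounded symmetric domain\<close>

lemma disc_lipschitz:
  fixes f :: "complex \<Rightarrow> complex"
  assumes f: "f holomorphic_on ball c \<rho>" and B: "\<And>w. w \<in> ball c \<rho> \<Longrightarrow> cmod (f w) \<le> B"
    and w: "w \<in> ball c \<rho>"
  shows "cmod (f w - f c) \<le> 3 * B * cmod (w - c) / \<rho>"
proof -
  have \<rho>: "0 < \<rho>" using w zero_le_dist[of c w] unfolding mem_ball by linarith
  have B0: "0 \<le> B" using B[OF w] norm_ge_zero order_trans by blast
  show ?thesis
  proof (cases "B = 0")
    case True
    then have "f w = 0" "f c = 0" using B[OF w] B[of c] \<rho> by auto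
    then show ?thesis using True by simp
  next
    case False
    then have Bp: "0 < B" using B0 by simp
    \<comment> \<open>The difference is at most \<open>2 * B\<close> in modulus; dividing by
      \<open>3 * B\<close> makes the bound strict, as the Schwarz lemma wants it.\<close>
    define g where "g = (\<lambda>x. (f (c + of_real \<rho> * x) - f c) / of_real (3 * B))"
    have inb: "c + of_real \<rho> * x \<in> ball c \<rho>" if "cmod x < 1" for x
      using that \<rho> by (simp add: dist_norm norm_mult)
    have "(\<lambda>x. f (c + of_real \<rho> * x)) holomorphic_on ball 0 1"
    proof -
      have "(f \<circ> (\<lambda>x. c + of_real \<rho> * x)) holomorphic_on ball 0 1"
        by (rule holomorphic_on_compose_gen[OF _ f]) (use inb in \<open>auto intro!: holomorphic_intros\<close>)
      then show ?thesis by (simp add: o_def)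
    qed
    then have g: "g holomorphic_on ball 0 1" unfolding g_def using Bp by (intro holomorphic_intros) auto
    have g1: "cmod (g x) < 1" if "cmod x < 1" for x
    proof -
      have "cmod (f (c + of_real \<rho> * x) - f c) \<le> B + B"
        using norm_triangle_ineq4[of "f (c + of_real \<rho> * x)" "f c"] B[OF inb[OF that]] B[of c] \<rho> by simp
      then show ?thesis using Bp by (simp add: g_def norm_divide)
    qed
    define x where "x = (w - c) / of_real \<rho>"
    have l: "cmod x < 1" "c + of_real \<rho> * x = w" using w \<rho> by (auto simp: x_def norm_divide dist_norm norm_minus_commute)
    have "cmod (g x) \<le> cmod x"
      using Schwarz_Lemma(1)[OF g _ g1 l(1)] by (simp add: g_def)
    then show ?thesis unfolding g_def l(2) using Bp \<rho> by (simp add: x_def norm_divide field_simps)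
  qed
qed

text \<open>The Lipschitz estimate applied to the derivative, whose bound on the half disc comes
  from Cauchy's inequality. The decay like \<open>1 / R^2\<close> later becomes the quadratic error
  of a symmetry.\<close>

lemma disc_second_order:
  fixes f :: "complex \<Rightarrow> complex"
  assumes f: "f holomorphic_on ball 0 R" and R: "2 < R" and B: "\<And>w. w \<in> ball 0 R \<Longrightarrow> cmod (f w) \<le> B"
  shows "cmod (f 1 - f 0 - deriv f 0) \<le> 12 * B / R\<^sup>2"
proof -
  have df: "cmod (deriv f w) \<le> 2 * B / R" if w: "w \<in> ball 0 (R / 2)" for w
  proof -
    have sub: "cball w (R / 2) \<subseteq> ball 0 R"
    proof
      fix x assume "x \<in> cball w (R / 2)"
      then have "cmod (x - w) \<le> R / 2" by (simp add: dist_norm norm_minus_commute)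
      then show "x \<in> ball 0 R" using w norm_triangle_ineq[of "x - w" w] by simp
    qed
    have "cmod ((deriv ^^ 1) f w) \<le> fact 1 * B / (R / 2) ^ 1"
    proof (rule Cauchy_inequality)
      show "f holomorphic_on ball w (R / 2)" using sub by (intro holomorphic_on_subset[OF f]) auto
      show "continuous_on (cball w (R / 2)) f"
        by (rule continuous_on_subset[OF holomorphic_on_imp_continuous_on[OF f] sub])
      show "cmod (f x) \<le> B" if "cmod (w - x) = R / 2" for x
        using sub that by (intro B) (auto simp: dist_norm)
    qed (use R in auto)
    then show ?thesis using R by (simp add: mult.commute)
  qed
  have hdf: "deriv f holomorphic_on ball 0 (R / 2)"
    using R by (intro holomorphic_deriv holomorphic_on_subset[OF f]) auto
  define g where "g = (\<lambda>w. f w - deriv f 0 * w)"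
  have "cmod (g 1 - g 0) \<le> 12 * B / R\<^sup>2 * cmod (1 - 0 :: complex)"
  proof (rule field_differentiable_bound[of "cball 0 1" g "\<lambda>w. deriv f w - deriv f 0"])
    fix w :: complex assume w: "w \<in> cball 0 1"
    have "(f has_field_derivative deriv f w) (at w within cball 0 1)"
      by (rule has_field_derivative_at_within, rule holomorphic_derivI[OF f]) (use R w in auto)
    then show "(g has_field_derivative deriv f w - deriv f 0) (at w within cball 0 1)"
      unfolding g_def by (rule DERIV_diff) (rule DERIV_cmult_Id)
    have "cmod (deriv f w - deriv f 0) \<le> 3 * (2 * B / R) * cmod (w - 0) / (R / 2)"
      by (rule disc_lipschitz[OF hdf df]) (use w R in auto)
    also have "\<dots> = 12 * B / R\<^sup>2 * cmod w" by (simp add: power2_eq_square)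
    also have "\<dots> \<le> 12 * B / R\<^sup>2 * 1"
    proof (rule mult_left_mono)
      have "cmod (f 0) \<le> B" using B[of 0] R by simp
      then have "0 \<le> B" using norm_ge_zero[of "f 0"] by linarith
      then show "0 \<le> 12 * B / R\<^sup>2" by simp
    qed (use w in auto)
    finally show "cmod (deriv f w - deriv f 0) \<le> 12 * B / R\<^sup>2" by simp
  qed auto
  then show ?thesis by (simp add: g_def algebra_simps)
qed

section \<open>A distance of Caratheodory type\<close>

definition disc_valued :: "(complex ^ 'n::finite) set \<Rightarrow> (complex ^ 'n \<Rightarrow> complex) set" where
  "disc_valued \<Omega> = {F. cn_holomorphic_on F \<Omega> \<and> (\<forall>z\<in>\<Omega>. cmod (F z) \<le> 1)}"

text \<open>The Caratheodory distance with the Euclidean metric of the disc instead of the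
  hyperbolic one. Contraction under holomorphic self-maps and the triangle inequality survive this
  change, and the distance of two points of the domain is at most 2.\<close>

definition cdist :: "(complex ^ 'n::finite) set \<Rightarrow> complex ^ 'n \<Rightarrow> complex ^ 'n \<Rightarrow> real" where
  "cdist \<Omega> a b = (SUP F\<in>disc_valued \<Omega>. cmod (F a - F b))"

lemma zero_disc_valued: "(\<lambda>_. 0) \<in> disc_valued \<Omega>"
  by (simp add: disc_valued_def)

lemma disc_valued_diff_le_2:
  assumes "a \<in> \<Omega>" "b \<in> \<Omega>" "F \<in> disc_valued \<Omega>"
  shows "cmod (F a - F b) \<le> 2"
proof -
  have "cmod (F a) \<le> 1" "cmod (F b) \<le> 1" using assms by (auto simp: disc_valued_def)
  then show ?thesis using norm_triangle_ineq4[of "F a" "F b"] by linarith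
qed

lemma cdist_upper:
  assumes "a \<in> \<Omega>" "b \<in> \<Omega>" "F \<in> disc_valued \<Omega>"
  shows "cmod (F a - F b) \<le> cdist \<Omega> a b"
  unfolding cdist_def
proof (rule cSUP_upper[OF assms(3)])
  show "bdd_above ((\<lambda>F. cmod (F a - F b)) ` disc_valued \<Omega>)"
    by (rule bdd_aboveI2[of _ _ 2]) (rule disc_valued_diff_le_2[OF assms(1,2)])
qed

lemma cdist_least: "(\<And>F. F \<in> disc_valued \<Omega> \<Longrightarrow> cmod (F a - F b) \<le> C) \<Longrightarrow> cdist \<Omega> a b \<le> C"
  unfolding cdist_def using zero_disc_valued by (intro cSUP_least) auto

lemma cdist_triangle:
  assumes "a \<in> \<Omega>" "b \<in> \<Omega>" "c \<in> \<Omega>"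
  shows "cdist \<Omega> a c \<le> cdist \<Omega> a b + cdist \<Omega> b c"
proof (rule cdist_least)
  fix F assume F: "F \<in> disc_valued \<Omega>"
  have "cmod (F a - F c) \<le> cmod (F a - F b) + cmod (F b - F c)"
    using norm_triangle_ineq[of "F a - F b" "F b - F c"] by simp
  also have "\<dots> \<le> cdist \<Omega> a b + cdist \<Omega> b c" using assms F by (intro add_mono cdist_upper)
  finally show "cmod (F a - F c) \<le> cdist \<Omega> a b + cdist \<Omega> b c" .
qed

lemma cdist_commute: "cdist \<Omega> a b = cdist \<Omega> b a"
  unfolding cdist_def by (simp add: norm_minus_commute)

lemma cdist_nonneg: "a \<in> \<Omega> \<Longrightarrow> b \<in> \<Omega> \<Longrightarrow> 0 \<le> cdist \<Omega> a b"
  using cdist_upper[OF _ _ zero_disc_valued, of a \<Omega> b] by simp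

lemma cdist_map_le:
  assumes F: "cn_holomorphic_map_on F \<Omega>" "F ` \<Omega> \<subseteq> \<Omega>" and ab: "a \<in> \<Omega>" "b \<in> \<Omega>"
  shows "cdist \<Omega> (F a) (F b) \<le> cdist \<Omega> a b"
proof (rule cdist_least)
  fix G assume G: "G \<in> disc_valued \<Omega>"
  then have "(\<lambda>z. G (F z)) \<in> disc_valued \<Omega>"
    using F cn_holomorphic_map_compose[of G \<Omega> F \<Omega>] unfolding disc_valued_def by auto
  from cdist_upper[OF ab this] show "cmod (G (F a) - G (F b)) \<le> cdist \<Omega> a b" .
qed

text \<open>The complex line through \<open>a\<close> and \<open>b\<close> meets the ball in a disc
  of radius \<open>\<rho> / norm (b - a)\<close> in the parameter that is 0 at \<open>a\<close> and
  1 at \<open>b\<close>; the Schwarz estimate applies to it.\<close>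

lemma cdist_le_norm:
  assumes a: "ball a \<rho> \<subseteq> \<Omega>" and b: "b \<in> ball a \<rho>"
  shows "cdist \<Omega> a b \<le> 3 * norm (b - a) / \<rho>"
proof (cases "b = a")
  case True
  then show ?thesis by (intro cdist_least) simp
next
  case False
  have \<rho>: "0 < \<rho>" using b zero_le_dist[of a b] unfolding mem_ball by linarith
  show ?thesis
  proof (rule cdist_least)
    fix F assume F: "F \<in> disc_valued \<Omega>"
    define f where "f = (\<lambda>w. F (a + w *s (b - a)))"
    have inb: "a + w *s (b - a) \<in> \<Omega>" if "w \<in> ball 0 (\<rho> / norm (b - a))" for w
    proof -
      have "cmod w * norm (b - a) < \<rho>" using that False by (simp add: field_simps)
      then have "a + w *s (b - a) \<in> ball a \<rho>"
        by (simp add: dist_norm norm_vector_smult del: vector_ssub_ldistrib)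
      then show ?thesis using a by blast
    qed
    have "cmod (f 1 - f 0) \<le> 3 * 1 * cmod (1 - 0) / (\<rho> / norm (b - a))"
    proof (rule disc_lipschitz)
      show "f holomorphic_on ball 0 (\<rho> / norm (b - a))"
        unfolding f_def using F inb by (intro cn_holomorphic_slice) (auto simp: disc_valued_def)
      show "cmod (f w) \<le> 1" if "w \<in> ball 0 (\<rho> / norm (b - a))" for w
        using F inb[OF that] by (auto simp: disc_valued_def f_def)
      show "(1 :: complex) \<in> ball 0 (\<rho> / norm (b - a))" 
      proof -
        have "norm (b - a) < \<rho>" using b by (simp add: dist_norm norm_minus_commute)
        then show ?thesis using False unfolding mem_ball dist_norm by simp
      qed
    qed
    then show "cmod (F a - F b) \<le> 3 * norm (b - a) / \<rho>" by (simp add: f_def norm_minus_commute)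
  qed
qed

lemma norm_vec_le_sum: "norm (v :: complex ^ 'n::finite) \<le> (\<Sum>i\<in>UNIV. cmod (v $ i))"
  unfolding norm_vec_def by (rule L2_set_le_sum) simp

text \<open>The coordinates divided by \<open>M\<close> are competitors in the supremum; this is how
  boundedness makes a small distance force a small norm.\<close>

lemma norm_le_cdist:
  fixes \<Omega> :: "(complex ^ 'n::finite) set"
  assumes bd: "\<And>z. z \<in> \<Omega> \<Longrightarrow> norm z \<le> M" and M: "0 < M" and ab: "a \<in> \<Omega>" "b \<in> \<Omega>"
  shows "norm (a - b) \<le> real CARD('n) * M * cdist \<Omega> a b"
proof -
  have "cmod (a $ i - b $ i) \<le> M * cdist \<Omega> a b" for i
  proof -
    have "(\<lambda>z. z $ i * of_real (1 / M)) \<in> disc_valued \<Omega>"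
      unfolding disc_valued_def
    proof (intro CollectI conjI ballI cn_holomorphic_mult cn_holomorphic_component cn_holomorphic_const)
      fix z assume "z \<in> \<Omega>"
      then show "cmod (z $ i * of_real (1 / M)) \<le> 1"
        using bd[of z] Finite_Cartesian_Product.norm_nth_le[of z i] M by (simp add: norm_mult norm_divide)
    qed
    from cdist_upper[OF ab this] have "cmod ((a $ i - b $ i) * of_real (1 / M)) \<le> cdist \<Omega> a b"
      by (simp add: algebra_simps diff_divide_distrib)
    then show ?thesis using M by (simp add: norm_mult norm_divide field_simps)
  qed
  then have "(\<Sum>i\<in>UNIV. cmod ((a - b) $ i)) \<le> (\<Sum>i\<in>(UNIV :: 'n set). M * cdist \<Omega> a b)"
    by (intro sum_mono) simp
  then show ?thesis using norm_vec_le_sum[of "a - b"] by (simp add: mult.assoc)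
qed

section \<open>The radius of relatively compact balls\<close>

definition relcompact_ball :: "(complex ^ 'n::finite) set \<Rightarrow> real \<Rightarrow> complex ^ 'n \<Rightarrow> bool" where
  "relcompact_ball \<Omega> \<epsilon> a \<longleftrightarrow> (\<exists>K. compact K \<and> K \<subseteq> \<Omega> \<and> {b\<in>\<Omega>. cdist \<Omega> a b \<le> \<epsilon>} \<subseteq> K)"

text \<open>Distances are at most 2, so a larger radius would give the same ball as 2; the cap
  bounds the set whose supremum is taken.\<close>

definition completeness_radius :: "(complex ^ 'n::finite) set \<Rightarrow> complex ^ 'n \<Rightarrow> real" where
  "completeness_radius \<Omega> a = Sup {\<epsilon>. 0 \<le> \<epsilon> \<and> \<epsilon> \<le> 2 \<and> relcompact_ball \<Omega> \<epsilon> a}"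

lemma cn_holomorphic_map_imp_continuous_on:
  assumes "cn_holomorphic_map_on F S"
  shows "continuous_on S F"
proof -
  have "continuous_on S (\<lambda>z. \<chi> i. F z $ i)"
    using assms by (intro continuous_on_vec_lambda cn_holomorphic_imp_continuous_on) (simp add: cn_holomorphic_map_on_def)
  then show ?thesis by simp
qed

text \<open>By contraction, \<open>s\<close> carries the ball about \<open>s a\<close> back into the
  ball about \<open>a\<close> of the same radius, so the image under \<open>s\<close> of a compact
  set for \<open>a\<close> serves for \<open>s a\<close>.\<close>

lemma relcompact_ball_transport:
  assumes s: "cn_holomorphic_map_on s \<Omega>" "s ` \<Omega> \<subseteq> \<Omega>" "\<And>z. z \<in> \<Omega> \<Longrightarrow> s (s z) = z" and a: "a \<in> \<Omega>"
    and rc: "relcompact_ball \<Omega> \<epsilon> a"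
  shows "relcompact_ball \<Omega> \<epsilon> (s a)"
proof -
  obtain K where K: "compact K" "K \<subseteq> \<Omega>" "{b\<in>\<Omega>. cdist \<Omega> a b \<le> \<epsilon>} \<subseteq> K"
    using rc unfolding relcompact_ball_def by blast
  have "{b\<in>\<Omega>. cdist \<Omega> (s a) b \<le> \<epsilon>} \<subseteq> s ` K"
  proof
    fix b assume b: "b \<in> {b\<in>\<Omega>. cdist \<Omega> (s a) b \<le> \<epsilon>}"
    then have "cdist \<Omega> (s (s a)) (s b) \<le> \<epsilon>"
      using cdist_map_le[OF s(1,2), of "s a" b] a s(2) by fastforce
    then have "s b \<in> K" using K(3) a b s by auto
    then show "b \<in> s ` K" using s(3)[of b] b by force
  qed
  moreover have "compact (s ` K)"
    using K by (intro compact_continuous_image continuous_on_subset[OF cn_holomorphic_map_imp_continuous_on[OF s(1)]])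
  ultimately show ?thesis unfolding relcompact_ball_def using K(2) s(2) by blast
qed

context
  fixes \<Omega> :: "(complex ^ 'n::finite) set" and M :: real
  assumes open_\<Omega>: "open \<Omega>" and bound: "\<And>z. z \<in> \<Omega> \<Longrightarrow> norm z \<le> M" and M: "0 < M"
begin

lemma relcompact_ball_exists:
  assumes "a \<in> \<Omega>"
  obtains \<epsilon> where "0 < \<epsilon>" "\<epsilon> \<le> 2" "relcompact_ball \<Omega> \<epsilon> a"
proof -
  obtain \<rho> where \<rho>: "0 < \<rho>" "cball a \<rho> \<subseteq> \<Omega>" using open_\<Omega> assms open_contains_cball by blast
  define c where "c = real CARD('n) * M"
  have c: "0 < c" using M by (simp add: c_def)
  define \<epsilon> where "\<epsilon> = min 2 (\<rho> / c)"
  have "{b\<in>\<Omega>. cdist \<Omega> a b \<le> \<epsilon>} \<subseteq> cball a \<rho>"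
  proof
    fix b assume b: "b \<in> {b\<in>\<Omega>. cdist \<Omega> a b \<le> \<epsilon>}"
    then have "norm (a - b) \<le> c * cdist \<Omega> a b" using norm_le_cdist[OF bound M assms, of b] by (simp add: c_def)
    also have "\<dots> \<le> c * (\<rho> / c)" using b c by (intro mult_left_mono) (auto simp: \<epsilon>_def)
    finally show "b \<in> cball a \<rho>" using c by (simp add: dist_norm)
  qed
  then have "relcompact_ball \<Omega> \<epsilon> a" unfolding relcompact_ball_def using \<rho> by (intro exI[of _ "cball a \<rho>"]) auto
  then show ?thesis using that[of \<epsilon>] \<rho> c by (auto simp: \<epsilon>_def)
qed

lemma relcompact_ball_mono: "relcompact_ball \<Omega> \<epsilon> a \<Longrightarrow> \<delta> \<le> \<epsilon> \<Longrightarrow> relcompact_ball \<Omega> \<delta> a"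
proof -
  assume "relcompact_ball \<Omega> \<epsilon> a" "\<delta> \<le> \<epsilon>"
  moreover from this(2) have "{b\<in>\<Omega>. cdist \<Omega> a b \<le> \<delta>} \<subseteq> {b\<in>\<Omega>. cdist \<Omega> a b \<le> \<epsilon>}" by auto
  ultimately show ?thesis unfolding relcompact_ball_def by blast
qed

lemma completeness_radius_properties:
  assumes a: "a \<in> \<Omega>"
  shows "0 < completeness_radius \<Omega> a"
    and "relcompact_ball \<Omega> \<epsilon> a \<Longrightarrow> 0 \<le> \<epsilon> \<Longrightarrow> \<epsilon> \<le> 2 \<Longrightarrow> \<epsilon> \<le> completeness_radius \<Omega> a"
    and "\<epsilon> < completeness_radius \<Omega> a \<Longrightarrow> relcompact_ball \<Omega> \<epsilon> a"
proof -
  let ?S = "{\<epsilon>. 0 \<le> \<epsilon> \<and> \<epsilon> \<le> 2 \<and> relcompact_ball \<Omega> \<epsilon> a}"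
  have bdd: "bdd_above ?S" by (rule bdd_aboveI[of _ 2]) auto
  obtain \<delta> where \<delta>: "0 < \<delta>" "\<delta> \<le> 2" "relcompact_ball \<Omega> \<delta> a" using relcompact_ball_exists[OF a] .
  show up: "\<epsilon> \<le> completeness_radius \<Omega> a" if "relcompact_ball \<Omega> \<epsilon> a" "0 \<le> \<epsilon>" "\<epsilon> \<le> 2" for \<epsilon>
    unfolding completeness_radius_def using that by (intro cSup_upper bdd) auto
  show "0 < completeness_radius \<Omega> a" using up[of \<delta>] \<delta> by simp
  show "relcompact_ball \<Omega> \<epsilon> a" if lt: "\<epsilon> < completeness_radius \<Omega> a"
  proof -
    have "?S \<noteq> {}" using \<delta> by auto
    from less_cSupD[OF this lt[unfolded completeness_radius_def]]
    obtain x where "x \<in> ?S" "\<epsilon> < x" by blast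
    then show ?thesis using relcompact_ball_mono[of x a \<epsilon>] by simp
  qed
qed

text \<open>The ball about \<open>b\<close> of radius \<open>\<epsilon> - cdist \<Omega> a b\<close>
  lies in the ball about \<open>a\<close> of radius \<open>\<epsilon>\<close>.\<close>

lemma completeness_radius_lipschitz:
  assumes a: "a \<in> \<Omega>" and b: "b \<in> \<Omega>"
  shows "completeness_radius \<Omega> a \<le> completeness_radius \<Omega> b + cdist \<Omega> a b"
proof (rule field_le_epsilon)
  fix e :: real assume e: "0 < e"
  define \<epsilon> where "\<epsilon> = completeness_radius \<Omega> a - e"
  show "completeness_radius \<Omega> a \<le> completeness_radius \<Omega> b + cdist \<Omega> a b + e"
  proof (cases "\<epsilon> \<le> cdist \<Omega> a b")
    case True
    then show ?thesis using completeness_radius_properties(1)[OF b] by (simp add: \<epsilon>_def)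
  next
    case False
    have "relcompact_ball \<Omega> \<epsilon> a" using e by (intro completeness_radius_properties(3)[OF a]) (simp add: \<epsilon>_def)
    then obtain K where K: "compact K" "K \<subseteq> \<Omega>" "{c\<in>\<Omega>. cdist \<Omega> a c \<le> \<epsilon>} \<subseteq> K"
      unfolding relcompact_ball_def by blast
    have "{c\<in>\<Omega>. cdist \<Omega> b c \<le> \<epsilon> - cdist \<Omega> a b} \<subseteq> K"
    proof
      fix c assume c: "c \<in> {c\<in>\<Omega>. cdist \<Omega> b c \<le> \<epsilon> - cdist \<Omega> a b}"
      then have "cdist \<Omega> a c \<le> \<epsilon>" using cdist_triangle[OF a b, of c] by auto
      then show "c \<in> K" using K c by auto
    qed
    then have "relcompact_ball \<Omega> (\<epsilon> - cdist \<Omega> a b) b" unfolding relcompact_ball_def using K by blast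
    moreover have "\<epsilon> \<le> 2"
    proof -
      have "completeness_radius \<Omega> a \<le> 2"
        unfolding completeness_radius_def
      proof (rule cSup_least)
        obtain \<delta> where "0 < \<delta>" "\<delta> \<le> 2" "relcompact_ball \<Omega> \<delta> a" using relcompact_ball_exists[OF a] .
        then have "\<delta> \<in> {\<epsilon>. 0 \<le> \<epsilon> \<and> \<epsilon> \<le> 2 \<and> relcompact_ball \<Omega> \<epsilon> a}" by simp
        then show "{\<epsilon>. 0 \<le> \<epsilon> \<and> \<epsilon> \<le> 2 \<and> relcompact_ball \<Omega> \<epsilon> a} \<noteq> {}" by blast
      qed simp
      then show ?thesis using e by (simp add: \<epsilon>_def)
    qed
    ultimately have "\<epsilon> - cdist \<Omega> a b \<le> completeness_radius \<Omega> b"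
      using False cdist_nonneg[OF a b] by (intro completeness_radius_properties(2)[OF b]) auto
    then show ?thesis by (simp add: \<epsilon>_def)
  qed
qed

lemma completeness_radius_involution:
  assumes s: "cn_holomorphic_map_on s \<Omega>" "s ` \<Omega> \<subseteq> \<Omega>" "\<And>z. z \<in> \<Omega> \<Longrightarrow> s (s z) = z" and a: "a \<in> \<Omega>"
  shows "completeness_radius \<Omega> (s a) = completeness_radius \<Omega> a"
proof -
  have sa: "s a \<in> \<Omega>" using s(2) a by blast
  have "relcompact_ball \<Omega> \<epsilon> (s a) \<longleftrightarrow> relcompact_ball \<Omega> \<epsilon> a" for \<epsilon>
    using relcompact_ball_transport[OF s a, of \<epsilon>] relcompact_ball_transport[OF s sa, of \<epsilon>]
    unfolding s(3)[OF a] by blast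
  then show ?thesis by (simp add: completeness_radius_def)
qed

text \<open>With \<open>A\<close> the derivative of \<open>s\<close> at \<open>a\<close>, the map \<open>z + A (s z)\<close> intertwines \<open>s\<close> with \<open>A\<close>; it is locally
  injective, so a fixed vector of \<open>A\<close> would give fixed points of \<open>s\<close> close to \<open>a\<close>.\<close>

lemma involution_derivative:
  assumes s: "cn_holomorphic_map_on s \<Omega>" "s ` \<Omega> \<subseteq> \<Omega>" "\<And>z. z \<in> \<Omega> \<Longrightarrow> s (s z) = z"
    and a: "a \<in> \<Omega>" "s a = a" "\<not> a islimpt {z\<in>\<Omega>. s z = z}"
  shows "(s has_derivative (\<lambda>v. - v)) (at a)"
proof -
  have sc: "cn_holomorphic_on (\<lambda>z. s z $ i) \<Omega>" for i using s(1) by (simp add: cn_holomorphic_map_on_def)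
  have "\<exists>G. (\<forall>z\<in>\<Omega>. ((\<lambda>z. s z $ i) has_derivative blinfun_apply (G z)) (at z)) \<and> continuous_on \<Omega> G" for i
    using cn_holomorphic_C1[OF open_\<Omega> sc] by metis
  then obtain G where G: "\<And>i z. z \<in> \<Omega> \<Longrightarrow> ((\<lambda>z. s z $ i) has_derivative blinfun_apply (G i z)) (at z)"
      "\<And>i. continuous_on \<Omega> (G i)" by metis
  define L :: "'n \<Rightarrow> complex \<Rightarrow>\<^sub>L (complex ^ 'n)" where "L = (\<lambda>i. Blinfun (\<lambda>c. c *s axis i 1))"
  have L: "blinfun_apply (L i) = (\<lambda>c. c *s axis i 1)" for i
    unfolding L_def by (rule bounded_linear_Blinfun_apply[OF bounded_linear_smult_left])
  define S' where "S' = (\<lambda>z. \<Sum>i\<in>UNIV. L i o\<^sub>L G i z)"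
  have S'app: "blinfun_apply (S' z) = (\<lambda>v. \<chi> i. G i z v)" for z
    using basis_expansion[of "\<chi> i. G i z v" for v] by (simp add: S'_def blinfun.sum_left L fun_eq_iff)
  have dS: "(s has_derivative blinfun_apply (S' z)) (at z)" if "z \<in> \<Omega>" for z
    unfolding S'app by (intro has_derivative_vecI G(1) that)
  have cS: "continuous_on \<Omega> S'" unfolding S'_def by (intro continuous_intros G(2))
  define A where "A = S' a"
  have AA: "A (A v) = v" for v
  proof -
    have "((\<lambda>z. s (s z)) has_derivative (\<lambda>v. S' (s a) (S' a v))) (at a)"
      using has_derivative_compose[OF dS[OF a(1)] dS[of "s a"]] a by simp
    then have "((\<lambda>z. z) has_derivative (\<lambda>v. A (A v))) (at a)"
      unfolding a(2) A_def[symmetric] by (rule has_derivative_transform_within_open[OF _ open_\<Omega> a(1)]) (simp add: s(3))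
    from has_derivative_unique[OF this has_derivative_ident] show ?thesis by metis
  qed
  define \<psi> where "\<psi> = (\<lambda>z. z + A (s z))"
  define \<psi>' where "\<psi>' = (\<lambda>z. id_blinfun + (A o\<^sub>L S' z))"
  have d\<psi>: "(\<psi> has_derivative blinfun_apply (\<psi>' z)) (at z)" if "z \<in> \<Omega>" for z
  proof -
    have "blinfun_apply (\<psi>' z) = (\<lambda>v. v + A (S' z v))" by (simp add: \<psi>'_def fun_eq_iff blinfun.add_left)
    then show ?thesis unfolding \<psi>_def
      using has_derivative_add[OF has_derivative_ident bounded_linear.has_derivative[OF blinfun.bounded_linear_right[of A] dS[OF that]]]
      by simp
  qed
  have c\<psi>: "continuous_on \<Omega> \<psi>'" unfolding \<psi>'_def by (intro continuous_intros cS)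
  \<comment> \<open>\<open>\<psi>' a\<close> is the identity plus \<open>A\<close> composed with
    itself, hence twice the identity.\<close>
  have inv: "((1 / 2) *\<^sub>R id_blinfun) o\<^sub>L \<psi>' a = id_blinfun"
  proof (rule blinfun_eqI)
    fix v show "(((1 / 2) *\<^sub>R id_blinfun) o\<^sub>L \<psi>' a) v = id_blinfun v"
      by (simp add: \<psi>'_def blinfun.add_left blinfun.scaleR_left AA flip: A_def)
  qed
  obtain U V g where UV: "open U" "U \<subseteq> \<Omega>" "a \<in> U" "open V" "\<psi> a \<in> V" "homeomorphism U V \<psi> g"
    using inverse_function_theorem[OF open_\<Omega> d\<psi> c\<psi> a(1) inv] by metis
  have Av: "A v = - v" for v
  proof (rule ccontr)
    assume neg: "A v \<noteq> - v"
    \<comment> \<open>A vector fixed by the involution \<open>A\<close>; it is nonzero because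
      \<open>A v \<noteq> - v\<close>.\<close>
    define u where "u = v + A v"
    have u: "u \<noteq> 0" using neg unfolding u_def by (simp add: eq_neg_iff_add_eq_0 add.commute)
    have u': "A u = u" by (simp add: u_def AA blinfun.add_right add.commute)
    have comm: "\<psi> (s z) = A (\<psi> z)" if "z \<in> \<Omega>" for z
      using s(3)[OF that] by (simp add: \<psi>_def blinfun.add_right AA)
    have "a islimpt {z\<in>\<Omega>. s z = z}"
      unfolding islimpt_def
    proof (intro allI impI)
      fix T assume T: "a \<in> T" "open T"
      have cs: "continuous_on \<Omega> s" by (rule cn_holomorphic_map_imp_continuous_on[OF s(1)])
      define T' where "T' = T \<inter> U \<inter> (\<Omega> \<inter> s -` U)"
      have T': "open T'" "a \<in> T'" "T' \<subseteq> U"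
        unfolding T'_def using T UV a continuous_open_preimage[OF cs open_\<Omega> UV(1)] by auto
      have "open (V \<inter> g -` T')"
        using UV(4,6) T'(1) by (intro continuous_open_preimage) (auto simp: homeomorphism_def)
      moreover have "\<psi> a \<in> V \<inter> g -` T'" using UV T' by (auto simp: homeomorphism_def)
      ultimately obtain e where e: "0 < e" "ball (\<psi> a) e \<subseteq> V \<inter> g -` T'" by (meson open_contains_ball)
      define t where "t = e / (2 * norm u)"
      have t: "0 < t" using e u by (simp add: t_def)
      have "\<psi> a + t *\<^sub>R u \<in> ball (\<psi> a) e" using u e by (simp add: dist_norm t_def)
      then have yV: "\<psi> a + t *\<^sub>R u \<in> V" "g (\<psi> a + t *\<^sub>R u) \<in> T'" using e by auto
      define y where "y = g (\<psi> a + t *\<^sub>R u)"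
      have y: "y \<in> T'" "\<psi> y = \<psi> a + t *\<^sub>R u" using yV UV(6) by (auto simp: y_def homeomorphism_def)
      have yO: "y \<in> \<Omega>" "s y \<in> U" "y \<in> U" "y \<in> T" using y(1) by (auto simp: T'_def)
      \<comment> \<open>\<open>A\<close> fixes \<open>\<psi> a\<close> and \<open>u\<close>, hence
        also \<open>\<psi> y\<close>; so \<open>\<psi> (s y) = \<psi> y\<close>, and injectivity of
        \<open>\<psi>\<close> on \<open>U\<close> makes \<open>y\<close> a fixed point of
        \<open>s\<close>.\<close>
      have "A (\<psi> a) = \<psi> a" using comm[OF a(1)] a(2) by simp
      then have "\<psi> (s y) = \<psi> y" using comm[OF yO(1)] by (simp add: y(2) blinfun.add_right blinfun.scaleR_right u')
      then have "s y = y" using UV(6) yO by (metis homeomorphism_apply1)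
      moreover have "y \<noteq> a" using y(2) t u by auto
      ultimately show "\<exists>y\<in>{z\<in>\<Omega>. s z = z}. y \<in> T \<and> y \<noteq> a" using yO by auto
    qed
    with a(3) show False by simp
  qed
  have "blinfun_apply A = (\<lambda>v. - v)" by (rule ext) (rule Av)
  then show ?thesis using dS[OF a(1)] unfolding A_def[symmetric] by simp
qed

lemma has_derivative_zero_quadratic:
  fixes f :: "'a::real_normed_vector \<Rightarrow> real"
  assumes \<delta>: "0 < \<delta>" and f: "\<And>c. norm (c - a) < \<delta> \<Longrightarrow> \<bar>f c - f a\<bar> \<le> K * (norm (c - a))\<^sup>2" and K: "0 < K"
  shows "(f has_derivative (\<lambda>_. 0)) (at a)"
  unfolding has_derivative_at_alt
proof (intro conjI allI impI)
  fix e :: real assume e: "0 < e"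
  show "\<exists>d>0. \<forall>y. norm (y - a) < d \<longrightarrow> norm (f y - f a - 0) \<le> e * norm (y - a)"
  proof (intro exI[of _ "min \<delta> (e / K)"] conjI allI impI)
    fix y assume y: "norm (y - a) < min \<delta> (e / K)"
    have "norm (f y - f a - 0) \<le> K * norm (y - a) * norm (y - a)"
      using f[of y] y by (simp add: power2_eq_square mult.assoc)
    also have "\<dots> \<le> e * norm (y - a)"
      using y K by (intro mult_right_mono) (auto simp: pos_less_divide_eq mult.commute)
    finally show "norm (f y - f a - 0) \<le> e * norm (y - a)" .
  qed (use \<delta> e K in auto)
qed simp

text \<open>The symmetry at the midpoint of \<open>a\<close> and \<open>c\<close> moves \<open>c\<close> to a point at distance
  \<open>O(\<bar>c - a\<bar>^2)\<close> from \<open>a\<close>, so the radius has derivative 0.\<close>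

lemma completeness_radius_constant:
  assumes conn: "connected \<Omega>"
    and sym: "\<And>a. a \<in> \<Omega> \<Longrightarrow> \<exists>s. cn_holomorphic_map_on s \<Omega> \<and> s ` \<Omega> \<subseteq> \<Omega> \<and> (\<forall>z\<in>\<Omega>. s (s z) = z) \<and> s a = a \<and>
        \<not> a islimpt {z\<in>\<Omega>. s z = z}"
    and xy: "x \<in> \<Omega>" "y \<in> \<Omega>"
  shows "completeness_radius \<Omega> x = completeness_radius \<Omega> y"
proof (rule has_derivative_zero_unique_connected[OF open_\<Omega> conn _ xy])
  fix a assume a: "a \<in> \<Omega>"
  obtain r where r: "0 < r" "ball a r \<subseteq> \<Omega>" using open_\<Omega> a open_contains_ball by blast
  define \<rho> where "\<rho> = r / 4"
  have \<rho>: "0 < \<rho>" "ball a (4 * \<rho>) \<subseteq> \<Omega>" using r by (auto simp: \<rho>_def)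
  define K where "K = real CARD('n) * (3 * M / \<rho>\<^sup>2)"
  have K: "0 < K" unfolding K_def using M \<rho> by simp
  define \<delta> where "\<delta> = min \<rho> (min 1 (\<rho> / K))"
  have \<delta>: "0 < \<delta>" using \<rho> K by (simp add: \<delta>_def)
  show "(completeness_radius \<Omega> has_derivative (\<lambda>x. 0)) (at a)"
  proof (rule has_derivative_zero_quadratic[OF \<delta>, of _ _ "3 * K / \<rho>"])
    show "0 < 3 * K / \<rho>" using K \<rho> by simp
    fix c assume c: "norm (c - a) < \<delta>"
    show "\<bar>completeness_radius \<Omega> c - completeness_radius \<Omega> a\<bar> \<le> 3 * K / \<rho> * (norm (c - a))\<^sup>2"
    proof (cases "c = a")
      case False
      \<comment> \<open>\<open>m\<close> is the midpoint, with \<open>a = m + v\<close> and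
        \<open>c = m - v\<close>. A map that fixes \<open>m\<close> with derivative
        \<open>- 1\<close> there sends \<open>a\<close> to \<open>c\<close> up to second order in
        \<open>v\<close>.\<close>
      define v where "v = (1 / 2) *\<^sub>R (a - c)"
      define m where "m = a - v"
      have v: "norm v = norm (c - a) / 2" "norm v < \<rho>" "0 < norm v"
        using c False \<rho> by (auto simp: v_def \<delta>_def norm_minus_commute)
      have mv: "m - v = c" "m + v = a"
      proof -
        have "(1 / 2) *\<^sub>R (a - c) + (1 / 2) *\<^sub>R (a - c) = a - c" by (simp flip: scaleR_2)
        then show "m - v = c" by (simp add: m_def v_def algebra_simps)
      qed (simp add: m_def)
      have inb: "m + u \<in> \<Omega>" if "norm u < 2 * \<rho>" for u
      proof -
        have "dist a (m + u) \<le> norm v + norm u" using norm_triangle_ineq4[of v u] by (simp add: dist_norm m_def)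
        then show ?thesis using v that \<rho> by auto
      qed
      have m: "m \<in> \<Omega>" using inb[of 0] \<rho> by simp
      obtain s where s: "cn_holomorphic_map_on s \<Omega>" "s ` \<Omega> \<subseteq> \<Omega>" "\<And>z. z \<in> \<Omega> \<Longrightarrow> s (s z) = z" "s m = m"
          "\<not> m islimpt {z\<in>\<Omega>. s z = z}"
        using sym[OF m] by blast
      have ds: "(s has_derivative (\<lambda>v. - v)) (at m)" by (rule involution_derivative[OF s(1-3) m s(4,5)])
      \<comment> \<open>\<open>m + w *s v\<close> stays in the domain for \<open>cmod w < R\<close>,
        so the remainder \<open>12 * M / R^2\<close> of the slice is quadratic in
        \<open>norm v\<close>.\<close>
      define R where "R = 2 * \<rho> / norm v"
      have R: "2 < R" using v(2) unfolding R_def pos_less_divide_eq[OF v(3)] by simp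
      have comp: "cmod (s a $ i - c $ i) \<le> 3 * M / \<rho>\<^sup>2 * (norm (c - a))\<^sup>2" for i
      proof -
        define f where "f = (\<lambda>w. s (m + w *s v) $ i)"
        have sc: "cn_holomorphic_on (\<lambda>z. s z $ i) \<Omega>" using s(1) by (simp add: cn_holomorphic_map_on_def)
        have inw: "m + w *s v \<in> \<Omega>" if "w \<in> ball 0 R" for w :: complex
        proof (rule inb)
          have "cmod w < 2 * \<rho> / norm v" using that by (simp add: R_def)
          then show "norm (w *s v) < 2 * \<rho>" unfolding norm_vector_smult pos_less_divide_eq[OF v(3)] .
        qed
        have "cmod (f 1 - f 0 - deriv f 0) \<le> 12 * M / R\<^sup>2"
        proof (rule disc_second_order[OF _ R])
          show "f holomorphic_on ball 0 R" unfolding f_def by (rule cn_holomorphic_slice[OF sc inw])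
          fix w :: complex assume w: "w \<in> ball 0 R"
          have "s (m + w *s v) \<in> \<Omega>" using inw[OF w] s(2) by auto
          from bound[OF this] show "cmod (f w) \<le> M"
            unfolding f_def using Finite_Cartesian_Product.norm_nth_le[of "s (m + w *s v)" i] by linarith
        qed
        also have "12 * M / R\<^sup>2 = 3 * M / \<rho>\<^sup>2 * (norm v)\<^sup>2"
          by (simp add: R_def power_divide power_mult_distrib)
        also have "\<dots> \<le> 3 * M / \<rho>\<^sup>2 * (norm (c - a))\<^sup>2"
        proof (rule mult_left_mono)
          have "norm v \<le> norm (c - a)" using v(1) norm_ge_zero[of "c - a"] by linarith
          then show "(norm v)\<^sup>2 \<le> (norm (c - a))\<^sup>2" by (rule power_mono) simp
        qed (use M in simp)
        also have "deriv f 0 = - v $ i"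
        proof -
          have "((\<lambda>z. s z $ i) has_derivative (\<lambda>u. (- u) $ i)) (at m)"
            by (rule bounded_linear.has_derivative[OF bounded_linear_vec_nth ds])
          from frechet_derivative_at[OF this, symmetric] have "frechet_derivative (\<lambda>z. s z $ i) (at m) v = - v $ i" by simp
          moreover have "(f has_field_derivative frechet_derivative (\<lambda>z. s z $ i) (at (m + 0 *s v)) v) (at 0)"
            unfolding f_def by (rule cn_holomorphic_slice_deriv[OF sc]) (simp add: m)
          ultimately show ?thesis by (simp add: DERIV_imp_deriv)
        qed
        also have "f 1 - f 0 - (- v $ i) = s a $ i - c $ i"
        proof -
          have "c $ i = m $ i - v $ i" unfolding mv(1)[symmetric] by simp
          moreover have "f 1 = s a $ i" "f 0 = m $ i" using mv(2) s(4) by (simp_all add: f_def)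
          ultimately show ?thesis by simp
        qed
        finally show ?thesis .
      qed
      have "norm (s a - c) \<le> (\<Sum>i\<in>UNIV. cmod ((s a - c) $ i))" by (rule norm_vec_le_sum)
      also have "\<dots> \<le> (\<Sum>i\<in>(UNIV :: 'n set). 3 * M / \<rho>\<^sup>2 * (norm (c - a))\<^sup>2)"
        using comp by (intro sum_mono) simp
      also have "\<dots> = K * (norm (c - a))\<^sup>2" by (simp add: K_def)
      finally have sac: "norm (s a - c) \<le> K * (norm (c - a))\<^sup>2" .
      have "K * (norm (c - a))\<^sup>2 \<le> K * (norm (c - a) * 1)"
        unfolding power2_eq_square using c K by (intro mult_left_mono) (auto simp: \<delta>_def)
      also have "\<dots> < \<rho>" using c K by (auto simp: \<delta>_def pos_less_divide_eq mult.commute)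
      finally have sab: "s a \<in> ball c \<rho>" using sac by (simp add: dist_norm norm_minus_commute)
      have bc: "ball c \<rho> \<subseteq> \<Omega>"
      proof
        fix x assume "x \<in> ball c \<rho>"
        then have "dist a x < \<rho> + \<rho>"
          using dist_triangle[of a x c] c by (auto simp: \<delta>_def dist_norm norm_minus_commute)
        then show "x \<in> \<Omega>" using \<rho> by auto
      qed
      have cO: "c \<in> \<Omega>" "s a \<in> \<Omega>" using bc \<rho> s(2) a by auto
      have "cdist \<Omega> c (s a) \<le> 3 * norm (s a - c) / \<rho>" by (rule cdist_le_norm[OF bc sab])
      also have "\<dots> \<le> 3 * (K * (norm (c - a))\<^sup>2) / \<rho>" using sac \<rho> by (intro divide_right_mono mult_left_mono) auto
      finally have "cdist \<Omega> c (s a) \<le> 3 * K / \<rho> * (norm (c - a))\<^sup>2" by simp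
      \<comment> \<open>Since the involution preserves the radius, the radii at \<open>a\<close> and
        \<open>c\<close> differ by at most the distance of \<open>c\<close> and
        \<open>s a\<close>.\<close>
      moreover have "completeness_radius \<Omega> (s a) = completeness_radius \<Omega> a"
        by (rule completeness_radius_involution[OF s(1-3) a])
      ultimately show ?thesis
        using completeness_radius_lipschitz[OF cO] completeness_radius_lipschitz[OF cO(2,1)] cdist_commute[of \<Omega> c "s a"]
        by (simp add: abs_le_iff)
    qed simp
  qed
qed

end

section \<open>Shrinking the closure into the domain\<close>

lemma standard_realization_smult:
  assumes \<Omega>: "standard_realization \<Omega>" and z: "z \<in> \<Omega>" and c: "cmod c \<le> 1"
  shows "c *s z \<in> \<Omega>"
proof -
  have "cis (Arg c) *s z \<in> \<Omega>" using \<Omega> z unfolding standard_realization_def by blast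
  then have "closed_segment 0 (cis (Arg c) *s z) \<subseteq> \<Omega>" using \<Omega> unfolding standard_realization_def by blast
  moreover have "cmod c *\<^sub>R (cis (Arg c) *s z) \<in> closed_segment 0 (cis (Arg c) *s z)"
    using c by (auto simp: closed_segment_def intro!: exI[of _ "cmod c"])
  moreover have "cmod c *\<^sub>R (cis (Arg c) *s z) = c *s z"
    unfolding scaleR_eq_smult vector_smult_assoc using rcis_cmod_Arg[of c] by (simp add: rcis_def)
  ultimately show ?thesis by auto
qed

text \<open>Let \<open>x n\<close> in \<open>\<Omega>\<close> tend to \<open>w\<close>. If
  \<open>s *s w\<close> lies in \<open>\<Omega>\<close>, a short step from \<open>s\<close> to
  \<open>s'\<close> keeps \<open>s' *s x n\<close> in the \<open>\<epsilon>\<close>-ball about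
  \<open>s *s w\<close>, uniformly in large \<open>n\<close>, because
  \<open>\<xi> \<mapsto> \<xi> *s x n\<close> maps the unit disc into \<open>\<Omega>\<close>. That
  ball lies in a compact subset of \<open>\<Omega>\<close>, which then contains the limit
  \<open>s' *s w\<close>. As one \<open>\<epsilon>\<close> serves for all points, the step length is
  fixed and finitely many steps lead from 0 to \<open>cmod c\<close>.\<close>

lemma smult_closure_mem:
  fixes \<Omega> :: "(complex ^ 'n::finite) set"
  assumes bsd: "bounded_symmetric_domain \<Omega>" and sr: "standard_realization \<Omega>"
    and w: "w \<in> closure \<Omega>" and c: "cmod c < 1"
  shows "c *s w \<in> \<Omega>"
proof -
  have op: "open \<Omega>" and conn: "connected \<Omega>" and "bounded \<Omega>" using bsd by (auto simp: bounded_symmetric_domain_def)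
  then obtain M where M: "0 < M" "\<And>z. z \<in> \<Omega> \<Longrightarrow> norm z \<le> M" unfolding bounded_pos by blast
  have zero: "0 \<in> \<Omega>" using sr by (simp add: standard_realization_def)
  have sym: "\<exists>s. cn_holomorphic_map_on s \<Omega> \<and> s ` \<Omega> \<subseteq> \<Omega> \<and> (\<forall>z\<in>\<Omega>. s (s z) = z) \<and> s a = a \<and> \<not> a islimpt {z\<in>\<Omega>. s z = z}"
    if "a \<in> \<Omega>" for a
    using bsd that unfolding bounded_symmetric_domain_def holomorphic_automorphisms_def bij_betw_def by blast
  define \<epsilon> where "\<epsilon> = completeness_radius \<Omega> 0 / 2"
  have R0: "0 < completeness_radius \<Omega> 0" by (rule completeness_radius_properties(1)[OF op M(2,1) zero])
  then have \<epsilon>: "0 < \<epsilon>" by (simp add: \<epsilon>_def)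
  have rc: "relcompact_ball \<Omega> \<epsilon> a" if "a \<in> \<Omega>" for a
    using completeness_radius_properties(3)[OF op M(2,1) that, of \<epsilon>] R0
      completeness_radius_constant[OF op M(2,1) conn sym that zero] by (simp add: \<epsilon>_def)
  obtain x where x: "\<And>n :: nat. x n \<in> \<Omega>" "x \<longlonglongrightarrow> w" using w unfolding closure_sequential by blast
  define t where "t = cmod c"
  have t: "0 \<le> t" "t < 1" using c by (auto simp: t_def)
  \<comment> \<open>The first bound keeps \<open>s'\<close> in the disc of radius
    \<open>1 - t\<close> about \<open>s\<close>; by the second the Lipschitz constant
    \<open>3 / (1 - t)\<close> yields a distance of at most \<open>\<epsilon> / 2\<close>.\<close>
  define \<kappa> where "\<kappa> = min ((1 - t) / 2) (\<epsilon> * (1 - t) / 6)"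
  have \<kappa>: "0 < \<kappa>" using t \<epsilon> by (simp add: \<kappa>_def)
  have step: "of_real s' *s w \<in> \<Omega>" if s: "0 \<le> s" "of_real s *s w \<in> \<Omega>" "s \<le> s'" "s' \<le> s + \<kappa>" "s' \<le> t" for s s'
  proof -
    have st: "s \<le> t" using s by simp
    have xs: "of_real u *s x n \<in> \<Omega>" if "0 \<le> u" "u \<le> t" for u n
      using that t by (intro standard_realization_smult[OF sr x(1)]) auto
    have near: "cdist \<Omega> (of_real s *s x n) (of_real s' *s x n) \<le> \<epsilon> / 2" for n
    proof (rule cdist_least)
      fix F assume F: "F \<in> disc_valued \<Omega>"
      define f where "f = (\<lambda>\<xi>. F (0 + \<xi> *s x n))"
      have inb: "0 + \<xi> *s x n \<in> \<Omega>" if "\<xi> \<in> ball (of_real s) (1 - t)" for \<xi>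
      proof -
        have "cmod \<xi> \<le> cmod (of_real s - \<xi>) + cmod (of_real s)" using norm_triangle_sub[of \<xi> "of_real s"] by (simp add: norm_minus_commute)
        then have "cmod \<xi> \<le> 1" using that s(1) st by (auto simp: dist_norm)
        then show ?thesis using standard_realization_smult[OF sr x(1)] by simp
      qed
      have d: "cmod (of_real s' - of_real s) \<le> \<kappa>" using s by (simp flip: of_real_diff)
      have "cmod (f (of_real s') - f (of_real s)) \<le> 3 * 1 * cmod (of_real s' - of_real s) / (1 - t)"
      proof (rule disc_lipschitz)
        show "f holomorphic_on ball (of_real s) (1 - t)"
          unfolding f_def using F inb by (intro cn_holomorphic_slice) (auto simp: disc_valued_def)
        show "cmod (f \<xi>) \<le> 1" if "\<xi> \<in> ball (of_real s) (1 - t)" for \<xi>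
          using F inb[OF that] by (simp add: disc_valued_def f_def)
        show "of_real s' \<in> ball (of_real s :: complex) (1 - t)"
          using d t by (simp add: dist_norm norm_minus_commute \<kappa>_def)
      qed
      also have "\<dots> \<le> 3 * (\<epsilon> * (1 - t) / 6) / (1 - t)" using d t by (intro divide_right_mono) (auto simp: \<kappa>_def)
      also have "\<dots> = \<epsilon> / 2" using t by (simp add: divide_simps)
      finally show "cmod (F (of_real s *s x n) - F (of_real s' *s x n)) \<le> \<epsilon> / 2"
        by (simp add: f_def norm_minus_commute)
    qed
    obtain \<rho> where \<rho>: "0 < \<rho>" "ball (of_real s *s w) \<rho> \<subseteq> \<Omega>" using op s(2) open_contains_ball by blast
    have lim: "(\<lambda>n. of_real u *s x n) \<longlonglongrightarrow> of_real u *s w" for u :: real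
      unfolding scaleR_eq_smult[symmetric] by (intro tendsto_intros x(2))
    define e where "e = min \<rho> (\<epsilon> * \<rho> / 6)"
    have "0 < e" using \<rho> \<epsilon> by (simp add: e_def)
    then have ev: "\<forall>\<^sub>F n in sequentially. dist (of_real s *s x n) (of_real s *s w) < e"
      using tendstoD[OF lim] by blast
    obtain K where K: "compact K" "K \<subseteq> \<Omega>" "{b\<in>\<Omega>. cdist \<Omega> (of_real s *s w) b \<le> \<epsilon>} \<subseteq> K"
      using rc[OF s(2)] unfolding relcompact_ball_def by blast
    have "\<forall>\<^sub>F n in sequentially. of_real s' *s x n \<in> K"
      using ev
    proof (rule eventually_mono)
      fix n assume n: "dist (of_real s *s x n) (of_real s *s w) < e"
      have "cdist \<Omega> (of_real s *s w) (of_real s *s x n) \<le> 3 * norm (of_real s *s x n - of_real s *s w) / \<rho>"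
        by (rule cdist_le_norm[OF \<rho>(2)]) (use n in \<open>simp add: e_def dist_commute\<close>)
      also have "\<dots> \<le> 3 * (\<epsilon> * \<rho> / 6) / \<rho>" using n \<rho> by (intro divide_right_mono) (auto simp: e_def dist_norm)
      also have "\<dots> = \<epsilon> / 2" using \<rho> by simp
      finally have "cdist \<Omega> (of_real s *s w) (of_real s' *s x n) \<le> \<epsilon>"
        using cdist_triangle[OF s(2) xs[of s n] xs[of s' n]] near[of n] s st by auto
      then show "of_real s' *s x n \<in> K" using K(3) xs[of s' n] s by auto
    qed
    then have "of_real s' *s w \<in> K"
      by (intro Lim_in_closed_set[OF compact_imp_closed[OF K(1)] _ _ lim]) auto
    then show ?thesis using K by auto
  qed
  have steps: "\<forall>s. 0 \<le> s \<and> s \<le> t \<and> s \<le> real n * \<kappa> \<longrightarrow> of_real s *s w \<in> \<Omega>" for n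
  proof (induction n)
    case 0
    have "of_real s *s w \<in> \<Omega>" if "s = 0" for s :: real using zero that by simp
    then show ?case by auto
  next
    case (Suc n)
    show ?case
    proof (intro allI impI)
      fix s assume s: "0 \<le> s \<and> s \<le> t \<and> s \<le> real (Suc n) * \<kappa>"
      define s0 where "s0 = max 0 (s - \<kappa>)"
      have "0 \<le> s0 \<and> s0 \<le> t \<and> s0 \<le> real n * \<kappa>" using s \<kappa> t by (auto simp: s0_def algebra_simps)
      then have "of_real s0 *s w \<in> \<Omega>" using Suc by blast
      then show "of_real s *s w \<in> \<Omega>" using s \<kappa> by (intro step[of s0 s]) (auto simp: s0_def)
    qed
  qed
  obtain n where "t / \<kappa> \<le> real n" using real_arch_simple by blast
  then have "t \<le> real n * \<kappa>" using \<kappa> by (simp add: pos_divide_le_eq)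
  then have tw: "of_real t *s w \<in> \<Omega>" using steps t by auto
  have eq: "cis (Arg c) *s (of_real t *s w) = c *s w"
    unfolding vector_smult_assoc using rcis_cmod_Arg[of c] by (simp add: rcis_def t_def mult.commute)
  have "cis (Arg c) *s (of_real t *s w) \<in> \<Omega>" by (rule standard_realization_smult[OF sr tw]) simp
  then show ?thesis unfolding eq .
qed

section \<open>Circle means and the Silov boundary\<close>

lemma circle_mean_norm:
  fixes f :: "complex \<Rightarrow> complex"
  assumes "continuous_on (sphere 0 1) f"
  shows "cmod (circle_mean f) \<le> circle_mean (\<lambda>z. cmod (f z))"
proof -
  have "cmod (integral {0..2 * pi} (\<lambda>t. f (cis t))) \<le> integral {0..2 * pi} (\<lambda>t. cmod (f (cis t)))"
    by (intro integral_norm_bound_integral integrable_on_cis assms integrable_on_cis[of "\<lambda>z. cmod (f z)"] continuous_intros) auto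
  then show ?thesis by (simp add: circle_mean_def divide_right_mono)
qed

text \<open>Approximation by real parts of polynomials, whose mean is the value at 0 however the
  circle is rotated. One inequality is enough, since the inverse rotation gives the other.\<close>

lemma circle_mean_rotate:
  fixes f :: "complex \<Rightarrow> real"
  assumes f: "continuous_on (sphere 0 1) f" and w: "cmod w = 1"
  shows "circle_mean (\<lambda>z. f (w * z)) = circle_mean f"
proof -
  have le: "circle_mean g \<le> circle_mean f'" if g: "continuous_on (sphere 0 1) f'" "\<And>z. g z = f' (v * z)" "cmod v = 1" for f' g :: "complex \<Rightarrow> real" and v
  proof (rule field_le_epsilon)
    fix e :: real assume e: "0 < e"
    obtain Q where Q: "\<And>z. z \<in> sphere 0 1 \<Longrightarrow> \<bar>f' z - Re (poly Q z)\<bar> < e / 2"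
      using Re_poly_dense_on_circle[OF zero_less_one g(1) half_gt_zero[OF e]] by blast
    have mv: "circle_mean (\<lambda>z. Re (poly Q (u * z))) = Re (poly Q 0)" for u :: complex
    proof -
      have "circle_mean (\<lambda>z. poly Q (u * z)) = poly Q 0"
        by (subst circle_mean_value) (auto intro!: holomorphic_intros)
      then show ?thesis
        by (subst circle_mean_linear[OF _ bounded_linear_Re]) (auto intro!: continuous_intros)
    qed
    have cg: "continuous_on (sphere 0 1) g"
      unfolding g(2) by (rule continuous_on_compose2[OF g(1)]) (use g(3) in \<open>auto intro!: continuous_intros simp: norm_mult\<close>)
    have "circle_mean g \<le> circle_mean (\<lambda>z. Re (poly Q (v * z)) + e / 2)"
    proof (rule circle_mean_mono[OF cg])
      fix z :: complex assume "z \<in> sphere 0 1"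
      then have "v * z \<in> sphere 0 1" using g(3) by (simp add: norm_mult)
      from Q[OF this] show "g z \<le> Re (poly Q (v * z)) + e / 2" unfolding g(2) by arith
    qed (intro continuous_intros)
    also have "\<dots> = circle_mean (\<lambda>z. Re (poly Q (1 * z)) + e / 2)"
      using mv[of 1] by (subst (1 2) circle_mean_add) (auto intro!: continuous_intros simp: mv)
    also have "\<dots> \<le> circle_mean (\<lambda>z. f' z + e)"
    proof (rule circle_mean_mono)
      fix z :: complex assume z: "z \<in> sphere 0 1"
      from Q[OF this] show "Re (poly Q (1 * z)) + e / 2 \<le> f' z + e" unfolding mult_1_left by arith
    qed (intro continuous_intros g(1))+
    also have "\<dots> = circle_mean f' + e"
      by (subst circle_mean_add) (auto intro!: continuous_intros g(1))
    finally show "circle_mean g \<le> circle_mean f' + e" .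
  qed
  have c: "continuous_on (sphere 0 1) (\<lambda>z. f (w * z))"
    by (rule continuous_on_compose2[OF f]) (use w in \<open>auto intro!: continuous_intros simp: norm_mult\<close>)
  have "w * (cnj w * z) = z" for z
    using w complex_norm_square[of w] by (simp flip: mult.assoc)
  then have "f z = f (w * (cnj w * z))" for z by (simp only:)
  then have "circle_mean f \<le> circle_mean (\<lambda>z. f (w * z))" by (rule le[OF c]) (use w in simp)
  moreover have "circle_mean (\<lambda>z. f (w * z)) \<le> circle_mean f" by (rule le[OF f _ w]) simp
  ultimately show ?thesis by simp
qed

section \<open>The mean of the Cauchy kernel over the circle\<close>

lemma cmod_cis_minus_1: "0 \<le> t \<Longrightarrow> t \<le> 2 * pi \<Longrightarrow> cmod (cis t - 1) = 2 * sin (t / 2)"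
proof -
  assume t: "0 \<le> t" "t \<le> 2 * pi"
  have "(cmod (cis t - 1))\<^sup>2 = (cos t - 1)\<^sup>2 + (sin t)\<^sup>2" by (simp add: cmod_power2)
  also have "\<dots> = 2 - 2 * cos (2 * (t / 2))"
    using sin_cos_squared_add[of t] by (simp add: power2_eq_square algebra_simps)
  also have "\<dots> = (2 * sin (t / 2))\<^sup>2" by (simp only: cos_double_sin) (simp add: power_mult_distrib)
  finally show ?thesis by (rule power2_eq_imp_eq) (use t in \<open>auto intro!: sin_ge_zero\<close>)
qed

lemma continuous_on_circle_kernel:
  assumes "0 \<le> s" "s < 1"
  shows "continuous_on (sphere 0 1) (\<lambda>z. 1 / cmod (z - of_real s))"
  using assms by (intro continuous_intros) auto

lemma circle_kernel_upper:
  assumes s: "0 \<le> s" "s < 1"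
  shows "circle_mean (\<lambda>z. 1 / cmod (z - of_real s)) \<le> 2 * ln (3 / (1 - s))"
proof -
  \<comment> \<open>From \<open>|cis t - s| \<ge> (1 - s + sin (t / 2)) / 2\<close> and the chord
    bound for the sine, each half of the circle is majorized by one summand; adding both avoids a
    splitting of the interval. \<open>A\<close> is an antiderivative.\<close>
  define k where "k = (\<lambda>t. 2 / (1 - s + t / pi) + 2 / (1 - s + (2 * pi - t) / pi))"
  define A where "A = (\<lambda>t. 2 * pi * ln (1 - s + t / pi) - 2 * pi * ln (1 - s + (2 * pi - t) / pi))"
  have pos: "0 < 1 - s + t / pi" "0 < 1 - s + (2 * pi - t) / pi" if "0 \<le> t" "t \<le> 2 * pi" for t
    using that s by (auto intro!: add_pos_nonneg)
  have I: "(k has_integral A (2 * pi) - A 0) {0..2 * pi}"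
  proof (rule fundamental_theorem_of_calculus)
    fix t assume t: "t \<in> {0..2 * pi}"
    define x where "x = 1 - s + t / pi"
    define y where "y = 1 - s + (2 * pi - t) / pi"
    have xy: "0 < x" "0 < y" using pos[of t] t by (auto simp: x_def y_def)
    have d1: "((\<lambda>t. 1 - s + t / pi) has_real_derivative 1 / pi) (at t within {0..2 * pi})"
      by (auto intro!: derivative_eq_intros)
    have d2: "((\<lambda>t. 1 - s + (2 * pi - t) / pi) has_real_derivative - (1 / pi)) (at t within {0..2 * pi})"
      by (auto intro!: derivative_eq_intros)
    have "(A has_real_derivative 2 * pi * (1 / x * (1 / pi)) - 2 * pi * (1 / y * - (1 / pi))) (at t within {0..2 * pi})"
      unfolding A_def x_def y_def
      by (intro DERIV_diff DERIV_cmult DERIV_chain2[OF DERIV_ln_divide d1] DERIV_chain2[OF DERIV_ln_divide d2])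
         (use xy in \<open>simp_all add: x_def y_def\<close>)
    moreover have "2 * pi * (1 / x * (1 / pi)) - 2 * pi * (1 / y * - (1 / pi)) = k t"
      by (simp add: k_def x_def[symmetric] y_def[symmetric])
    ultimately have "(A has_real_derivative k t) (at t within {0..2 * pi})" by simp
    then show "(A has_vector_derivative k t) (at t within {0..2 * pi})"
      by (simp add: has_real_derivative_iff_has_vector_derivative)
  qed auto
  have le: "1 / cmod (cis t - of_real s) \<le> k t" if t: "t \<in> {0..2 * pi}" for t
  proof -
    have a: "1 - s \<le> cmod (cis t - of_real s)" using norm_triangle_ineq2[of "cis t" "of_real s"] s by simp
    have "cmod (cis t - 1) \<le> cmod (cis t - of_real s) + cmod (of_real s - 1)"
      using norm_triangle_ineq[of "cis t - of_real s" "of_real s - 1"] by simp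
    also have "of_real s - 1 = (of_real (s - 1) :: complex)" by simp
    also have "cmod (of_real (s - 1)) = 1 - s" using s by (simp only: norm_of_real)
    finally have "2 * sin (t / 2) \<le> 2 * cmod (cis t - of_real s)" using a cmod_cis_minus_1[of t] t by simp
    then have b: "(1 - s + sin (t / 2)) / 2 \<le> cmod (cis t - of_real s)" using a by simp
    have c: "0 < cmod (cis t - of_real s)" using a s by linarith
    show ?thesis
    proof (cases "t \<le> pi")
      case True
      have "t / pi \<le> sin (t / pi * (pi / 2))" by (rule sin_ge_chord) (use t True in auto)
      then have "(1 - s + t / pi) / 2 \<le> cmod (cis t - of_real s)" using b by simp
      then have "1 / cmod (cis t - of_real s) \<le> 1 / ((1 - s + t / pi) / 2)"
        using pos[of t] t c by (intro divide_left_mono mult_pos_pos) auto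
      also have "\<dots> \<le> k t" unfolding k_def using pos[of t] t by simp
      finally show ?thesis .
    next
      case False
      have "(2 * pi - t) / pi \<le> sin ((2 * pi - t) / pi * (pi / 2))" by (rule sin_ge_chord) (use t False in \<open>auto simp: field_simps\<close>)
      also have "(2 * pi - t) / pi * (pi / 2) = pi - t / 2" by (simp add: field_simps)
      finally have "(1 - s + (2 * pi - t) / pi) / 2 \<le> cmod (cis t - of_real s)" using b by simp
      then have "1 / cmod (cis t - of_real s) \<le> 1 / ((1 - s + (2 * pi - t) / pi) / 2)"
        using pos[of t] t c by (intro divide_left_mono mult_pos_pos) auto
      also have "\<dots> \<le> k t" unfolding k_def using pos[of t] t by simp
      finally show ?thesis .
    qed
  qed
  have "integral {0..2 * pi} (\<lambda>t. 1 / cmod (cis t - of_real s)) \<le> integral {0..2 * pi} k"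
    by (rule integral_le[OF integrable_on_cis[OF continuous_on_circle_kernel[OF s]] has_integral_integrable[OF I] le])
  also have "\<dots> = A (2 * pi) - A 0" using I by (rule integral_unique)
  also have "\<dots> = 4 * pi * (ln (3 - s) - ln (1 - s))" by (simp add: A_def algebra_simps)
  also have "\<dots> = 4 * pi * ln ((3 - s) / (1 - s))" using s by (simp add: ln_div)
  also have "\<dots> \<le> 4 * pi * ln (3 / (1 - s))" using s by (simp add: divide_right_mono)
  finally show ?thesis unfolding circle_mean_def by (simp add: field_simps)
qed

text \<open>Already the crude bound \<open>|cis t - s| \<le> 1 - s + t\<close> leads to an integral
  with logarithmic growth; the upper end point contributes at least \<open>ln 1\<close>.\<close>

lemma circle_kernel_lower:
  assumes s: "0 \<le> s" "s < 1"
  shows "1 / (2 * pi) * ln (1 / (1 - s)) \<le> circle_mean (\<lambda>z. 1 / cmod (z - of_real s))"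
proof -
  define A where "A = (\<lambda>t. ln (1 - s + t))"
  have I: "((\<lambda>t. 1 / (1 - s + t)) has_integral A (2 * pi) - A 0) {0..2 * pi}"
  proof (rule fundamental_theorem_of_calculus)
    fix t assume t: "t \<in> {0..2 * pi}"
    have "(A has_real_derivative 1 / (1 - s + t)) (at t within {0..2 * pi})"
      unfolding A_def using s t by (auto intro!: derivative_eq_intros)
    then show "(A has_vector_derivative 1 / (1 - s + t)) (at t within {0..2 * pi})"
      by (simp add: has_real_derivative_iff_has_vector_derivative)
  qed auto
  have le: "1 / (1 - s + t) \<le> 1 / cmod (cis t - of_real s)" if t: "t \<in> {0..2 * pi}" for t
  proof -
    have "cmod (cis t - of_real s) \<le> cmod (cis t - 1) + cmod (1 - of_real s)"
      using norm_triangle_ineq[of "cis t - 1" "1 - of_real s"] by simp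
    also have "1 - of_real s = (of_real (1 - s) :: complex)" by simp
    also have "cmod (of_real (1 - s)) = 1 - s" using s by (simp only: norm_of_real)
    also have "cmod (cis t - 1) \<le> t" using cmod_cis_minus_1[of t] t sin_x_le_x[of "t / 2"] by simp
    finally have 1: "cmod (cis t - of_real s) \<le> 1 - s + t" by simp
    have "cis t \<noteq> of_real s"
    proof
      assume "cis t = of_real s"
      then have "cmod (cis t) = cmod (of_real s)" by simp
      then show False using s by simp
    qed
    then show ?thesis using 1 s t by (intro divide_left_mono mult_pos_pos) auto
  qed
  have "ln (1 / (1 - s)) = ln 1 - ln (1 - s)" using s by (simp add: ln_div)
  also have "\<dots> \<le> A (2 * pi) - A 0"
    using s pi_ge_two unfolding A_def by (intro diff_mono) (subst ln_le_cancel_iff, auto)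
  also have "\<dots> = integral {0..2 * pi} (\<lambda>t. 1 / (1 - s + t))" using I by (simp add: integral_unique)
  also have "\<dots> \<le> integral {0..2 * pi} (\<lambda>t. 1 / cmod (cis t - of_real s))"
    by (rule integral_le[OF has_integral_integrable[OF I] integrable_on_cis[OF continuous_on_circle_kernel[OF s]] le])
  finally show ?thesis unfolding circle_mean_def by (simp add: field_simps)
qed

lemma cn_holomorphic_on_cong:
  assumes "open S" "cn_holomorphic_on f S" "\<And>z. z \<in> S \<Longrightarrow> f z = g z"
  shows "cn_holomorphic_on g S"
  unfolding cn_holomorphic_on_def
proof
  fix z assume z: "z \<in> S"
  note f = cn_holomorphic_onE[OF assms(2) z]
  have "(g has_derivative frechet_derivative f (at z)) (at z)"
    by (rule has_derivative_transform_within_open[OF f(1) assms(1) z assms(3)])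
  then show "\<exists>f'. (g has_derivative f') (at z) \<and> (\<forall>c v. f' (c *s v) = c * f' v)"
    using f(2) by blast
qed

lemma cn_holomorphic_map_smult: "cn_holomorphic_map_on (\<lambda>z. c *s z) S"
  unfolding cn_holomorphic_map_on_def
  by (simp add: cn_holomorphic_mult cn_holomorphic_component)

lemma continuous_on_smult_both:
  fixes f :: "'a::topological_space \<Rightarrow> complex ^ 'n::finite"
  assumes "continuous_on S c" "continuous_on S f"
  shows "continuous_on S (\<lambda>x. c x *s f x)"
proof -
  have "continuous_on S (\<lambda>x. \<chi> i. c x * f x $ i)"
    by (intro continuous_on_vec_lambda continuous_intros assms)
  then show ?thesis by (simp add: vector_scalar_mult_def)
qed

section \<open>Rotations and slices on the Silov boundary\<close>

locale silov_setting =
  fixes \<Omega> :: "(complex ^ 'n::finite) set" and \<sigma> :: "(complex ^ 'n) measure"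
  assumes bsd: "bounded_symmetric_domain \<Omega>" and sr: "standard_realization \<Omega>"
    and sm: "silov_invariant_measure \<Omega> \<sigma>"
begin

abbreviation b where "b \<equiv> silov_boundary \<Omega>"

lemma open_\<Omega>: "open \<Omega>" and bounded_\<Omega>: "bounded \<Omega>"
  using bsd by (auto simp: bounded_symmetric_domain_def)

lemma zero_\<Omega>: "0 \<in> \<Omega>"
  using sr by (simp add: standard_realization_def)

lemma b_closure: "b \<subseteq> closure \<Omega>"
proof -
  have "maximum_modulus_set \<Omega> (closure \<Omega>)" unfolding maximum_modulus_set_def by auto
  then show ?thesis unfolding silov_boundary_def by blast
qed

lemma compact_b: "compact b"
proof -
  have "closed b" unfolding silov_boundary_def by (rule closed_Inter) (auto simp: maximum_modulus_set_def)
  moreover have "bounded b" using b_closure bounded_\<Omega> bounded_closure bounded_subset by blast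
  ultimately show ?thesis by (simp add: compact_eq_bounded_closed)
qed

lemma b_smult: "\<zeta> \<in> b \<Longrightarrow> cmod c < 1 \<Longrightarrow> c *s \<zeta> \<in> \<Omega>"
  using smult_closure_mem[OF bsd sr] b_closure by blast

lemma b_scaleR: "\<zeta> \<in> b \<Longrightarrow> 0 \<le> r \<Longrightarrow> r < 1 \<Longrightarrow> r *\<^sub>R \<zeta> \<in> \<Omega>"
  using b_smult[of \<zeta> "of_real r"] by (simp add: scaleR_eq_smult)

lemma sets_\<sigma>: "sets \<sigma> = sets (restrict_space borel b)"
  using sm by (simp add: silov_invariant_measure_def)

lemma space_\<sigma> [simp]: "space \<sigma> = b"
  using sets_eq_imp_space_eq[OF sets_\<sigma>] by (simp add: space_restrict_space)

lemma emeasure_b: "emeasure \<sigma> b = 1"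
  using sm by (simp add: silov_invariant_measure_def)

sublocale finite_measure \<sigma>
  by standard (simp add: emeasure_b)

lemma b_nonempty: "b \<noteq> {}"
  using emeasure_b by auto

lemma measure_b [simp]: "measure \<sigma> b = 1"
  by (simp add: measure_def emeasure_b)

lemma rot_image: "(\<lambda>z. cis \<theta> *s z) ` \<Omega> \<subseteq> \<Omega>"
  using sr by (auto simp: standard_realization_def)

lemma rot_closure: "z \<in> closure \<Omega> \<Longrightarrow> cis \<theta> *s z \<in> closure \<Omega>"
proof -
  assume z: "z \<in> closure \<Omega>"
  have c: "continuous_on (closure \<Omega>) (\<lambda>z. cis \<theta> *s z)" by (intro continuous_on_smult_right continuous_on_id)
  have "(\<lambda>z. cis \<theta> *s z) ` closure \<Omega> \<subseteq> closure \<Omega>"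
    by (rule image_closure_subset[OF c closed_closure]) (use rot_image[of \<theta>] closure_subset[of \<Omega>] in blast)
  then show ?thesis using z by blast
qed

lemma rot_cancel [simp]: "cis \<theta> * cis (- \<theta>) = 1" "cis (- \<theta>) * cis \<theta> = 1"
  by (simp_all add: cis_mult)

text \<open>The preimage of a maximum modulus set under a rotation is again one, so the intersection
  of all of them is rotation invariant.\<close>

lemma rot_b:
  assumes \<zeta>: "\<zeta> \<in> b"
  shows "cis \<theta> *s \<zeta> \<in> b"
  unfolding silov_boundary_def
proof (intro InterI, elim CollectE)
  fix E assume E: "maximum_modulus_set \<Omega> E"
  define E' where "E' = (\<lambda>z. cis \<theta> *s z) -` E"
  have "maximum_modulus_set \<Omega> E'"
    unfolding maximum_modulus_set_def
  proof (intro conjI allI impI ballI)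
    show "closed E'" unfolding E'_def
      using E by (intro closed_vimage continuous_on_smult_right continuous_on_id) (simp add: maximum_modulus_set_def)
    show "E' \<subseteq> closure \<Omega>"
    proof
      fix z assume "z \<in> E'"
      then have "cis \<theta> *s z \<in> closure \<Omega>" using E unfolding E'_def maximum_modulus_set_def by blast
      from rot_closure[OF this, of "- \<theta>"] show "z \<in> closure \<Omega>" by simp
    qed
    fix f z assume f: "continuous_on (closure \<Omega>) f \<and> cn_holomorphic_on f \<Omega>" and z: "z \<in> closure \<Omega>"
    define f' where "f' = (\<lambda>z. f (cis (- \<theta>) *s z))"
    have "continuous_on (closure \<Omega>) f'" unfolding f'_def
      by (rule continuous_on_compose2[OF conjunct1[OF f] continuous_on_smult_right[OF continuous_on_id]])
         (intro image_subsetI rot_closure)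
    moreover have "cn_holomorphic_on f' \<Omega>" unfolding f'_def
      by (rule cn_holomorphic_map_compose[OF conjunct2[OF f] cn_holomorphic_map_smult rot_image])
    ultimately obtain w where "w \<in> E" "cmod (f' (cis \<theta> *s z)) \<le> cmod (f' w)"
      using E rot_closure[OF z, of \<theta>] unfolding maximum_modulus_set_def by blast
    then show "\<exists>w\<in>E'. cmod (f z) \<le> cmod (f w)"
      by (intro bexI[of _ "cis (- \<theta>) *s w"]) (simp_all add: f'_def E'_def)
  qed
  then show "cis \<theta> *s \<zeta> \<in> E" using \<zeta> unfolding silov_boundary_def E'_def by blast
qed

lemma rot_isotropy: "(\<lambda>z. cis \<theta> *s z) \<in> isotropy_group \<Omega> 0"
proof -
  have bij: "bij_betw (\<lambda>z. cis \<theta> *s z) \<Omega> \<Omega>"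
    by (rule bij_betw_byWitness[where f' = "\<lambda>z. cis (- \<theta>) *s z"]) (use rot_image in auto)
  have "cn_holomorphic_map_on (inv_into \<Omega> (\<lambda>z. cis \<theta> *s z)) \<Omega>"
    unfolding cn_holomorphic_map_on_def
  proof
    fix i
    show "cn_holomorphic_on (\<lambda>z. inv_into \<Omega> (\<lambda>z. cis \<theta> *s z) z $ i) \<Omega>"
    \<comment> \<open>\<open>inv_into\<close> is known to be the opposite rotation only on
      \<open>\<Omega>\<close>, so holomorphy is transferred there and not by an equation of
      functions.\<close>
    proof (rule cn_holomorphic_on_cong[OF open_\<Omega>])
      show "cn_holomorphic_on (\<lambda>z. (cis (- \<theta>) *s z) $ i) \<Omega>"
        using cn_holomorphic_map_smult unfolding cn_holomorphic_map_on_def by blast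
      fix z assume z: "z \<in> \<Omega>"
      have "inv_into \<Omega> (\<lambda>z. cis \<theta> *s z) (cis \<theta> *s (cis (- \<theta>) *s z)) = cis (- \<theta>) *s z"
        using z rot_image[of "- \<theta>"] by (intro inv_into_f_f bij_betw_imp_inj_on[OF bij]) auto
      then show "(cis (- \<theta>) *s z) $ i = inv_into \<Omega> (\<lambda>z. cis \<theta> *s z) z $ i" by simp
    qed
  qed
  then show ?thesis unfolding isotropy_group_def holomorphic_automorphisms_def
    using bij cn_holomorphic_map_smult by auto
qed

lemma borel_measurable_continuous_on_b:
  fixes u :: "complex ^ 'n \<Rightarrow> 'a::topological_space"
  assumes "continuous_on b u"
  shows "u \<in> borel_measurable \<sigma>"
  using borel_measurable_continuous_on_restrict[OF assms] measurable_cong_sets[OF sets_\<sigma> refl] by blast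

lemma rot_measurable: "(\<lambda>z. cis \<theta> *s z) \<in> measurable \<sigma> \<sigma>"
proof -
  have "(\<lambda>z. cis \<theta> *s z) \<in> measurable \<sigma> (restrict_space borel b)"
    by (rule measurable_restrict_space2)
       (auto intro!: rot_b borel_measurable_continuous_on_b continuous_on_smult_right continuous_on_id)
  then show ?thesis using measurable_cong_sets[OF refl sets_\<sigma>] by blast
qed

lemma rot_distr: "distr \<sigma> \<sigma> (\<lambda>z. cis \<theta> *s z) = \<sigma>"
proof (rule measure_eqI)
  fix A assume "A \<in> sets (distr \<sigma> \<sigma> (\<lambda>z. cis \<theta> *s z))"
  then have A: "A \<in> sets \<sigma>" by simp
  have "emeasure \<sigma> {\<zeta>\<in>b. cis \<theta> *s \<zeta> \<in> A} = emeasure \<sigma> A"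
    using sm rot_isotropy A unfolding silov_invariant_measure_def
    by (auto intro!: continuous_on_smult_right continuous_on_id)
  then show "emeasure (distr \<sigma> \<sigma> (\<lambda>z. cis \<theta> *s z)) A = emeasure \<sigma> A"
    by (simp add: emeasure_distr[OF rot_measurable A] vimage_def Int_def conj_commute)
qed simp

lemma integral_rotate:
  fixes u :: "complex ^ 'n \<Rightarrow> real"
  assumes "continuous_on b u" and w: "cmod w = 1"
  shows "(LINT \<zeta>|\<sigma>. u (w *s \<zeta>)) = (LINT \<zeta>|\<sigma>. u \<zeta>)"
proof -
  have w: "w = cis (Arg w)" using rcis_cmod_Arg[of w] w by (simp add: rcis_def)
  have "(LINT \<zeta>|distr \<sigma> \<sigma> (\<lambda>z. cis (Arg w) *s z). u \<zeta>) = (LINT \<zeta>|\<sigma>. u (cis (Arg w) *s \<zeta>))"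
    by (rule integral_distr[OF rot_measurable borel_measurable_continuous_on_b[OF assms(1)]])
  then show ?thesis unfolding rot_distr unfolding w[symmetric] by simp
qed

lemma integrable_continuous_b:
  fixes u :: "complex ^ 'n \<Rightarrow> real"
  assumes "continuous_on b u"
  shows "integrable \<sigma> u"
proof -
  obtain B where "\<forall>x\<in>u ` b. norm x \<le> B"
    using compact_imp_bounded[OF compact_continuous_image[OF assms compact_b]] unfolding bounded_iff by blast
  then show ?thesis
    by (intro integrable_const_bound[of _ B] borel_measurable_continuous_on_b assms) auto
qed

lemma Fubini_circle:
  fixes v :: "complex ^ 'n \<Rightarrow> complex \<Rightarrow> real"
  assumes v: "continuous_on (b \<times> sphere 0 1) (\<lambda>(\<zeta>, z). v \<zeta> z)"
  shows "(LINT \<zeta>|\<sigma>. circle_mean (v \<zeta>)) = circle_mean (\<lambda>z. LINT \<zeta>|\<sigma>. v \<zeta> z)" (is ?eq)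
    and "integrable \<sigma> (\<lambda>\<zeta>. circle_mean (v \<zeta>))" (is ?int)
proof -
  define I where "I = {0..2 * pi}"
  define K where "K = b \<times> I"
  \<comment> \<open>Extension by 0 off the compact set \<open>K\<close> makes a continuous function
    Borel measurable on the product with the whole line, so that Fubini for \<open>\<sigma>\<close>
    and \<open>lborel\<close> applies.\<close>
  define V where "V = (\<lambda>x :: (complex ^ 'n) \<times> real. indicator K x *\<^sub>R v (fst x) (cis (snd x)))"
  interpret P: pair_sigma_finite \<sigma> lborel ..
  have cK: "compact K" unfolding K_def I_def by (intro compact_Times compact_b) simp
  have cont: "continuous_on K (\<lambda>x. v (fst x) (cis (snd x)))"
  proof -
    have "continuous_on K (\<lambda>x. (\<lambda>(\<zeta>, z). v \<zeta> z) (fst x, cis (snd x)))"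
      by (rule continuous_on_compose2[OF v]) (auto simp: K_def intro!: continuous_intros)
    then show ?thesis by simp
  qed
  obtain B where B: "\<forall>y\<in>(\<lambda>x. v (fst x) (cis (snd x))) ` K. norm y \<le> B"
    using compact_imp_bounded[OF compact_continuous_image[OF cont cK]] unfolding bounded_iff by blast
  have Kset: "K \<in> sets (\<sigma> \<Otimes>\<^sub>M lborel)"
    unfolding K_def I_def by (intro pair_measureI) (use sets.top[of \<sigma>] in auto)
  have "V \<in> borel_measurable borel"
    unfolding V_def using compact_imp_closed[OF cK] by (intro borel_measurable_continuous_on_indicator cont) auto
  \<comment> \<open>\<open>\<sigma>\<close> carries the trace of the Borel sets on the boundary, so
    measurability has to be pulled back along the inclusion.\<close>
  moreover have "(\<lambda>x. (fst x, snd x)) \<in> measurable (\<sigma> \<Otimes>\<^sub>M lborel) (borel \<Otimes>\<^sub>M borel)"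
  proof (intro measurable_Pair)
    have id: "(\<lambda>z. z) \<in> borel_measurable \<sigma>" by (intro borel_measurable_continuous_on_b continuous_intros)
    show "fst \<in> borel_measurable (\<sigma> \<Otimes>\<^sub>M lborel)" by (rule measurable_compose[OF measurable_fst id])
    show "snd \<in> borel_measurable (\<sigma> \<Otimes>\<^sub>M lborel)" by measurable
  qed
  then have "(\<lambda>x. x) \<in> borel_measurable (\<sigma> \<Otimes>\<^sub>M lborel)" by (simp add: borel_prod)
  ultimately have Vm: "V \<in> borel_measurable (\<sigma> \<Otimes>\<^sub>M lborel)"
    by (rule measurable_compose[rotated])
  have Vi: "integrable (\<sigma> \<Otimes>\<^sub>M lborel) V"
  proof (rule integrableI_bounded_set[OF Kset Vm])
    show "emeasure (\<sigma> \<Otimes>\<^sub>M lborel) K < \<infinity>"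
      unfolding K_def I_def using sets.top[of \<sigma>]
      by (subst lborel.emeasure_pair_measure_Times) (auto simp: emeasure_b ennreal_mult_less_top)
    show "AE x in \<sigma> \<Otimes>\<^sub>M lborel. x \<in> K \<longrightarrow> norm (V x) \<le> B"
      using B by (intro AE_I2) (auto simp: V_def)
    show "AE x in \<sigma> \<Otimes>\<^sub>M lborel. x \<notin> K \<longrightarrow> V x = 0"
      by (intro AE_I2) (auto simp: V_def)
  qed
  have mean: "circle_mean (v \<zeta>) = 1 / (2 * pi) * (LINT t|lborel. V (\<zeta>, t))" if \<zeta>: "\<zeta> \<in> b" for \<zeta>
  proof -
    have c: "continuous_on I (\<lambda>t. v \<zeta> (cis t))"
    proof -
      have "continuous_on I (\<lambda>t. (\<lambda>(\<zeta>, z). v \<zeta> z) (\<zeta>, cis t))"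
        by (rule continuous_on_compose2[OF v]) (use \<zeta> in \<open>auto intro!: continuous_intros\<close>)
      then show ?thesis by simp
    qed
    have "set_integrable lborel I (\<lambda>t. v \<zeta> (cis t))"
      unfolding I_def by (rule borel_integrable_atLeastAtMost') (use c in \<open>simp add: I_def\<close>)
    from set_borel_integral_eq_integral(2)[OF this]
    have "(LINT t|lborel. V (\<zeta>, t)) = integral I (\<lambda>t. v \<zeta> (cis t))"
      using \<zeta> by (simp add: set_lebesgue_integral_def V_def K_def indicator_def of_bool_def)
    then show ?thesis by (simp add: circle_mean_def I_def)
  qed
  have mean2: "circle_mean (\<lambda>z. LINT \<zeta>|\<sigma>. v \<zeta> z) = 1 / (2 * pi) * (LINT t|lborel. LINT \<zeta>|\<sigma>. V (\<zeta>, t))"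
  proof -
    have e: "(LINT \<zeta>|\<sigma>. V (\<zeta>, t)) = indicator I t *\<^sub>R (LINT \<zeta>|\<sigma>. v \<zeta> (cis t))" for t
    proof -
      have "(LINT \<zeta>|\<sigma>. V (\<zeta>, t)) = (LINT \<zeta>|\<sigma>. indicator I t *\<^sub>R v \<zeta> (cis t))"
        by (intro Bochner_Integration.integral_cong) (auto simp: V_def K_def indicator_def)
      then show ?thesis by simp
    qed
    have "integrable lborel (\<lambda>t. LINT \<zeta>|\<sigma>. V (\<zeta>, t))"
      by (rule P.integrable_snd) (use Vi in simp)
    then have "set_integrable lborel I (\<lambda>t. LINT \<zeta>|\<sigma>. v \<zeta> (cis t))"
      unfolding set_integrable_def e .
    from set_borel_integral_eq_integral(2)[OF this] show ?thesis
      unfolding e by (simp add: circle_mean_def I_def set_lebesgue_integral_def)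
  qed
  have fst: "integrable \<sigma> (\<lambda>\<zeta>. LINT t|lborel. V (\<zeta>, t))" by (rule P.integrable_fst'[OF Vi])
  then have "integrable \<sigma> (\<lambda>\<zeta>. 1 / (2 * pi) * (LINT t|lborel. V (\<zeta>, t)))" by simp
  then show ?int using mean by (subst Bochner_Integration.integrable_cong[OF refl]) auto
  have "(LINT \<zeta>|\<sigma>. circle_mean (v \<zeta>)) = (LINT \<zeta>|\<sigma>. 1 / (2 * pi) * (LINT t|lborel. V (\<zeta>, t)))"
    by (intro Bochner_Integration.integral_cong) (auto simp: mean)
  also have "\<dots> = 1 / (2 * pi) * (LINT \<zeta>|\<sigma>. LINT t|lborel. V (\<zeta>, t))" by simp
  also have "(LINT \<zeta>|\<sigma>. LINT t|lborel. V (\<zeta>, t)) = (LINT t|lborel. LINT \<zeta>|\<sigma>. V (\<zeta>, t))"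
    using P.Fubini_integral[of "\<lambda>\<zeta> t. V (\<zeta>, t)"] Vi by simp
  finally show ?eq using mean2 by simp
qed

lemma continuous_on_b_scaled:
  assumes u: "continuous_on \<Omega> u" and r: "0 \<le> r" "r < 1"
  shows "continuous_on b (\<lambda>\<zeta>. u (r *\<^sub>R \<zeta>))"
  by (rule continuous_on_compose2[OF u]) (auto intro!: continuous_intros b_scaleR r)

lemma continuous_on_b_circle:
  assumes u: "continuous_on \<Omega> u" and r: "0 \<le> r" "r < 1"
  shows "continuous_on (b \<times> sphere 0 1) (\<lambda>(\<zeta>, z). u ((of_real r * z) *s \<zeta>))"
  unfolding case_prod_beta
  by (rule continuous_on_compose2[OF u])
     (use r in \<open>auto intro!: continuous_on_smult_both continuous_intros b_smult simp: norm_mult\<close>)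

lemma integral_eq_circle_mean:
  fixes u :: "complex ^ 'n \<Rightarrow> real"
  assumes u: "continuous_on \<Omega> u" and r: "0 \<le> r" "r < 1"
  shows "(LINT \<zeta>|\<sigma>. u (r *\<^sub>R \<zeta>)) = (LINT \<zeta>|\<sigma>. circle_mean (\<lambda>z. u ((of_real r * z) *s \<zeta>)))"
    and "integrable \<sigma> (\<lambda>\<zeta>. circle_mean (\<lambda>z. u ((of_real r * z) *s \<zeta>)))"
proof -
  note F = Fubini_circle[OF continuous_on_b_circle[OF u r]]
  have c: "continuous_on b (\<lambda>\<zeta>. u (of_real r *s \<zeta>))"
    using continuous_on_b_scaled[OF u r] by (simp add: scaleR_eq_smult)
  have "(LINT \<zeta>|\<sigma>. u ((of_real r * z) *s \<zeta>)) = (LINT \<zeta>|\<sigma>. u (r *\<^sub>R \<zeta>))" if "cmod z = 1" for z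
    using integral_rotate[OF c that] by (simp add: scaleR_eq_smult vector_smult_assoc mult.commute)
  then have "circle_mean (\<lambda>z. LINT \<zeta>|\<sigma>. u ((of_real r * z) *s \<zeta>)) = circle_mean (\<lambda>z. LINT \<zeta>|\<sigma>. u (r *\<^sub>R \<zeta>))"
    unfolding circle_mean_def by simp
  with F(1) show "(LINT \<zeta>|\<sigma>. u (r *\<^sub>R \<zeta>)) = (LINT \<zeta>|\<sigma>. circle_mean (\<lambda>z. u ((of_real r * z) *s \<zeta>)))" by simp
  show "integrable \<sigma> (\<lambda>\<zeta>. circle_mean (\<lambda>z. u ((of_real r * z) *s \<zeta>)))" by (rule F(2))
qed

lemma integral_radius_mono:
  fixes u :: "complex ^ 'n \<Rightarrow> real"
  assumes u: "continuous_on \<Omega> u" and sub: "\<And>\<zeta>. \<zeta> \<in> b \<Longrightarrow> disc_subharmonic (\<lambda>z. u (z *s \<zeta>))"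
    and r: "0 \<le> r1" "r1 \<le> r2" "r2 < 1"
  shows "(LINT \<zeta>|\<sigma>. u (r1 *\<^sub>R \<zeta>)) \<le> (LINT \<zeta>|\<sigma>. u (r2 *\<^sub>R \<zeta>))"
proof -
  have r': "r1 < 1" "0 \<le> r2" using r by auto
  show ?thesis
    unfolding integral_eq_circle_mean(1)[OF u r(1) r'(1)] integral_eq_circle_mean(1)[OF u r'(2) r(3)]
  proof (rule integral_mono)
    fix \<zeta> assume "\<zeta> \<in> space \<sigma>"
    then show "circle_mean (\<lambda>z. u ((of_real r1 * z) *s \<zeta>)) \<le> circle_mean (\<lambda>z. u ((of_real r2 * z) *s \<zeta>))"
      using circle_mean_radius_mono[OF sub r] by simp
  qed (use integral_eq_circle_mean(2)[OF u] r in auto)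
qed

text \<open>The smaller radius is 0, where the total mass 1 turns the integral into
  \<open>u 0\<close>.\<close>

lemma value_le_integral:
  fixes u :: "complex ^ 'n \<Rightarrow> real"
  assumes u: "continuous_on \<Omega> u" and sub: "\<And>\<zeta>. \<zeta> \<in> b \<Longrightarrow> disc_subharmonic (\<lambda>z. u (z *s \<zeta>))"
    and r: "0 \<le> r" "r < 1"
  shows "u 0 \<le> (LINT \<zeta>|\<sigma>. u (r *\<^sub>R \<zeta>))"
  using integral_radius_mono[OF u sub order_refl r] by simp

lemma slice_holomorphic:
  assumes "cn_holomorphic_on h \<Omega>" "\<zeta> \<in> b"
  shows "(\<lambda>z. h (z *s \<zeta>)) holomorphic_on ball 0 1"
  using cn_holomorphic_slice[OF assms(1), of "ball 0 1" 0 \<zeta>] b_smult[OF assms(2)] by simp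

end

section \<open>Hardy norms for exponents larger than 1\<close>

lemma C1_eq: "0 < p \<Longrightarrow> C1 p = ((1 - \<bar>cos (pi / p)\<bar>) powr (p / 2)) powr (1 / p)"
  by (simp add: C1_def powr_powr powr_half_sqrt)

lemma C1_pos:
  assumes "1 < p"
  shows "0 < C1 p"
proof -
  have "0 < pi / p" "pi / p < pi" using assms by (auto simp: field_simps)
  then have "cos pi < cos (pi / p)" "cos (pi / p) < cos 0"
    using cos_monotone_0_pi[of "pi / p" pi] cos_monotone_0_pi[of 0 "pi / p"] by simp_all
  then show ?thesis by (simp add: C1_def abs_less_iff)
qed

text \<open>By the double-angle formulas, twice the larger of the squares of sine and cosine at
  \<open>pi / (2 * p)\<close> is \<open>1 + |cos (pi / p)|\<close>, the constant of the pointwise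
  inequality.\<close>

lemma C2_eq:
  assumes p: "1 < p"
  shows "C2 p = ((1 + \<bar>cos (pi / p)\<bar>) powr (p / 2)) powr (1 / p)"
proof -
  define s where "s = sin (pi / (2 * p))"
  define c where "c = cos (pi / (2 * p))"
  have sc: "0 < s" "0 < c" using half_angle_facts(1,2)[OF p] by (auto simp: s_def c_def)
  have cs: "cos (pi / p) = 2 * c\<^sup>2 - 1" "cos (pi / p) = 1 - 2 * s\<^sup>2"
    using cos_double_cos[of "pi / (2 * p)"] cos_double_sin[of "pi / (2 * p)"] by (simp_all add: s_def c_def)
  have "(C2 p)\<^sup>2 = 2 * (max s c)\<^sup>2"
    by (simp add: C2_def s_def c_def power_mult_distrib)
  also have "(max s c)\<^sup>2 = max (s\<^sup>2) (c\<^sup>2)" using sc by (auto simp: max_def power_mono_iff)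
  also have "2 * max (s\<^sup>2) (c\<^sup>2) = 1 + \<bar>cos (pi / p)\<bar>" using cs by (auto simp: max_def)
  finally have "C2 p = sqrt (1 + \<bar>cos (pi / p)\<bar>)"
    using sc by (intro real_sqrt_unique[symmetric]) (auto simp: C2_def s_def c_def)
  then show ?thesis using p by (simp add: powr_powr powr_half_sqrt)
qed

text \<open>The sum is at most twice the larger norm. This argument also covers exponents below 1,
  where the power is not convex.\<close>

lemma norm_add_powr_le:
  fixes a c :: "'a::real_normed_vector"
  assumes "0 \<le> p"
  shows "norm (a + c) powr p \<le> 2 powr p * (norm a powr p + norm c powr p)"
proof -
  define m where "m = max (norm a) (norm c)"
  have m: "0 \<le> m" "norm (a + c) \<le> 2 * m"
    using norm_triangle_ineq[of a c] norm_ge_zero[of a] by (auto simp: m_def le_max_iff_disj)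
  have "norm (a + c) powr p \<le> (2 * m) powr p" using m assms by (intro powr_mono2) auto
  also have "\<dots> = 2 powr p * m powr p" using m by (simp add: powr_mult)
  also have "m powr p \<le> norm a powr p + norm c powr p" by (auto simp: m_def max_def)
  finally show ?thesis by simp
qed

lemma cmod_powr_le_pair:
  assumes "0 \<le> p"
  shows "cmod x powr p \<le> ((cmod x)\<^sup>2 + (cmod y)\<^sup>2) powr (p / 2)"
    and "((cmod x)\<^sup>2 + (cmod y)\<^sup>2) powr (p / 2) \<le> 2 powr p * (cmod x powr p + cmod y powr p)"
proof -
  have sq: "t powr p = (t\<^sup>2) powr (p / 2)" if "0 \<le> t" for t :: real
    using that by (cases "t = 0") (auto simp: powr_powr simp flip: powr_numeral)
  show "cmod x powr p \<le> ((cmod x)\<^sup>2 + (cmod y)\<^sup>2) powr (p / 2)"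
    using assms by (subst sq) (auto intro!: powr_mono2)
  have "((cmod x)\<^sup>2 + (cmod y)\<^sup>2) powr (p / 2) \<le> ((cmod x + cmod y)\<^sup>2) powr (p / 2)"
    using assms by (intro powr_mono2) (auto simp: power2_sum)
  also have "\<dots> = norm (cmod x + cmod y) powr p" by (subst sq[symmetric]) auto
  also have "\<dots> \<le> 2 powr p * (cmod x powr p + cmod y powr p)"
    using norm_add_powr_le[OF assms, of "cmod x" "cmod y"] by simp
  finally show "((cmod x)\<^sup>2 + (cmod y)\<^sup>2) powr (p / 2) \<le> 2 powr p * (cmod x powr p + cmod y powr p)" .
qed

lemma mono_bounded_limit_at_left:
  fixes f :: "real \<Rightarrow> real"
  assumes mono: "\<And>r s. 0 \<le> r \<Longrightarrow> r \<le> s \<Longrightarrow> s < 1 \<Longrightarrow> f r \<le> f s"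
    and bound: "\<And>r. 0 \<le> r \<Longrightarrow> r < 1 \<Longrightarrow> f r \<le> B"
  obtains L where "(f \<longlongrightarrow> L) (at_left 1)" "L \<le> B" "\<And>r. 0 \<le> r \<Longrightarrow> r < 1 \<Longrightarrow> f r \<le> L"
proof -
  define L where "L = (SUP r\<in>{0..<1}. f r)"
  have bdd: "bdd_above (f ` {0..<1})" using bound by (intro bdd_aboveI2[of _ _ B]) auto
  have up: "f r \<le> L" if "0 \<le> r" "r < 1" for r
    unfolding L_def using that by (intro cSUP_upper bdd) auto
  have "L \<le> B" unfolding L_def using bound by (intro cSUP_least) auto
  moreover have "(f \<longlongrightarrow> L) (at_left 1)"
  proof (rule order_tendstoI)
    fix a assume "a < L"
    then obtain r where r: "0 \<le> r" "r < 1" "a < f r"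
      unfolding L_def using less_cSUP_iff[OF _ bdd, of a] by auto
    have "a < f x" if "r < x" "x < 1" for x using mono[of r x] that r by linarith
    then show "\<forall>\<^sub>F x in at_left 1. a < f x" using r eventually_at_left[of r 1] by auto
  next
    fix a assume a: "L < a"
    have "f x < a" if "0 < x" "x < 1" for x using up[of x] that a by linarith
    then show "\<forall>\<^sub>F x in at_left 1. f x < a" using eventually_at_left[of 0 "1::real"] by (auto intro!: exI[of _ 0])
  qed
  ultimately show ?thesis using that up by blast
qed

section \<open>Integrated Riesz inequalities and the norm estimates\<close>

context silov_setting
begin

lemma integrable_scaled:
  fixes u :: "complex ^ 'n \<Rightarrow> real"
  assumes "continuous_on \<Omega> u" "0 \<le> r" "r < 1"
  shows "integrable \<sigma> (\<lambda>\<zeta>. u (r *\<^sub>R \<zeta>))"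
  by (rule integrable_continuous_b[OF continuous_on_b_scaled[OF assms]])

lemma integral_scaled_mono:
  fixes u v :: "complex ^ 'n \<Rightarrow> real"
  assumes "continuous_on \<Omega> u" "continuous_on \<Omega> v" "0 \<le> r" "r < 1" "\<And>z. z \<in> \<Omega> \<Longrightarrow> u z \<le> v z"
  shows "(LINT \<zeta>|\<sigma>. u (r *\<^sub>R \<zeta>)) \<le> (LINT \<zeta>|\<sigma>. v (r *\<^sub>R \<zeta>))"
  by (rule integral_mono) (use assms b_scaleR in \<open>auto intro!: integrable_scaled\<close>)

lemma continuous_cmod_powr:
  assumes "continuous_on \<Omega> f" "0 < p"
  shows "continuous_on \<Omega> (\<lambda>z. cmod (f z) powr p)"
  using assms by (intro continuous_on_powr' continuous_intros) auto

lemma continuous_pair_powr: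
  assumes "continuous_on \<Omega> h" "continuous_on \<Omega> g" "0 < p"
  shows "continuous_on \<Omega> (\<lambda>z. ((cmod (h z))\<^sup>2 + (cmod (g z))\<^sup>2) powr (p / 2))"
  using assms by (intro continuous_on_powr' continuous_intros) auto

lemma hardy_mean_real:
  "hardy_mean \<Omega> \<sigma> (ereal p) r f = (LINT \<zeta>|\<sigma>. cmod (f (r *\<^sub>R \<zeta>)) powr p) powr (1 / p)"
  by (simp add: hardy_mean_def)

lemma hardy_mean_one:
  "hardy_mean \<Omega> \<sigma> 1 r f = (LINT \<zeta>|\<sigma>. cmod (f (r *\<^sub>R \<zeta>)))"
  by (simp add: hardy_mean_def)

lemma hardy_norm_finite_iff:
  "hardy_norm \<Omega> \<sigma> p f < \<infinity> \<longleftrightarrow> (\<exists>B. \<forall>r\<in>{0..<1}. hardy_mean \<Omega> \<sigma> p r f \<le> B)"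
proof
  assume fin: "hardy_norm \<Omega> \<sigma> p f < \<infinity>"
  have up: "ereal (hardy_mean \<Omega> \<sigma> p r f) \<le> hardy_norm \<Omega> \<sigma> p f" if "r \<in> {0..<1}" for r
    unfolding hardy_norm_def using that by (rule SUP_upper)
  obtain N where "hardy_norm \<Omega> \<sigma> p f = ereal N"
    using fin up[of 0] by (cases "hardy_norm \<Omega> \<sigma> p f") auto
  then show "\<exists>B. \<forall>r\<in>{0..<1}. hardy_mean \<Omega> \<sigma> p r f \<le> B" using up by (intro exI[of _ N]) auto
next
  assume "\<exists>B. \<forall>r\<in>{0..<1}. hardy_mean \<Omega> \<sigma> p r f \<le> B"
  then obtain B where "\<forall>r\<in>{0..<1}. hardy_mean \<Omega> \<sigma> p r f \<le> B" by blast
  then have "hardy_norm \<Omega> \<sigma> p f \<le> ereal B" unfolding hardy_norm_def by (intro SUP_least) auto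
  then show "hardy_norm \<Omega> \<sigma> p f < \<infinity>" by (rule le_less_trans) simp
qed

lemma hardy_norm_finite_real_iff:
  assumes p: "0 < p"
  shows "hardy_norm \<Omega> \<sigma> (ereal p) f < \<infinity> \<longleftrightarrow> (\<exists>B. \<forall>r\<in>{0..<1}. (LINT \<zeta>|\<sigma>. cmod (f (r *\<^sub>R \<zeta>)) powr p) \<le> B)"
  unfolding hardy_norm_finite_iff hardy_mean_real
proof
  have nn: "0 \<le> (LINT \<zeta>|\<sigma>. cmod (f (r *\<^sub>R \<zeta>)) powr p)" for r by (intro Bochner_Integration.integral_nonneg) simp
  assume "\<exists>B. \<forall>r\<in>{0..<1}. (LINT \<zeta>|\<sigma>. cmod (f (r *\<^sub>R \<zeta>)) powr p) powr (1 / p) \<le> B"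
  then obtain B where B: "\<And>r. r \<in> {0..<1} \<Longrightarrow> (LINT \<zeta>|\<sigma>. cmod (f (r *\<^sub>R \<zeta>)) powr p) powr (1 / p) \<le> B" by blast
  have "(LINT \<zeta>|\<sigma>. cmod (f (r *\<^sub>R \<zeta>)) powr p) \<le> B powr p" if "r \<in> {0..<1}" for r
    using powr_mono2[OF _ _ B[OF that], of p] p nn[of r] by (simp add: powr_powr)
  then show "\<exists>B. \<forall>r\<in>{0..<1}. (LINT \<zeta>|\<sigma>. cmod (f (r *\<^sub>R \<zeta>)) powr p) \<le> B" by blast
next
  have nn: "0 \<le> (LINT \<zeta>|\<sigma>. cmod (f (r *\<^sub>R \<zeta>)) powr p)" for r by (intro Bochner_Integration.integral_nonneg) simp
  assume "\<exists>B. \<forall>r\<in>{0..<1}. (LINT \<zeta>|\<sigma>. cmod (f (r *\<^sub>R \<zeta>)) powr p) \<le> B"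
  then obtain B where B: "\<And>r. r \<in> {0..<1} \<Longrightarrow> (LINT \<zeta>|\<sigma>. cmod (f (r *\<^sub>R \<zeta>)) powr p) \<le> B" by blast
  have "(LINT \<zeta>|\<sigma>. cmod (f (r *\<^sub>R \<zeta>)) powr p) powr (1 / p) \<le> B powr (1 / p)" if "r \<in> {0..<1}" for r
    using B[OF that] nn[of r] p by (intro powr_mono2) auto
  then show "\<exists>B. \<forall>r\<in>{0..<1}. (LINT \<zeta>|\<sigma>. cmod (f (r *\<^sub>R \<zeta>)) powr p) powr (1 / p) \<le> B" by blast
qed

lemma PH_add_cnj_iff:
  assumes "cn_holomorphic_on h \<Omega>" "cn_holomorphic_on g \<Omega>" "0 < p"
  shows "(\<lambda>z. h z + cnj (g z)) \<in> PH \<Omega> \<sigma> (ereal p) \<longleftrightarrow>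
     (\<exists>B. \<forall>r\<in>{0..<1}. (LINT \<zeta>|\<sigma>. cmod (h (r *\<^sub>R \<zeta>) + cnj (g (r *\<^sub>R \<zeta>))) powr p) \<le> B)"
  unfolding PH_def using pluriharmonic_add_cnj[OF open_\<Omega> assms(1,2)] hardy_norm_finite_real_iff[OF assms(3)] by simp

lemma PH_holomorphic_iff:
  assumes "cn_holomorphic_on h \<Omega>" "0 < p"
  shows "h \<in> PH \<Omega> \<sigma> (ereal p) \<longleftrightarrow> (\<exists>B. \<forall>r\<in>{0..<1}. (LINT \<zeta>|\<sigma>. cmod (h (r *\<^sub>R \<zeta>)) powr p) \<le> B)"
  unfolding PH_def using pluriharmonic_cn_holomorphic[OF open_\<Omega> assms(1)] hardy_norm_finite_real_iff[OF assms(2)] by simp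

lemma integral_riesz_fn_nonneg:
  assumes p: "1 < p" and F: "cn_holomorphic_on F \<Omega>" and r: "0 \<le> r" "r < 1" and F0: "0 \<le> Re (F 0)"
  shows "0 \<le> (LINT \<zeta>|\<sigma>. riesz_fn p (F (r *\<^sub>R \<zeta>)))"
    and "continuous_on \<Omega> (\<lambda>z. riesz_fn p (F z))"
proof -
  show c: "continuous_on \<Omega> (\<lambda>z. riesz_fn p (F z))"
    by (rule continuous_on_compose2[OF continuous_riesz_fn[OF p] cn_holomorphic_imp_continuous_on[OF F]]) simp
  have "riesz_fn p (F 0) \<le> (LINT \<zeta>|\<sigma>. riesz_fn p (F (r *\<^sub>R \<zeta>)))"
    by (rule value_le_integral[OF c disc_subharmonic_riesz_fn[OF p slice_holomorphic[OF F]] r])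
  then show "0 \<le> (LINT \<zeta>|\<sigma>. riesz_fn p (F (r *\<^sub>R \<zeta>)))" using riesz_fn_nonneg[OF p F0] by linarith
qed

context
  fixes h g :: "complex ^ 'n \<Rightarrow> complex"
  assumes h: "cn_holomorphic_on h \<Omega>" and g: "cn_holomorphic_on g \<Omega>"
begin

lemma continuous_hgf: "continuous_on \<Omega> h" "continuous_on \<Omega> g" "continuous_on \<Omega> (\<lambda>z. h z + cnj (g z))"
  by (intro continuous_intros cn_holomorphic_imp_continuous_on h g)+

lemma riesz_integral_lower:
  assumes p: "1 < p" and r: "0 \<le> r" "r < 1" and pos: "0 \<le> Re (g 0 * h 0)"
  shows "(1 - \<bar>cos (pi / p)\<bar>) powr (p / 2) * (LINT \<zeta>|\<sigma>. ((cmod (h (r *\<^sub>R \<zeta>)))\<^sup>2 + (cmod (g (r *\<^sub>R \<zeta>)))\<^sup>2) powr (p / 2))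
     \<le> (LINT \<zeta>|\<sigma>. cmod (h (r *\<^sub>R \<zeta>) + cnj (g (r *\<^sub>R \<zeta>))) powr p)"
proof -
  obtain \<kappa> where \<kappa>: "0 \<le> \<kappa>" "\<And>z w. (1 - \<bar>cos (pi / p)\<bar>) powr (p / 2) *
      (((cmod z)\<^sup>2 + (cmod w)\<^sup>2) powr (p / 2) + \<kappa> * riesz_fn p (2 * z * w)) \<le> cmod (z + cnj w) powr p"
    using riesz_pointwise_lower[OF p] by metis
  define m where "m = (1 - \<bar>cos (pi / p)\<bar>) powr (p / 2)"
  have F: "cn_holomorphic_on (\<lambda>z. 2 * h z * g z) \<Omega>" by (intro cn_holomorphic_mult cn_holomorphic_const h g)
  have F0: "0 \<le> Re (2 * h 0 * g 0)" using pos by (simp add: mult.commute)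
  note R = integral_riesz_fn_nonneg[OF p F r F0]
  define P where "P = (\<lambda>z. ((cmod (h z))\<^sup>2 + (cmod (g z))\<^sup>2) powr (p / 2))"
  have cP: "continuous_on \<Omega> P" unfolding P_def using p by (intro continuous_pair_powr continuous_hgf) auto
  have "m * (LINT \<zeta>|\<sigma>. P (r *\<^sub>R \<zeta>)) \<le> m * ((LINT \<zeta>|\<sigma>. P (r *\<^sub>R \<zeta>)) + \<kappa> * (LINT \<zeta>|\<sigma>. riesz_fn p (2 * h (r *\<^sub>R \<zeta>) * g (r *\<^sub>R \<zeta>))))"
    using R(1) \<kappa>(1) by (intro mult_left_mono) (auto simp: m_def)
  also have "\<dots> = (LINT \<zeta>|\<sigma>. m * (P (r *\<^sub>R \<zeta>) + \<kappa> * riesz_fn p (2 * h (r *\<^sub>R \<zeta>) * g (r *\<^sub>R \<zeta>))))"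
    using integrable_scaled[OF cP r] integrable_scaled[OF R(2) r] by simp
  also have "\<dots> \<le> (LINT \<zeta>|\<sigma>. cmod (h (r *\<^sub>R \<zeta>) + cnj (g (r *\<^sub>R \<zeta>))) powr p)"
    by (rule integral_scaled_mono[where u = "\<lambda>z. m * (P z + \<kappa> * riesz_fn p (2 * h z * g z))" and v = "\<lambda>z. cmod (h z + cnj (g z)) powr p"])
       (use \<kappa>(2) r p in \<open>auto simp: m_def P_def intro!: continuous_intros cP[unfolded P_def] R(2) continuous_cmod_powr continuous_hgf\<close>)
  finally show ?thesis by (simp add: m_def P_def)
qed

lemma riesz_integral_upper:
  assumes p: "1 < p" and r: "0 \<le> r" "r < 1" and neg: "Re (g 0 * h 0) \<le> 0"
  shows "(LINT \<zeta>|\<sigma>. cmod (h (r *\<^sub>R \<zeta>) + cnj (g (r *\<^sub>R \<zeta>))) powr p)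
     \<le> (1 + \<bar>cos (pi / p)\<bar>) powr (p / 2) * (LINT \<zeta>|\<sigma>. ((cmod (h (r *\<^sub>R \<zeta>)))\<^sup>2 + (cmod (g (r *\<^sub>R \<zeta>)))\<^sup>2) powr (p / 2))"
proof -
  obtain \<kappa> where \<kappa>: "0 \<le> \<kappa>" "\<And>z w. cmod (z + cnj w) powr p \<le> (1 + \<bar>cos (pi / p)\<bar>) powr (p / 2) *
      (((cmod z)\<^sup>2 + (cmod w)\<^sup>2) powr (p / 2) - \<kappa> * riesz_fn p (- (2 * z * w)))"
    using riesz_pointwise_upper[OF p] by metis
  define m where "m = (1 + \<bar>cos (pi / p)\<bar>) powr (p / 2)"
  have "cn_holomorphic_on (\<lambda>z. (- 2) * h z * g z) \<Omega>" by (intro cn_holomorphic_mult cn_holomorphic_const h g)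
  then have F: "cn_holomorphic_on (\<lambda>z. - (2 * h z * g z)) \<Omega>" by simp
  have F0: "0 \<le> Re (- (2 * h 0 * g 0))" using neg by (simp add: mult.commute)
  note R = integral_riesz_fn_nonneg[OF p F r F0]
  define P where "P = (\<lambda>z. ((cmod (h z))\<^sup>2 + (cmod (g z))\<^sup>2) powr (p / 2))"
  have cP: "continuous_on \<Omega> P" unfolding P_def using p by (intro continuous_pair_powr continuous_hgf) auto
  have "(LINT \<zeta>|\<sigma>. cmod (h (r *\<^sub>R \<zeta>) + cnj (g (r *\<^sub>R \<zeta>))) powr p) \<le> (LINT \<zeta>|\<sigma>. m * (P (r *\<^sub>R \<zeta>) - \<kappa> * riesz_fn p (- (2 * h (r *\<^sub>R \<zeta>) * g (r *\<^sub>R \<zeta>)))))"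
    by (rule integral_scaled_mono[where v = "\<lambda>z. m * (P z - \<kappa> * riesz_fn p (- (2 * h z * g z)))" and u = "\<lambda>z. cmod (h z + cnj (g z)) powr p"])
       (use \<kappa>(2) r p in \<open>auto simp: m_def P_def intro!: continuous_intros cP[unfolded P_def] R(2) continuous_cmod_powr continuous_hgf\<close>)
  also have "\<dots> = m * ((LINT \<zeta>|\<sigma>. P (r *\<^sub>R \<zeta>)) - \<kappa> * (LINT \<zeta>|\<sigma>. riesz_fn p (- (2 * h (r *\<^sub>R \<zeta>) * g (r *\<^sub>R \<zeta>)))))"
    using integrable_scaled[OF cP r] integrable_scaled[OF R(2) r] by simp
  also have "\<dots> \<le> m * (LINT \<zeta>|\<sigma>. P (r *\<^sub>R \<zeta>))"
    using R(1) \<kappa>(1) by (intro mult_left_mono) (auto simp: m_def)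
  finally show ?thesis by (simp add: m_def P_def)
qed

lemma pair_mean_mono:
  assumes p: "0 < p" and r: "0 \<le> r" "r \<le> s" "s < 1"
  shows "pair_mean \<sigma> p r h g \<le> pair_mean \<sigma> p s h g"
  unfolding pair_mean_def
proof (rule powr_mono2)
  show "(LINT \<zeta>|\<sigma>. ((cmod (h (r *\<^sub>R \<zeta>)))\<^sup>2 + (cmod (g (r *\<^sub>R \<zeta>)))\<^sup>2) powr (p / 2))
      \<le> (LINT \<zeta>|\<sigma>. ((cmod (h (s *\<^sub>R \<zeta>)))\<^sup>2 + (cmod (g (s *\<^sub>R \<zeta>)))\<^sup>2) powr (p / 2))"
    using integral_radius_mono[OF continuous_pair_powr[OF continuous_hgf(1,2) p]
        disc_subharmonic_pair[OF p slice_holomorphic[OF h] slice_holomorphic[OF g]] r] .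
qed (use p in \<open>auto intro!: Bochner_Integration.integral_nonneg\<close>)

end

lemma PH_add_cnj_split:
  assumes h: "cn_holomorphic_on h \<Omega>" and g: "cn_holomorphic_on g \<Omega>" and p: "1 < p"
    and f: "(\<lambda>z. h z + cnj (g z)) \<in> PH \<Omega> \<sigma> (ereal p)"
  shows "h \<in> PH \<Omega> \<sigma> (ereal p)" "g \<in> PH \<Omega> \<sigma> (ereal p)"
proof -
  have p0: "0 < p" using p by simp
  obtain B where B: "\<And>r. r \<in> {0..<1} \<Longrightarrow> (LINT \<zeta>|\<sigma>. cmod (h (r *\<^sub>R \<zeta>) + cnj (g (r *\<^sub>R \<zeta>))) powr p) \<le> B"
    using f unfolding PH_add_cnj_iff[OF h g p0] by blast
  \<comment> \<open>\<open>h1 + cnj g1\<close> is still \<open>f\<close>, and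
    \<open>h1 0 = 0\<close> meets the sign condition of the lower estimate.\<close>
  define h1 where "h1 = (\<lambda>z. h z + (- h 0))"
  define g1 where "g1 = (\<lambda>z. g z + cnj (h 0))"
  have h1: "cn_holomorphic_on h1 \<Omega>" and g1: "cn_holomorphic_on g1 \<Omega>"
    unfolding h1_def g1_def by (intro cn_holomorphic_add cn_holomorphic_const h g)+
  define m where "m = (1 - \<bar>cos (pi / p)\<bar>) powr (p / 2)"
  have m: "0 < m" using C1_pos[OF p] by (simp add: m_def C1_def)
  define P where "P = (\<lambda>z. ((cmod (h1 z))\<^sup>2 + (cmod (g1 z))\<^sup>2) powr (p / 2))"
  have cP: "continuous_on \<Omega> P"
    unfolding P_def using p by (intro continuous_pair_powr continuous_hgf[OF h1 g1]) auto
  have PB: "(LINT \<zeta>|\<sigma>. P (r *\<^sub>R \<zeta>)) \<le> B / m" if r: "r \<in> {0..<1}" for r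
  proof -
    have "m * (LINT \<zeta>|\<sigma>. P (r *\<^sub>R \<zeta>)) \<le> (LINT \<zeta>|\<sigma>. cmod (h1 (r *\<^sub>R \<zeta>) + cnj (g1 (r *\<^sub>R \<zeta>))) powr p)"
      unfolding m_def P_def using r by (intro riesz_integral_lower[OF h1 g1 p]) (auto simp: h1_def)
    also have "\<dots> \<le> B" using B[OF r] by (simp add: h1_def g1_def)
    finally show ?thesis using m by (simp add: field_simps)
  qed
  have bound: "\<exists>B. \<forall>r\<in>{0..<1}. (LINT \<zeta>|\<sigma>. cmod (k (r *\<^sub>R \<zeta>)) powr p) \<le> B"
    if k: "continuous_on \<Omega> k" "\<And>z. cmod (k z + c) powr p \<le> P z" for k :: "complex ^ 'n \<Rightarrow> complex" and c
  proof (intro exI ballI)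
    fix r :: real assume r: "r \<in> {0..<1}"
    have le: "cmod (k z) powr p \<le> 2 powr p * (P z + cmod c powr p)" for z
    proof -
      have "cmod (k z) powr p \<le> 2 powr p * (cmod (k z + c) powr p + cmod (- c) powr p)"
        using norm_add_powr_le[of p "k z + c" "- c"] p by simp
      also have "\<dots> \<le> 2 powr p * (P z + cmod c powr p)" using k(2)[of z] by simp
      finally show ?thesis .
    qed
    have "(LINT \<zeta>|\<sigma>. cmod (k (r *\<^sub>R \<zeta>)) powr p) \<le> (LINT \<zeta>|\<sigma>. 2 powr p * (P (r *\<^sub>R \<zeta>) + cmod c powr p))"
      by (rule integral_scaled_mono[where u = "\<lambda>z. cmod (k z) powr p" and v = "\<lambda>z. 2 powr p * (P z + cmod c powr p)"])
         (use r le p0 k in \<open>auto intro!: continuous_cmod_powr continuous_intros cP\<close>)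
    also have "\<dots> = 2 powr p * ((LINT \<zeta>|\<sigma>. P (r *\<^sub>R \<zeta>)) + cmod c powr p)"
      using r integrable_scaled[OF cP, of r] by simp
    also have "\<dots> \<le> 2 powr p * (B / m + cmod c powr p)" using PB[OF r] by simp
    finally show "(LINT \<zeta>|\<sigma>. cmod (k (r *\<^sub>R \<zeta>)) powr p) \<le> 2 powr p * (B / m + cmod c powr p)" .
  qed
  show "h \<in> PH \<Omega> \<sigma> (ereal p)"
    unfolding PH_holomorphic_iff[OF h p0]
    by (rule bound[of h "- h 0"])
       (use p cmod_powr_le_pair(1)[of p "h1 z" "g1 z" for z] in \<open>auto simp: P_def h1_def intro: continuous_hgf[OF h g]\<close>)
  show "g \<in> PH \<Omega> \<sigma> (ereal p)"
    unfolding PH_holomorphic_iff[OF g p0]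
    by (rule bound[of g "cnj (h 0)"])
       (use p cmod_powr_le_pair(1)[of p "g1 z" "h1 z" for z] in \<open>auto simp: P_def g1_def add.commute intro: continuous_hgf[OF h g]\<close>)
qed

text \<open>One bound for two uses: the integrand dominates the power \<open>p\<close> of
  \<open>cmod (h + cnj g)\<close> as well as the power of the pair.\<close>

lemma PH_add_cnj_join:
  assumes h: "cn_holomorphic_on h \<Omega>" and g: "cn_holomorphic_on g \<Omega>" and p: "0 < p"
    and PH: "h \<in> PH \<Omega> \<sigma> (ereal p)" "g \<in> PH \<Omega> \<sigma> (ereal p)"
  obtains B where "\<And>r. r \<in> {0..<1} \<Longrightarrow> (LINT \<zeta>|\<sigma>. 2 powr p * (cmod (h (r *\<^sub>R \<zeta>)) powr p + cmod (g (r *\<^sub>R \<zeta>)) powr p)) \<le> B"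
proof -
  obtain B1 where B1: "\<And>r. r \<in> {0..<1} \<Longrightarrow> (LINT \<zeta>|\<sigma>. cmod (h (r *\<^sub>R \<zeta>)) powr p) \<le> B1"
    using PH(1) unfolding PH_holomorphic_iff[OF h p] by blast
  obtain B2 where B2: "\<And>r. r \<in> {0..<1} \<Longrightarrow> (LINT \<zeta>|\<sigma>. cmod (g (r *\<^sub>R \<zeta>)) powr p) \<le> B2"
    using PH(2) unfolding PH_holomorphic_iff[OF g p] by blast
  show ?thesis
  proof (rule that[of "2 powr p * (B1 + B2)"])
    fix r :: real assume r: "r \<in> {0..<1}"
    then have r': "0 \<le> r" "r < 1" by auto
    note c = continuous_cmod_powr[OF continuous_hgf(1)[OF h g] p] continuous_cmod_powr[OF continuous_hgf(2)[OF h g] p]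
    have "(LINT \<zeta>|\<sigma>. 2 powr p * (cmod (h (r *\<^sub>R \<zeta>)) powr p + cmod (g (r *\<^sub>R \<zeta>)) powr p))
        = 2 powr p * ((LINT \<zeta>|\<sigma>. cmod (h (r *\<^sub>R \<zeta>)) powr p) + (LINT \<zeta>|\<sigma>. cmod (g (r *\<^sub>R \<zeta>)) powr p))"
      using integrable_scaled[OF c(1) r'] integrable_scaled[OF c(2) r'] by simp
    also have "\<dots> \<le> 2 powr p * (B1 + B2)" using B1[OF r] B2[OF r] by (intro mult_left_mono add_mono) auto
    finally show "(LINT \<zeta>|\<sigma>. 2 powr p * (cmod (h (r *\<^sub>R \<zeta>)) powr p + cmod (g (r *\<^sub>R \<zeta>)) powr p)) \<le> 2 powr p * (B1 + B2)" .
  qed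
qed

lemma PH_add_cnj_equiv:
  assumes h: "cn_holomorphic_on h \<Omega>" and g: "cn_holomorphic_on g \<Omega>" and p: "1 < p"
  shows "(\<lambda>z. h z + cnj (g z)) \<in> PH \<Omega> \<sigma> (ereal p) \<longleftrightarrow> h \<in> PH \<Omega> \<sigma> (ereal p) \<and> g \<in> PH \<Omega> \<sigma> (ereal p)"
proof
  assume "h \<in> PH \<Omega> \<sigma> (ereal p) \<and> g \<in> PH \<Omega> \<sigma> (ereal p)"
  moreover have p0: "0 < p" using p by simp
  ultimately obtain B where B: "\<And>r. r \<in> {0..<1} \<Longrightarrow> (LINT \<zeta>|\<sigma>. 2 powr p * (cmod (h (r *\<^sub>R \<zeta>)) powr p + cmod (g (r *\<^sub>R \<zeta>)) powr p)) \<le> B"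
    using PH_add_cnj_join[OF h g p0] by blast
  show "(\<lambda>z. h z + cnj (g z)) \<in> PH \<Omega> \<sigma> (ereal p)"
    unfolding PH_add_cnj_iff[OF h g p0]
  proof (intro exI[of _ B] ballI)
    fix r :: real assume r: "r \<in> {0..<1}"
    have "(LINT \<zeta>|\<sigma>. cmod (h (r *\<^sub>R \<zeta>) + cnj (g (r *\<^sub>R \<zeta>))) powr p)
       \<le> (LINT \<zeta>|\<sigma>. 2 powr p * (cmod (h (r *\<^sub>R \<zeta>)) powr p + cmod (g (r *\<^sub>R \<zeta>)) powr p))"
    proof (rule integral_scaled_mono[where u = "\<lambda>z. cmod (h z + cnj (g z)) powr p" and v = "\<lambda>z. 2 powr p * (cmod (h z) powr p + cmod (g z) powr p)"])
      show "cmod (h z + cnj (g z)) powr p \<le> 2 powr p * (cmod (h z) powr p + cmod (g z) powr p)" for z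
        using norm_add_powr_le[of p "h z" "cnj (g z)"] p by simp
    qed (use r p0 in \<open>auto intro!: continuous_cmod_powr continuous_intros continuous_hgf[OF h g]\<close>)
    with B[OF r] show "(LINT \<zeta>|\<sigma>. cmod (h (r *\<^sub>R \<zeta>) + cnj (g (r *\<^sub>R \<zeta>))) powr p) \<le> B" by linarith
  qed
qed (use PH_add_cnj_split[OF h g p] in blast)

text \<open>The means of a subharmonic function increase with the radius, so a bound suffices for
  the limit; it comes from the fact that \<open>h\<close> and \<open>g\<close> lie in the space
  themselves.\<close>

lemma pair_mean_limit:
  assumes h: "cn_holomorphic_on h \<Omega>" and g: "cn_holomorphic_on g \<Omega>" and p: "1 < p"
    and f: "(\<lambda>z. h z + cnj (g z)) \<in> PH \<Omega> \<sigma> (ereal p)"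
  obtains L where "((\<lambda>r. pair_mean \<sigma> p r h g) \<longlongrightarrow> L) (at_left 1)"
    "\<And>r. 0 \<le> r \<Longrightarrow> r < 1 \<Longrightarrow> pair_mean \<sigma> p r h g \<le> L"
proof -
  have p0: "0 < p" using p by simp
  obtain B where B: "\<And>r. r \<in> {0..<1} \<Longrightarrow> (LINT \<zeta>|\<sigma>. 2 powr p * (cmod (h (r *\<^sub>R \<zeta>)) powr p + cmod (g (r *\<^sub>R \<zeta>)) powr p)) \<le> B"
    using PH_add_cnj_join[OF h g p0 PH_add_cnj_split[OF h g p f]] by blast
  have bound: "pair_mean \<sigma> p r h g \<le> B powr (1 / p)" if r: "0 \<le> r" "r < 1" for r
    unfolding pair_mean_def
  proof (rule powr_mono2)
    have "(LINT \<zeta>|\<sigma>. ((cmod (h (r *\<^sub>R \<zeta>)))\<^sup>2 + (cmod (g (r *\<^sub>R \<zeta>)))\<^sup>2) powr (p / 2))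
       \<le> (LINT \<zeta>|\<sigma>. 2 powr p * (cmod (h (r *\<^sub>R \<zeta>)) powr p + cmod (g (r *\<^sub>R \<zeta>)) powr p))"
    proof (rule integral_scaled_mono[where u = "\<lambda>z. ((cmod (h z))\<^sup>2 + (cmod (g z))\<^sup>2) powr (p / 2)" and v = "\<lambda>z. 2 powr p * (cmod (h z) powr p + cmod (g z) powr p)"])
      show "((cmod (h z))\<^sup>2 + (cmod (g z))\<^sup>2) powr (p / 2) \<le> 2 powr p * (cmod (h z) powr p + cmod (g z) powr p)" for z
        using p by (intro cmod_powr_le_pair) simp
      show "continuous_on \<Omega> (\<lambda>z. ((cmod (h z))\<^sup>2 + (cmod (g z))\<^sup>2) powr (p / 2))"
        by (intro continuous_pair_powr continuous_hgf[OF h g] p0)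
      show "continuous_on \<Omega> (\<lambda>z. 2 powr p * (cmod (h z) powr p + cmod (g z) powr p))"
        by (intro continuous_on_mult continuous_on_const continuous_on_add continuous_cmod_powr continuous_hgf[OF h g] p0)
    qed (use r in auto)
    then show "(LINT \<zeta>|\<sigma>. ((cmod (h (r *\<^sub>R \<zeta>)))\<^sup>2 + (cmod (g (r *\<^sub>R \<zeta>)))\<^sup>2) powr (p / 2)) \<le> B"
      using B[of r] r by simp
  qed (use p in \<open>auto intro!: Bochner_Integration.integral_nonneg\<close>)
  show ?thesis
  proof (rule mono_bounded_limit_at_left)
    show "pair_mean \<sigma> p r h g \<le> pair_mean \<sigma> p s h g" if "0 \<le> r" "r \<le> s" "s < 1" for r s
      by (rule pair_mean_mono[OF h g p0 that])
    show "pair_mean \<sigma> p r h g \<le> B powr (1 / p)" if "0 \<le> r" "r < 1" for r by (rule bound[OF that])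
    fix L assume "((\<lambda>r. pair_mean \<sigma> p r h g) \<longlongrightarrow> L) (at_left 1)" "\<And>r. 0 \<le> r \<Longrightarrow> r < 1 \<Longrightarrow> pair_mean \<sigma> p r h g \<le> L"
    then show thesis by (rule that)
  qed
qed

lemma pair_mean_limit_le_hardy_norm:
  assumes h: "cn_holomorphic_on h \<Omega>" and g: "cn_holomorphic_on g \<Omega>" and p: "1 < p"
    and f: "(\<lambda>z. h z + cnj (g z)) \<in> PH \<Omega> \<sigma> (ereal p)" and pos: "0 \<le> Re (g 0 * h 0)"
  shows "\<exists>L::real. ((\<lambda>r. pair_mean \<sigma> p r h g) \<longlongrightarrow> L) (at_left 1) \<and>
      ereal L \<le> ereal (1 / C1 p) * hardy_norm \<Omega> \<sigma> (ereal p) (\<lambda>z. h z + cnj (g z))"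
proof -
  let ?f = "\<lambda>z. h z + cnj (g z)"
  have p0: "0 < p" using p by simp
  obtain L where L: "((\<lambda>r. pair_mean \<sigma> p r h g) \<longlongrightarrow> L) (at_left 1)" using pair_mean_limit[OF h g p f] by blast
  have up: "ereal (hardy_mean \<Omega> \<sigma> (ereal p) r ?f) \<le> hardy_norm \<Omega> \<sigma> (ereal p) ?f" if "r \<in> {0..<1}" for r
    unfolding hardy_norm_def using that by (rule SUP_upper)
  obtain N where N: "hardy_norm \<Omega> \<sigma> (ereal p) ?f = ereal N"
    using f up[of 0] by (cases "hardy_norm \<Omega> \<sigma> (ereal p) ?f") (auto simp: PH_def)
  have le: "pair_mean \<sigma> p r h g \<le> 1 / C1 p * N" if r: "0 \<le> r" "r < 1" for r
  proof -
    define m where "m = (1 - \<bar>cos (pi / p)\<bar>) powr (p / 2)"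
    define I where "I = (LINT \<zeta>|\<sigma>. ((cmod (h (r *\<^sub>R \<zeta>)))\<^sup>2 + (cmod (g (r *\<^sub>R \<zeta>)))\<^sup>2) powr (p / 2))"
    have I0: "0 \<le> I" unfolding I_def by (intro Bochner_Integration.integral_nonneg) simp
    have "C1 p * pair_mean \<sigma> p r h g = (m * I) powr (1 / p)"
      using I0 by (simp add: C1_eq[OF p0] pair_mean_def m_def I_def powr_mult)
    also have "\<dots> \<le> hardy_mean \<Omega> \<sigma> (ereal p) r ?f"
      unfolding hardy_mean_real m_def I_def using riesz_integral_lower[OF h g p r pos] I0 p
      by (intro powr_mono2) (auto simp: I_def)
    also have "\<dots> \<le> N" using up[of r] r N by simp
    finally show ?thesis using C1_pos[OF p] by (simp add: field_simps)
  qed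
  have "L \<le> 1 / C1 p * N"
  proof (rule tendsto_upperbound[OF L])
    show "\<forall>\<^sub>F r in at_left 1. pair_mean \<sigma> p r h g \<le> 1 / C1 p * N"
      using le eventually_at_left[of 0 "1::real"] by (auto intro!: exI[of _ 0])
  qed simp
  then show ?thesis using L unfolding N by auto
qed

lemma hardy_norm_le_pair_mean_limit:
  assumes h: "cn_holomorphic_on h \<Omega>" and g: "cn_holomorphic_on g \<Omega>" and p: "1 < p"
    and f: "(\<lambda>z. h z + cnj (g z)) \<in> PH \<Omega> \<sigma> (ereal p)" and neg: "Re (g 0 * h 0) \<le> 0"
  shows "\<exists>L::real. ((\<lambda>r. pair_mean \<sigma> p r h g) \<longlongrightarrow> L) (at_left 1) \<and>
      hardy_norm \<Omega> \<sigma> (ereal p) (\<lambda>z. h z + cnj (g z)) \<le> ereal (C2 p * L)"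
proof -
  let ?f = "\<lambda>z. h z + cnj (g z)"
  have p0: "0 < p" using p by simp
  obtain L where L: "((\<lambda>r. pair_mean \<sigma> p r h g) \<longlongrightarrow> L) (at_left 1)"
    "\<And>r. 0 \<le> r \<Longrightarrow> r < 1 \<Longrightarrow> pair_mean \<sigma> p r h g \<le> L" using pair_mean_limit[OF h g p f] by blast
  have le: "hardy_mean \<Omega> \<sigma> (ereal p) r ?f \<le> C2 p * L" if r: "0 \<le> r" "r < 1" for r
  proof -
    define m where "m = (1 + \<bar>cos (pi / p)\<bar>) powr (p / 2)"
    define I where "I = (LINT \<zeta>|\<sigma>. ((cmod (h (r *\<^sub>R \<zeta>)))\<^sup>2 + (cmod (g (r *\<^sub>R \<zeta>)))\<^sup>2) powr (p / 2))"
    have I0: "0 \<le> I" unfolding I_def by (intro Bochner_Integration.integral_nonneg) simp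
    have "hardy_mean \<Omega> \<sigma> (ereal p) r ?f \<le> (m * I) powr (1 / p)"
      unfolding hardy_mean_real m_def I_def using riesz_integral_upper[OF h g p r neg] p
      by (intro powr_mono2 Bochner_Integration.integral_nonneg) auto
    also have "\<dots> = C2 p * pair_mean \<sigma> p r h g"
      using I0 by (simp add: C2_eq[OF p] pair_mean_def m_def I_def powr_mult)
    also have "\<dots> \<le> C2 p * L" using L(2)[OF r] by (intro mult_left_mono) (simp_all add: C2_eq[OF p])
    finally show ?thesis .
  qed
  have "hardy_norm \<Omega> \<sigma> (ereal p) ?f \<le> ereal (C2 p * L)"
    unfolding hardy_norm_def using le by (intro SUP_least) auto
  then show ?thesis using L(1) by blast
qed

end

section \<open>The exponents 1 and infinity\<close>

lemma norm_axis_of_real: "norm (axis j c :: complex ^ 'n::finite) = cmod c"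
  by (simp add: norm_vec_def L2_set_def axis_def if_distrib[where f = norm] if_distrib[where f = "\<lambda>x. x\<^sup>2"] cong: if_cong)

context silov_setting
begin

lemma kolmogorov_integral:
  assumes F: "cn_holomorphic_on F \<Omega>" and q: "0 < q" "q < 1" and r: "0 \<le> r" "r < 1"
  shows "cos (q * (pi / 2)) * (LINT \<zeta>|\<sigma>. cmod (F (r *\<^sub>R \<zeta>)) powr q)
      \<le> (LINT \<zeta>|\<sigma>. \<bar>Re (F (r *\<^sub>R \<zeta>))\<bar>) - kolmogorov_fn q (F 0)"
proof -
  have cF: "continuous_on \<Omega> F" by (rule cn_holomorphic_imp_continuous_on[OF F])
  have cK: "continuous_on \<Omega> (\<lambda>z. kolmogorov_fn q (F z))"
    by (rule continuous_on_compose2[OF continuous_kolmogorov_fn cF]) simp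
  have cR: "continuous_on \<Omega> (\<lambda>z. \<bar>Re (F z)\<bar>)" by (intro continuous_intros cF)
  have "kolmogorov_fn q (F 0) \<le> (LINT \<zeta>|\<sigma>. kolmogorov_fn q (F (r *\<^sub>R \<zeta>)))"
    by (rule value_le_integral[OF cK disc_subharmonic_kolmogorov_fn[OF q slice_holomorphic[OF F]] r])
  moreover have "cos (q * (pi / 2)) * (LINT \<zeta>|\<sigma>. cmod (F (r *\<^sub>R \<zeta>)) powr q)
      = (LINT \<zeta>|\<sigma>. cos (q * (pi / 2)) * cmod (F (r *\<^sub>R \<zeta>)) powr q)" by simp
  moreover have "\<dots> \<le> (LINT \<zeta>|\<sigma>. \<bar>Re (F (r *\<^sub>R \<zeta>))\<bar> - kolmogorov_fn q (F (r *\<^sub>R \<zeta>)))"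
  proof (rule integral_scaled_mono[where u = "\<lambda>z. cos (q * (pi / 2)) * cmod (F z) powr q" and v = "\<lambda>z. \<bar>Re (F z)\<bar> - kolmogorov_fn q (F z)"])
    show "continuous_on \<Omega> (\<lambda>z. cos (q * (pi / 2)) * cmod (F z) powr q)"
      by (intro continuous_on_mult continuous_on_const continuous_cmod_powr cF q)
    show "continuous_on \<Omega> (\<lambda>z. \<bar>Re (F z)\<bar> - kolmogorov_fn q (F z))" by (intro continuous_on_diff cR cK)
  qed (use r kolmogorov_fn_bound[OF q] in auto)
  moreover have "\<dots> = (LINT \<zeta>|\<sigma>. \<bar>Re (F (r *\<^sub>R \<zeta>))\<bar>) - (LINT \<zeta>|\<sigma>. kolmogorov_fn q (F (r *\<^sub>R \<zeta>)))"
    using integrable_scaled[OF cR r] integrable_scaled[OF cK r] by simp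
  ultimately show ?thesis by linarith
qed

lemma PH_powr_bounded_of_Re:
  assumes F: "cn_holomorphic_on F \<Omega>" and q: "0 < q" "q < 1"
    and A: "\<And>r. r \<in> {0..<1} \<Longrightarrow> (LINT \<zeta>|\<sigma>. \<bar>Re (F (r *\<^sub>R \<zeta>))\<bar>) \<le> A"
  shows "F \<in> PH \<Omega> \<sigma> (ereal q)"
  unfolding PH_holomorphic_iff[OF F q(1)]
proof (intro exI ballI)
  fix r :: real assume r: "r \<in> {0..<1}"
  have "q * (pi / 2) < pi / 2" using q mult_strict_right_mono[of q 1 "pi / 2"] by simp
  then have c: "0 < cos (q * (pi / 2))" using q by (intro cos_gt_zero) auto
  have "cos (q * (pi / 2)) * (LINT \<zeta>|\<sigma>. cmod (F (r *\<^sub>R \<zeta>)) powr q) \<le> A - kolmogorov_fn q (F 0)"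
    using kolmogorov_integral[OF F q, of r] A[OF r] r by simp
  then show "(LINT \<zeta>|\<sigma>. cmod (F (r *\<^sub>R \<zeta>)) powr q) \<le> (A - kolmogorov_fn q (F 0)) / cos (q * (pi / 2))"
    using c by (simp add: pos_le_divide_eq mult.commute)
qed

lemma PH_linear_combination:
  assumes F: "cn_holomorphic_on F \<Omega>" and G: "cn_holomorphic_on G \<Omega>" and q: "0 < q"
    and PH: "F \<in> PH \<Omega> \<sigma> (ereal q)" "G \<in> PH \<Omega> \<sigma> (ereal q)"
  shows "(\<lambda>z. F z * c + G z * d) \<in> PH \<Omega> \<sigma> (ereal q)"
proof -
  have hol: "cn_holomorphic_on (\<lambda>z. F z * c + G z * d) \<Omega>"
    by (intro cn_holomorphic_add cn_holomorphic_mult cn_holomorphic_const F G)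
  have scaled: "(\<lambda>z. K z * e) \<in> PH \<Omega> \<sigma> (ereal q)" if K: "cn_holomorphic_on K \<Omega>" "K \<in> PH \<Omega> \<sigma> (ereal q)" for K e
  proof -
    obtain B where B: "\<And>r. r \<in> {0..<1} \<Longrightarrow> (LINT \<zeta>|\<sigma>. cmod (K (r *\<^sub>R \<zeta>)) powr q) \<le> B"
      using K(2) unfolding PH_holomorphic_iff[OF K(1) q] by blast
    have hol': "cn_holomorphic_on (\<lambda>z. K z * e) \<Omega>" by (intro cn_holomorphic_mult cn_holomorphic_const K)
    show ?thesis unfolding PH_holomorphic_iff[OF hol' q]
    proof (intro exI[of _ "B * cmod e powr q"] ballI)
      fix r :: real assume "r \<in> {0..<1}"
      from B[OF this] have "(LINT \<zeta>|\<sigma>. cmod (K (r *\<^sub>R \<zeta>)) powr q) * cmod e powr q \<le> B * cmod e powr q"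
        by (intro mult_right_mono) auto
      then show "(LINT \<zeta>|\<sigma>. cmod (K (r *\<^sub>R \<zeta>) * e) powr q) \<le> B * cmod e powr q"
        by (simp add: norm_mult powr_mult)
    qed
  qed
  have hF: "cn_holomorphic_on (\<lambda>z. F z * c) \<Omega>" and hG: "cn_holomorphic_on (\<lambda>z. G z * d) \<Omega>"
    by (intro cn_holomorphic_mult cn_holomorphic_const F G)+
  obtain B where B: "\<And>r. r \<in> {0..<1} \<Longrightarrow> (LINT \<zeta>|\<sigma>. 2 powr q * (cmod (F (r *\<^sub>R \<zeta>) * c) powr q + cmod (G (r *\<^sub>R \<zeta>) * d) powr q)) \<le> B"
    using PH_add_cnj_join[OF hF hG q scaled[OF F PH(1)] scaled[OF G PH(2)]] by blast
  show ?thesis unfolding PH_holomorphic_iff[OF hol q]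
  proof (intro exI[of _ B] ballI)
    fix r :: real assume r: "r \<in> {0..<1}"
    have "(LINT \<zeta>|\<sigma>. cmod (F (r *\<^sub>R \<zeta>) * c + G (r *\<^sub>R \<zeta>) * d) powr q)
       \<le> (LINT \<zeta>|\<sigma>. 2 powr q * (cmod (F (r *\<^sub>R \<zeta>) * c) powr q + cmod (G (r *\<^sub>R \<zeta>) * d) powr q))"
    proof (rule integral_scaled_mono[where u = "\<lambda>z. cmod (F z * c + G z * d) powr q" and v = "\<lambda>z. 2 powr q * (cmod (F z * c) powr q + cmod (G z * d) powr q)"])
      show "cmod (F z * c + G z * d) powr q \<le> 2 powr q * (cmod (F z * c) powr q + cmod (G z * d) powr q)" for z
        using q by (intro norm_add_powr_le) simp
      show "continuous_on \<Omega> (\<lambda>z. cmod (F z * c + G z * d) powr q)"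
        by (intro continuous_cmod_powr cn_holomorphic_imp_continuous_on hol q)
      show "continuous_on \<Omega> (\<lambda>z. 2 powr q * (cmod (F z * c) powr q + cmod (G z * d) powr q))"
        by (intro continuous_on_mult[OF continuous_on_const] continuous_on_add continuous_cmod_powr cn_holomorphic_imp_continuous_on hF hG q)
    qed (use r in auto)
    with B[OF r] show "(LINT \<zeta>|\<sigma>. cmod (F (r *\<^sub>R \<zeta>) * c + G (r *\<^sub>R \<zeta>) * d) powr q) \<le> B" by linarith
  qed
qed

lemma PH_one_integral_bound:
  fixes u :: "complex ^ 'n \<Rightarrow> complex"
  assumes u: "u \<in> PH \<Omega> \<sigma> 1"
  obtains A where "\<And>r. r \<in> {0..<1} \<Longrightarrow> (LINT \<zeta>|\<sigma>. cmod (u (r *\<^sub>R \<zeta>))) \<le> A"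
  using u hardy_norm_finite_iff[of 1 u] unfolding PH_def hardy_mean_one by blast

lemma PH_kolmogorov:
  assumes h: "cn_holomorphic_on h \<Omega>" and g: "cn_holomorphic_on g \<Omega>" and q: "0 < q" "q < 1"
    and f: "(\<lambda>z. h z + cnj (g z)) \<in> PH \<Omega> \<sigma> 1"
  shows "h \<in> PH \<Omega> \<sigma> (ereal q)" "g \<in> PH \<Omega> \<sigma> (ereal q)"
proof -
  let ?f = "\<lambda>z. h z + cnj (g z)"
  obtain A where A: "\<And>r. r \<in> {0..<1} \<Longrightarrow> (LINT \<zeta>|\<sigma>. cmod (?f (r *\<^sub>R \<zeta>))) \<le> A" using PH_one_integral_bound[OF f] by blast
  have cf: "continuous_on \<Omega> ?f" by (intro continuous_intros cn_holomorphic_imp_continuous_on h g)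
  \<comment> \<open>\<open>F\<close> and \<open>G\<close> are holomorphic with real parts
    \<open>Re f\<close> and \<open>Im f\<close>, hence dominated by \<open>cmod f\<close>;
    \<open>h\<close> and \<open>g\<close> are linear combinations of them.\<close>
  define F where "F = (\<lambda>z. h z + g z)"
  define G where "G = (\<lambda>z. h z * (- \<i>) + g z * \<i>)"
  have F: "cn_holomorphic_on F \<Omega>" and G: "cn_holomorphic_on G \<Omega>"
    unfolding F_def G_def by (intro cn_holomorphic_add cn_holomorphic_mult cn_holomorphic_const h g)+
  have bound: "K \<in> PH \<Omega> \<sigma> (ereal q)" if K: "cn_holomorphic_on K \<Omega>" "\<And>z. \<bar>Re (K z)\<bar> \<le> cmod (?f z)" for K
  proof (rule PH_powr_bounded_of_Re[OF K(1) q])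
    fix r :: real assume r: "r \<in> {0..<1}"
    have cK: "continuous_on \<Omega> (\<lambda>z. \<bar>Re (K z)\<bar>)"
      by (intro continuous_intros cn_holomorphic_imp_continuous_on K(1))
    have "(LINT \<zeta>|\<sigma>. \<bar>Re (K (r *\<^sub>R \<zeta>))\<bar>) \<le> (LINT \<zeta>|\<sigma>. cmod (?f (r *\<^sub>R \<zeta>)))"
      using integral_scaled_mono[OF cK continuous_on_norm[OF cf] _ _ K(2)] r by simp
    then show "(LINT \<zeta>|\<sigma>. \<bar>Re (K (r *\<^sub>R \<zeta>))\<bar>) \<le> A" using A[OF r] by linarith
  qed
  have FP: "F \<in> PH \<Omega> \<sigma> (ereal q)"
  proof (rule bound[OF F])
    show "\<bar>Re (F z)\<bar> \<le> cmod (?f z)" for z using abs_Re_le_cmod[of "?f z"] by (simp add: F_def)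
  qed
  have GP: "G \<in> PH \<Omega> \<sigma> (ereal q)"
  proof (rule bound[OF G])
    show "\<bar>Re (G z)\<bar> \<le> cmod (?f z)" for z using abs_Im_le_cmod[of "?f z"] by (simp add: G_def)
  qed
  have "h = (\<lambda>z. F z * (1 / 2) + G z * (\<i> / 2))" "g = (\<lambda>z. F z * (1 / 2) + G z * (- \<i> / 2))"
    by (simp_all add: F_def G_def fun_eq_iff field_simps)
  then show "h \<in> PH \<Omega> \<sigma> (ereal q)" "g \<in> PH \<Omega> \<sigma> (ereal q)"
    using PH_linear_combination[OF F G q(1) FP GP] by metis+
qed

text \<open>Cauchy's formula on a circle of radius \<open>R\<close> between \<open>r\<close> and 1,
  applied to \<open>f\<close>, reproduces \<open>h\<close> up to the constant
  \<open>cnj (g 0)\<close>. After taking moduli and integrating over the boundary, rotation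
  invariance lets the mean of \<open>f\<close> factor out, and the mean of the kernel
  remains.\<close>

lemma integral_norm_le_log:
  assumes h: "cn_holomorphic_on h \<Omega>" and g: "cn_holomorphic_on g \<Omega>"
    and A: "\<And>r. r \<in> {0..<1} \<Longrightarrow> (LINT \<zeta>|\<sigma>. cmod (h (r *\<^sub>R \<zeta>) + cnj (g (r *\<^sub>R \<zeta>)))) \<le> A"
    and r: "0 \<le> r" "r < 1"
  shows "(LINT \<zeta>|\<sigma>. cmod (h (r *\<^sub>R \<zeta>))) \<le> cmod (g 0) + 2 * A * ln (6 / (1 - r))"
proof -
  let ?f = "\<lambda>z. h z + cnj (g z)"
  have cf: "continuous_on \<Omega> ?f" by (intro continuous_intros cn_holomorphic_imp_continuous_on h g)
  have ch: "continuous_on \<Omega> h" by (intro cn_holomorphic_imp_continuous_on h)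
  define R where "R = (1 + r) / 2"
  define s where "s = r / R"
  have R: "0 < R" "R < 1" "R * s = r" using r by (auto simp: R_def s_def)
  have s: "0 \<le> s" "s < 1" using r by (auto simp: s_def R_def field_simps)
  define k where "k = (\<lambda>z. 1 / cmod (z - of_real s))"
  define v where "v = (\<lambda>\<zeta> z. k z * cmod (?f ((of_real R * z) *s \<zeta>)))"
  have z0: "z - of_real s \<noteq> 0" if "cmod z = 1" for z
  proof
    assume "z - of_real s = 0"
    then have "cmod z = cmod (of_real s)" by simp
    then show False using that s by simp
  qed
  have ck: "continuous_on (sphere 0 1) k" unfolding k_def by (rule continuous_on_circle_kernel[OF s])
  have cv: "continuous_on (b \<times> sphere 0 1) (\<lambda>(\<zeta>, z). v \<zeta> z)"
    unfolding v_def case_prod_beta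
    using continuous_on_b_circle[OF cf, of R] R
    by (intro continuous_on_mult continuous_on_norm continuous_on_compose2[OF ck]) (auto simp: case_prod_beta intro!: continuous_intros)
  have point: "cmod (h (r *\<^sub>R \<zeta>)) \<le> cmod (g 0) + circle_mean (v \<zeta>)" if \<zeta>: "\<zeta> \<in> b" for \<zeta>
  proof -
    define H where "H = (\<lambda>z. h ((of_real R * z) *s \<zeta>))"
    define G where "G = (\<lambda>z. g ((of_real R * z) *s \<zeta>))"
    have inb: "of_real R * z \<in> ball 0 1" if "z \<in> cball 0 1" for z :: complex
    proof -
      have "R * cmod z \<le> R * 1" using that R by (intro mult_left_mono) auto
      then have "R * cmod z < 1" using R by linarith
      then show ?thesis using R by (simp add: norm_mult)
    qed
    have hol: "(\<lambda>z. F ((of_real R * z) *s \<zeta>)) holomorphic_on cball 0 1" if F: "cn_holomorphic_on F \<Omega>" for F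
    proof -
      have "((\<lambda>z. F (z *s \<zeta>)) \<circ> (\<lambda>z. of_real R * z)) holomorphic_on cball 0 1"
        by (rule holomorphic_on_compose_gen[OF _ slice_holomorphic[OF F \<zeta>]]) (use inb in \<open>auto intro!: holomorphic_intros\<close>)
      then show ?thesis by (simp add: o_def)
    qed
    have Hh: "H holomorphic_on cball 0 1" and Gh: "G holomorphic_on cball 0 1" unfolding H_def G_def by (intro hol h g)+
    have cH: "continuous_on (sphere 0 1) H" and cG: "continuous_on (sphere 0 1) G"
      using Hh Gh by (auto intro!: holomorphic_on_imp_continuous_on intro: holomorphic_on_subset)
    define w :: "complex \<Rightarrow> complex" where "w = (\<lambda>z. z / (z - of_real s))"
    have cw: "continuous_on (sphere 0 1) w" unfolding w_def using z0 by (intro continuous_intros) auto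
    have 1: "circle_mean (\<lambda>z. H z * w z) = H (of_real s)"
      unfolding w_def by (rule circle_mean_Cauchy[OF Hh]) (use s in simp)
    \<comment> \<open>On the unit circle \<open>w z = 1 / (1 - s * cnj z)\<close>, so the integrand
      is the conjugate of a function holomorphic on the closed disc with value \<open>G 0\<close> at
      0.\<close>
    have 2: "circle_mean (\<lambda>z. cnj (G z) * w z) = cnj (G 0)"
    proof -
      have "(\<lambda>z. G z / (1 - of_real s * z)) holomorphic_on cball 0 1"
      proof (intro holomorphic_intros Gh)
        fix z :: complex assume "z \<in> cball 0 1"
        then have "cmod (of_real s * z) \<le> s * 1" using s unfolding norm_mult by (intro mult_mono) auto
        then have "cmod (of_real s * z) < 1" using s by simp
        then show "1 - of_real s * z \<noteq> 0" by auto
      qed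
      from circle_mean_value[OF this] have "circle_mean (\<lambda>z. G z / (1 - of_real s * z)) = G 0" by simp
      moreover have "circle_mean (\<lambda>z. cnj (G z) * w z) = circle_mean (\<lambda>z. cnj (G z / (1 - of_real s * z)))"
      proof -
        have "cnj (G (cis t)) * w (cis t) = cnj (G (cis t) / (1 - of_real s * cis t))" for t
        proof -
          have "cis t * cnj (cis t) = 1" by (simp add: cis_cnj cis_mult)
          then have "cis t - of_real s = cis t * (1 - of_real s * cnj (cis t))" by (simp add: algebra_simps)
          then have "w (cis t) = 1 / (1 - of_real s * cnj (cis t))" by (simp add: w_def)
          then show ?thesis by simp
        qed
        then show ?thesis unfolding circle_mean_def by simp
      qed
      moreover have "circle_mean (\<lambda>z. cnj (G z / (1 - of_real s * z))) = cnj (circle_mean (\<lambda>z. G z / (1 - of_real s * z)))"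
        by (rule circle_mean_linear[OF _ bounded_linear_cnj])
           (use \<open>(\<lambda>z. G z / (1 - of_real s * z)) holomorphic_on cball 0 1\<close> in \<open>auto intro!: holomorphic_on_imp_continuous_on intro: holomorphic_on_subset\<close>)
      ultimately show ?thesis by simp
    qed
    have "circle_mean (\<lambda>z. (H z + cnj (G z)) * w z) = circle_mean (\<lambda>z. H z * w z) + circle_mean (\<lambda>z. cnj (G z) * w z)"
      by (subst circle_mean_add[symmetric]) (auto intro!: continuous_intros cH cG cw simp: distrib_right)
    also have "\<dots> = h (r *\<^sub>R \<zeta>) + cnj (g 0)"
      unfolding 1 2 using R(3) by (simp add: H_def G_def scaleR_eq_smult flip: of_real_mult)
    finally have "h (r *\<^sub>R \<zeta>) = circle_mean (\<lambda>z. (H z + cnj (G z)) * w z) - cnj (g 0)" by simp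
    then have "cmod (h (r *\<^sub>R \<zeta>)) \<le> cmod (circle_mean (\<lambda>z. (H z + cnj (G z)) * w z)) + cmod (g 0)"
      using norm_triangle_ineq4[of "circle_mean (\<lambda>z. (H z + cnj (G z)) * w z)" "cnj (g 0)"] by simp
    also have "cmod (circle_mean (\<lambda>z. (H z + cnj (G z)) * w z)) \<le> circle_mean (\<lambda>z. cmod ((H z + cnj (G z)) * w z))"
      by (rule circle_mean_norm) (intro continuous_intros cH cG cw)
    also have "circle_mean (\<lambda>z. cmod ((H z + cnj (G z)) * w z)) = circle_mean (v \<zeta>)"
      unfolding circle_mean_def v_def k_def w_def H_def G_def by (simp add: norm_mult norm_divide mult.commute)
    finally show ?thesis by simp
  qed
  have "(LINT \<zeta>|\<sigma>. cmod (h (r *\<^sub>R \<zeta>))) \<le> (LINT \<zeta>|\<sigma>. cmod (g 0) + circle_mean (v \<zeta>))"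
  proof (rule integral_mono)
    show "integrable \<sigma> (\<lambda>\<zeta>. cmod (h (r *\<^sub>R \<zeta>)))"
      by (rule integrable_scaled[where u = "\<lambda>z. cmod (h z)"]) (use r in \<open>auto intro!: continuous_intros ch\<close>)
  qed (use point Fubini_circle(2)[OF cv] in auto)
  also have "\<dots> = cmod (g 0) + circle_mean (\<lambda>z. LINT \<zeta>|\<sigma>. v \<zeta> z)"
    using Fubini_circle(2)[OF cv] Fubini_circle(1)[OF cv] by simp
  also have "circle_mean (\<lambda>z. LINT \<zeta>|\<sigma>. v \<zeta> z) = circle_mean (\<lambda>z. (LINT \<zeta>|\<sigma>. cmod (?f (R *\<^sub>R \<zeta>))) * k z)"
  proof -
    have c: "continuous_on b (\<lambda>\<zeta>. cmod (?f (of_real R *s \<zeta>)))"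
      using continuous_on_b_scaled[of "\<lambda>z. cmod (?f z)" R] R continuous_on_norm[OF cf] by (simp add: scaleR_eq_smult)
    have "(LINT \<zeta>|\<sigma>. v \<zeta> (cis t)) = (LINT \<zeta>|\<sigma>. cmod (?f (R *\<^sub>R \<zeta>))) * k (cis t)" for t
      using integral_rotate[OF c, of "cis t"]
      by (simp add: v_def scaleR_eq_smult vector_smult_assoc mult.commute)
    then show ?thesis unfolding circle_mean_def by simp
  qed
  also have "\<dots> = (LINT \<zeta>|\<sigma>. cmod (?f (R *\<^sub>R \<zeta>))) * circle_mean k"
    by (rule circle_mean_linear[OF ck bounded_linear_mult_right])
  also have "\<dots> \<le> A * (2 * ln (6 / (1 - r)))"
  proof (rule mult_mono)
    show "(LINT \<zeta>|\<sigma>. cmod (?f (R *\<^sub>R \<zeta>))) \<le> A" using A[of R] R by simp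
    have "0 \<le> (LINT \<zeta>|\<sigma>. cmod (?f (R *\<^sub>R \<zeta>)))" by (intro Bochner_Integration.integral_nonneg) simp
    with \<open>_ \<le> A\<close> show "0 \<le> A" by linarith
    have "circle_mean (\<lambda>_. 0 :: real) \<le> circle_mean k" by (intro circle_mean_mono ck) (auto simp: k_def)
    then show "0 \<le> circle_mean k" by simp
    have "circle_mean k \<le> 2 * ln (3 / (1 - s))" unfolding k_def by (rule circle_kernel_upper[OF s])
    \<comment> \<open>\<open>R\<close> is the midpoint of \<open>r\<close> and 1, so
      \<open>1 - s = (1 - r) / (1 + r)\<close> and only a factor 2 is lost.\<close>
    also have "3 / (1 - s) \<le> 6 / (1 - r)"
    proof -
      have "1 - s = (1 - r) / (1 + r)" using r by (simp add: s_def R_def field_simps)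
      then have "3 / (1 - s) = 3 * (1 + r) / (1 - r)" using r by simp
      also have "\<dots> \<le> 6 / (1 - r)" using r by (intro divide_right_mono) auto
      finally show ?thesis .
    qed
    then have "ln (3 / (1 - s)) \<le> ln (6 / (1 - r))" using s r by (subst ln_le_cancel_iff) auto
    then have "2 * ln (3 / (1 - s)) \<le> 2 * ln (6 / (1 - r))" by simp
    finally show "circle_mean k \<le> 2 * ln (6 / (1 - r))" .
  qed
  finally show ?thesis by simp
qed

lemma hardy_mean_bigo_log_bounded:
  assumes h: "cn_holomorphic_on h \<Omega>" and g: "cn_holomorphic_on g \<Omega>"
    and A: "\<And>r. r \<in> {0..<1} \<Longrightarrow> (LINT \<zeta>|\<sigma>. cmod (h (r *\<^sub>R \<zeta>) + cnj (g (r *\<^sub>R \<zeta>)))) \<le> A"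
  shows "(\<lambda>r. hardy_mean \<Omega> \<sigma> 1 r h) \<in> O[at_left 1](\<lambda>r. ln (1 / (1 - r)))"
proof (rule bigoI)
  have A0: "0 \<le> A"
  proof -
    have "cmod (h 0 + cnj (g 0)) \<le> A" using A[of 0] by simp
    then show ?thesis by (rule order_trans[OF norm_ge_zero])
  qed
  \<comment> \<open>Beyond \<open>5 / 6\<close> the logarithm is at least
    \<open>ln 6 \<ge> 1\<close>; it absorbs both the constant \<open>cmod (g 0)\<close> and the
    \<open>ln 6\<close> inside \<open>ln (6 / (1 - r))\<close>.\<close>
  have le: "norm (hardy_mean \<Omega> \<sigma> 1 r h) \<le> (cmod (g 0) + 4 * A) * norm (ln (1 / (1 - r)))" if r: "5 / 6 < r" "r < 1" for r :: real
  proof -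
    define l where "l = ln (1 / (1 - r))"
    have "ln 6 \<le> l" unfolding l_def using r by (subst ln_le_cancel_iff) (auto simp: field_simps)
    moreover have "1 \<le> ln (6 :: real)"
    proof -
      have "exp 1 \<le> (6 :: real)" using exp_le by linarith
      then show ?thesis by (simp add: ln_ge_iff)
    qed
    moreover have "ln (6 / (1 - r)) = ln 6 + l" using r by (simp add: l_def ln_div)
    ultimately have l: "1 \<le> l" "ln (6 / (1 - r)) \<le> 2 * l" by linarith+
    have "(LINT \<zeta>|\<sigma>. cmod (h (r *\<^sub>R \<zeta>))) \<le> cmod (g 0) + 2 * A * ln (6 / (1 - r))"
      by (rule integral_norm_le_log[OF h g A]) (use r in auto)
    also have "\<dots> \<le> cmod (g 0) * l + 2 * A * (2 * l)"
      using l A0 mult_left_mono[OF l(1), of "cmod (g 0)"] by (intro add_mono mult_left_mono) auto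
    also have "\<dots> = (cmod (g 0) + 4 * A) * l" by (simp add: algebra_simps)
    moreover have "0 \<le> (LINT \<zeta>|\<sigma>. cmod (h (r *\<^sub>R \<zeta>)))" by (intro Bochner_Integration.integral_nonneg) simp
    ultimately show ?thesis using l unfolding hardy_mean_one l_def by simp
  qed
  show "\<forall>\<^sub>F r in at_left 1. norm (hardy_mean \<Omega> \<sigma> 1 r h) \<le> (cmod (g 0) + 4 * A) * norm (ln (1 / (1 - r)))"
    using le eventually_at_left[of "5 / 6" "1::real"] by (auto intro!: exI[of _ "5 / 6"])
qed

lemma hardy_mean_bigo_log:
  assumes h: "cn_holomorphic_on h \<Omega>" and g: "cn_holomorphic_on g \<Omega>"
    and f: "(\<lambda>z. h z + cnj (g z)) \<in> PH \<Omega> \<sigma> 1"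
  shows "(\<lambda>r. hardy_mean \<Omega> \<sigma> 1 r h) \<in> O[at_left 1](\<lambda>r. ln (1 / (1 - r)))"
    and "(\<lambda>r. hardy_mean \<Omega> \<sigma> 1 r g) \<in> O[at_left 1](\<lambda>r. ln (1 / (1 - r)))"
proof -
  obtain A where A: "\<And>r. r \<in> {0..<1} \<Longrightarrow> (LINT \<zeta>|\<sigma>. cmod (h (r *\<^sub>R \<zeta>) + cnj (g (r *\<^sub>R \<zeta>)))) \<le> A"
    using PH_one_integral_bound[OF f] by blast
  show "(\<lambda>r. hardy_mean \<Omega> \<sigma> 1 r h) \<in> O[at_left 1](\<lambda>r. ln (1 / (1 - r)))" by (rule hardy_mean_bigo_log_bounded[OF h g A])
  \<comment> \<open>Conjugation exchanges the roles of \<open>h\<close> and \<open>g\<close> without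
    changing the modulus of the sum.\<close>
  have eq: "cmod (g z + cnj (h z)) = cmod (h z + cnj (g z))" for z
    using complex_mod_cnj[of "g z + cnj (h z)"] by (simp add: add.commute)
  show "(\<lambda>r. hardy_mean \<Omega> \<sigma> 1 r g) \<in> O[at_left 1](\<lambda>r. ln (1 / (1 - r)))"
    by (rule hardy_mean_bigo_log_bounded[OF g h]) (use A in \<open>simp add: eq\<close>)
qed

text \<open>\<open>M\<close> is the supremum of \<open>cmod (z $ j)\<close>. Since it is not
  attained on the open set, the logarithm is defined on all of \<open>\<Omega>\<close>, and since it
  is approached, the logarithm is unbounded. One function serves as both \<open>h\<close> and
  \<open>g\<close>, because \<open>h + cnj h = 2 * Re h\<close>.\<close>

lemma unbounded_conjugates_bounded_sum:
  "\<exists>h g. cn_holomorphic_on h \<Omega> \<and> cn_holomorphic_on g \<Omega> \<and> \<not> bounded (h ` \<Omega>) \<and> \<not> bounded (g ` \<Omega>) \<and>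
        (\<lambda>z. h z + cnj (g z)) \<in> PH \<Omega> \<sigma> \<infinity>"
proof -
  define j where "j = (undefined :: 'n)"
  define M where "M = (SUP z\<in>\<Omega>. cmod (z $ j))"
  obtain C where C: "\<And>z. z \<in> \<Omega> \<Longrightarrow> norm z \<le> C" using bounded_\<Omega> unfolding bounded_iff by blast
  have bdd: "bdd_above ((\<lambda>z. cmod (z $ j)) ` \<Omega>)"
    by (rule bdd_aboveI2[of _ _ C]) (use C Finite_Cartesian_Product.norm_nth_le order_trans in blast)
  have up: "cmod (z $ j) \<le> M" if "z \<in> \<Omega>" for z unfolding M_def using that by (intro cSUP_upper bdd)
  obtain e where e: "0 < e" "ball 0 e \<subseteq> \<Omega>" using open_\<Omega> zero_\<Omega> open_contains_ball by blast
  have M0: "0 < M"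
  proof -
    have "norm (axis j (of_real (e / 2) :: complex)) = e / 2" using e by (simp add: norm_axis_of_real)
    then have "axis j (of_real (e / 2)) \<in> \<Omega>" using e by auto
    from up[OF this] show ?thesis using e by simp
  qed
  have less: "cmod (z $ j) < M" if z: "z \<in> \<Omega>" for z
  proof (rule ccontr)
    assume neg: "\<not> ?thesis"
    obtain d where d: "0 < d" "ball z d \<subseteq> \<Omega>" using open_\<Omega> z open_contains_ball by blast
    define N where "N = norm z + 1"
    have N: "0 < N" by (simp add: N_def add_nonneg_pos)
    define t where "t = d / (2 * N)"
    have t: "0 < t" using d N by (simp add: t_def)
    have "t * norm z < d"
    proof -
      have "t * norm z \<le> t * N" using t by (simp add: N_def)
      also have "\<dots> = d / 2" using N by (simp add: t_def)
      finally show ?thesis using d by simp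
    qed
    then have "z + t *\<^sub>R z \<in> \<Omega>" using d t by (auto simp: dist_norm)
    then have "cmod ((1 + t) *\<^sub>R (z $ j)) \<le> M" using up[of "z + t *\<^sub>R z"] by (simp add: scaleR_add_left)
    then have "(1 + t) * cmod (z $ j) \<le> M" using t by simp
    moreover have "M < (1 + t) * M" using t M0 by simp
    moreover have "(1 + t) * M \<le> (1 + t) * cmod (z $ j)" using neg t by (intro mult_left_mono) auto
    ultimately show False by linarith
  qed
  define G where "G = (\<lambda>w. \<i> * Ln (1 - w / of_real M))"
  have Re_pos: "0 < Re (1 - w / of_real M)" if "w \<in> ball 0 M" for w :: complex
  proof -
    have "cmod (w / of_real M) < 1" using that M0 by (simp add: norm_divide)
    then show ?thesis using complex_Re_le_cmod[of "w / of_real M"] by simp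
  qed
  have nonpos: "1 - w / of_real M \<notin> \<real>\<^sub>\<le>\<^sub>0" if "w \<in> ball 0 M" for w :: complex
    using Re_pos[OF that] unfolding complex_nonpos_Reals_iff by linarith
  have G: "G holomorphic_on ball 0 M"
    unfolding G_def by (intro holomorphic_intros) (use M0 nonpos in auto)
  define h where "h = (\<lambda>z. G (z $ j))"
  have h: "cn_holomorphic_on h \<Omega>"
    unfolding h_def by (rule cn_holomorphic_compose[OF cn_holomorphic_component G]) (use less in auto)
  have unb: "\<not> bounded (h ` \<Omega>)"
  proof
    assume "bounded (h ` \<Omega>)"
    then obtain B where B: "\<And>z. z \<in> \<Omega> \<Longrightarrow> cmod (h z) \<le> B" unfolding bounded_iff by blast
    \<comment> \<open>The threshold makes \<open>x = 1 - cmod (z $ j) / M\<close> smaller than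
      \<open>exp (- B - 1)\<close>, so that \<open>|ln x| > B\<close>. Rotating \<open>z\<close>
      makes its coordinate real and the complex logarithm a real one.\<close>
    have "M * (1 - exp (- B - 1)) < M" using M0 by simp
    then obtain z where z: "z \<in> \<Omega>" "M * (1 - exp (- B - 1)) < cmod (z $ j)"
      unfolding M_def using less_cSUP_iff[OF _ bdd] zero_\<Omega> by (metis empty_iff)
    define z' where "z' = cis (- Arg (z $ j)) *s z"
    have z': "z' \<in> \<Omega>" unfolding z'_def using rot_image z(1) by blast
    have "z' $ j = of_real (cmod (z $ j))"
    proof -
      have "z $ j = of_real (cmod (z $ j)) * cis (Arg (z $ j))" using rcis_cmod_Arg[of "z $ j"] by (simp add: rcis_def)
      then have "z' $ j = of_real (cmod (z $ j)) * (cis (- Arg (z $ j)) * cis (Arg (z $ j)))"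
        unfolding z'_def vector_smult_component by (metis mult.left_commute)
      then show ?thesis by simp
    qed
    define x where "x = 1 - cmod (z $ j) / M"
    have x: "0 < x" "x < exp (- B - 1)" using less[OF z(1)] z(2) M0 by (auto simp: x_def field_simps)
    have "1 - of_real (cmod (z $ j)) / of_real M = (of_real x :: complex)" by (simp add: x_def)
    then have "h z' = \<i> * of_real (ln x)"
      unfolding h_def G_def \<open>z' $ j = _\<close> using Ln_of_real[OF x(1)] by simp
    then have "cmod (h z') = \<bar>ln x\<bar>" by (simp add: norm_mult)
    moreover have "ln x < - B - 1" using x by (metis ln_less_cancel_iff exp_gt_zero ln_exp)
    ultimately show False using B[OF z'] by linarith
  qed
  have bound: "cmod (h z + cnj (h z)) \<le> 2 * pi" if "z \<in> \<Omega>" for z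
  proof -
    define w where "w = 1 - z $ j / of_real M"
    have w0: "w \<noteq> 0" using Re_pos[of "z $ j"] less[OF that] unfolding w_def by force
    have "h z + cnj (h z) = of_real (2 * Re (h z))" by (simp add: complex_add_cnj)
    also have "Re (h z) = - Im (Ln w)" by (simp add: h_def G_def w_def)
    finally have "cmod (h z + cnj (h z)) = 2 * \<bar>Im (Ln w)\<bar>" by (simp add: norm_mult)
    moreover have "\<bar>Im (Ln w)\<bar> \<le> pi" using Im_Ln_le_pi[OF w0] mpi_less_Im_Ln[OF w0] by linarith
    ultimately show ?thesis by linarith
  qed
  have "hardy_mean \<Omega> \<sigma> \<infinity> r (\<lambda>z. h z + cnj (h z)) \<le> 2 * pi" if "r \<in> {0..<1}" for r
    unfolding hardy_mean_def using that b_nonempty bound b_scaleR by (auto intro!: cSUP_least)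
  then have "hardy_norm \<Omega> \<sigma> \<infinity> (\<lambda>z. h z + cnj (h z)) < \<infinity>" unfolding hardy_norm_finite_iff by blast
  then have "(\<lambda>z. h z + cnj (h z)) \<in> PH \<Omega> \<sigma> \<infinity>" unfolding PH_def using pluriharmonic_add_cnj[OF open_\<Omega> h h] by simp
  then show ?thesis using h unb by blast
qed

end

section \<open>Sharpness on the polydisk\<close>

lemma mem_closure_unit_polydisk:
  fixes y :: "complex ^ 'n::finite"
  assumes y: "\<And>i. cmod (y $ i) \<le> 1"
  shows "y \<in> closure unit_polydisk"
proof (rule Lim_in_closed_set)
  show "((\<lambda>t. t *\<^sub>R y) \<longlongrightarrow> y) (at_left 1)"
    by (rule tendsto_eq_rhs[OF tendsto_scaleR[OF tendsto_ident_at tendsto_const]]) simp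
  have "t *\<^sub>R y \<in> closure unit_polydisk" if t: "0 < t" "t < 1" for t
  proof -
    have "t * cmod (y $ i) < 1" for i using mult_left_mono[OF y[of i], of t] t by linarith
    then have "t *\<^sub>R y \<in> unit_polydisk" using t by (simp add: unit_polydisk_def)
    then show ?thesis using closure_subset by blast
  qed
  then show "\<forall>\<^sub>F t in at_left 1. t *\<^sub>R y \<in> closure unit_polydisk"
    using eventually_at_left[of 0 "1::real"] by (auto intro!: exI[of _ 0])
qed auto

lemma closure_unit_polydisk_component: "z \<in> closure unit_polydisk \<Longrightarrow> cmod (z $ j) \<le> 1"
proof -
  have "closure unit_polydisk \<subseteq> {z. cmod (z $ j) \<le> 1}"
    by (intro closure_minimal closed_Collect_le continuous_intros) (auto simp: unit_polydisk_def less_imp_le)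
  then show "z \<in> closure unit_polydisk \<Longrightarrow> cmod (z $ j) \<le> 1" by blast
qed

lemma bounded_unit_polydisk: "bounded (unit_polydisk :: (complex ^ 'n::finite) set)"
  unfolding bounded_iff
proof (intro exI ballI)
  fix z :: "complex ^ 'n" assume z: "z \<in> unit_polydisk"
  have "norm z \<le> (\<Sum>i\<in>UNIV. cmod (z $ i))" by (rule norm_vec_le_sum)
  also have "\<dots> \<le> (\<Sum>i\<in>(UNIV::'n set). 1)" using z by (intro sum_mono) (auto simp: unit_polydisk_def less_imp_le)
  finally show "norm z \<le> (\<Sum>i\<in>(UNIV::'n set). 1)" .
qed

text \<open>The Silov boundary is contained in each maximum modulus set; exhibiting this one for
  every \<open>j\<close> shows that all coordinates of its points have modulus 1.\<close>

lemma maximum_modulus_set_unit_polydisk: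
  fixes j :: "'n::finite"
  shows "maximum_modulus_set unit_polydisk {z \<in> closure unit_polydisk. cmod (z $ j) = 1}"
    (is "maximum_modulus_set ?D ?E")
  unfolding maximum_modulus_set_def
proof (intro conjI allI impI ballI)
  have "?E = closure ?D \<inter> {z. cmod (z $ j) = 1}" by auto
  then show cl: "closed ?E" by (auto intro!: closed_Int closed_Collect_eq continuous_intros)
  show "?E \<subseteq> closure ?D" by auto
  fix u :: "complex ^ 'n \<Rightarrow> complex" and z
  assume u: "continuous_on (closure ?D) u \<and> cn_holomorphic_on u ?D" and z: "z \<in> closure ?D"
  have "bounded ?E" by (rule bounded_subset[OF bounded_closure[OF bounded_unit_polydisk]]) auto
  with cl have "compact ?E" by (simp add: compact_eq_bounded_closed)
  moreover have "(\<chi> i. 1) \<in> ?E" by (simp add: mem_closure_unit_polydisk)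
  then have "?E \<noteq> {}" by blast
  moreover have "continuous_on ?E (\<lambda>z. cmod (u z))"
    by (intro continuous_on_norm continuous_on_subset[OF conjunct1[OF u]]) auto
  ultimately obtain w where w: "w \<in> ?E" and max: "\<And>y. y \<in> ?E \<Longrightarrow> cmod (u y) \<le> cmod (u w)"
    using continuous_attains_sup[of ?E "\<lambda>z. cmod (u z)"] by blast
  \<comment> \<open>Shrinking by \<open>t < 1\<close> puts the other coordinates into the open disc.
    Then coordinate \<open>j\<close> may range over the closed disc, with \<open>u\<close>
    holomorphic inside and the boundary circle in the set; afterwards \<open>t\<close> tends to
    1.\<close>
  have le: "cmod (u (t *\<^sub>R z)) \<le> cmod (u w)" and mem: "t *\<^sub>R z \<in> closure ?D" if t: "0 < t" "t < 1" for t
  proof -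
    define a where "a = (\<chi> i. if i = j then 0 else of_real t * z $ i)"
    define \<phi> where "\<phi> = (\<lambda>c. a + c *s axis j 1)"
    have nth: "\<phi> c $ i = (if i = j then c else of_real t * z $ i)" for c i
      by (simp add: \<phi>_def a_def axis_def)
    have tz: "cmod (of_real t * z $ i) < 1" for i
    proof -
      have "t * cmod (z $ i) < 1"
        using mult_left_mono[OF closure_unit_polydisk_component[OF z, of i], of t] t by linarith
      then show ?thesis using t by (simp add: norm_mult)
    qed
    have cball: "\<phi> c \<in> closure ?D" if "c \<in> cball 0 1" for c
      using that tz by (intro mem_closure_unit_polydisk) (auto simp: nth less_imp_le)
    have ball: "\<phi> c \<in> ?D" if "c \<in> ball 0 1" for c
      using that tz by (auto simp: unit_polydisk_def nth)
    have sphere: "\<phi> c \<in> ?E" if "c \<in> sphere 0 1" for c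
      using that cball[of c] by (auto simp: nth)
    have z': "\<phi> (of_real t * z $ j) = t *\<^sub>R z"
      unfolding vec_eq_iff nth by (simp only: vector_scaleR_component) (simp add: scaleR_conv_of_real)
    have c\<phi>: "continuous_on (cball 0 1) \<phi>"
      unfolding \<phi>_def by (intro continuous_intros)
    have "cmod ((u \<circ> \<phi>) (of_real t * z $ j)) \<le> cmod (u w)"
    proof (rule maximum_modulus_frontier[where f = "u \<circ> \<phi>" and S = "cball 0 1"])
      show "(u \<circ> \<phi>) holomorphic_on interior (cball 0 1)"
        using cn_holomorphic_slice[OF conjunct2[OF u], of "ball 0 1" a "axis j 1"] ball by (simp add: \<phi>_def o_def)
      show "continuous_on (closure (cball 0 1)) (u \<circ> \<phi>)"
        unfolding o_def using cball by (auto intro!: continuous_on_compose2[OF conjunct1[OF u]] c\<phi>)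
      show "cmod ((u \<circ> \<phi>) c) \<le> cmod (u w)" if "c \<in> frontier (cball 0 1)" for c
        using that max[OF sphere, of c] by simp
      show "of_real t * z $ j \<in> cball 0 1" using tz[of j] by simp
    qed simp
    then show "cmod (u (t *\<^sub>R z)) \<le> cmod (u w)" by (simp add: z')
    have "of_real t * z $ j \<in> cball 0 1" using tz[of j] by simp
    from cball[OF this] show "t *\<^sub>R z \<in> closure ?D" by (simp only: z')
  qed
  have ev: "\<forall>\<^sub>F t in at_left 1. 0 < t \<and> t < (1::real)"
    using eventually_at_left[of 0 "1::real"] by (auto intro!: exI[of _ 0])
  have "((\<lambda>t. t *\<^sub>R z) \<longlongrightarrow> z) (at_left 1)"
    by (rule tendsto_eq_rhs[OF tendsto_scaleR[OF tendsto_ident_at tendsto_const]]) simp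
  then have "((\<lambda>t. u (t *\<^sub>R z)) \<longlongrightarrow> u z) (at_left 1)"
    by (rule continuous_on_tendsto_compose[OF conjunct1[OF u] _ z]) (use ev in \<open>eventually_elim, use mem in blast\<close>)
  then have "((\<lambda>t. cmod (u (t *\<^sub>R z))) \<longlongrightarrow> cmod (u z)) (at_left 1)" by (rule tendsto_norm)
  then have "cmod (u z) \<le> cmod (u w)"
    by (rule tendsto_upperbound) (use ev in \<open>auto elim!: eventually_mono intro: le\<close>)
  then show "\<exists>w\<in>?E. cmod (u z) \<le> cmod (u w)" using w by blast
qed

lemma not_smallo_log:
  fixes u :: "real \<Rightarrow> real"
  assumes c: "0 < c" and u: "\<And>r. 0 \<le> r \<Longrightarrow> r < 1 \<Longrightarrow> c * ln (1 / (1 - r)) \<le> u r"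
  shows "u \<notin> o[at_left 1](\<lambda>r. ln (1 / (1 - r)))"
proof
  assume o: "u \<in> o[at_left 1](\<lambda>r. ln (1 / (1 - r)))"
  have "\<forall>\<^sub>F r in at_left 1. norm (u r) \<le> c / 2 * norm (ln (1 / (1 - r)))"
    by (rule landau_o.smallD[OF o]) (use c in simp)
  moreover have "\<forall>\<^sub>F t in at_left 1. 0 < t \<and> t < (1::real)"
    using eventually_at_left[of 0 "1::real"] by (auto intro!: exI[of _ 0])
  ultimately have "\<forall>\<^sub>F r in at_left (1::real). False"
  proof eventually_elim
    fix r :: real assume le: "norm (u r) \<le> c / 2 * norm (ln (1 / (1 - r)))" and r: "0 < r \<and> r < 1"
    define l where "l = ln (1 / (1 - r))"
    have l: "0 < l" unfolding l_def using r by (intro ln_gt_zero) simp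
    have "c * l \<le> c / 2 * l" using u[of r] le l r unfolding l_def[symmetric] by simp
    then show False using c l by simp
  qed
  then show False by simp
qed

section \<open>The Poisson kernel of one coordinate\<close>

context silov_setting
begin

lemma polydisk_silov_component:
  fixes j :: 'n
  assumes "\<Omega> = unit_polydisk" "\<zeta> \<in> b"
  shows "cmod (\<zeta> $ j) = 1"
  using assms(2) maximum_modulus_set_unit_polydisk[of j] unfolding silov_boundary_def assms(1) by blast

lemma polydisk_disc:
  fixes j :: 'n
  shows "\<Omega> = unit_polydisk \<Longrightarrow> z \<in> \<Omega> \<Longrightarrow> z $ j \<in> ball 0 1"
  by (simp add: unit_polydisk_def)

lemma polydisk_holomorphic:
  fixes j :: 'n
  assumes \<Omega>: "\<Omega> = unit_polydisk" and G: "G holomorphic_on ball 0 1"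
  shows "cn_holomorphic_on (\<lambda>z. G (z $ j)) \<Omega>"
  using polydisk_disc[OF \<Omega>] by (intro cn_holomorphic_compose[OF cn_holomorphic_component G]) auto

text \<open>The values are real and nonnegative, being the Poisson kernel
  \<open>1 + 2 * Re K\<close> in one coordinate. So the modulus is itself harmonic on slices, and
  all its means equal 1.\<close>

lemma polydisk_Poisson_PH:
  fixes j :: 'n
  assumes \<Omega>: "\<Omega> = unit_polydisk"
  shows "(\<lambda>z. 1 / (1 - z $ j) + cnj (z $ j / (1 - z $ j))) \<in> PH \<Omega> \<sigma> 1"
proof -
  define K where "K = (\<lambda>w :: complex. w / (1 - w))"
  define u where "u = (\<lambda>z :: complex ^ 'n. 1 / (1 - z $ j) + cnj (z $ j / (1 - z $ j)))"
  have K: "K holomorphic_on ball 0 1" unfolding K_def by (intro holomorphic_intros) auto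
  have norm_u: "cmod (u z) = 1 + 2 * Re (K (z $ j))" if z: "z \<in> \<Omega>" for z
  proof -
    define w where "w = z $ j"
    have w: "cmod w < 1" using polydisk_disc[OF \<Omega> z] by (simp add: w_def)
    then have ne: "1 - w \<noteq> 0" by auto
    have e: "1 / (1 - w) = 1 + K w" using ne by (simp add: K_def field_simps)
    have "u z = 1 / (1 - w) + cnj (K w)" by (simp only: u_def w_def K_def)
    then have "u z = of_real (1 + 2 * Re (K w))" unfolding e by (simp add: complex_eq_iff)
    \<comment> \<open>\<open>K w\<close> is no farther from 0 than from \<open>- 1\<close>, which
      means \<open>Re (K w) \<ge> - 1 / 2\<close>.\<close>
    moreover have "cmod (K w) \<le> cmod (1 + K w)"
      using w by (simp add: e[symmetric]) (simp add: K_def norm_divide divide_right_mono)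
    then have "(cmod (K w))\<^sup>2 \<le> (cmod (1 + K w))\<^sup>2" by (rule power_mono) simp
    then have "0 \<le> 1 + 2 * Re (K w)" by (simp add: cmod_power2) (simp add: power2_eq_square algebra_simps)
    ultimately show ?thesis by (simp only: norm_of_real w_def)
  qed
  have cK: "continuous_on \<Omega> (\<lambda>z. 1 + 2 * Re (K (z $ j)))"
    by (intro continuous_intros cn_holomorphic_imp_continuous_on polydisk_holomorphic[OF \<Omega> K])
  have "hardy_mean \<Omega> \<sigma> 1 r u = 1" if r: "r \<in> {0..<1}" for r
  proof -
    have r': "0 \<le> r" "r < 1" using r by auto
    have mean: "circle_mean (\<lambda>z. 1 + 2 * Re (K (((of_real r * z) *s \<zeta>) $ j))) = 1" if \<zeta>: "\<zeta> \<in> b" for \<zeta>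
    proof -
      define F where "F = (\<lambda>z. 1 + 2 * K (of_real r * z * \<zeta> $ j))"
      have mem: "of_real r * z * \<zeta> $ j \<in> ball 0 1" if "z \<in> cball 0 1" for z
      proof -
        have "r * cmod z \<le> r * 1" using that r' by (intro mult_left_mono) auto
        then have "r * cmod z < 1" using r' by linarith
        then have "(of_real r * z) *s \<zeta> \<in> \<Omega>" using r' by (intro b_smult[OF \<zeta>]) (simp add: norm_mult)
        from polydisk_disc[OF \<Omega> this] show ?thesis by simp
      qed
      have "K \<circ> (\<lambda>z. of_real r * z * \<zeta> $ j) holomorphic_on cball 0 1"
      proof (rule holomorphic_on_compose_gen[OF _ K])
        show "(\<lambda>z. of_real r * z * \<zeta> $ j) holomorphic_on cball 0 1" by (intro holomorphic_intros)
        show "(\<lambda>z. of_real r * z * \<zeta> $ j) ` cball 0 1 \<subseteq> ball 0 1" using mem by blast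
      qed
      then have "(\<lambda>z. K (of_real r * z * \<zeta> $ j)) holomorphic_on cball 0 1" by (simp add: o_def)
      then have F: "F holomorphic_on cball 0 1" unfolding F_def by (intro holomorphic_intros)
      then have cF: "continuous_on (sphere 0 1) F"
        by (intro holomorphic_on_imp_continuous_on) (auto intro: holomorphic_on_subset)
      have "circle_mean (\<lambda>z. Re (F z)) = Re (F 0)"
        unfolding circle_mean_linear[OF cF bounded_linear_Re] circle_mean_value[OF F] ..
      moreover have "K 0 = 0" by (simp add: K_def)
      ultimately show ?thesis by (simp add: F_def)
    qed
    have "hardy_mean \<Omega> \<sigma> 1 r u = (LINT \<zeta>|\<sigma>. 1 + 2 * Re (K ((r *\<^sub>R \<zeta>) $ j)))"
      unfolding hardy_mean_one using r' norm_u b_scaleR by (intro Bochner_Integration.integral_cong) auto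
    also have "\<dots> = (LINT \<zeta>|\<sigma>. circle_mean (\<lambda>z. 1 + 2 * Re (K (((of_real r * z) *s \<zeta>) $ j))))"
      by (rule integral_eq_circle_mean(1)[OF cK r'])
    also have "\<dots> = (LINT \<zeta>|\<sigma>. 1)" using mean by (intro Bochner_Integration.integral_cong) auto
    finally show ?thesis by simp
  qed
  then have "hardy_norm \<Omega> \<sigma> 1 u < \<infinity>" unfolding hardy_norm_finite_iff by (intro exI[of _ 1]) simp
  moreover have "pluriharmonic_on u \<Omega>"
    unfolding u_def
    by (intro pluriharmonic_add_cnj open_\<Omega> polydisk_holomorphic[OF \<Omega>, of "\<lambda>w. 1 / (1 - w)"]
        polydisk_holomorphic[OF \<Omega>, of "\<lambda>w. w / (1 - w)"] holomorphic_intros) auto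
  ultimately show ?thesis by (simp add: PH_def u_def)
qed

text \<open>The coordinate of a boundary point has modulus 1, so rotating the circle removes
  \<open>\<zeta>\<close> from the mean; and \<open>|1 - r * z| = |z - r|\<close> on the unit
  circle.\<close>

lemma polydisk_kernel_mean:
  fixes j :: 'n
  assumes \<Omega>: "\<Omega> = unit_polydisk" and r: "0 \<le> r" "r < 1"
  shows "1 / (2 * pi) * ln (1 / (1 - r)) \<le> hardy_mean \<Omega> \<sigma> 1 r (\<lambda>z. 1 / (1 - z $ j))"
proof -
  have cu: "continuous_on \<Omega> (\<lambda>z. cmod (1 / (1 - z $ j)))"
    by (intro continuous_on_norm cn_holomorphic_imp_continuous_on polydisk_holomorphic[OF \<Omega>, of "\<lambda>w. 1 / (1 - w)"] holomorphic_intros) auto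
  define k where "k = (\<lambda>z :: complex. 1 / cmod (1 - of_real r * z))"
  have ne: "1 - of_real r * z \<noteq> 0" if "z \<in> sphere 0 1" for z :: complex
  proof
    assume "1 - of_real r * z = 0"
    then have "cmod (of_real r * z) = cmod 1" by simp
    then show False using that r by (simp add: norm_mult)
  qed
  have ck: "continuous_on (sphere 0 1) k" unfolding k_def using ne by (intro continuous_intros) auto
  have rot: "circle_mean (\<lambda>z. cmod (1 / (1 - ((of_real r * z) *s \<zeta>) $ j))) = circle_mean k" if "\<zeta> \<in> b" for \<zeta>
  proof -
    have "circle_mean (\<lambda>z. k (\<zeta> $ j * z)) = circle_mean k"
      by (rule circle_mean_rotate[OF ck polydisk_silov_component[OF \<Omega> that]])
    then show ?thesis by (simp add: k_def norm_divide mult_ac)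
  qed
  have kernel: "k (cis t) = 1 / cmod (cis t - of_real r)" for t
  proof -
    have "cis t * cnj (cis t) = 1" by (simp add: cis_cnj cis_mult)
    then have "cis t - of_real r = cis t * cnj (1 - of_real r * cis t)" by (simp add: algebra_simps)
    then have "cmod (cis t - of_real r) = cmod (cis t) * cmod (cnj (1 - of_real r * cis t))"
      by (simp only: norm_mult)
    then show ?thesis by (simp only: k_def complex_mod_cnj norm_cis mult_1_left)
  qed
  have "1 / (2 * pi) * ln (1 / (1 - r)) \<le> circle_mean (\<lambda>z. 1 / cmod (z - of_real r))"
    by (rule circle_kernel_lower[OF r])
  also have "\<dots> = circle_mean k" unfolding circle_mean_def kernel ..
  also have "\<dots> = (LINT \<zeta>|\<sigma>. circle_mean (\<lambda>z. cmod (1 / (1 - ((of_real r * z) *s \<zeta>) $ j))))"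
    using rot by (subst Bochner_Integration.integral_cong[where N = \<sigma> and g = "\<lambda>_. circle_mean k"]) auto
  also have "\<dots> = hardy_mean \<Omega> \<sigma> 1 r (\<lambda>z. 1 / (1 - z $ j))"
    unfolding hardy_mean_one by (rule integral_eq_circle_mean(1)[OF cu r, symmetric])
  finally show ?thesis .
qed

lemma polydisk_sharp:
  assumes \<Omega>: "\<Omega> = unit_polydisk"
  obtains h g where "cn_holomorphic_on h \<Omega>" "cn_holomorphic_on g \<Omega>"
    "(\<lambda>z. h z + cnj (g z)) \<in> PH \<Omega> \<sigma> 1" "(\<lambda>z. g z + cnj (h z)) \<in> PH \<Omega> \<sigma> 1"
    "(\<lambda>r. hardy_mean \<Omega> \<sigma> 1 r h) \<notin> o[at_left 1](\<lambda>r. ln (1 / (1 - r)))"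
proof -
  fix j :: 'n
  define h where "h = (\<lambda>z :: complex ^ 'n. 1 / (1 - z $ j))"
  define g where "g = (\<lambda>z :: complex ^ 'n. z $ j / (1 - z $ j))"
  have PH: "(\<lambda>z. h z + cnj (g z)) \<in> PH \<Omega> \<sigma> 1" unfolding h_def g_def by (rule polydisk_Poisson_PH[OF \<Omega>])
  have "g z + cnj (h z) = h z + cnj (g z)" for z
  \<comment> \<open>The two sums are identified as total functions, hence also where the denominator
    vanishes; there both quotients have the value 0.\<close>
  proof (cases "1 - z $ j = 0")
    case False
    then have "h z = 1 + g z" by (simp add: h_def g_def field_simps)
    then show ?thesis by (simp add: complex_eq_iff)
  qed (simp add: h_def g_def)
  then have eq: "(\<lambda>z. g z + cnj (h z)) = (\<lambda>z. h z + cnj (g z))" by (rule ext)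
  have H: "cn_holomorphic_on h \<Omega>"
    unfolding h_def by (intro polydisk_holomorphic[OF \<Omega>, of "\<lambda>w. 1 / (1 - w)"] holomorphic_intros) auto
  have G: "cn_holomorphic_on g \<Omega>"
    unfolding g_def by (intro polydisk_holomorphic[OF \<Omega>, of "\<lambda>w. w / (1 - w)"] holomorphic_intros) auto
  have "(\<lambda>r. hardy_mean \<Omega> \<sigma> 1 r h) \<notin> o[at_left 1](\<lambda>r. ln (1 / (1 - r)))"
    unfolding h_def by (rule not_smallo_log[OF _ polydisk_kernel_mean[OF \<Omega>]]) auto
  then show ?thesis using that[OF H G PH] PH unfolding eq by blast
qed

end

text \<open>The limits are given by an explicit real \<open>L\<close>, since their existence is part
  of the claim and a total limit operator would return a value even without convergence.\<close>

theorem theorem2p1: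
  fixes \<Omega> :: "(complex ^ 'n::finite) set" and \<sigma> :: "(complex ^ 'n) measure"
  assumes "bounded_symmetric_domain \<Omega>"
    and "standard_realization \<Omega>"
    and "silov_invariant_measure \<Omega> \<sigma>"
  shows
    "(\<forall>(p::real) h g. 1 < p \<and> cn_holomorphic_on h \<Omega> \<and> cn_holomorphic_on g \<Omega> \<longrightarrow>
        ((\<lambda>z. h z + cnj (g z)) \<in> PH \<Omega> \<sigma> (ereal p) \<longleftrightarrow>
           h \<in> PH \<Omega> \<sigma> (ereal p) \<and> g \<in> PH \<Omega> \<sigma> (ereal p)) \<and>
        ((\<lambda>z. h z + cnj (g z)) \<in> PH \<Omega> \<sigma> (ereal p) \<and> Re (g 0 * h 0) \<ge> 0 \<longrightarrow>
           (\<exists>L::real. ((\<lambda>r. pair_mean \<sigma> p r h g) \<longlongrightarrow> L) (at_left 1) \<and>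
              ereal L \<le> ereal (1 / C1 p) * hardy_norm \<Omega> \<sigma> (ereal p) (\<lambda>z. h z + cnj (g z)))) \<and>
        ((\<lambda>z. h z + cnj (g z)) \<in> PH \<Omega> \<sigma> (ereal p) \<and> Re (g 0 * h 0) \<le> 0 \<longrightarrow>
           (\<exists>L::real. ((\<lambda>r. pair_mean \<sigma> p r h g) \<longlongrightarrow> L) (at_left 1) \<and>
              hardy_norm \<Omega> \<sigma> (ereal p) (\<lambda>z. h z + cnj (g z)) \<le> ereal (C2 p * L)))) \<and>
     (\<forall>h g. cn_holomorphic_on h \<Omega> \<and> cn_holomorphic_on g \<Omega> \<and>
        (\<lambda>z. h z + cnj (g z)) \<in> PH \<Omega> \<sigma> 1 \<longrightarrow>
        (\<forall>q::real. 0 < q \<and> q < 1 \<longrightarrow> h \<in> PH \<Omega> \<sigma> (ereal q) \<and> g \<in> PH \<Omega> \<sigma> (ereal q)) \<and>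
        (\<lambda>r. hardy_mean \<Omega> \<sigma> 1 r h) \<in> O[at_left 1](\<lambda>r. ln (1 / (1 - r))) \<and>
        (\<lambda>r. hardy_mean \<Omega> \<sigma> 1 r g) \<in> O[at_left 1](\<lambda>r. ln (1 / (1 - r)))) \<and>
     (\<Omega> = unit_polydisk \<longrightarrow>
        \<not> (\<forall>h g. cn_holomorphic_on h \<Omega> \<and> cn_holomorphic_on g \<Omega> \<and>
               (\<lambda>z. h z + cnj (g z)) \<in> PH \<Omega> \<sigma> 1 \<longrightarrow>
               (\<lambda>r. hardy_mean \<Omega> \<sigma> 1 r h) \<in> o[at_left 1](\<lambda>r. ln (1 / (1 - r)))) \<and>
        \<not> (\<forall>h g. cn_holomorphic_on h \<Omega> \<and> cn_holomorphic_on g \<Omega> \<and>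
               (\<lambda>z. h z + cnj (g z)) \<in> PH \<Omega> \<sigma> 1 \<longrightarrow>
               (\<lambda>r. hardy_mean \<Omega> \<sigma> 1 r g) \<in> o[at_left 1](\<lambda>r. ln (1 / (1 - r))))) \<and>
     (\<exists>h g. cn_holomorphic_on h \<Omega> \<and> cn_holomorphic_on g \<Omega> \<and>
        \<not> bounded (h ` \<Omega>) \<and> \<not> bounded (g ` \<Omega>) \<and>
        (\<lambda>z. h z + cnj (g z)) \<in> PH \<Omega> \<sigma> \<infinity>)"
proof -
  interpret silov_setting \<Omega> \<sigma> by standard (fact assms)+
  have B1: "((\<lambda>z. h z + cnj (g z)) \<in> PH \<Omega> \<sigma> (ereal p) \<longleftrightarrow>
           h \<in> PH \<Omega> \<sigma> (ereal p) \<and> g \<in> PH \<Omega> \<sigma> (ereal p)) \<and>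
        ((\<lambda>z. h z + cnj (g z)) \<in> PH \<Omega> \<sigma> (ereal p) \<and> Re (g 0 * h 0) \<ge> 0 \<longrightarrow>
           (\<exists>L::real. ((\<lambda>r. pair_mean \<sigma> p r h g) \<longlongrightarrow> L) (at_left 1) \<and>
              ereal L \<le> ereal (1 / C1 p) * hardy_norm \<Omega> \<sigma> (ereal p) (\<lambda>z. h z + cnj (g z)))) \<and>
        ((\<lambda>z. h z + cnj (g z)) \<in> PH \<Omega> \<sigma> (ereal p) \<and> Re (g 0 * h 0) \<le> 0 \<longrightarrow>
           (\<exists>L::real. ((\<lambda>r. pair_mean \<sigma> p r h g) \<longlongrightarrow> L) (at_left 1) \<and>
              hardy_norm \<Omega> \<sigma> (ereal p) (\<lambda>z. h z + cnj (g z)) \<le> ereal (C2 p * L)))"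
    if "1 < p \<and> cn_holomorphic_on h \<Omega> \<and> cn_holomorphic_on g \<Omega>" for p :: real and h g
    using that PH_add_cnj_equiv[of h g p] pair_mean_limit_le_hardy_norm[of h g p] hardy_norm_le_pair_mean_limit[of h g p] by blast
  have B2: "(\<forall>q::real. 0 < q \<and> q < 1 \<longrightarrow> h \<in> PH \<Omega> \<sigma> (ereal q) \<and> g \<in> PH \<Omega> \<sigma> (ereal q)) \<and>
        (\<lambda>r. hardy_mean \<Omega> \<sigma> 1 r h) \<in> O[at_left 1](\<lambda>r. ln (1 / (1 - r))) \<and>
        (\<lambda>r. hardy_mean \<Omega> \<sigma> 1 r g) \<in> O[at_left 1](\<lambda>r. ln (1 / (1 - r)))"
    if "cn_holomorphic_on h \<Omega> \<and> cn_holomorphic_on g \<Omega> \<and> (\<lambda>z. h z + cnj (g z)) \<in> PH \<Omega> \<sigma> 1" for h g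
    using that PH_kolmogorov[of h g] hardy_mean_bigo_log[of h g] by blast
  have sharp: "\<not> (\<forall>h g. cn_holomorphic_on h \<Omega> \<and> cn_holomorphic_on g \<Omega> \<and>
               (\<lambda>z. h z + cnj (g z)) \<in> PH \<Omega> \<sigma> 1 \<longrightarrow>
               (\<lambda>r. hardy_mean \<Omega> \<sigma> 1 r h) \<in> o[at_left 1](\<lambda>r. ln (1 / (1 - r)))) \<and>
        \<not> (\<forall>h g. cn_holomorphic_on h \<Omega> \<and> cn_holomorphic_on g \<Omega> \<and>
               (\<lambda>z. h z + cnj (g z)) \<in> PH \<Omega> \<sigma> 1 \<longrightarrow>
               (\<lambda>r. hardy_mean \<Omega> \<sigma> 1 r g) \<in> o[at_left 1](\<lambda>r. ln (1 / (1 - r))))"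
    if disk: "\<Omega> = unit_polydisk"
  proof -
    obtain h g where "cn_holomorphic_on h \<Omega>" "cn_holomorphic_on g \<Omega>"
      "(\<lambda>z. h z + cnj (g z)) \<in> PH \<Omega> \<sigma> 1" "(\<lambda>z. g z + cnj (h z)) \<in> PH \<Omega> \<sigma> 1"
      "(\<lambda>r. hardy_mean \<Omega> \<sigma> 1 r h) \<notin> o[at_left 1](\<lambda>r. ln (1 / (1 - r)))"
      using polydisk_sharp[OF disk] by blast
    \<comment> \<open>The pair \<open>(h, g)\<close> refutes the first improvement and the swapped
      pair \<open>(g, h)\<close> the second.\<close>
    then show ?thesis by blast
  qed
  show ?thesis
    by (intro conjI[OF _ conjI[OF _ conjI[OF _ unbounded_conjugates_bounded_sum]]] allI impI B1 B2 sharp)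
qed

end
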